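(* Consider the single-queue vacation model with retrials and glue periods described in the context, in steady state. If $\rho=\lambda\,\mathbb{E}[B]<1$, then the following hold for $|z_q|\le1$, $|z_o|\le 1$. (a) The joint generating function $R_{va}(z_q,z_o)$ of the number of customers in the queue and in the orbit at an arbitrary time point in a vacation period equals the generating function $R_{va}(z_o)$ of the number of customers in orbit at an arbitrary time point in a vacation period and is given by $$R_{va}(z_q,z_o)=\mathbb{E}[z_o^{Z}]\,\frac{1-\tilde S(\lambda(1-z_o))}{\lambda(1-z_o)\,\mathbb{E}[S]}.$$ (b) The joint generating function $R_{gl}(z_q,z_o)$ of the number of customers in the queue and in the orbit at an arbitrary time point in a glue period is given by $$R_{gl}(z_q,z_o)=\int_{0}^{G}e^{-\lambda(1-z_q)t}\;\mathbb{E}\Bigl[\bigl\{(1-e^{-\nu t})z_q+e^{-\nu t}z_o\bigr\}^{X}\Bigr]\frac{dt}{G}.$$ (c) The joint generating function $R_{vi}(z_q,z_o)$ of the number of customers in the queue and in the orbit at an arbitrary time point in a visit period is given by $$R_{vi}(z_q,z_o)=\frac{z_q\Bigl(\mathbb{E}\bigl[z_q^{Y^{(q)}}z_o^{Y^{(o)}}\bigr]-\mathbb{E}\bigl[\tilde B(\lambda(1-z_o))^{Y^{(q)}}z_o^{Y^{(o)}}\bigr]\Bigr)}{\mathbb{E}[Y^{(q)}]\,\bigl(z_q-\tilde B(\lambda(1-z_o))\bigr)}\cdot\frac{1-\tilde B(\lambda(1-z_o))}{\lambda(1-z_o)\,\mathbb{E}[B]}.$$ (d) The joint generating function $R(z_q,z_o)$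 of the number of customers in the queue and in the orbit at an arbitrary time point is given by $$R(z_q,z_o)=\rho R_{vi}(z_q,z_o)+(1-\rho)\frac{G}{G+\mathbb{E}[S]}R_{gl}(z_q,z_o)+(1-\rho)\frac{\mathbb{E}[S]}{G+\mathbb{E}[S]}R_{va}(z_q,z_o).$$
   Context: Model. Customers arrive at a single queue $Q$ according to a Poisson process with rate $\lambda>0$. Service times are i.i.d., distributed as a generic nonnegative random variable $B$ with $0<\mathbb{E}[B]<\infty$ and Laplace-Stieltjes transform (LST) $\tilde B(s)=\mathbb{E}[e^{-sB}]$. The single server cyclically goes through: a glue period of deterministic length $G>0$, then a visit period, then a vacation. Vacation lengths are i.i.d., distributed as a generic nonnegative random variable $S$ with $0<\mathbb{E}[S]<\infty$ and LST $\tilde S(s)=\mathbb{E}[e^{-sS}]$. Arrivals, service times, vacation lengths and retrial times are all independent. Customers (new arrivals and retrials) who arrive at $Q$ during a glue period stick, i.e. join the queue. Customers who arrive in any other period (visit or vacation) immediately leave to the orbit and retry after an exponentially distributed time with rate $\nu>0$, independent of everything else; each further unsuccessful retrial is again followed by an independent exponential($\nu$) retrial interval. Service is gated: during a visit period the server serves exactly those customers who are in the queue at the end of the preceding glue period (none of those in orbit and no new arrivals); the vacation then begins. Notation. $X_n$ is the number of customers in the system (all in orbit) at the start of the $n$th glue period; $Y_n^{(q)}$ and $Y_n^{(o)}$ are the numbers of customers in the queue and in orbit at the start of the $n$th visit period (which is the end of the $n$th glue period); $Z_n$ is the number of customers in the system (all in orbit) at the start of the $n$th vacation (following the $n$th visit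 period). $X$, $(Y^{(q)},Y^{(o)})$ and $Z$ are random variables having the corresponding limiting (steady-state) distributions as $n\to\infty$. Conventions. The "number of customers in the queue" during a visit period includes the customer in service. "At an arbitrary time point in a period" of a given kind (vacation, glue, visit) refers to the steady-state time average over such periods: if $N_q(t),N_o(t)$ are the numbers in queue and in orbit at time $t$, and a cycle (glue period, visit period, vacation) starts with a number of customers in orbit distributed as $X$, the generating function is $\mathbb{E}\bigl[\int_{\text{period}}z_q^{N_q(t)}z_o^{N_o(t)}\,dt\bigr]/\mathbb{E}[\text{length of period}]$; "at an arbitrary time point" means the same ratio with the whole cycle as the period. Quotients of the form $0/0$ in the formulas are understood by continuity. *)

theory Defs
  imports "HOL-Probability.Probability"
begin

text \<open>
  \<open>Initial i\<close> are the customers that are in orbit at time 0, when the first glue period starts;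
  \<open>Arrival k\<close> is the customer brought by the (k+1)-st event of the Poisson arrival process.
\<close>

datatype customer = Initial nat | Arrival nat

text \<open>
  \<open>Retrial c m\<close> is the (m+1)-st retrial interval of customer \<open>c\<close>; \<open>Service n j\<close> is the duration of
  the (j+1)-st service performed in cycle \<open>n\<close> (the order in which customers are served is
  irrelevant for all quantities considered here). Cycles are numbered from 0.
\<close>

datatype clock =
    Interarrival nat
  | Retrial customer nat
  | Service nat nat
  | Vacation nat

fun clock_law :: "real \<Rightarrow> real \<Rightarrow> real measure \<Rightarrow> real measure \<Rightarrow> clock \<Rightarrow> real measure" where
  "clock_law lam nu FB FS (Interarrival k) = density lborel (exponential_density lam)"
| "clock_law lam nu FB FS (Retrial c m) = density lborel (exponential_density nu)"
| "clock_law lam nu FB FS (Service n j) = FB"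
| "clock_law lam nu FB FS (Vacation n) = FS"

text \<open>
  A sample consists of the initial number of customers in orbit and of the values of all clocks.
  Under \<open>system\<close> all of these are independent and the initial number of customers has law \<open>p\<close>.
\<close>

type_synonym sample = "nat \<times> (clock \<Rightarrow> real)"

definition system ::
  "real \<Rightarrow> real \<Rightarrow> real measure \<Rightarrow> real measure \<Rightarrow> nat pmf \<Rightarrow> sample measure" where
  "system lam nu FB FS p = measure_pmf p \<Otimes>\<^sub>M (\<Pi>\<^sub>M c\<in>UNIV. clock_law lam nu FB FS c)"

definition customers :: "sample \<Rightarrow> customer set" where
  "customers w = Initial ` {..<fst w} \<union> range Arrival"

fun entry_time :: "sample \<Rightarrow> customer \<Rightarrow> real" where
  "entry_time w (Initial i) = 0"
| "entry_time w (Arrival k) = (\<Sum>i\<le>k. snd w (Interarrival i))"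

text \<open>
  The epochs at which a customer tries to join the queue if never successful: the arrival epoch
  (not for the initial customers, who are already in orbit) and all retrial epochs.
\<close>

fun attempts :: "sample \<Rightarrow> customer \<Rightarrow> real set" where
  "attempts w (Initial i) = range (\<lambda>j. \<Sum>m\<le>j. snd w (Retrial (Initial i) m))"
| "attempts w (Arrival k) =
     range (\<lambda>j. entry_time w (Arrival k) + (\<Sum>m<j. snd w (Retrial (Arrival k) m)))"

text \<open>
  \<open>queue_of G w c D\<close> is the set of customers that join the queue during the glue period starting
  at time \<open>c\<close>, if \<open>D\<close> is the set of customers that joined in earlier glue periods.
  \<open>cycle_start G w n\<close> consists of the start of the glue period of cycle \<open>n\<close> and of the set of
  customers that joined the queue in an earlier cycle.
\<close>

definition queue_of :: "real \<Rightarrow> sample \<Rightarrow> real \<Rightarrow> customer set \<Rightarrow> customer set" where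
  "queue_of G w c D = {k \<in> customers w - D. attempts w k \<inter> {c..c + G} \<noteq> {}}"

primrec cycle_start :: "real \<Rightarrow> sample \<Rightarrow> nat \<Rightarrow> real \<times> customer set" where
  "cycle_start G w 0 = (0, {})"
| "cycle_start G w (Suc n) =
     (let (c, D) = cycle_start G w n; Q = queue_of G w c D
      in (c + G + (\<Sum>j<card Q. snd w (Service n j)) + snd w (Vacation n), D \<union> Q))"

definition glue_start :: "real \<Rightarrow> nat \<Rightarrow> sample \<Rightarrow> real" where
  "glue_start G n w = fst (cycle_start G w n)"

definition visit_start :: "real \<Rightarrow> nat \<Rightarrow> sample \<Rightarrow> real" where
  "visit_start G n w = glue_start G n w + G"

definition served :: "real \<Rightarrow> nat \<Rightarrow> sample \<Rightarrow> nat" where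
  "served G n w = card (queue_of G w (glue_start G n w) (snd (cycle_start G w n)))"

definition vacation_start :: "real \<Rightarrow> nat \<Rightarrow> sample \<Rightarrow> real" where
  "vacation_start G n w = visit_start G n w + (\<Sum>j<served G n w. snd w (Service n j))"

definition arrived :: "sample \<Rightarrow> real \<Rightarrow> customer set" where
  "arrived w t = {c \<in> customers w. entry_time w c \<le> t}"

definition joined :: "real \<Rightarrow> sample \<Rightarrow> real \<Rightarrow> customer set" where
  "joined G w t =
     {c \<in> customers w. \<exists>n. \<exists>s\<in>attempts w c. glue_start G n w \<le> s \<and> s \<le> visit_start G n w \<and> s \<le> t}"

text \<open>Completed services; a pair \<open>(n, j)\<close> stands for the (j+1)-st service of cycle \<open>n\<close>.\<close>

definition completed :: "real \<Rightarrow> sample \<Rightarrow> real \<Rightarrow> (nat \<times> nat) set" where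
  "completed G w t =
     {(n, j). j < served G n w \<and> visit_start G n w + (\<Sum>i\<le>j. snd w (Service n i)) \<le> t}"

definition num_queue :: "real \<Rightarrow> sample \<Rightarrow> real \<Rightarrow> nat" where
  "num_queue G w t = card (joined G w t) - card (completed G w t)"

definition num_orbit :: "real \<Rightarrow> sample \<Rightarrow> real \<Rightarrow> nat" where
  "num_orbit G w t = card (arrived w t - joined G w t)"

definition num_system :: "real \<Rightarrow> sample \<Rightarrow> real \<Rightarrow> nat" where
  "num_system G w t = num_queue G w t + num_orbit G w t"

definition X_seq :: "real \<Rightarrow> nat \<Rightarrow> sample \<Rightarrow> nat" where
  "X_seq G n w = num_system G w (glue_start G n w)"

definition Y_seq :: "real \<Rightarrow> nat \<Rightarrow> sample \<Rightarrow> nat \<times> nat" where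
  "Y_seq G n w = (served G n w, num_orbit G w (visit_start G n w))"

definition Z_seq :: "real \<Rightarrow> nat \<Rightarrow> sample \<Rightarrow> nat" where
  "Z_seq G n w = num_system G w (vacation_start G n w)"

text \<open>
  Convergence in distribution for random variables with values in a countable discrete space.
\<close>

definition has_limit_law :: "'w measure \<Rightarrow> (nat \<Rightarrow> 'w \<Rightarrow> 'a::countable) \<Rightarrow> 'a pmf \<Rightarrow> bool" where
  "has_limit_law M U p \<longleftrightarrow>
     (\<forall>k. (\<lambda>n. measure M {w \<in> space M. U n w = k}) \<longlonglongrightarrow> pmf p k)"

text \<open>The period runs from the random time \<open>a\<close> to the random time \<open>b\<close>.\<close>

definition period_gf ::
  "sample measure \<Rightarrow> real \<Rightarrow> (sample \<Rightarrow> real) \<Rightarrow> (sample \<Rightarrow> real) \<Rightarrow> complex \<Rightarrow> complex \<Rightarrow> complex" where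
  "period_gf M G a b zq zo =
     (\<integral>w. (LBINT t:{a w..b w}. zq ^ num_queue G w t * zo ^ num_orbit G w t) \<partial>M)
     / complex_of_real (\<integral>w. b w - a w \<partial>M)"

definition period_gf_orbit ::
  "sample measure \<Rightarrow> real \<Rightarrow> (sample \<Rightarrow> real) \<Rightarrow> (sample \<Rightarrow> real) \<Rightarrow> complex \<Rightarrow> complex" where
  "period_gf_orbit M G a b zo =
     (\<integral>w. (LBINT t:{a w..b w}. zo ^ num_orbit G w t) \<partial>M)
     / complex_of_real (\<integral>w. b w - a w \<partial>M)"

text \<open>
  The first cycle of the system is used: with initial law \<open>p\<close> it is a cycle that starts with a
  number of customers in orbit distributed according to \<open>p\<close>.
\<close>

definition gf_glue :: "sample measure \<Rightarrow> real \<Rightarrow> complex \<Rightarrow> complex \<Rightarrow> complex" where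
  "gf_glue M G = period_gf M G (glue_start G 0) (visit_start G 0)"

definition gf_visit :: "sample measure \<Rightarrow> real \<Rightarrow> complex \<Rightarrow> complex \<Rightarrow> complex" where
  "gf_visit M G = period_gf M G (visit_start G 0) (vacation_start G 0)"

definition gf_vacation :: "sample measure \<Rightarrow> real \<Rightarrow> complex \<Rightarrow> complex \<Rightarrow> complex" where
  "gf_vacation M G = period_gf M G (vacation_start G 0) (glue_start G 1)"

definition gf_vacation_orbit :: "sample measure \<Rightarrow> real \<Rightarrow> complex \<Rightarrow> complex" where
  "gf_vacation_orbit M G = period_gf_orbit M G (vacation_start G 0) (glue_start G 1)"

definition gf_cycle :: "sample measure \<Rightarrow> real \<Rightarrow> complex \<Rightarrow> complex \<Rightarrow> complex" where
  "gf_cycle M G = period_gf M G (glue_start G 0) (glue_start G 1)"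

text \<open>Laws of nonnegative random variables with finite and strictly positive mean.\<close>

definition nonneg_law :: "real measure \<Rightarrow> bool" where
  "nonneg_law F \<longleftrightarrow> prob_space F \<and> sets F = sets borel \<and> (AE x in F. 0 \<le> x)
     \<and> integrable F (\<lambda>x. x) \<and> 0 < (\<integral>x. x \<partial>F)"

definition lst :: "real measure \<Rightarrow> complex \<Rightarrow> complex" where
  "lst F s = (\<integral>x. exp (- s * complex_of_real x) \<partial>F)"

text \<open>
  \<open>v\<close> is the value at \<open>z\<close> of the expression \<open>F\<close>, which is literally meaningful on \<open>N\<close> only and is
  understood by continuity elsewhere.
\<close>

definition value_by_continuity ::
  "'a::topological_space set \<Rightarrow> ('a \<Rightarrow> 'b::topological_space) \<Rightarrow> 'a \<Rightarrow> 'b \<Rightarrow> bool" where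
  "value_by_continuity N F z v \<longleftrightarrow>
     (if z \<in> N then v = F z else z islimpt N \<and> (F \<longlongrightarrow> v) (at z within N))"

end

theory Submission
  imports Defs
begin

text \<open>
  The numbers at successive embedded epochs are related by the strong Markov property of the
  exponential clocks, proved by redrawing independent coordinates. During a glue period every
  customer in orbit sticks independently with probability \<open>1 - exp (- nu * G)\<close> while Poisson arrivals
  join the queue; during a visit or a vacation only Poisson arrivals to the orbit occur. Conditioning
  on the state at the start of a period and integrating over its duration expresses the integral of
  \<open>zq ^ N_q * zo ^ N_o\<close> over the period by transforms at the start of the period. In the limit the
  transforms of \<open>X\<close>, \<open>Y\<close> and \<open>Z\<close> satisfy the same one-step equations; iterating them shows that
  \<open>X\<close> has finite mean if \<open>rho < 1\<close>, and differentiating at 1 gives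
  \<open>E[Y_q] * (1 - rho) = lam * (G + E[S])\<close>, hence the mean period lengths. The removable singularities
  are handled by dominated convergence on the closed bidisc.
\<close>

section \<open>Independent real coordinates\<close>

text \<open>The epochs of the model depend on the arrivals and retrials themselves, so Poisson
  counts after them need a strong Markov property. No filtration is set up: the argument splits by
  the index of the clock running at the epoch and compares samples that differ only in that clock
  and its successors.

  The limits \<open>X\<close>, \<open>Y\<close>, \<open>Z\<close> are three separate laws, with no
  joint law and no finite mean given. The one-step equations are therefore proved for every initial
  law and every cycle, and used twice: from \<open>init\<close>, as the cycle number grows, they tie
  the limits together; from \<open>X\<close> in cycle 0 they show that a cycle started with
  \<open>X\<close> reproduces \<open>Y\<close> and \<open>Z\<close>.

  On [0, 1] they combine into the equation of a branching process with immigration: an orbiting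
  customer either stays or is replaced by the arrivals during its service. Its mean offspring
  \<open>p_stick * rho + (1 - p_stick)\<close> is below 1 exactly when \<open>rho < 1\<close>.

  Singularities are avoided rather than removed: period integrals are kept as integrals and finite
  sums, continuous on the closed bidisc, and the quotients appear only in the last
  comparison.\<close>

lemma borel_measurable_pred_le [measurable (raw)]:
  fixes f :: "'a \<Rightarrow> 'b::{second_countable_topology, linorder_topology}"
  shows "f \<in> borel_measurable M \<Longrightarrow> g \<in> borel_measurable M \<Longrightarrow> Measurable.pred M (\<lambda>w. f w \<le> g w)"
  unfolding Measurable.pred_def by (rule borel_measurable_le)

text \<open>The injection \<open>to_nat\<close> turns a random set of customers or services into a
  random set of naturals of the same cardinality; infinite sets have \<open>card\<close> 0 on both
  sides.\<close>

lemma measurable_card_countable [measurable (raw)]: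
  fixes S :: "'a \<Rightarrow> 'b::countable set"
  assumes [measurable]: "\<And>c. Measurable.pred M (\<lambda>x. c \<in> S x)"
  shows "(\<lambda>x. card (S x)) \<in> measurable M (count_space UNIV)"
proof -
  have eq: "card (S x) = card (to_nat ` S x)" for x
    by (rule card_image[symmetric]) (rule inj_on_subset[OF inj_to_nat subset_UNIV])
  have "(\<lambda>x. card (to_nat ` S x)) \<in> measurable M (count_space UNIV)"
  proof (rule measurable_card)
    fix i
    have "{x \<in> space M. i \<in> to_nat ` S x} = {x \<in> space M. \<exists>c. i = to_nat c \<and> c \<in> S x}"
      by auto
    also have "\<dots> \<in> sets M" by measurable
    finally show "{x \<in> space M. i \<in> to_nat ` S x} \<in> sets M" .
  qed
  then show ?thesis by (simp add: eq)
qed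

text \<open>The terms are dominated by \<open>C\<close> times the probabilities of the values of
  \<open>N\<close>, which are summable, so summation and expectation commute. With
  \<open>f n = u ^ n\<close> this turns a distribution into a generating function.\<close>

lemma sums_expectation_nat_measure:
  fixes f :: "nat \<Rightarrow> complex"
  assumes "prob_space M" and [measurable]: "N \<in> measurable M (count_space UNIV)"
    and bound: "\<And>n. norm (f n) \<le> C"
  shows "(\<lambda>n. measure M {x\<in>space M. N x = n} * f n) sums (\<integral>x. f (N x) \<partial>M)"
proof -
  interpret prob_space M by fact
  have [measurable]: "(\<lambda>x. g (N x)) \<in> borel_measurable M" for g :: "nat \<Rightarrow> complex"
    by (rule measurable_compose[OF assms(2)]) simp
  have int: "integrable M (\<lambda>x. f (N x))"
    by (rule integrable_const_bound[where B=C]) (auto intro: bound)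
  have "(\<lambda>n. \<integral>x. indicator {n} (N x) *\<^sub>R f n \<partial>M) sums (\<integral>x. (\<Sum>n. indicator {n} (N x) *\<^sub>R f n) \<partial>M)"
  proof (rule sums_integral)
    show "integrable M (\<lambda>x. indicator {n} (N x) *\<^sub>R f n)" for n
      by (rule integrable_const_bound[where B=C]) (auto intro: bound order.trans[OF norm_ge_zero bound] split: split_indicator)
    have s: "(\<lambda>n. norm (indicator {n} (N x) *\<^sub>R f n)) sums (norm (f (N x)))" for x
    proof -
      have "(\<lambda>n. norm (indicator {n} (N x) *\<^sub>R f n)) = (\<lambda>n. if n = N x then norm (f n) else 0)"
        by (auto simp: fun_eq_iff)
      then show ?thesis using sums_single[of "N x" "\<lambda>n. norm (f n)"] by simp
    qed
    show "AE x in M. summable (\<lambda>n. norm (indicator {n} (N x) *\<^sub>R f n))"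
      using sums_summable[OF s] by auto
    have "summable (\<lambda>n. measure M {x\<in>space M. N x = n} * norm (f n))"
    proof (rule summable_comparison_test'[where N=0])
      have "(\<lambda>n. measure M {x\<in>space M. N x = n}) sums measure M (\<Union>n. {x\<in>space M. N x = n})"
        by (rule finite_measure_UNION) (auto simp: disjoint_family_on_def)
      then show "summable (\<lambda>n. C * measure M {x\<in>space M. N x = n})"
        by (intro summable_mult) (auto simp: summable_def)
      show "norm (measure M {x\<in>space M. N x = n} * norm (f n)) \<le> C * measure M {x\<in>space M. N x = n}" for n
        using mult_right_mono[OF bound[of n], of "measure M {x\<in>space M. N x = n}"] by (simp add: mult.commute)
    qed
    moreover have "(\<integral>x. norm (indicator {n} (N x) *\<^sub>R f n) \<partial>M) = measure M {x\<in>space M. N x = n} * norm (f n)" for n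
    proof -
      have "(\<integral>x. norm (indicator {n} (N x) *\<^sub>R f n) \<partial>M) = (\<integral>x. indicator {x\<in>space M. N x = n} x * norm (f n) \<partial>M)"
        by (intro Bochner_Integration.integral_cong) (auto split: split_indicator)
      then show ?thesis by simp
    qed
    ultimately show "summable (\<lambda>n. \<integral>x. norm (indicator {n} (N x) *\<^sub>R f n) \<partial>M)"
      by presburger
  qed
  moreover have "(\<Sum>n. indicator {n} (N x) *\<^sub>R f n) = f (N x)" for x
  proof -
    have "(\<lambda>n. indicator {n} (N x) *\<^sub>R f n) = (\<lambda>n. if n = N x then f n else 0)"
      by (auto simp: fun_eq_iff)
    then show ?thesis using sums_unique[OF sums_single[of "N x" f]] by simp
  qed
  moreover have "(\<integral>x. indicator {n} (N x) *\<^sub>R f n \<partial>M) = measure M {x\<in>space M. N x = n} * f n" for n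
  proof -
    have "(\<integral>x. indicator {n} (N x) *\<^sub>R f n \<partial>M) = (\<integral>x. indicator {x\<in>space M. N x = n} x *\<^sub>R f n \<partial>M)"
      by (intro Bochner_Integration.integral_cong) (auto split: split_indicator)
    then show ?thesis by (simp add: scaleR_conv_of_real)
  qed
  ultimately show ?thesis by simp
qed

text \<open>Isolates what the queue supplies: independent real clocks. The index set is a whole
  type, so a point of the space is an arbitrary function and \<open>space P\<close> is
  \<open>UNIV\<close>.\<close>

locale real_product =
  fixes M :: "'i \<Rightarrow> real measure"
  assumes prob_M: "\<And>i. prob_space (M i)"
    and sets_M [simp]: "\<And>i. sets (M i) = sets borel"
begin

abbreviation P :: "('i \<Rightarrow> real) measure" where "P \<equiv> PiM UNIV M"

sublocale P: product_prob_space M UNIV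
  by (intro product_prob_space.intro product_prob_space_axioms.intro product_sigma_finite.intro
      prob_space_imp_sigma_finite prob_M)

sublocale PP: pair_prob_space P P ..

lemma space_M [simp]: "space (M i) = UNIV"
  using sets_eq_imp_space_eq[OF sets_M] by simp

lemma space_P [simp]: "space P = UNIV"
  by (simp add: space_PiM PiE_def Pi_def extensional_def)

lemma coord_measurable [measurable (raw)]: "(\<lambda>x. x i) \<in> borel_measurable P"
  using measurable_component_singleton[of i UNIV M] measurable_cong_sets[OF refl sets_M] by blast

lemma measurable_PI:
  assumes "\<And>i. (\<lambda>x. f x i) \<in> borel_measurable N"
  shows "f \<in> measurable N P"
proof -
  have "(\<lambda>x. \<lambda>i\<in>UNIV. f x i) \<in> measurable N P"
    by (rule measurable_restrict) (use assms measurable_cong_sets[OF refl sets_M] in blast)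
  then show ?thesis by (simp add: restrict_UNIV)
qed

lemma measurable_override [measurable (raw)]:
  assumes [measurable]: "f \<in> measurable N P" "g \<in> measurable N P"
  shows "(\<lambda>z. override_on (f z) (g z) K) \<in> measurable N P"
proof (rule measurable_PI)
  fix i
  have *: "(\<lambda>x. f x i) \<in> borel_measurable N" "(\<lambda>x. g x i) \<in> borel_measurable N"
    using measurable_compose[OF assms(1) coord_measurable] measurable_compose[OF assms(2) coord_measurable] by auto
  show "(\<lambda>x. override_on (f x) (g x) K i) \<in> borel_measurable N"
    by (cases "i \<in> K") (use * in simp_all)
qed

text \<open>Independence is used in this form throughout: redrawing the coordinates in \<open>K\<close> does not change the law.\<close>

lemma resample: "distr (P \<Otimes>\<^sub>M P) P (\<lambda>(x, y). override_on x y K) = P"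
proof (rule P.PiM_eq)
  fix J :: "'i set" and F assume J: "finite J" and F: "\<And>j. j \<in> J \<Longrightarrow> F j \<in> sets (M j)"
  let ?f = "\<lambda>(x, y). override_on x y K"
  \<comment> \<open>A cylinder constrains the coordinates outside \<open>K\<close> through the first
    copy and those in \<open>K\<close> through the second, so its preimage is a rectangle and the
    product measure factorises.\<close>
  have eq: "?f -` prod_emb UNIV M J (\<Pi>\<^sub>E j\<in>J. F j) \<inter> space (P \<Otimes>\<^sub>M P)
     = prod_emb UNIV M (J - K) (\<Pi>\<^sub>E j\<in>J-K. F j) \<times> prod_emb UNIV M (J \<inter> K) (\<Pi>\<^sub>E j\<in>J\<inter>K. F j)"
    by (auto simp: prod_emb_def space_pair_measure PiE_iff override_on_def split: if_splits)
  have "emeasure (distr (P \<Otimes>\<^sub>M P) P ?f) (prod_emb UNIV M J (\<Pi>\<^sub>E j\<in>J. F j))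
      = emeasure (P \<Otimes>\<^sub>M P) (?f -` prod_emb UNIV M J (\<Pi>\<^sub>E j\<in>J. F j) \<inter> space (P \<Otimes>\<^sub>M P))"
    using J F by (intro emeasure_distr sets_PiM_I) auto
  also have "\<dots> = emeasure P (prod_emb UNIV M (J - K) (\<Pi>\<^sub>E j\<in>J-K. F j)) * emeasure P (prod_emb UNIV M (J \<inter> K) (\<Pi>\<^sub>E j\<in>J\<inter>K. F j))"
    unfolding eq using J F by (intro P.emeasure_pair_measure_Times sets_PiM_I) auto
  also have "\<dots> = (\<Prod>j\<in>J-K. emeasure (M j) (F j)) * (\<Prod>j\<in>J\<inter>K. emeasure (M j) (F j))"
    using J F by (subst (1 2) P.emeasure_PiM_emb) auto
  also have "\<dots> = (\<Prod>j\<in>J. emeasure (M j) (F j))"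
    using prod.Int_Diff[OF J, of "\<lambda>j. emeasure (M j) (F j)" K] by (simp add: mult.commute)
  finally show "emeasure (distr (P \<Otimes>\<^sub>M P) P ?f) (prod_emb UNIV M J (\<Pi>\<^sub>E j\<in>J. F j)) = (\<Prod>j\<in>J. emeasure (M j) (F j))" .
qed simp

lemma integral_resample:
  fixes f :: "('i \<Rightarrow> real) \<Rightarrow> 'b::{banach, second_countable_topology}"
  assumes int: "integrable P f"
  shows "(\<integral>x. f x \<partial>P) = (\<integral>x. (\<integral>y. f (override_on x y K) \<partial>P) \<partial>P)"
proof -
  have "integrable (distr (P \<Otimes>\<^sub>M P) P (\<lambda>(x, y). override_on x y K)) f"
    using int by (simp add: resample)
  then have 1: "integrable (P \<Otimes>\<^sub>M P) (\<lambda>(x, y). f (override_on x y K))"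
    by (subst (asm) integrable_distr_eq) (use int in \<open>auto simp: case_prod_unfold\<close>)
  have "(\<integral>x. f x \<partial>P) = (\<integral>x. f x \<partial>distr (P \<Otimes>\<^sub>M P) P (\<lambda>(x, y). override_on x y K))"
    by (simp add: resample)
  also have "\<dots> = (\<integral>z. f (case z of (x, y) \<Rightarrow> override_on x y K) \<partial>(P \<Otimes>\<^sub>M P))"
    using int by (intro integral_distr) auto
  also have "\<dots> = (\<integral>x. (\<integral>y. f (override_on x y K) \<partial>P) \<partial>P)"
    using PP.integral_fst'[OF 1] by (simp add: case_prod_unfold)
  finally show ?thesis .
qed

lemma AE_resample:
  assumes "AE x in P. Q x"
  shows "AE x in P. AE y in P. Q (override_on x y K)"
proof -
  have "AE z in distr (P \<Otimes>\<^sub>M P) P (\<lambda>(x, y). override_on x y K). Q z"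
    by (subst resample) (rule assms)
  then have "AE z in P \<Otimes>\<^sub>M P. Q ((\<lambda>(x, y). override_on x y K) z)"
    by (rule AE_distrD[rotated]) auto
  from PP.AE_pair[OF this] show ?thesis by simp
qed

lemma integral_coordinate:
  fixes f :: "real \<Rightarrow> 'b::{banach, second_countable_topology}"
  assumes [measurable]: "f \<in> borel_measurable borel"
  shows "(\<integral>x. f (x i) \<partial>P) = (\<integral>z. f z \<partial>M i)"
proof -
  have "(\<integral>z. f z \<partial>M i) = (\<integral>z. f z \<partial>distr P (M i) (\<lambda>x. x i))"
    by (simp add: P.PiM_component)
  also have "\<dots> = (\<integral>x. f (x i) \<partial>P)"
  proof (rule integral_distr)
    show "f \<in> borel_measurable (M i)"
      using assms measurable_cong_sets[OF sets_M refl] by blast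
  qed simp
  finally show ?thesis by simp
qed

lemma integrable_bounded_P:
  fixes f :: "('i \<Rightarrow> real) \<Rightarrow> 'b::{banach, second_countable_topology}"
  assumes "f \<in> borel_measurable P" "\<And>x. norm (f x) \<le> C"
  shows "integrable P f"
  using assms by (intro P.integrable_const_bound[where B=C]) auto

lemma indep_coordinates: "P.indep_vars (\<lambda>_. borel) (\<lambda>i x. x i) I"
proof -
  have "P.indep_vars M (\<lambda>i x. x i) UNIV"
    by (subst P.indep_vars_iff_distr_eq_PiM)
       (auto simp: P.PiM_component restrict_UNIV intro!: distr_id)
  then have "P.indep_vars (\<lambda>_. borel) (\<lambda>i x. id (x i)) UNIV"
    by (rule P.indep_vars_compose2) (simp add: measurable_cong_sets[OF sets_M refl])
  then show ?thesis by (auto intro: P.indep_vars_subset)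
qed

end

section \<open>Poisson processes\<close>

context real_product
begin

text \<open>Epoch of the point number \<open>k + 1\<close> of the renewal process with gaps
  \<open>x (\<kappa> 0)\<close>, \<open>x (\<kappa> 1)\<close> and so on;
  \<open>partial \<kappa> x 0\<close> is already the first gap.\<close>

definition partial :: "(nat \<Rightarrow> 'i) \<Rightarrow> ('i \<Rightarrow> real) \<Rightarrow> nat \<Rightarrow> real" where
  "partial \<kappa> x k = (\<Sum>i\<le>k. x (\<kappa> i))"

lemma partial_measurable [measurable (raw)]:
  assumes [measurable]: "f \<in> measurable N P"
  shows "(\<lambda>x. partial \<kappa> (f x) k) \<in> borel_measurable N"
proof -
  have "(\<lambda>x. f x i) \<in> borel_measurable N" for i
    using measurable_compose[OF assms coord_measurable] .
  then show ?thesis unfolding partial_def by measurable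
qed

text \<open>Injectivity makes the gaps distinct, hence independent, coordinates, so the epochs form
  a Poisson process of rate \<open>\<mu>\<close>.\<close>

definition exp_clocks :: "(nat \<Rightarrow> 'i) \<Rightarrow> real \<Rightarrow> bool" where
  "exp_clocks \<kappa> \<mu> \<longleftrightarrow> inj \<kappa> \<and> 0 < \<mu> \<and> (\<forall>i. M (\<kappa> i) = density lborel (exponential_density \<mu>))"

lemma exp_clocks_shift: "exp_clocks \<kappa> \<mu> \<Longrightarrow> exp_clocks (\<lambda>i. \<kappa> (m + i)) \<mu>"
proof -
  assume a: "exp_clocks \<kappa> \<mu>"
  then have "inj \<kappa>" by (simp add: exp_clocks_def)
  then have "inj (\<lambda>i. \<kappa> (m + i))" by (intro injI) (simp add: inj_eq)
  with a show ?thesis by (simp add: exp_clocks_def)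
qed

lemma AE_exp_clocks_pos:
  assumes "exp_clocks \<kappa> \<mu>"
  shows "AE x in P. \<forall>i. 0 < x (\<kappa> i)"
proof -
  have "AE x in P. 0 < x (\<kappa> i)" for i
  proof (rule P.AE_component)
    \<comment> \<open>The density is positive at 0 itself, so 0 has to be discarded as a Lebesgue
      null point.\<close>
    have *: "AE x in lborel. x \<noteq> (0::real)"
      by (rule AE_lborel_singleton)
    have Mi: "M (\<kappa> i) = density lborel (exponential_density \<mu>)"
      using assms by (simp add: exp_clocks_def)
    show "AE x in M (\<kappa> i). 0 < x"
      unfolding Mi
    proof (subst AE_density)
      show "AE x in lborel. 0 < ennreal (exponential_density \<mu> x) \<longrightarrow> 0 < x"
        using *
      proof (rule AE_mp, intro AE_I2 impI)
        fix x :: real assume "x \<noteq> 0" "0 < ennreal (exponential_density \<mu> x)"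
        then show "0 < x" by (cases "x < 0") (simp_all add: exponential_density_def)
      qed
    qed simp
  qed simp
  then show ?thesis by (simp add: AE_all_countable)
qed

lemma partial_distr:
  assumes "exp_clocks \<kappa> \<mu>" "0 \<le> l"
  shows "measure P {x. partial \<kappa> x k \<le> l} = erlang_CDF k \<mu> l"
proof -
  have inj: "inj_on \<kappa> {..k}" and mu: "0 < \<mu>"
    using assms by (auto simp: exp_clocks_def intro: inj_on_subset)
  have d: "distributed P lborel (\<lambda>x. x i) (exponential_density \<mu>)" if "i \<in> \<kappa> ` {..k}" for i
  proof -
    have Mi: "M i = density lborel (exponential_density \<mu>)"
      using assms that by (auto simp: exp_clocks_def)
    have "distr P lborel (\<lambda>x. x i) = distr P (M i) (\<lambda>x. x i)"
      by (rule distr_cong) simp_all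
    also have "\<dots> = density lborel (exponential_density \<mu>)"
      using P.PiM_component[of i] Mi by simp
    finally show ?thesis
      by (auto simp: distributed_def)
  qed
  have "distributed P lborel (\<lambda>x. \<Sum>i\<in>\<kappa> ` {..k}. x i) (erlang_density (card (\<kappa> ` {..k}) - 1) \<mu>)"
    by (rule P.exponential_distributed_sum) (use d mu indep_coordinates in auto)
  moreover have "(\<Sum>i\<in>\<kappa> ` {..k}. x i) = partial \<kappa> x k" for x
    by (simp add: partial_def sum.reindex[OF inj])
  ultimately have D: "distributed P lborel (\<lambda>x. partial \<kappa> x k) (erlang_density k \<mu>)"
    by (simp add: card_image[OF inj])
  show ?thesis
    using P.erlang_distributed_le[OF D mu assms(2)] by simp
qed

text \<open>\<open>erlang_CDF k\<close> is 1 minus a partial sum of Poisson probabilities, and these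
  sum to 1.\<close>

lemma erlang_CDF_tendsto:
  assumes "0 \<le> l"
  shows "(\<lambda>k. erlang_CDF k \<mu> l) \<longlonglongrightarrow> 0"
proof -
  have "(\<lambda>n. (\<mu> * l) ^ n /\<^sub>R fact n) sums exp (\<mu> * l)"
    by (rule exp_converges)
  then have "(\<lambda>n. (\<mu> * l) ^ n / fact n * exp (- \<mu> * l)) sums (exp (\<mu> * l) * exp (- \<mu> * l))"
    by (intro sums_mult2) (simp add: divide_inverse_commute)
  then have "(\<lambda>n. (\<mu> * l) ^ n * exp (- \<mu> * l) / fact n) sums 1"
    by (simp add: mult_exp_exp field_simps)
  then have "(\<lambda>k. 1 - (\<Sum>n\<le>k. (\<mu> * l) ^ n * exp (- \<mu> * l) / fact n)) \<longlonglongrightarrow> 1 - 1"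
    by (intro tendsto_intros) (simp add: sums_def_le)
  then show ?thesis using assms by (simp add: erlang_CDF_def)
qed

text \<open>Staying below \<open>n\<close> forever is contained in each event that the epoch with
  index \<open>k\<close> is at most \<open>n\<close>, whose probability tends to 0 as
  \<open>k\<close> grows: the process does not explode.\<close>

lemma AE_partial_unbounded:
  assumes "exp_clocks \<kappa> \<mu>"
  shows "AE x in P. \<forall>t. \<exists>k. t < partial \<kappa> x k"
proof -
  have mu: "0 < \<mu>" using assms by (auto simp: exp_clocks_def)
  have "AE x in P. \<exists>k. real n < partial \<kappa> x k" for n
  proof (rule AE_I[where N="{x. \<forall>k. partial \<kappa> x k \<le> real n}"])
    show "{x \<in> space P. \<not> (\<exists>k. real n < partial \<kappa> x k)} \<subseteq> {x. \<forall>k. partial \<kappa> x k \<le> real n}"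
      by (auto simp: not_less)
    have [measurable]: "{x. \<forall>k. partial \<kappa> x k \<le> real n} \<in> sets P"
    proof -
      have "{x \<in> space P. \<forall>k. partial \<kappa> x k \<le> real n} \<in> sets P" by measurable
      then show ?thesis by simp
    qed
    show "{x. \<forall>k. partial \<kappa> x k \<le> real n} \<in> sets P" by fact
    have le: "measure P {x. \<forall>k. partial \<kappa> x k \<le> real n} \<le> erlang_CDF k \<mu> (real n)" for k
    proof -
      have "{x \<in> space P. partial \<kappa> x k \<le> real n} \<in> sets P" by measurable
      then have "measure P {x. \<forall>k. partial \<kappa> x k \<le> real n} \<le> measure P {x. partial \<kappa> x k \<le> real n}"
        by (intro P.finite_measure_mono) auto
      then show ?thesis using partial_distr[OF assms, of "real n"] by simp
    qed
    have "(\<lambda>k. erlang_CDF k \<mu> (real n)) \<longlonglongrightarrow> 0"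
      by (rule erlang_CDF_tendsto) simp
    then have "measure P {x. \<forall>k. partial \<kappa> x k \<le> real n} \<le> 0"
      by (rule LIMSEQ_le_const) (use le in auto)
    then have "measure P {x. \<forall>k. partial \<kappa> x k \<le> real n} = 0"
      using measure_nonneg[of P] by (simp add: order.antisym)
    then show "emeasure P {x. \<forall>k. partial \<kappa> x k \<le> real n} = 0"
      by (simp add: P.emeasure_eq_measure)
  qed
  then have "AE x in P. \<forall>n. \<exists>k. real n < partial \<kappa> x k"
    by (simp add: AE_all_countable)
  then show ?thesis
  proof (rule AE_mp, intro AE_I2 impI allI)
    fix x t assume *: "\<forall>n. \<exists>k. real n < partial \<kappa> x k"
    obtain n where "t < real n" using reals_Archimedean2 by blast
    then show "\<exists>k. t < partial \<kappa> x k" using * by (meson order.strict_trans)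
  qed
qed

definition good_seq :: "(nat \<Rightarrow> 'i) \<Rightarrow> ('i \<Rightarrow> real) \<Rightarrow> bool" where
  "good_seq \<kappa> x \<longleftrightarrow> (\<forall>i. 0 < x (\<kappa> i)) \<and> (\<forall>t. \<exists>k. t < partial \<kappa> x k)"

lemma AE_good_seq: "exp_clocks \<kappa> \<mu> \<Longrightarrow> AE x in P. good_seq \<kappa> x"
  unfolding good_seq_def using AE_exp_clocks_pos AE_partial_unbounded by (simp add: AE_conj_iff)

lemma partial_strict_mono:
  assumes "\<forall>i. 0 < x (\<kappa> i)" "j < k" shows "partial \<kappa> x j < partial \<kappa> x k"
  using assms(2)
proof (induction k)
  case (Suc k)
  have "partial \<kappa> x (Suc k) = partial \<kappa> x k + x (\<kappa> (Suc k))" by (simp add: partial_def)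
  moreover have "0 < x (\<kappa> (Suc k))" using assms by auto
  ultimately show ?case using Suc by (cases "j = k") auto
qed simp

text \<open>The epochs increase and are unbounded, so the points up to \<open>t\<close> have exactly
  the indices below some \<open>m\<close>. In particular the counting sets are finite and their
  \<open>card\<close> is meaningful.\<close>

lemma good_seq_threshold:
  assumes "good_seq \<kappa> x"
  shows "\<exists>m. \<forall>k. partial \<kappa> x k \<le> t \<longleftrightarrow> k < m"
proof (intro exI allI)
  fix k
  have ex: "\<exists>k. t < partial \<kappa> x k" using assms by (auto simp: good_seq_def)
  have pos: "\<forall>i. 0 < x (\<kappa> i)" using assms by (auto simp: good_seq_def)
  show "partial \<kappa> x k \<le> t \<longleftrightarrow> k < (LEAST k. t < partial \<kappa> x k)"
  proof
    assume k: "partial \<kappa> x k \<le> t"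
    show "k < (LEAST k. t < partial \<kappa> x k)"
    proof (rule ccontr)
      assume "\<not> k < (LEAST k. t < partial \<kappa> x k)"
      then have "partial \<kappa> x (LEAST k. t < partial \<kappa> x k) \<le> partial \<kappa> x k"
        using partial_strict_mono[of x \<kappa> k "LEAST k. t < partial \<kappa> x k"] partial_strict_mono[of x \<kappa> "LEAST k. t < partial \<kappa> x k" k] pos by (cases "(LEAST k. t < partial \<kappa> x k) = k") auto
      then show False using LeastI_ex[OF ex] k by linarith
    qed
  next
    assume "k < (LEAST k. t < partial \<kappa> x k)"
    then show "partial \<kappa> x k \<le> t" using not_less_Least[of k "\<lambda>k. t < partial \<kappa> x k"] by simp
  qed
qed

text \<open>At least \<open>j + 1\<close> points lie in the interval iff the epoch with index
  \<open>j\<close> is at most \<open>l\<close>; the probability of exactly \<open>n\<close> points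
  is thus a difference of consecutive Erlang distribution functions.\<close>

lemma poisson_prob:
  assumes "exp_clocks \<kappa> \<mu>" and "0 \<le> l"
  shows "measure P {x. card {k. partial \<kappa> x k \<le> l} = n} = (\<mu> * l) ^ n * exp (- \<mu> * l) / fact n"
proof -
  have mu: "0 < \<mu>" using assms by (auto simp: exp_clocks_def)
  have S [measurable]: "{x. partial \<kappa> x k \<le> l} \<in> sets P" for k
  proof -
    have "{x \<in> space P. partial \<kappa> x k \<le> l} \<in> sets P" by measurable
    then show ?thesis by simp
  qed
  have card: "card {k. partial \<kappa> x k \<le> l} = m" if "\<And>k. partial \<kappa> x k \<le> l \<longleftrightarrow> k < m" for x m
    using that by simp
  have meas: "{x. card {k. partial \<kappa> x k \<le> l} = n} \<in> sets P"
  proof -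
    have "{x \<in> space P. card {k. partial \<kappa> x k \<le> l} = n} \<in> sets P" by measurable
    then show ?thesis by simp
  qed
  show ?thesis
  proof (cases n)
    case 0
    have "measure P {x. card {k. partial \<kappa> x k \<le> l} = n} = measure P (UNIV - {x. partial \<kappa> x 0 \<le> l})"
    proof (rule measure_eq_AE)
      show "AE x in P. x \<in> {x. card {k. partial \<kappa> x k \<le> l} = n} \<longleftrightarrow> x \<in> UNIV - {x. partial \<kappa> x 0 \<le> l}"
        using AE_good_seq[OF assms(1)]
      proof (rule AE_mp, intro AE_I2 impI)
        fix x assume "good_seq \<kappa> x"
        from good_seq_threshold[OF this, of l] obtain m where "\<forall>k. partial \<kappa> x k \<le> l \<longleftrightarrow> k < m" .. 
        then show "x \<in> {x. card {k. partial \<kappa> x k \<le> l} = n} \<longleftrightarrow> x \<in> UNIV - {x. partial \<kappa> x 0 \<le> l}"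
          using 0 by simp
      qed
    qed (use meas S[of 0] sets.compl_sets[OF S[of 0]] in auto)
    also have "\<dots> = 1 - measure P {x. partial \<kappa> x 0 \<le> l}"
      using P.prob_compl[OF S[of 0]] by simp
    finally show ?thesis
      using 0 assms by (simp add: partial_distr[OF assms(1)] erlang_CDF_def)
  next
    case (Suc j)
    have "measure P {x. card {k. partial \<kappa> x k \<le> l} = n} = measure P ({x. partial \<kappa> x j \<le> l} - {x. partial \<kappa> x (Suc j) \<le> l})"
    proof (rule measure_eq_AE)
      show "AE x in P. x \<in> {x. card {k. partial \<kappa> x k \<le> l} = n} \<longleftrightarrow> x \<in> {x. partial \<kappa> x j \<le> l} - {x. partial \<kappa> x (Suc j) \<le> l}"
        using AE_good_seq[OF assms(1)]
      proof (rule AE_mp, intro AE_I2 impI)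
        fix x assume "good_seq \<kappa> x"
        from good_seq_threshold[OF this, of l] obtain m where "\<forall>k. partial \<kappa> x k \<le> l \<longleftrightarrow> k < m" ..
        then have "card {k. partial \<kappa> x k \<le> l} = m" "partial \<kappa> x j \<le> l \<longleftrightarrow> j < m"
           "partial \<kappa> x (Suc j) \<le> l \<longleftrightarrow> Suc j < m"
          by simp_all
        then show "x \<in> {x. card {k. partial \<kappa> x k \<le> l} = n} \<longleftrightarrow> x \<in> {x. partial \<kappa> x j \<le> l} - {x. partial \<kappa> x (Suc j) \<le> l}"
          by (simp add: Suc) linarith
      qed
    qed (use meas S in auto)
    also have "\<dots> = measure P {x. partial \<kappa> x j \<le> l} - measure P ({x. partial \<kappa> x j \<le> l} \<inter> {x. partial \<kappa> x (Suc j) \<le> l})"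
      using S by (intro P.finite_measure_Diff') auto
    also have "measure P ({x. partial \<kappa> x j \<le> l} \<inter> {x. partial \<kappa> x (Suc j) \<le> l}) = measure P {x. partial \<kappa> x (Suc j) \<le> l}"
    proof (rule measure_eq_AE)
      show "AE x in P. x \<in> {x. partial \<kappa> x j \<le> l} \<inter> {x. partial \<kappa> x (Suc j) \<le> l} \<longleftrightarrow> x \<in> {x. partial \<kappa> x (Suc j) \<le> l}"
        using AE_good_seq[OF assms(1)]
      proof (rule AE_mp, intro AE_I2 impI)
        fix x assume "good_seq \<kappa> x"
        then have "partial \<kappa> x j < partial \<kappa> x (Suc j)"
          using partial_strict_mono[of x \<kappa> j "Suc j"] by (auto simp: good_seq_def)
        then show "x \<in> {x. partial \<kappa> x j \<le> l} \<inter> {x. partial \<kappa> x (Suc j) \<le> l} \<longleftrightarrow> x \<in> {x. partial \<kappa> x (Suc j) \<le> l}"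
          by auto
      qed
    qed (use S in auto)
    finally show ?thesis
      using Suc assms by (simp add: partial_distr[OF assms(1)] erlang_CDF_def)
  qed
qed

lemma poisson_gf:
  fixes u :: complex
  assumes "exp_clocks \<kappa> \<mu>" and "0 \<le> l" and u: "norm u \<le> 1"
  shows "(\<integral>x. u ^ card {k. partial \<kappa> x k \<le> l} \<partial>P) = exp (- of_real (\<mu> * l) * (1 - u))"
proof -
  have 1: "(\<lambda>n. measure P {x\<in>space P. card {k. partial \<kappa> x k \<le> l} = n} * u ^ n) sums (\<integral>x. u ^ card {k. partial \<kappa> x k \<le> l} \<partial>P)"
    by (rule sums_expectation_nat_measure[where C=1])
       (auto simp: norm_power power_le_one u P.prob_space_axioms)
  have "(\<lambda>n. (of_real (\<mu> * l) * u) ^ n /\<^sub>R fact n) sums exp (of_real (\<mu> * l) * u)"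
    by (rule exp_converges)
  then have "(\<lambda>n. (of_real (\<mu> * l) * u) ^ n /\<^sub>R fact n * exp (- of_real (\<mu> * l))) sums (exp (of_real (\<mu> * l) * u) * exp (- of_real (\<mu> * l)))"
    by (rule sums_mult2)
  then have gs: "(\<lambda>n. (of_real (\<mu> * l) * u) ^ n /\<^sub>R fact n * exp (- of_real (\<mu> * l))) sums exp (- of_real (\<mu> * l) * (1 - u))"
    by (simp add: exp_add[symmetric] algebra_simps)
  have e: "exp (- complex_of_real (\<mu> * l)) = of_real (exp (- \<mu> * l))"
    using exp_of_real[of "- \<mu> * l"] by simp
  have "(\<lambda>n. (of_real (\<mu> * l) * u) ^ n /\<^sub>R fact n * exp (- of_real (\<mu> * l)))
     = (\<lambda>n. measure P {x\<in>space P. card {k. partial \<kappa> x k \<le> l} = n} * u ^ n)"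
    unfolding e
    by (simp add: fun_eq_iff poisson_prob[OF assms(1,2)] power_mult_distrib scaleR_conv_of_real divide_inverse mult_ac)
  with gs have "(\<lambda>n. measure P {x\<in>space P. card {k. partial \<kappa> x k \<le> l} = n} * u ^ n) sums exp (- of_real (\<mu> * l) * (1 - u))"
    by (simp only:)
  from sums_unique2[OF 1 this] show ?thesis .
qed

end

section \<open>Memorylessness and the strong Markov property\<close>

context real_product
begin

lemma fun_upd_measurable [measurable (raw)]:
  assumes "f \<in> borel_measurable N"
  shows "(\<lambda>z. x(i := f z)) \<in> measurable N P"
  by (rule measurable_PI) (use assms in \<open>auto simp: fun_upd_def\<close>)

text \<open>Resampling of a single coordinate, with the inner integral over the law of that
  coordinate, so that its density becomes available.\<close>

lemma integral_update:
  fixes f :: "('i \<Rightarrow> real) \<Rightarrow> 'b::{banach, second_countable_topology}"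
  assumes int: "integrable P f"
  shows "(\<integral>x. f x \<partial>P) = (\<integral>x. (\<integral>z. f (x(i := z)) \<partial>M i) \<partial>P)"
proof -
  have "override_on x y {i} = x(i := y i)" for x y :: "'i \<Rightarrow> real"
    by (auto simp: override_on_def)
  moreover have "(\<integral>y. f (x(i := y i)) \<partial>P) = (\<integral>z. f (x(i := z)) \<partial>M i)" for x
  proof (rule integral_coordinate)
    have [measurable]: "f \<in> borel_measurable P" using int by simp
    show "(\<lambda>z. f (x(i := z))) \<in> borel_measurable borel"
      by measurable
  qed
  ultimately show ?thesis using integral_resample[OF int, of "{i}"] by simp
qed

lemma partial_fun_upd_0:
  assumes "inj \<kappa>"
  shows "partial \<kappa> (x(\<kappa> 0 := z)) k = z + (\<Sum>i\<in>{0<..k}. x (\<kappa> i))"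
proof -
  have "{..k} = insert 0 {0<..k}" by auto
  then have "partial \<kappa> (x(\<kappa> 0 := z)) k = (\<Sum>i\<in>insert 0 {0<..k}. (x(\<kappa> 0 := z)) (\<kappa> i))"
    unfolding partial_def by simp
  also have "\<dots> = z + (\<Sum>i\<in>{0<..k}. (x(\<kappa> 0 := z)) (\<kappa> i))"
    by (subst sum.insert) auto
  also have "(\<Sum>i\<in>{0<..k}. (x(\<kappa> 0 := z)) (\<kappa> i)) = (\<Sum>i\<in>{0<..k}. x (\<kappa> i))"
    using assms by (intro sum.cong) (auto simp: inj_eq)
  finally show ?thesis .
qed

text \<open>Lack of memory at a deterministic time. Translating the first gap by \<open>s\<close>
  multiplies its density by \<open>exp (- \<mu> * s)\<close> and carries the count in the window
  after \<open>s\<close> into the count up to \<open>l\<close>; on \<open>s < x (\<kappa> 0)\<close>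
  no point has occurred by time \<open>s\<close>.\<close>

lemma memoryless:
  fixes u :: complex
  assumes ec: "exp_clocks \<kappa> \<mu>" and s: "0 \<le> s" and l: "0 \<le> l" and u: "norm u \<le> 1"
  shows "(\<integral>x. (if s < x (\<kappa> 0) then u ^ card {k. s < partial \<kappa> x k \<and> partial \<kappa> x k \<le> s + l} else 0) \<partial>P)
     = of_real (exp (- \<mu> * s)) * exp (- of_real (\<mu> * l) * (1 - u))"
proof -
  define F where "F = (\<lambda>x. if s < x (\<kappa> 0) then u ^ card {k. s < partial \<kappa> x k \<and> partial \<kappa> x k \<le> s + l} else 0)"
  define g where "g = (\<lambda>x. u ^ card {k. partial \<kappa> x k \<le> l})"
  have inj: "inj \<kappa>" and mu: "0 < \<mu>" and M0: "M (\<kappa> 0) = density lborel (exponential_density \<mu>)"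
    using ec by (auto simp: exp_clocks_def)
  have F_meas [measurable]: "F \<in> borel_measurable P" unfolding F_def by measurable
  have g_meas [measurable]: "g \<in> borel_measurable P" unfolding g_def by measurable
  have F_int: "integrable P F"
    by (rule integrable_bounded_P[where C=1]) (auto simp: F_def norm_power power_le_one u)
  have g_int: "integrable P g"
    by (rule integrable_bounded_P[where C=1]) (auto simp: g_def norm_power power_le_one u)
  \<comment> \<open>At \<open>z = 0\<close> the left side vanishes, since \<open>s < s\<close>
    fails, while the right side need not; hence the exclusion of this single point.\<close>
  have shift: "exponential_density \<mu> (s + z) *\<^sub>R F (x(\<kappa> 0 := s + z))
      = of_real (exp (- \<mu> * s)) * (exponential_density \<mu> z *\<^sub>R g (x(\<kappa> 0 := z)))"
    if x: "\<forall>i. 0 < x (\<kappa> i)" and z: "z \<noteq> 0" for x z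
  proof (cases "z < 0")
    case True
    then show ?thesis by (simp add: F_def exponential_density_def)
  next
    case False
    then have z: "0 < z" using z by simp
    have p: "partial \<kappa> (x(\<kappa> 0 := s + z)) k = s + partial \<kappa> (x(\<kappa> 0 := z)) k" for k
      by (simp add: partial_fun_upd_0[OF inj])
    have "0 < partial \<kappa> (x(\<kappa> 0 := z)) k" for k
      using z x by (simp add: partial_fun_upd_0[OF inj] add_pos_nonneg sum_nonneg less_imp_le)
    then have "F (x(\<kappa> 0 := s + z)) = g (x(\<kappa> 0 := z))"
      using z by (simp add: F_def g_def p)
    moreover have "exponential_density \<mu> (s + z) = exp (- \<mu> * s) * exponential_density \<mu> z"
      using z s by (simp add: exponential_density_def exp_add[symmetric] algebra_simps)
    ultimately show ?thesis
      by (simp add: scaleR_conv_of_real)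
  qed
  have inner: "(\<integral>z. F (x(\<kappa> 0 := z)) \<partial>M (\<kappa> 0)) = of_real (exp (- \<mu> * s)) * (\<integral>z. g (x(\<kappa> 0 := z)) \<partial>M (\<kappa> 0))"
    if x: "\<forall>i. 0 < x (\<kappa> i)" for x
  proof -
    have "(\<integral>z. F (x(\<kappa> 0 := z)) \<partial>M (\<kappa> 0)) = (\<integral>z. exponential_density \<mu> z *\<^sub>R F (x(\<kappa> 0 := z)) \<partial>lborel)"
      unfolding M0 using mu by (intro integral_density) auto
    also have "\<dots> = (\<integral>z. exponential_density \<mu> (s + z) *\<^sub>R F (x(\<kappa> 0 := s + z)) \<partial>lborel)"
      using lborel_integral_real_affine[of 1 "\<lambda>z. exponential_density \<mu> z *\<^sub>R F (x(\<kappa> 0 := z))" s] by simp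
    also have "\<dots> = (\<integral>z. of_real (exp (- \<mu> * s)) * (exponential_density \<mu> z *\<^sub>R g (x(\<kappa> 0 := z))) \<partial>lborel)"
    proof (rule integral_cong_AE)
      show "AE z in lborel. exponential_density \<mu> (s + z) *\<^sub>R F (x(\<kappa> 0 := s + z))
          = of_real (exp (- \<mu> * s)) * (exponential_density \<mu> z *\<^sub>R g (x(\<kappa> 0 := z)))"
        using AE_lborel_singleton[of 0] by (rule AE_mp) (use shift[OF x] in \<open>auto intro!: AE_I2\<close>)
    qed measurable
    also have "\<dots> = of_real (exp (- \<mu> * s)) * (\<integral>z. exponential_density \<mu> z *\<^sub>R g (x(\<kappa> 0 := z)) \<partial>lborel)"
      by (rule integral_mult_right_zero)
    also have "(\<integral>z. exponential_density \<mu> z *\<^sub>R g (x(\<kappa> 0 := z)) \<partial>lborel) = (\<integral>z. g (x(\<kappa> 0 := z)) \<partial>M (\<kappa> 0))"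
      unfolding M0 using mu by (intro integral_density[symmetric]) auto
    finally show ?thesis .
  qed
  have "(\<integral>x. F x \<partial>P) = (\<integral>x. (\<integral>z. F (x(\<kappa> 0 := z)) \<partial>M (\<kappa> 0)) \<partial>P)"
    by (rule integral_update[OF F_int])
  also have "\<dots> = (\<integral>x. of_real (exp (- \<mu> * s)) * (\<integral>z. g (x(\<kappa> 0 := z)) \<partial>M (\<kappa> 0)) \<partial>P)"
  proof (rule integral_cong_AE)
    have sf: "sigma_finite_measure (M (\<kappa> 0))"
      using prob_M prob_space_imp_sigma_finite by blast
    have m: "(\<lambda>(x, z). x(\<kappa> 0 := z)) \<in> measurable (P \<Otimes>\<^sub>M M (\<kappa> 0)) P"
    proof (rule measurable_PI)
      have "snd \<in> borel_measurable (P \<Otimes>\<^sub>M M (\<kappa> 0))"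
        using measurable_snd[of P "M (\<kappa> 0)"] measurable_cong_sets[OF refl sets_M] by blast
      then show "(\<lambda>z. (case z of (x, z) \<Rightarrow> x(\<kappa> 0 := z)) i) \<in> borel_measurable (P \<Otimes>\<^sub>M M (\<kappa> 0))" for i
        using measurable_compose[OF measurable_fst coord_measurable] by (cases "i = \<kappa> 0") (simp_all add: fun_upd_def case_prod_unfold)
    qed
    have "(\<lambda>x. \<integral>z. f (x(\<kappa> 0 := z)) \<partial>M (\<kappa> 0)) \<in> borel_measurable P" 
      if "f \<in> borel_measurable P" for f :: "_ \<Rightarrow> complex"
      using sigma_finite_measure.borel_measurable_lebesgue_integral[OF sf] measurable_compose[OF m that]
      by (simp add: case_prod_unfold)
    from this[OF F_meas] this[OF g_meas]
    show "(\<lambda>x. \<integral>z. F (x(\<kappa> 0 := z)) \<partial>M (\<kappa> 0)) \<in> borel_measurable P"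
      "(\<lambda>x. of_real (exp (- \<mu> * s)) * (\<integral>z. g (x(\<kappa> 0 := z)) \<partial>M (\<kappa> 0))) \<in> borel_measurable P"
      by auto
    show "AE x in P. (\<integral>z. F (x(\<kappa> 0 := z)) \<partial>M (\<kappa> 0)) = of_real (exp (- \<mu> * s)) * (\<integral>z. g (x(\<kappa> 0 := z)) \<partial>M (\<kappa> 0))"
      using AE_exp_clocks_pos[OF ec] by (rule AE_mp) (use inner in \<open>auto intro!: AE_I2\<close>)
  qed
  also have "\<dots> = of_real (exp (- \<mu> * s)) * (\<integral>x. g x \<partial>P)"
    using integral_update[OF g_int, of "\<kappa> 0"] by simp
  also have "(\<integral>x. g x \<partial>P) = exp (- of_real (\<mu> * l) * (1 - u))"
    unfolding g_def by (rule poisson_gf[OF ec l u])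
  finally show ?thesis by (simp add: F_def)
qed

lemma norm_exp_gap_le:
  fixes u :: complex
  assumes "0 \<le> c" "norm u \<le> 1" shows "norm (exp (- of_real c * (1 - u))) \<le> 1"
proof -
  have "Re u \<le> 1" using assms complex_Re_le_cmod[of u] by linarith
  then show ?thesis using assms by (simp add: norm_exp_eq_Re)
qed

text \<open>
  The stopping property \<open>stop\<close>: the epoch \<open>T\<close>, the length \<open>L\<close> and the factor \<open>\<Phi>\<close> see the
  points of the process up to \<open>T\<close> only, so they are unchanged when the clock running at \<open>T\<close> and its
  successors are replaced by any others that do not ring before \<open>T\<close>.
\<close>

lemma strong_markov:
  fixes \<Phi> :: "('i \<Rightarrow> real) \<Rightarrow> complex" and e T L :: "('i \<Rightarrow> real) \<Rightarrow> real" and u :: complex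
  assumes ec: "exp_clocks \<kappa> \<mu>"
    and [measurable]: "e \<in> borel_measurable P" "T \<in> borel_measurable P" "L \<in> borel_measurable P" "\<Phi> \<in> borel_measurable P"
    and good: "AE x in P. good x"
    and bound: "\<And>x. norm (\<Phi> x) \<le> 1" and u: "norm u \<le> 1"
    and e: "\<And>x x'. (\<forall>c. c \<notin> range \<kappa> \<longrightarrow> x c = x' c) \<Longrightarrow> e x = e x'"
    and dom: "\<And>x. good x \<Longrightarrow> \<Phi> x \<noteq> 0 \<Longrightarrow> e x \<le> T x \<and> 0 \<le> L x"
    and stop: "\<And>x x' m. good x \<Longrightarrow> good x' \<Longrightarrow> (\<forall>c. c \<notin> \<kappa> ` {m..} \<longrightarrow> x c = x' c) \<Longrightarrow> \<Phi> x \<noteq> 0 \<Longrightarrow>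
       (\<forall>i<m. e x + partial \<kappa> x i \<le> T x) \<Longrightarrow> T x < e x + partial \<kappa> x m \<Longrightarrow> T x < e x + partial \<kappa> x' m \<Longrightarrow>
       T x' = T x \<and> L x' = L x \<and> \<Phi> x' = \<Phi> x"
  shows "(\<integral>x. \<Phi> x * u ^ card {k. T x < e x + partial \<kappa> x k \<and> e x + partial \<kappa> x k \<le> T x + L x} \<partial>P)
       = (\<integral>x. \<Phi> x * exp (- of_real (\<mu> * L x) * (1 - u)) \<partial>P)"
proof -
  define F where "F = (\<lambda>x. \<Phi> x * u ^ card {k. T x < e x + partial \<kappa> x k \<and> e x + partial \<kappa> x k \<le> T x + L x})"
  define H where "H = (\<lambda>x. \<Phi> x * exp (- of_real (\<mu> * L x) * (1 - u)))"
  \<comment> \<open>\<open>A m\<close>: the clock with index \<open>m\<close> is the one running at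
    \<open>T\<close>. Up to a null set these events partition the set where \<open>\<Phi>\<close> is
    nonzero.\<close>
  define A where "A = (\<lambda>m x. \<Phi> x \<noteq> 0 \<and> (\<forall>i<m. e x + partial \<kappa> x i \<le> T x) \<and> T x < e x + partial \<kappa> x m)"
  have mu: "0 < \<mu>" using ec by (auto simp: exp_clocks_def)
  have [measurable]: "F \<in> borel_measurable P" unfolding F_def by measurable
  have [measurable]: "H \<in> borel_measurable P" unfolding H_def by measurable
  have [measurable]: "Measurable.pred P (A m)" for m unfolding A_def by measurable
  have F_le: "norm (F x) \<le> 1" for x
    using bound[of x] by (auto simp: F_def norm_mult norm_power intro!: mult_le_one power_le_one u)
  have H_le: "AE x in P. norm (H x) \<le> 1"
    using good
  proof (rule AE_mp, intro AE_I2 impI)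
    fix x assume "good x"
    then show "norm (H x) \<le> 1"
      using bound[of x] dom[of x] mu norm_exp_gap_le[OF _ u, of "\<mu> * L x"]
      by (cases "\<Phi> x = 0") (auto simp: H_def norm_mult intro!: mult_le_one)
  qed
  have part: "(\<integral>x. (if A m x then F x else 0) \<partial>P) = (\<integral>x. (if A m x then H x else 0) \<partial>P)" for m
  proof -
    define K where "K = \<kappa> ` {m..}"
    define \<kappa>' where "\<kappa>' = (\<lambda>i. \<kappa> (m + i))"
    have ec': "exp_clocks \<kappa>' \<mu>" unfolding \<kappa>'_def by (rule exp_clocks_shift[OF ec])
    have inj: "inj \<kappa>" using ec by (auto simp: exp_clocks_def)
    have intF: "integrable P (\<lambda>x. if A m x then F x else 0)"
      by (rule integrable_bounded_P[where C=1]) (auto intro: F_le)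
    have intH: "integrable P (\<lambda>x. if A m x then H x else 0)"
    proof (rule P.integrable_const_bound[where B=1])
      show "AE x in P. norm (if A m x then H x else 0) \<le> 1"
        using H_le by eventually_elim auto
    qed measurable
    \<comment> \<open>Along a fibre only the clocks with index at least \<open>m\<close> vary. The
      claim is proved for almost every fibre and then integrated over \<open>x\<close>.\<close>
    have main: "(\<integral>y. (if A m (override_on x y K) then F (override_on x y K) else 0) \<partial>P)
       = (\<integral>y. (if A m (override_on x y K) then H (override_on x y K) else 0) \<partial>P)"
      if g: "AE y in P. good (override_on x y K)" for x
    proof (cases "\<exists>y. good (override_on x y K) \<and> A m (override_on x y K)")
      case False
      have "AE y in P. \<not> A m (override_on x y K)"
        using g by (rule AE_mp) (use False in \<open>auto intro!: AE_I2\<close>)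
      then have "(\<integral>y. (if A m (override_on x y K) then f (override_on x y K) else 0) \<partial>P) = (\<integral>y. 0 \<partial>P)"
        if [measurable]: "f \<in> borel_measurable P" for f :: "_ \<Rightarrow> complex"
      proof (intro integral_cong_AE)
        show "AE y in P. (if A m (override_on x y K) then f (override_on x y K) else 0) = 0"
          using \<open>AE y in P. \<not> A m (override_on x y K)\<close> by eventually_elim auto
      qed measurable
      then show ?thesis by simp
    next
      case True
      then obtain y0 where y0: "good (override_on x y0 K)" "A m (override_on x y0 K)" by blast
      \<comment> \<open>A reference sample in the fibre. By \<open>stop\<close> the values of
        \<open>T\<close>, \<open>L\<close> and \<open>\<Phi>\<close> on \<open>A m\<close> are those
        at \<open>x0\<close>; \<open>s\<close> is the time for which the clock \<open>m\<close> has
        been running at \<open>T\<close>.\<close>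
      define x0 where "x0 = override_on x y0 K"
      define a where "a = (\<Sum>i<m. x (\<kappa> i))"
      define s where "s = T x0 - (e x0 + a)"
      have x0: "good x0" "A m x0" using y0 by (auto simp: x0_def)
      have range: "K \<subseteq> range \<kappa>" by (auto simp: K_def)
      have e_eq: "e (override_on x y K) = e x0" for y
        by (rule e) (use range in \<open>auto simp: x0_def override_on_def\<close>)
      have low: "partial \<kappa> (override_on x y K) i = partial \<kappa> x i" if "i < m" for i y
        unfolding partial_def using that inj by (intro sum.cong) (auto simp: K_def override_on_def inj_eq)
      have high: "partial \<kappa> (override_on x y K) (m + i) = a + partial \<kappa>' y i" for y i
      proof -
        have "{..m+i} = {..<m} \<union> (\<lambda>j. m + j) ` {..i}"
        proof -
          have "{m..m+i} = (\<lambda>j. m + j) ` {..i}"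
            using image_add_atLeastAtMost[of m 0 i] by (simp add: atLeast0AtMost)
          moreover have "{..m+i} = {..<m} \<union> {m..m+i}" by auto
          ultimately show ?thesis by (simp only:)
        qed
        then have "partial \<kappa> (override_on x y K) (m + i)
            = (\<Sum>j\<in>{..<m}. override_on x y K (\<kappa> j)) + (\<Sum>j\<in>(\<lambda>j. m + j) ` {..i}. override_on x y K (\<kappa> j))"
          unfolding partial_def by (subst sum.union_disjoint[symmetric]) auto
        also have "(\<Sum>j\<in>{..<m}. override_on x y K (\<kappa> j)) = a"
          unfolding a_def using inj by (intro sum.cong) (auto simp: K_def override_on_def inj_eq)
        also have "(\<Sum>j\<in>(\<lambda>j. m + j) ` {..i}. override_on x y K (\<kappa> j)) = (\<Sum>j\<le>i. override_on x y K (\<kappa> (m + j)))"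
          by (subst sum.reindex) auto
        also have "\<dots> = partial \<kappa>' y i"
          unfolding partial_def \<kappa>'_def by (intro sum.cong) (auto simp: K_def)
        finally show ?thesis .
      qed
      have s: "0 \<le> s"
      proof (cases m)
        case 0
        then show ?thesis using dom[OF x0(1)] x0(2) by (auto simp: s_def a_def A_def)
      next
        case (Suc j)
        have "partial \<kappa> x j = a" unfolding partial_def a_def Suc by (simp add: lessThan_Suc_atMost)
        moreover have "e x0 + partial \<kappa> x0 j \<le> T x0" using x0(2) Suc by (auto simp: A_def)
        ultimately show ?thesis using low[of j y0] Suc by (simp add: s_def x0_def)
      qed
      have L0: "0 \<le> L x0" using dom[OF x0(1)] x0(2) by (auto simp: A_def)
      have at_m: "partial \<kappa> (override_on x y K) m = a + y (\<kappa>' 0)" for y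
        using high[of y 0] by (simp add: partial_def)
      have same: "\<forall>c. c \<notin> \<kappa> ` {m..} \<longrightarrow> override_on x y K c = override_on x y' K c" for y y'
        by (auto simp: K_def override_on_def)
      have fwd: "A m (override_on x y K) \<and> T (override_on x y K) = T x0 \<and> L (override_on x y K) = L x0
           \<and> \<Phi> (override_on x y K) = \<Phi> x0"
        if gy: "good (override_on x y K)" and sy: "s < y (\<kappa>' 0)" for y
      proof -
        have lt: "T x0 < e x0 + partial \<kappa> (override_on x y K) m"
          using sy by (simp add: at_m s_def)
        have "T (override_on x y K) = T x0 \<and> L (override_on x y K) = L x0 \<and> \<Phi> (override_on x y K) = \<Phi> x0"
        proof (rule stop[of x0 "override_on x y K" m])
          show "\<forall>c. c \<notin> \<kappa> ` {m..} \<longrightarrow> x0 c = override_on x y K c"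
            using same[of y0 y] by (simp add: x0_def)
        qed (use x0 gy lt in \<open>auto simp: A_def\<close>)
        moreover have "\<forall>i<m. e x0 + partial \<kappa> (override_on x y K) i \<le> T x0"
          using x0(2) low by (auto simp: A_def x0_def)
        ultimately show ?thesis
          using lt x0(2) by (simp add: A_def e_eq)
      qed
      \<comment> \<open>If the clock \<open>m\<close> rang within age \<open>s\<close>, then
        \<open>T\<close> would come earlier in this sample than in \<open>x0\<close>. The reference
        clock outlasts that earlier time as well, so \<open>stop\<close> in the reverse direction
        forces equal values of \<open>T\<close>, a contradiction.\<close>
      have bwd: "s < y (\<kappa>' 0)" if gy: "good (override_on x y K)" and Ay: "A m (override_on x y K)" for y
      proof (rule ccontr)
        assume "\<not> s < y (\<kappa>' 0)"
        then have le: "e x0 + partial \<kappa> (override_on x y K) m \<le> T x0"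
          by (simp add: at_m s_def)
        have lt: "T (override_on x y K) < e x0 + partial \<kappa> (override_on x y K) m"
          using Ay by (simp add: A_def e_eq)
        have "T x0 < e x0 + partial \<kappa> x0 m" using x0(2) by (simp add: A_def)
        then have lt': "T (override_on x y K) < e (override_on x y K) + partial \<kappa> x0 m"
          using le lt by (simp add: e_eq)
        have "T x0 = T (override_on x y K) \<and> L x0 = L (override_on x y K) \<and> \<Phi> x0 = \<Phi> (override_on x y K)"
        proof (rule stop[of "override_on x y K" x0 m])
          show "\<forall>c. c \<notin> \<kappa> ` {m..} \<longrightarrow> override_on x y K c = x0 c"
            using same[of y y0] by (simp add: x0_def)
        qed (use x0 gy Ay lt' in \<open>auto simp: A_def\<close>)
        then show False using le lt by simp
      qed
      have A_iff: "A m (override_on x y K) \<longleftrightarrow> s < y (\<kappa>' 0)" if "good (override_on x y K)" for y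
        using fwd[OF that] bwd[OF that] by blast
      have count: "card {k. T x0 < e x0 + partial \<kappa> (override_on x y K) k \<and> e x0 + partial \<kappa> (override_on x y K) k \<le> T x0 + L x0}
         = card {i. s < partial \<kappa>' y i \<and> partial \<kappa>' y i \<le> s + L x0}" for y
      proof -
        have "{k. T x0 < e x0 + partial \<kappa> (override_on x y K) k \<and> e x0 + partial \<kappa> (override_on x y K) k \<le> T x0 + L x0}
           = (\<lambda>i. m + i) ` {i. s < partial \<kappa>' y i \<and> partial \<kappa>' y i \<le> s + L x0}" (is "?B = ?C")
        proof (rule set_eqI)
          fix k
          show "k \<in> ?B \<longleftrightarrow> k \<in> ?C"
          proof (cases "k < m")
            case True
            then have "e x0 + partial \<kappa> (override_on x y K) k \<le> T x0"
              using x0(2) low[OF True] by (auto simp: A_def x0_def)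
            then show ?thesis using True by auto
          next
            case False
            then obtain i where "k = m + i" using le_Suc_ex not_less by blast
            then show ?thesis by (auto simp: high s_def)
          qed
        qed
        then show ?thesis by (simp add: card_image)
      qed
      have "(\<integral>y. (if A m (override_on x y K) then F (override_on x y K) else 0) \<partial>P)
        = (\<integral>y. \<Phi> x0 * (if s < y (\<kappa>' 0) then u ^ card {i. s < partial \<kappa>' y i \<and> partial \<kappa>' y i \<le> s + L x0} else 0) \<partial>P)"
      proof (rule integral_cong_AE)
        show "AE y in P. (if A m (override_on x y K) then F (override_on x y K) else 0)
          = \<Phi> x0 * (if s < y (\<kappa>' 0) then u ^ card {i. s < partial \<kappa>' y i \<and> partial \<kappa>' y i \<le> s + L x0} else 0)"
          using g
        proof (rule AE_mp, intro AE_I2 impI)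
          fix y assume gy: "good (override_on x y K)"
          show "(if A m (override_on x y K) then F (override_on x y K) else 0)
            = \<Phi> x0 * (if s < y (\<kappa>' 0) then u ^ card {i. s < partial \<kappa>' y i \<and> partial \<kappa>' y i \<le> s + L x0} else 0)"
            using A_iff[OF gy] fwd[OF gy] by (auto simp: F_def e_eq count)
        qed
      qed measurable
      \<comment> \<open>Survival of the running clock beyond age \<open>s\<close> is handled by
        \<open>memoryless\<close>, applied to the clocks from index \<open>m\<close> on.\<close>
      also have "\<dots> = \<Phi> x0 * (of_real (exp (- \<mu> * s)) * exp (- of_real (\<mu> * L x0) * (1 - u)))"
        by (simp only: integral_mult_right_zero memoryless[OF ec' s L0 u])
      also have "\<dots> = \<Phi> x0 * exp (- of_real (\<mu> * L x0) * (1 - u)) * of_real (exp (- \<mu> * s))"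
        by simp
      \<comment> \<open>The factor \<open>exp (- \<mu> * s)\<close> is turned back into the
        probability that the clock survives age \<open>s\<close>, which is \<open>memoryless\<close>
        with \<open>u = 1\<close>.\<close>
      also have "\<dots> = (\<integral>y. \<Phi> x0 * exp (- of_real (\<mu> * L x0) * (1 - u)) * (if s < y (\<kappa>' 0) then 1 else 0) \<partial>P)"
      proof -
        have "(\<integral>y. (if s < y (\<kappa>' 0) then 1 else 0) \<partial>P) = complex_of_real (exp (- \<mu> * s))"
          using memoryless[OF ec' s L0, of 1] unfolding power_one by simp
        then show ?thesis by (subst integral_mult_right_zero) (rule arg_cong, rule sym)
      qed
      also have "\<dots> = (\<integral>y. (if A m (override_on x y K) then H (override_on x y K) else 0) \<partial>P)"
      proof (rule integral_cong_AE)
        show "AE y in P. \<Phi> x0 * exp (- of_real (\<mu> * L x0) * (1 - u)) * (if s < y (\<kappa>' 0) then 1 else 0)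
          = (if A m (override_on x y K) then H (override_on x y K) else 0)"
          using g
        proof (rule AE_mp, intro AE_I2 impI)
          fix y assume gy: "good (override_on x y K)"
          show "\<Phi> x0 * exp (- of_real (\<mu> * L x0) * (1 - u)) * (if s < y (\<kappa>' 0) then 1 else 0)
            = (if A m (override_on x y K) then H (override_on x y K) else 0)"
            using A_iff[OF gy] fwd[OF gy] by (auto simp: H_def)
        qed
      qed measurable
      finally show ?thesis .
    qed
    show ?thesis
      unfolding integral_resample[OF intF, of K] integral_resample[OF intH, of K]
    proof (rule integral_cong_AE)
      show "AE x in P. (\<integral>y. (if A m (override_on x y K) then F (override_on x y K) else 0) \<partial>P)
         = (\<integral>y. (if A m (override_on x y K) then H (override_on x y K) else 0) \<partial>P)"
        using AE_resample[OF good, of K] by (rule AE_mp) (use main in \<open>auto intro!: AE_I2\<close>)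
    qed measurable
  qed
  \<comment> \<open>Summation over \<open>m\<close> recovers the integral: the events
    \<open>A m\<close> are disjoint, and almost surely only finitely many points precede
    \<open>T\<close>.\<close>
  have lim: "(\<lambda>n. \<Sum>m<n. \<integral>x. (if A m x then f x else 0) \<partial>P) \<longlonglongrightarrow> (\<integral>x. f x \<partial>P)"
    if [measurable]: "f \<in> borel_measurable P" and f: "AE x in P. norm (f x) \<le> 1" and z: "\<And>x. \<Phi> x = 0 \<Longrightarrow> f x = 0"
    for f :: "_ \<Rightarrow> complex"
  proof -
    have AU: "(\<Sum>m<n. if A m x then f x else 0) = (if \<exists>m<n. A m x then f x else 0)" for n x
    proof (induction n)
      case (Suc n)
      have "\<not> A n x" if ex: "\<exists>m<n. A m x"
      proof
        assume "A n x"
        obtain m where "m < n" "A m x" using ex by blast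
        then show False using \<open>A n x\<close> unfolding A_def by (metis not_le)
      qed
      then show ?case using Suc by (auto simp: less_Suc_eq)
    qed simp
    have "integrable P (\<lambda>x. if A m x then f x else 0)" for m
    proof (rule P.integrable_const_bound[where B=1])
      show "AE x in P. norm (if A m x then f x else 0) \<le> 1"
        using f by eventually_elim auto
    qed measurable
    then have "(\<Sum>m<n. \<integral>x. (if A m x then f x else 0) \<partial>P) = (\<integral>x. (if \<exists>m<n. A m x then f x else 0) \<partial>P)" for n
      by (subst Bochner_Integration.integral_sum[symmetric]) (auto simp: AU)
    moreover have "(\<lambda>n. \<integral>x. (if \<exists>m<n. A m x then f x else 0) \<partial>P) \<longlonglongrightarrow> (\<integral>x. f x \<partial>P)"
    proof (rule integral_dominated_convergence[where w="\<lambda>_. 1"])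
      show "AE x in P. (\<lambda>n. if \<exists>m<n. A m x then f x else 0) \<longlonglongrightarrow> f x"
        using AE_good_seq[OF ec]
      proof (rule AE_mp, intro AE_I2 impI)
        fix x assume gs: "good_seq \<kappa> x"
        show "(\<lambda>n. if \<exists>m<n. A m x then f x else 0) \<longlonglongrightarrow> f x"
        proof (cases "\<Phi> x = 0")
          case True
          then show ?thesis by (simp add: A_def z)
        next
          case False
          obtain m where m: "\<forall>k. partial \<kappa> x k \<le> T x - e x \<longleftrightarrow> k < m"
            using good_seq_threshold[OF gs] by blast
          have "e x + partial \<kappa> x k \<le> T x" if "k < m" for k
            using spec[OF m, of k] that by linarith
          moreover have "T x < e x + partial \<kappa> x m"
            using spec[OF m, of m] by linarith
          ultimately have Am: "A m x" using False by (simp add: A_def)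
          have "eventually (\<lambda>n. (if \<exists>m<n. A m x then f x else 0) = f x) sequentially"
            using eventually_gt_at_top[of m] by eventually_elim (use Am in auto)
          then show ?thesis by (rule tendsto_eventually)
        qed
      qed
      show "AE x in P. norm (if \<exists>m<n. A m x then f x else 0) \<le> 1" for n
        using f by eventually_elim auto
    qed simp_all
    ultimately show ?thesis by simp
  qed
  have "(\<integral>x. F x \<partial>P) = (\<integral>x. H x \<partial>P)"
  proof (rule LIMSEQ_unique)
    show "(\<lambda>n. \<Sum>m<n. \<integral>x. (if A m x then F x else 0) \<partial>P) \<longlonglongrightarrow> (\<integral>x. F x \<partial>P)"
      by (rule lim) (auto simp: F_le, auto simp: F_def)
    show "(\<lambda>n. \<Sum>m<n. \<integral>x. (if A m x then F x else 0) \<partial>P) \<longlonglongrightarrow> (\<integral>x. H x \<partial>P)"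
      unfolding part by (rule lim) (use H_le in \<open>auto simp: H_def\<close>)
  qed
  then show ?thesis by (simp add: F_def H_def)
qed

end

section \<open>Sample paths of the queue\<close>

text \<open>An enumeration of \<open>attempts\<close>, so that meeting an interval becomes a
  countable disjunction. Attempt 0 of an \<open>Arrival\<close> is the arrival itself; attempt 0 of
  an \<open>Initial\<close> customer is already its first retrial.\<close>

fun att :: "sample \<Rightarrow> customer \<Rightarrow> nat \<Rightarrow> real" where
  "att w (Initial i) j = (\<Sum>m\<le>j. snd w (Retrial (Initial i) m))"
| "att w (Arrival k) j = entry_time w (Arrival k) + (\<Sum>m<j. snd w (Retrial (Arrival k) m))"

lemma attempts_eq: "attempts w c = range (att w c)"
  by (cases c) auto

text \<open>The almost sure properties that make all path arguments deterministic. Services and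
  vacations may have length 0, so after the glue period only weak inequalities between the epochs of
  a cycle are available.\<close>

definition good_clocks :: "(clock \<Rightarrow> real) \<Rightarrow> bool" where
  "good_clocks x \<longleftrightarrow> (\<forall>k. 0 < x (Interarrival k)) \<and> (\<forall>c m. 0 < x (Retrial c m)) \<and>
     (\<forall>n j. 0 \<le> x (Service n j)) \<and> (\<forall>n. 0 \<le> x (Vacation n)) \<and>
     (\<forall>t. \<exists>k. t < (\<Sum>i\<le>k. x (Interarrival i)))"

definition prior :: "real \<Rightarrow> nat \<Rightarrow> sample \<Rightarrow> customer set" where
  "prior G n w = snd (cycle_start G w n)"

lemma prior_Suc: "prior G (Suc n) w = prior G n w \<union> queue_of G w (glue_start G n w) (prior G n w)"
  by (simp add: prior_def glue_start_def case_prod_unfold Let_def)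

lemma glue_start_Suc: "glue_start G (Suc n) w = vacation_start G n w + snd w (Vacation n)"
  by (simp add: vacation_start_def visit_start_def served_def glue_start_def case_prod_unfold Let_def)

lemma glue_start_0 [simp]: "glue_start G 0 w = 0"
  and prior_0 [simp]: "prior G 0 w = {}"
  by (simp_all add: glue_start_def prior_def)

lemma visit_start_0 [simp]: "visit_start G 0 w = G"
  by (simp add: visit_start_def)

lemma served_eq: "served G n w = card (queue_of G w (glue_start G n w) (prior G n w))"
  by (simp add: served_def prior_def)

locale good_sample =
  fixes G :: real and w :: sample
  assumes G: "0 < G" and good: "good_clocks (snd w)"
begin

lemma clocks:
  "0 < snd w (Interarrival k)" "0 < snd w (Retrial c m)" "0 \<le> snd w (Service n j)" "0 \<le> snd w (Vacation n)"
  "\<exists>k. t < (\<Sum>i\<le>k. snd w (Interarrival i))"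
  using good by (auto simp: good_clocks_def)

lemma clock_nonneg: "0 \<le> snd w a"
  by (cases a) (auto intro: less_imp_le clocks)

lemma entry_le_att: "entry_time w c \<le> att w c j"
  by (cases c) (auto intro!: sum_nonneg clock_nonneg)

lemma att_pos: "0 < att w c j"
proof (cases c)
  case (Initial i)
  then show ?thesis by (auto intro!: sum_pos clocks)
next
  case (Arrival k)
  have "0 < entry_time w (Arrival k)" by (auto intro!: sum_pos clocks)
  then show ?thesis using Arrival entry_le_att[of c j] by simp
qed

lemma entry_Arrival_mono: "j \<le> k \<Longrightarrow> entry_time w (Arrival j) \<le> entry_time w (Arrival k)"
  by (auto intro!: sum_mono2 clock_nonneg)

lemma finite_arrived: "finite (arrived w t)"
proof -
  obtain k where k: "t < entry_time w (Arrival k)" using clocks(5)[of t] by auto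
  have "arrived w t \<subseteq> Initial ` {..<fst w} \<union> Arrival ` {..<k}"
  proof
    fix c assume c: "c \<in> arrived w t"
    then consider i where "c = Initial i" "i < fst w" | j where "c = Arrival j" "entry_time w (Arrival j) \<le> t"
      by (auto simp: arrived_def customers_def)
    then show "c \<in> Initial ` {..<fst w} \<union> Arrival ` {..<k}"
    proof cases
      case 2
      then have "j < k" using k entry_Arrival_mono[of k j] by (cases "k \<le> j") auto
      then show ?thesis using 2 by auto
    qed auto
  qed
  then show ?thesis by (rule finite_subset) simp
qed

lemma arrived_mono: "s \<le> t \<Longrightarrow> arrived w s \<subseteq> arrived w t"
  by (auto simp: arrived_def)

lemma glue_less_visit: "glue_start G n w < visit_start G n w"
  using G by (simp add: visit_start_def)

lemma visit_le_vacation: "visit_start G n w \<le> vacation_start G n w"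
  by (auto simp: vacation_start_def intro!: sum_nonneg clocks)

lemma vacation_le_glue: "vacation_start G n w \<le> glue_start G (Suc n) w"
  by (simp add: glue_start_Suc clocks)

lemma glue_mono: "n \<le> m \<Longrightarrow> glue_start G n w \<le> glue_start G m w"
proof (induction m)
  case (Suc m)
  then show ?case
    using glue_less_visit[of m] visit_le_vacation[of m] vacation_le_glue[of m]
    by (cases "n = Suc m") auto
qed simp

lemma vacation_le_later: "n < m \<Longrightarrow> vacation_start G n w \<le> glue_start G m w"
  using vacation_le_glue[of n] glue_mono[of "Suc n" m] by simp

lemma visit_le_later: "n < m \<Longrightarrow> visit_start G n w \<le> glue_start G m w"
  using vacation_le_later[of n m] visit_le_vacation[of n] by simp

lemma queue_arrived: "queue_of G w (glue_start G n w) D \<subseteq> arrived w (visit_start G n w)"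
  using entry_le_att by (fastforce simp: queue_of_def arrived_def attempts_eq visit_start_def intro: order.trans)

lemma prior_arrived: "prior G n w \<subseteq> arrived w (glue_start G n w)"
proof (induction n)
  case (Suc n)
  have "arrived w (glue_start G n w) \<subseteq> arrived w (glue_start G (Suc n) w)"
    by (rule arrived_mono[OF glue_mono]) simp
  moreover have "arrived w (visit_start G n w) \<subseteq> arrived w (glue_start G (Suc n) w)"
    by (rule arrived_mono[OF visit_le_later]) simp
  ultimately show ?case using Suc queue_arrived[of n "prior G n w"] by (auto simp: prior_Suc)
qed simp

lemma prior_Suc_arrived: "prior G (Suc n) w \<subseteq> arrived w (visit_start G n w)"
proof -
  have "prior G n w \<subseteq> arrived w (visit_start G n w)"
    using prior_arrived[of n] arrived_mono[OF less_imp_le[OF glue_less_visit[of n]]] by blast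
  then show ?thesis using queue_arrived[of n "prior G n w"] by (simp add: prior_Suc)
qed

lemma finite_prior: "finite (prior G n w)"
  using finite_subset[OF prior_arrived finite_arrived] .

lemma card_prior: "card (prior G n w) = (\<Sum>m<n. served G m w)"
proof (induction n)
  case (Suc n)
  have "prior G n w \<inter> queue_of G w (glue_start G n w) (prior G n w) = {}"
    by (auto simp: queue_of_def)
  moreover have "finite (queue_of G w (glue_start G n w) (prior G n w))"
    using finite_subset[OF queue_arrived finite_arrived] .
  ultimately show ?case using Suc finite_prior[of n]
    by (simp add: prior_Suc card_Un_disjoint served_eq)
qed simp

text \<open>Removes the recursion: \<open>queue_of\<close> discards customers that joined earlier,
  but these are in the union anyway, so only the position of the attempts relative to the earlier
  glue periods matters.\<close>

lemma prior_iff: "c \<in> prior G n w \<longleftrightarrow> c \<in> customers w \<and> (\<exists>m<n. \<exists>s\<in>attempts w c. glue_start G m w \<le> s \<and> s \<le> visit_start G m w)"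
proof (induction n)
  case (Suc n)
  have "c \<in> queue_of G w (glue_start G n w) (prior G n w) \<longleftrightarrow> c \<in> customers w \<and> c \<notin> prior G n w \<and>
      (\<exists>s\<in>attempts w c. glue_start G n w \<le> s \<and> s \<le> visit_start G n w)"
    by (auto simp: queue_of_def visit_start_def)
  then show ?case using Suc by (auto simp: prior_Suc less_Suc_eq)
qed simp

text \<open>Attempt epochs run on fictitiously after a customer has joined. This is harmless because
  joining is recorded as a set of customers, not of attempts.\<close>

lemma joined_eq:
  assumes "glue_start G n w \<le> t" "t \<le> visit_start G n w"
  shows "joined G w t = prior G n w \<union> {c \<in> customers w. attempts w c \<inter> {glue_start G n w..t} \<noteq> {}}"
proof (intro set_eqI iffI)
  fix c assume "c \<in> joined G w t"
  then obtain m s where c: "c \<in> customers w" and s: "s \<in> attempts w c" "glue_start G m w \<le> s" "s \<le> visit_start G m w" "s \<le> t"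
    by (auto simp: joined_def)
  consider "m < n" | "m = n" | "n < m" by linarith
  then show "c \<in> prior G n w \<union> {c \<in> customers w. attempts w c \<inter> {glue_start G n w..t} \<noteq> {}}"
  proof cases
    case 1
    then have "c \<in> prior G n w" using c s unfolding prior_iff by blast
    then show ?thesis by blast
  next
    case 2
    then show ?thesis using c s by auto
  next
    case 3
    then have "glue_start G n w \<le> s" using s(2) glue_mono[of n m] by linarith
    then show ?thesis using c s by auto
  qed
next
  fix c assume "c \<in> prior G n w \<union> {c \<in> customers w. attempts w c \<inter> {glue_start G n w..t} \<noteq> {}}"
  then show "c \<in> joined G w t"
  proof
    assume "c \<in> prior G n w"
    then obtain m s where "c \<in> customers w" "m < n" "s \<in> attempts w c" "glue_start G m w \<le> s" "s \<le> visit_start G m w"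
      by (auto simp: prior_iff)
    moreover from this have "s \<le> t" using visit_le_later[of m n] assms by linarith
    ultimately show ?thesis by (auto simp: joined_def)
  next
    assume "c \<in> {c \<in> customers w. attempts w c \<inter> {glue_start G n w..t} \<noteq> {}}"
    then show ?thesis using assms by (force simp: joined_def)
  qed
qed

lemma joined_visit_start: "joined G w (visit_start G n w) = prior G (Suc n) w"
  using joined_eq[of n "visit_start G n w"] less_imp_le[OF glue_less_visit[of n]]
  by (auto simp: prior_Suc queue_of_def visit_start_def)

text \<open>
  An attempt exactly at the start of a glue period counts as joined at that instant, so the system
  would not be all in orbit then. The exception covers cycles whose visit and vacation both have length 0.
\<close>

definition no_tie :: bool where
  "no_tie \<longleftrightarrow> (\<forall>n. \<forall>c\<in>customers w. glue_start G (Suc n) w \<in> attempts w c \<longrightarrow> glue_start G (Suc n) w = visit_start G n w)"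

text \<open>Nobody joins between two glue periods. The only candidate is an attempt at the left end
  of the next glue period, which by \<open>no_tie\<close> coincides with the end of the previous one
  and is then already counted in \<open>prior G (Suc n) w\<close>.\<close>

lemma joined_between:
  assumes "visit_start G n w \<le> t" "t \<le> glue_start G (Suc n) w" no_tie
  shows "joined G w t = prior G (Suc n) w"
proof (intro set_eqI iffI)
  fix c assume "c \<in> joined G w t"
  then obtain m s where c: "c \<in> customers w" and s: "s \<in> attempts w c" "glue_start G m w \<le> s" "s \<le> visit_start G m w" "s \<le> t"
    by (auto simp: joined_def)
  show "c \<in> prior G (Suc n) w"
  proof (cases "m < Suc n")
    case True
    then show ?thesis using c s unfolding prior_iff by blast
  next
    case False
    then have "s = glue_start G (Suc n) w" using s glue_mono[of "Suc n" m] assms by auto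
    then have "s = visit_start G n w" using assms(3) c s unfolding no_tie_def by blast
    then have "glue_start G n w \<le> s \<and> s \<le> visit_start G n w" using glue_less_visit[of n] by simp
    then show ?thesis using c s unfolding prior_iff by blast
  qed
next
  fix c assume "c \<in> prior G (Suc n) w"
  then obtain m s where m: "c \<in> customers w" "m < Suc n" "s \<in> attempts w c" "glue_start G m w \<le> s" "s \<le> visit_start G m w"
    by (auto simp: prior_iff)
  have "visit_start G m w \<le> visit_start G n w"
    using m(2) glue_mono[of m n] by (simp add: visit_start_def)
  then have "s \<le> t" using m assms by linarith
  then show "c \<in> joined G w t" using m by (auto simp: joined_def)
qed

lemma services_le:
  assumes "j < served G m w" shows "visit_start G m w + (\<Sum>i\<le>j. snd w (Service m i)) \<le> vacation_start G m w"
  unfolding vacation_start_def using assms by (auto intro!: sum_mono2 clocks)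

lemma card_completed_union: "card {(m, j). m < n \<and> j < served G m w} = card (prior G n w)"
proof -
  have "{(m, j). m < n \<and> j < served G m w} = (SIGMA m:{..<n}. {..<served G m w})" by auto
  then show ?thesis by (simp add: card_prior)
qed

text \<open>All services of earlier visits are over. The upper bound on \<open>t\<close> is strict
  because a service of length 0 is completed at the very start of its visit.\<close>

lemma completed_glue:
  assumes "glue_start G n w \<le> t" "t < visit_start G n w"
  shows "card (completed G w t) = card (prior G n w)"
proof -
  have "completed G w t = {(m, j). m < n \<and> j < served G m w}"
  proof (intro set_eqI iffI; clarsimp simp: completed_def)
    fix m j assume a: "j < served G m w" "visit_start G m w + (\<Sum>i\<le>j. snd w (Service m i)) \<le> t"
    have "0 \<le> (\<Sum>i\<le>j. snd w (Service m i))" by (intro sum_nonneg clocks)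
    then have "visit_start G m w < visit_start G n w" using a assms by linarith
    then show "m < n" using glue_mono[of n m] by (force simp: visit_start_def not_less)
  next
    fix m j assume "m < n" "j < served G m w"
    then show "visit_start G m w + (\<Sum>i\<le>j. snd w (Service m i)) \<le> t"
      using services_le[of j m] vacation_le_later[of m n] assms by linarith
  qed
  then show ?thesis by (simp add: card_completed_union)
qed

text \<open>The right end belongs to the next glue period and is covered by
  \<open>completed_glue\<close>; before it no later visit has begun.\<close>

lemma completed_vacation:
  assumes "vacation_start G n w \<le> t" "t \<le> glue_start G (Suc n) w"
  shows "card (completed G w t) = card (prior G (Suc n) w)"
proof (cases "t = glue_start G (Suc n) w")
  case True
  then show ?thesis using completed_glue[of "Suc n" t] glue_less_visit[of "Suc n"] by simp
next
  case False
  have "completed G w t = {(m, j). m < Suc n \<and> j < served G m w}"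
  proof (intro set_eqI iffI; clarsimp simp: completed_def)
    fix m j assume a: "j < served G m w" "visit_start G m w + (\<Sum>i\<le>j. snd w (Service m i)) \<le> t"
    have "0 \<le> (\<Sum>i\<le>j. snd w (Service m i))" by (intro sum_nonneg clocks)
    then have "visit_start G m w < glue_start G (Suc n) w" using a assms False by linarith
    then show "m < Suc n" using glue_mono[of "Suc n" m] glue_less_visit[of m] by (force simp: not_less)
  next
    fix m j assume "m < Suc n" "j < served G m w"
    then show "visit_start G m w + (\<Sum>i\<le>j. snd w (Service m i)) \<le> t"
      using services_le[of j m] vacation_le_later[of m n] glue_less_visit[of n] visit_le_vacation[of n] assms
      by (cases "m = n") (auto simp: less_Suc_eq)
  qed
  then show ?thesis by (simp only: card_completed_union)
qed

text \<open>The truncated subtraction in \<open>num_queue\<close> is exact here: the customers of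
  earlier cycles have all joined and been completed, which leaves those who joined in the current
  glue period.\<close>

lemma num_queue_glue:
  assumes "glue_start G n w \<le> t" "t < visit_start G n w"
  shows "num_queue G w t = card {c \<in> customers w - prior G n w. attempts w c \<inter> {glue_start G n w..t} \<noteq> {}}"
proof -
  let ?A = "{c \<in> customers w - prior G n w. attempts w c \<inter> {glue_start G n w..t} \<noteq> {}}"
  have "?A \<subseteq> queue_of G w (glue_start G n w) (prior G n w)"
    using assms by (fastforce simp: queue_of_def visit_start_def)
  then have "finite ?A" using finite_subset[OF _ finite_subset[OF queue_arrived finite_arrived]] by blast
  moreover have "joined G w t = prior G n w \<union> ?A"
    using assms by (subst joined_eq[of n]) auto
  ultimately have "card (joined G w t) = card (prior G n w) + card ?A"
    using finite_prior[of n] by (simp only:) (rule card_Un_disjoint, auto)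
  then show ?thesis using completed_glue[OF assms] by (simp add: num_queue_def)
qed

lemma num_vacation:
  assumes "vacation_start G n w \<le> t" "t \<le> glue_start G (Suc n) w" no_tie
  shows "num_queue G w t = 0" "num_orbit G w t = card (arrived w t - prior G (Suc n) w)"
  using completed_vacation[OF assms(1,2)] joined_between[OF _ assms(2,3)] assms(1) visit_le_vacation[of n]
  by (auto simp: num_queue_def num_orbit_def)

lemma num_visit:
  assumes "visit_start G n w \<le> t" "t \<le> vacation_start G n w" no_tie
  shows "num_queue G w t = card (prior G (Suc n) w) - card (completed G w t)"
    "num_orbit G w t = card (arrived w t - prior G (Suc n) w)"
  using joined_between[OF assms(1) _ assms(3)] assms(2) vacation_le_glue[of n]
  by (auto simp: num_queue_def num_orbit_def)

text \<open>No later visit has begun by then, so only services of cycle 0 count.\<close>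

lemma completed_first_visit:
  assumes "t < vacation_start G 0 w"
  shows "card (completed G w t) = card {j. j < served G 0 w \<and> G + (\<Sum>i\<le>j. snd w (Service 0 i)) \<le> t}"
proof -
  have "completed G w t = Pair 0 ` {j. j < served G 0 w \<and> G + (\<Sum>i\<le>j. snd w (Service 0 i)) \<le> t}"
  proof (intro set_eqI iffI)
    fix p assume "p \<in> completed G w t"
    then obtain m j where p: "p = (m, j)" and a: "j < served G m w" "visit_start G m w + (\<Sum>i\<le>j. snd w (Service m i)) \<le> t"
      by (auto simp: completed_def)
    have "0 \<le> (\<Sum>i\<le>j. snd w (Service m i))" by (intro sum_nonneg clocks)
    then have "visit_start G m w < vacation_start G 0 w" using a assms by linarith
    then have "m = 0" using vacation_le_later[of 0 m] glue_less_visit[of m] by (cases m) auto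
    then show "p \<in> Pair 0 ` {j. j < served G 0 w \<and> G + (\<Sum>i\<le>j. snd w (Service 0 i)) \<le> t}" using p a by auto
  qed (auto simp: completed_def)
  then show ?thesis by (simp add: card_image inj_on_def)
qed

text \<open>For \<open>n = 0\<close> nobody has joined because attempt epochs are strictly positive;
  every later cycle starts at the end of a vacation, when the queue is empty.\<close>

lemma X_seq_eq:
  assumes no_tie
  shows "X_seq G n w = card (arrived w (glue_start G n w) - prior G n w)"
proof (cases n)
  case 0
  have "joined G w 0 = {}"
    using joined_eq[of 0 0] att_pos glue_less_visit[of 0] by (auto simp: attempts_eq) (metis less_irrefl)
  then show ?thesis using 0 by (simp add: X_seq_def num_system_def num_queue_def num_orbit_def)
next
  case (Suc m)
  then show ?thesis
    using num_vacation[OF vacation_le_glue order.refl assms, of m] by (simp add: X_seq_def num_system_def)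
qed

lemma Y_seq_eq: "Y_seq G n w = (served G n w, card (arrived w (visit_start G n w) - prior G (Suc n) w))"
  by (simp add: Y_seq_def num_orbit_def joined_visit_start)

lemma Z_seq_eq:
  assumes no_tie
  shows "Z_seq G n w = card (arrived w (vacation_start G n w) - prior G (Suc n) w)"
  using num_vacation[OF order.refl vacation_le_glue assms, of n] by (simp add: Z_seq_def num_system_def)

end

text \<open>Plays the part of the past of the arrival and retrial processes up to \<open>t\<close>.
  Services and vacations agree without restriction: they are independent of these processes and are
  integrated out separately.\<close>

definition same_history :: "real \<Rightarrow> sample \<Rightarrow> sample \<Rightarrow> bool" where
  "same_history t w w' \<longleftrightarrow> fst w' = fst w \<and> (\<forall>n j. snd w' (Service n j) = snd w (Service n j)) \<and>
     (\<forall>n. snd w' (Vacation n) = snd w (Vacation n)) \<and>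
     (\<forall>c. attempts w' c \<inter> {..t} = attempts w c \<inter> {..t}) \<and> (\<forall>s\<le>t. arrived w' s = arrived w s)"

lemma same_history_interval:
  assumes "same_history t w w'" "b \<le> t"
  shows "attempts w' c \<inter> {a..b} = attempts w c \<inter> {a..b}"
proof -
  have iff: "s \<in> attempts w' c \<inter> {..t} \<longleftrightarrow> s \<in> attempts w c \<inter> {..t}" for s
    using assms(1) by (auto simp: same_history_def)
  have "s \<in> attempts w' c \<longleftrightarrow> s \<in> attempts w c" if "s \<le> b" for s
    using iff[of s] order.trans[OF that assms(2)] by simp
  then show ?thesis by auto
qed

lemma same_history_queue:
  assumes "same_history t w w'" "c + G \<le> t"
  shows "queue_of G w' c D = queue_of G w c D"
proof -
  have "customers w' = customers w" using assms by (simp add: same_history_def customers_def)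
  then show ?thesis using same_history_interval[OF assms] by (simp add: queue_of_def)
qed

declare cycle_start.simps(2) [simp del]

text \<open>Once the glue period of cycle \<open>n\<close> is over by \<open>t\<close>, its queue is
  known; because services and vacations are shared, so is the start of cycle \<open>n + 1\<close>,
  although that may lie beyond \<open>t\<close>.\<close>

lemma (in good_sample) same_history_cycle:
  assumes h: "same_history t w w'" and "visit_start G n w \<le> t"
  shows "cycle_start G w' n = cycle_start G w n \<and> cycle_start G w' (Suc n) = cycle_start G w (Suc n)"
  using assms(2)
proof (induction n)
  case 0
  then show ?case using h same_history_queue[OF h, of 0 G "{}"]
    by (simp add: same_history_def Let_def cycle_start.simps(2))
next
  case (Suc n)
  have "visit_start G n w \<le> visit_start G (Suc n) w"
    using visit_le_later[of n "Suc n"] glue_less_visit[of "Suc n"] by simp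
  then have IH: "cycle_start G w' (Suc n) = cycle_start G w (Suc n)" using Suc by simp
  have "queue_of G w' (glue_start G (Suc n) w) D = queue_of G w (glue_start G (Suc n) w) D" for D
    using Suc.prems by (intro same_history_queue[OF h]) (simp add: visit_start_def)
  then have "cycle_start G w' (Suc (Suc n)) = cycle_start G w (Suc (Suc n))"
    using h IH by (subst (1 2) cycle_start.simps(2)) 
      (simp add: Let_def case_prod_unfold glue_start_def same_history_def)
  then show ?case using IH by simp
qed

lemma (in good_sample) same_history_times:
  assumes h: "same_history t w w'" 
  shows "visit_start G n w \<le> t \<Longrightarrow> glue_start G n w' = glue_start G n w"
    "visit_start G n w \<le> t \<Longrightarrow> visit_start G n w' = visit_start G n w"
    "visit_start G n w \<le> t \<Longrightarrow> served G n w' = served G n w"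
    "visit_start G n w \<le> t \<Longrightarrow> vacation_start G n w' = vacation_start G n w"
    "visit_start G n w \<le> t \<Longrightarrow> glue_start G (Suc n) w' = glue_start G (Suc n) w"
    "visit_start G n w \<le> t \<Longrightarrow> prior G (Suc n) w' = prior G (Suc n) w"
    "glue_start G n w \<le> t \<Longrightarrow> glue_start G n w' = glue_start G n w"
    "glue_start G n w \<le> t \<Longrightarrow> prior G n w' = prior G n w"
proof -
  assume v: "visit_start G n w \<le> t"
  note c = same_history_cycle[OF h v]
  show g: "glue_start G n w' = glue_start G n w" using c by (simp add: glue_start_def)
  then show vs: "visit_start G n w' = visit_start G n w" by (simp add: visit_start_def)
  have p: "prior G n w' = prior G n w" using c by (simp add: prior_def)
  show s: "served G n w' = served G n w"
    unfolding served_eq g p using same_history_queue[OF h, of "glue_start G n w" G] v by (simp add: visit_start_def)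
  show "vacation_start G n w' = vacation_start G n w"
    unfolding vacation_start_def vs s using h by (simp add: same_history_def)
  show "glue_start G (Suc n) w' = glue_start G (Suc n) w" "prior G (Suc n) w' = prior G (Suc n) w"
    using c by (simp_all add: glue_start_def prior_def)
next
  assume v: "glue_start G n w \<le> t"
  have "cycle_start G w' n = cycle_start G w n"
  proof (cases n)
    case (Suc m)
    then have "visit_start G m w \<le> t" using visit_le_later[of m n] v by simp
    then show ?thesis using same_history_cycle[OF h, of m] Suc by simp
  qed simp
  then show "glue_start G n w' = glue_start G n w" "prior G n w' = prior G n w"
    by (simp_all add: glue_start_def prior_def)
qed

text \<open>A change of the interarrival times from index \<open>m\<close> on is invisible up to
  \<open>t\<close> as long as arrival \<open>m\<close> comes after \<open>t\<close> in both samples: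
  an affected customer makes no attempt before its arrival.\<close>

lemma same_history_arrivals:
  assumes good: "good_clocks x" "good_clocks x'"
    and agree: "\<forall>c. c \<notin> Interarrival ` {m..} \<longrightarrow> x c = x' c"
    and t: "t < (\<Sum>i\<le>m. x (Interarrival i))" "t < (\<Sum>i\<le>m. x' (Interarrival i))"
  shows "same_history t (k, x) (k, x')"
proof -
  \<comment> \<open>The facts taken from the locale do not mention the glue length, so any positive
    value serves.\<close>
  interpret w: good_sample 1 "(k, x)" using good by unfold_locales auto
  interpret w': good_sample 1 "(k, x')" using good by unfold_locales auto
  have ret: "x' (Retrial c j) = x (Retrial c j)" "x' (Service n j) = x (Service n j)" "x' (Vacation n) = x (Vacation n)" for c n j
    by (auto intro!: agree[rule_format, symmetric])
  have early: "entry_time (k, x') (Arrival i) = entry_time (k, x) (Arrival i)" if "i < m" for i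
    using that by (auto intro!: sum.cong agree[rule_format, symmetric])
  have late: "t < entry_time (k, x) (Arrival i)" "t < entry_time (k, x') (Arrival i)" if "m \<le> i" for i
    using w.entry_Arrival_mono[OF that] w'.entry_Arrival_mono[OF that] t by auto
  have arr: "arrived (k, x') s = arrived (k, x) s" if "s \<le> t" for s
  proof -
    have "entry_time (k, x') c \<le> s \<longleftrightarrow> entry_time (k, x) c \<le> s" for c
    proof (cases c)
      case (Arrival i)
      then show ?thesis using early[of i] late[of i] that by (cases "i < m") auto
    qed simp
    then show ?thesis by (auto simp: arrived_def customers_def)
  qed
  have att: "attempts (k, x') c \<inter> {..t} = attempts (k, x) c \<inter> {..t}" for c
  proof (cases c)
    case (Initial i)
    then show ?thesis using ret by simp
  next
    case (Arrival i)
    show ?thesis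
    proof (cases "i < m")
      case True
      then show ?thesis using Arrival early[OF True] ret by simp
    next
      case False
      then have "t < att (k, x) c j" "t < att (k, x') c j" for j
        using late[of i] w.entry_le_att[of c j] w'.entry_le_att[of c j] Arrival by auto
      then show ?thesis by (auto simp: attempts_eq not_less[symmetric])
    qed
  qed
  show ?thesis using ret arr att by (simp add: same_history_def)
qed

text \<open>Only customer \<open>d\<close> is affected, and each of its changed attempts lies beyond
  \<open>t\<close> in both samples.\<close>

lemma same_history_retrials:
  assumes good: "good_clocks x" "good_clocks x'"
    and agree: "\<forall>c. c \<notin> Retrial d ` {m..} \<longrightarrow> x c = x' c"
    and t: "t < entry_time (k, x) d + (\<Sum>i\<le>m. x (Retrial d i))" "t < entry_time (k, x) d + (\<Sum>i\<le>m. x' (Retrial d i))"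
  shows "same_history t (k, x) (k, x')"
proof -
  interpret w: good_sample 1 "(k, x)" using good by unfold_locales auto
  interpret w': good_sample 1 "(k, x')" using good by unfold_locales auto
  have eq: "x' (Interarrival i) = x (Interarrival i)" "x' (Service n j) = x (Service n j)" "x' (Vacation n) = x (Vacation n)" for i n j
    by (auto intro!: agree[rule_format, symmetric])
  have ret: "x' (Retrial c i) = x (Retrial c i)" if "c \<noteq> d \<or> i < m" for c i
    using that by (auto intro!: agree[rule_format, symmetric])
  have entry: "entry_time (k, x') c = entry_time (k, x) c" for c
    using eq by (cases c) auto
  have att: "attempts (k, x') c \<inter> {..t} = attempts (k, x) c \<inter> {..t}" for c
  proof (cases "c = d")
    case False
    then have "att (k, x') c j = att (k, x) c j" for j
      using ret eq by (cases c) auto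
    then show ?thesis by (simp add: attempts_eq)
  next
    case True
    have dj: "att (k, x') d j = att (k, x) d j \<or> (t < att (k, x) d j \<and> t < att (k, x') d j)" for j
    proof (cases d)
      case (Initial i)
      show ?thesis
      proof (cases "j < m")
        case True
        then show ?thesis using Initial ret by (auto intro!: disjI1 sum.cong)
      next
        case False
        then have "(\<Sum>i\<le>m. x (Retrial d i)) \<le> (\<Sum>i\<le>j. x (Retrial d i))" "(\<Sum>i\<le>m. x' (Retrial d i)) \<le> (\<Sum>i\<le>j. x' (Retrial d i))"
          using w.clock_nonneg w'.clock_nonneg by (auto intro!: sum_mono2)
        then show ?thesis using t Initial by simp
      qed
    next
      case (Arrival i)
      \<comment> \<open>Attempt \<open>j\<close> of an arrival uses only the intervals below
        \<open>j\<close>, attempt \<open>j\<close> of an initial customer those up to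
        \<open>j\<close>; hence the bound \<open>j \<le> m\<close> here and \<open>j < m\<close>
        above.\<close>
      show ?thesis
      proof (cases "j \<le> m")
        case True
        then have "(\<Sum>i<j. x' (Retrial d i)) = (\<Sum>i<j. x (Retrial d i))"
          using ret by (intro sum.cong) auto
        then show ?thesis using Arrival entry[of d] by simp
      next
        case False
        then have "(\<Sum>i\<le>m. x (Retrial d i)) \<le> (\<Sum>i<j. x (Retrial d i))" "(\<Sum>i\<le>m. x' (Retrial d i)) \<le> (\<Sum>i<j. x' (Retrial d i))"
          using w.clock_nonneg w'.clock_nonneg by (auto intro!: sum_mono2)
        then show ?thesis using t Arrival entry[of d] by simp
      qed
    qed
    have iff: "att (k, x') d j \<le> t \<and> att (k, x') d j = s \<longleftrightarrow> att (k, x) d j \<le> t \<and> att (k, x) d j = s" for j s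
      using dj[of j] by auto
    have mem: "s \<in> attempts w d \<inter> {..t} \<longleftrightarrow> (\<exists>j. att w d j \<le> t \<and> att w d j = s)" for s w
      by (auto simp: attempts_eq)
    show ?thesis unfolding True by (rule set_eqI) (simp only: mem iff)
  qed
  show ?thesis using eq att entry by (simp add: same_history_def arrived_def customers_def)
qed

section \<open>Measurability and null events\<close>

lemma borel_measurable_pred_eq [measurable (raw)]:
  fixes f :: "'a \<Rightarrow> 'b::{second_countable_topology, linorder_topology}"
  shows "f \<in> borel_measurable M \<Longrightarrow> g \<in> borel_measurable M \<Longrightarrow> Measurable.pred M (\<lambda>w. f w = g w)"
  unfolding Measurable.pred_def by (rule borel_measurable_eq)

instance customer :: countable by countable_datatype

lemma attempts_meet_iff: "attempts w c \<inter> {a..b} \<noteq> {} \<longleftrightarrow> (\<exists>j. a \<le> att w c j \<and> att w c j \<le> b)"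
proof -
  have "A \<noteq> {} \<longleftrightarrow> (\<exists>s. s \<in> A)" for A :: "real set" by auto
  then show ?thesis by (auto simp: attempts_eq)
qed

text \<open>A Poisson point does not fall exactly at \<open>T\<close> if \<open>T\<close> is already
  decided at an earlier time \<open>S\<close>. The strong Markov property, applied shortly before
  \<open>T\<close>, bounds the probability of a point in the last \<open>\<epsilon>\<close> time
  units by \<open>\<mu> * \<epsilon>\<close>.\<close>

lemma (in real_product) AE_no_tie:
  fixes e S T :: "('i \<Rightarrow> real) \<Rightarrow> real"
  assumes ec: "exp_clocks \<kappa> \<mu>"
    and [measurable]: "e \<in> borel_measurable P" "S \<in> borel_measurable P" "T \<in> borel_measurable P"
    and good: "AE x in P. good x"
    and e: "\<And>x x'. (\<forall>c. c \<notin> range \<kappa> \<longrightarrow> x c = x' c) \<Longrightarrow> e x = e x'"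
    and stop: "\<And>x x' m. good x \<Longrightarrow> good x' \<Longrightarrow> (\<forall>c. c \<notin> \<kappa> ` {m..} \<longrightarrow> x c = x' c) \<Longrightarrow>
       S x < e x + partial \<kappa> x m \<Longrightarrow> S x < e x + partial \<kappa> x' m \<Longrightarrow> S x' = S x \<and> T x' = T x"
  shows "AE x in P. \<forall>j. e x + partial \<kappa> x j = T x \<longrightarrow> \<not> S x < T x"
proof -
  define E where "E = {x \<in> space P. S x < T x \<and> e x < T x \<and> (\<exists>j. e x + partial \<kappa> x j = T x)}"
  have mu: "0 < \<mu>" using ec by (auto simp: exp_clocks_def)
  have E [measurable]: "E \<in> sets P" unfolding E_def by measurable
  have le: "measure P E \<le> \<mu> * \<epsilon>" if \<epsilon>: "0 < \<epsilon>" for \<epsilon>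
  proof -
    define \<Phi> where "\<Phi> = (\<lambda>x. if S x < T x \<and> e x \<le> T x then 1 else 0 :: complex)"
    \<comment> \<open>The window starts \<open>\<epsilon>\<close> before \<open>T\<close>, but not
      before \<open>S\<close>, where \<open>T\<close> becomes known, nor before the process begins
      at \<open>e\<close>.\<close>
    define T' where "T' = (\<lambda>x. max (max (T x - \<epsilon>) (S x)) (e x))"
    define L where "L = (\<lambda>x. T x - T' x)"
    define N where "N = (\<lambda>x. card {k. T' x < e x + partial \<kappa> x k \<and> e x + partial \<kappa> x k \<le> T' x + L x})"
    have [measurable]: "\<Phi> \<in> borel_measurable P" "T' \<in> borel_measurable P" "L \<in> borel_measurable P"
      unfolding \<Phi>_def L_def T'_def by measurable
    have [measurable]: "N \<in> measurable P (count_space UNIV)" unfolding N_def by measurable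
    \<comment> \<open>With \<open>u = 0\<close> the power \<open>0 ^ N x\<close> is the indicator of
      no point in the window.\<close>
    have sm: "(\<integral>x. \<Phi> x * 0 ^ N x \<partial>P) = (\<integral>x. \<Phi> x * exp (- of_real (\<mu> * L x) * (1 - 0)) \<partial>P)"
      unfolding N_def
    proof (rule strong_markov[where good=good and \<kappa>=\<kappa> and e=e and T=T' and L=L and \<Phi>=\<Phi>, OF ec _ _ _ _ good])
      fix x x' m
      assume g: "good x" "good x'" and a: "\<forall>c. c \<notin> \<kappa> ` {m..} \<longrightarrow> x c = x' c" and "\<Phi> x \<noteq> 0"
        and t: "T' x < e x + partial \<kappa> x m" "T' x < e x + partial \<kappa> x' m"
      have "e x = e x'" using a by (intro e) auto
      moreover have "S x' = S x \<and> T x' = T x"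
        using t by (intro stop[OF g a]) (auto simp: T'_def)
      ultimately show "T' x' = T' x \<and> L x' = L x \<and> \<Phi> x' = \<Phi> x"
        by (simp add: T'_def L_def \<Phi>_def)
    next
      fix x x' :: "'i \<Rightarrow> real" assume "\<forall>c. c \<notin> range \<kappa> \<longrightarrow> x c = x' c"
      then show "e x = e x'" by (rule e)
    next
      fix x assume "\<Phi> x \<noteq> 0"
      then have "S x < T x \<and> e x \<le> T x" by (simp add: \<Phi>_def split: if_splits)
      then show "e x \<le> T' x \<and> 0 \<le> L x" using \<epsilon> by (simp add: T'_def L_def)
    next
      show "norm (\<Phi> x) \<le> 1" for x by (simp add: \<Phi>_def)
    qed simp_all
    have int1: "integrable P (\<lambda>x. \<Phi> x * 0 ^ N x)"
      by (rule integrable_bounded_P[where C=1]) (auto simp: \<Phi>_def norm_mult norm_power power_le_one)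
    have L_le: "0 \<le> L x \<and> L x \<le> \<epsilon>" if "\<Phi> x \<noteq> 0" for x
    proof -
      have "S x < T x \<and> e x \<le> T x" using that by (simp add: \<Phi>_def split: if_splits)
      then show ?thesis using \<epsilon> by (simp add: L_def T'_def)
    qed
    have int2: "integrable P (\<lambda>x. \<Phi> x * exp (- of_real (\<mu> * L x) * (1 - 0)))"
    proof (rule integrable_bounded_P[where C=1])
      show "norm (\<Phi> x * exp (- of_real (\<mu> * L x) * (1 - 0))) \<le> 1" for x
      proof (cases "\<Phi> x = 0")
        case False
        then have "norm (exp (- complex_of_real (\<mu> * L x) * (1 - 0))) \<le> 1"
          using norm_exp_gap_le[of "\<mu> * L x" 0] mu L_le[of x] by simp
        moreover have "norm (\<Phi> x) \<le> 1" by (simp add: \<Phi>_def)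
        ultimately show ?thesis unfolding norm_mult by (intro mult_le_one) simp_all
      qed simp
    qed measurable
    have int3: "integrable P \<Phi>"
      by (rule integrable_bounded_P[where C=1]) (auto simp: \<Phi>_def)
    have eq: "(\<integral>x. \<Phi> x * (1 - 0 ^ N x) \<partial>P) = (\<integral>x. \<Phi> x * (1 - exp (- of_real (\<mu> * L x))) \<partial>P)"
      using sm int1 int2 int3 by (simp add: right_diff_distrib)
    have "measure P E = (\<integral>x. indicator E x \<partial>P)" by simp
    also have "\<dots> \<le> (\<integral>x. Re (\<Phi> x * (1 - 0 ^ N x)) \<partial>P)"
    proof (rule integral_mono_AE)
      show "integrable P (\<lambda>x. Re (\<Phi> x * (1 - 0 ^ N x)))"
      proof (rule integrable_bounded_P[where C=1])
        show "norm (Re (\<Phi> x * (1 - 0 ^ N x))) \<le> 1" for x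
          by (cases "N x = 0") (auto simp: \<Phi>_def zero_power)
      qed measurable
      show "AE x in P. indicator E x \<le> Re (\<Phi> x * (1 - 0 ^ N x))"
        using AE_good_seq[OF ec]
      proof eventually_elim
        fix x assume gs: "good_seq \<kappa> x"
        show "indicator E x \<le> Re (\<Phi> x * (1 - 0 ^ N x))"
        proof (cases "x \<in> E")
          case True
          then obtain j where j: "e x + partial \<kappa> x j = T x" and st: "S x < T x" "e x < T x" by (auto simp: E_def)
          obtain m where m: "\<forall>k. partial \<kappa> x k \<le> T x - e x \<longleftrightarrow> k < m"
            using good_seq_threshold[OF gs] by blast
          have "{k. T' x < e x + partial \<kappa> x k \<and> e x + partial \<kappa> x k \<le> T' x + L x} \<subseteq> {..<m}"
          proof
            fix k assume "k \<in> {k. T' x < e x + partial \<kappa> x k \<and> e x + partial \<kappa> x k \<le> T' x + L x}"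
            then have "partial \<kappa> x k \<le> T x - e x" by (simp add: L_def)
            then show "k \<in> {..<m}" using spec[OF m, of k] by simp
          qed
          then have "finite {k. T' x < e x + partial \<kappa> x k \<and> e x + partial \<kappa> x k \<le> T' x + L x}"
            by (rule finite_subset) simp
          moreover have "j \<in> {k. T' x < e x + partial \<kappa> x k \<and> e x + partial \<kappa> x k \<le> T' x + L x}"
            using j st \<epsilon> by (auto simp: T'_def L_def)
          ultimately have "0 < N x" unfolding N_def card_gt_0_iff by blast
          then show ?thesis using st True by (simp add: \<Phi>_def zero_power)
        qed (cases "N x = 0", auto simp: \<Phi>_def zero_power)
      qed
    qed (rule integrable_bounded_P[where C=1], auto split: split_indicator)
    also have "\<dots> = Re (\<integral>x. \<Phi> x * (1 - 0 ^ N x) \<partial>P)"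
      using int1 int3 by (intro integral_Re) (simp add: right_diff_distrib)
    also have "\<dots> = Re (\<integral>x. \<Phi> x * (1 - exp (- of_real (\<mu> * L x))) \<partial>P)" by (simp only: eq)
    also have "\<dots> \<le> norm (\<integral>x. \<Phi> x * (1 - exp (- of_real (\<mu> * L x))) \<partial>P)" by (rule complex_Re_le_cmod)
    also have "\<dots> \<le> (\<integral>x. norm (\<Phi> x * (1 - exp (- of_real (\<mu> * L x)))) \<partial>P)" by (rule integral_norm_bound)
    also have "\<dots> \<le> (\<integral>x. \<mu> * \<epsilon> \<partial>P)"
    proof -
      have le: "norm (\<Phi> x * (1 - exp (- of_real (\<mu> * L x)))) \<le> \<mu> * \<epsilon>" for x
      proof (cases "\<Phi> x = 0")
        case False
        have "exp (- of_real (\<mu> * L x)) = complex_of_real (exp (- (\<mu> * L x)))"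
          using exp_of_real[of "- (\<mu> * L x)"] by simp
        then have "1 - exp (- of_real (\<mu> * L x)) = complex_of_real (1 - exp (- (\<mu> * L x)))"
          by simp
        then have "norm (1 - exp (- of_real (\<mu> * L x)) :: complex) = \<bar>1 - exp (- (\<mu> * L x))\<bar>"
          by (simp only: norm_of_real)
        also have "\<dots> = 1 - exp (- (\<mu> * L x))" using L_le[OF False] mu by simp
        also have "\<dots> \<le> \<mu> * L x" using exp_ge_add_one_self[of "- (\<mu> * L x)"] by simp
        also have "\<dots> \<le> \<mu> * \<epsilon>" using L_le[OF False] mu by simp
        finally have "norm (1 - exp (- of_real (\<mu> * L x)) :: complex) \<le> \<mu> * \<epsilon>" .
        moreover have "norm (\<Phi> x) = 1" using False by (auto simp: \<Phi>_def split: if_splits)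
        ultimately show ?thesis unfolding norm_mult by simp
      qed (use \<epsilon> mu in auto)
      show ?thesis
      proof (rule integral_mono)
        show "integrable P (\<lambda>x. norm (\<Phi> x * (1 - exp (- of_real (\<mu> * L x)))))"
        proof (rule integrable_bounded_P[where C="\<mu> * \<epsilon>"])
          show "norm (norm (\<Phi> x * (1 - exp (- of_real (\<mu> * L x))))) \<le> \<mu> * \<epsilon>" for x
            using le[of x] by (simp only: real_norm_def abs_norm_cancel)
        qed measurable
      qed (rule P.integrable_const, rule le)
    qed
    also have "\<dots> = \<mu> * \<epsilon>" using P.P.prob_space by simp
    finally show ?thesis .
  qed
  have "measure P E \<le> 0"
  proof (rule field_le_epsilon)
    fix d :: real assume "0 < d"
    then show "measure P E \<le> 0 + d" using le[of "d / \<mu>"] mu by simp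
  qed
  then have "emeasure P E = 0"
    using measure_nonneg[of P E] by (simp add: P.emeasure_eq_measure)
  then have "AE x in P. x \<notin> E" using E by (intro AE_not_in) auto
  then show ?thesis using AE_good_seq[OF ec]
  proof eventually_elim
    fix x assume "x \<notin> E" and gs: "good_seq \<kappa> x"
    have pos: "0 < partial \<kappa> x j" for j
      using gs unfolding partial_def good_seq_def by (intro sum_pos) auto
    show "\<forall>j. e x + partial \<kappa> x j = T x \<longrightarrow> \<not> S x < T x"
    proof (intro allI impI notI)
      fix j assume j: "e x + partial \<kappa> x j = T x" and "S x < T x"
      moreover have "e x < T x" using pos[of j] j by linarith
      ultimately have "x \<in> E" unfolding E_def by auto
      with \<open>x \<notin> E\<close> show False by simp
    qed
  qed
qed

locale glue_model =
  fixes lam nu G :: real and FB FS :: "real measure"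
  assumes lam: "0 < lam" and nu: "0 < nu" and G: "0 < G"
    and FB: "nonneg_law FB" and FS: "nonneg_law FS"
begin

lemma prob_clock_law: "prob_space (clock_law lam nu FB FS c)"
  using lam nu FB FS prob_space_exponential_density
  by (cases c) (auto simp: nonneg_law_def)

lemma sets_clock_law: "sets (clock_law lam nu FB FS c) = sets borel"
  using FB FS by (cases c) (auto simp: nonneg_law_def)

sublocale real_product "clock_law lam nu FB FS"
  by (rule real_product.intro) (rule prob_clock_law, rule sets_clock_law)

lemma arrival_clocks: "exp_clocks Interarrival lam"
  and retrial_clocks: "exp_clocks (Retrial c) nu"
  using lam nu by (auto simp: exp_clocks_def inj_def)

lemma AE_good_clocks: "AE x in P. good_clocks x"
proof -
  have s: "AE x in P. 0 \<le> x (Service n j)" for n j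
  proof (rule P.AE_component)
    show "AE x in clock_law lam nu FB FS (Service n j). 0 \<le> x"
      unfolding clock_law.simps using FB unfolding nonneg_law_def by blast
  qed simp
  have v: "AE x in P. 0 \<le> x (Vacation n)" for n
  proof (rule P.AE_component)
    show "AE x in clock_law lam nu FB FS (Vacation n). 0 \<le> x"
      unfolding clock_law.simps using FS unfolding nonneg_law_def by blast
  qed simp
  have "AE x in P. \<forall>c. good_seq (Retrial c) x"
    using AE_good_seq[OF retrial_clocks] by (simp add: AE_all_countable)
  moreover have "AE x in P. \<forall>n j. 0 \<le> x (Service n j)"
    using s by (simp add: AE_all_countable)
  moreover have "AE x in P. \<forall>n. 0 \<le> x (Vacation n)"
    using v by (simp add: AE_all_countable)
  ultimately show ?thesis using AE_good_seq[OF arrival_clocks]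
    by eventually_elim (auto simp: good_clocks_def good_seq_def partial_def)
qed

context
  fixes k :: nat
begin

lemma entry_time_measurable: "(\<lambda>x. entry_time (k, x) c) \<in> borel_measurable P"
  by (cases c) auto

lemma att_measurable: "(\<lambda>x. att (k, x) c j) \<in> borel_measurable P"
  using entry_time_measurable[of c] by (cases c) auto

lemma queue_measurable:
  assumes [measurable]: "T \<in> borel_measurable P" "\<And>c. Measurable.pred P (\<lambda>x. c \<in> D x)"
  shows "Measurable.pred P (\<lambda>x. c \<in> queue_of G (k, x) (T x) (D x))"
proof -
  note [measurable] = att_measurable
  have [measurable]: "Measurable.pred P (\<lambda>x. c \<in> customers (k, x))"
    by (simp add: customers_def)
  have "(\<lambda>x. c \<in> queue_of G (k, x) (T x) (D x)) =
    (\<lambda>x. c \<in> customers (k, x) \<and> c \<notin> D x \<and> (\<exists>j. T x \<le> att (k, x) c j \<and> att (k, x) c j \<le> T x + G))"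
    by (simp add: queue_of_def attempts_meet_iff fun_eq_iff conj_assoc del: att.simps)
  then show ?thesis by (simp del: att.simps)
qed

text \<open>Decomposition over the countably many values of the number of terms.\<close>

lemma random_sum_measurable:
  assumes [measurable]: "N \<in> measurable P (count_space UNIV)"
  shows "(\<lambda>x. \<Sum>j<N x. x (Service n j)) \<in> borel_measurable P"
  by (rule measurable_compose_countable[where g=N and f="\<lambda>m x. \<Sum>j<m. x (Service n j)"]) measurable

text \<open>Both statements have to be proved jointly: the queue depends on the start of its glue
  period, and the next start on the size of the queue.\<close>

lemma cycle_measurable: "(\<lambda>x. glue_start G n (k, x)) \<in> borel_measurable P \<and> (\<forall>c. Measurable.pred P (\<lambda>x. c \<in> prior G n (k, x)))"
proof (induction n)
  case (Suc n)
  then have [measurable]: "(\<lambda>x. glue_start G n (k, x)) \<in> borel_measurable P" "\<And>c. Measurable.pred P (\<lambda>x. c \<in> prior G n (k, x))"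
    by auto
  have [measurable]: "Measurable.pred P (\<lambda>x. c \<in> queue_of G (k, x) (glue_start G n (k, x)) (prior G n (k, x)))" for c
    by (rule queue_measurable) measurable
  have [measurable]: "(\<lambda>x. \<Sum>j<card (queue_of G (k, x) (glue_start G n (k, x)) (prior G n (k, x))). x (Service n j)) \<in> borel_measurable P"
    by (rule random_sum_measurable) measurable
  have "Measurable.pred P (\<lambda>x. c \<in> prior G (Suc n) (k, x))" for c
    by (simp add: prior_Suc)
  moreover have "(\<lambda>x. glue_start G (Suc n) (k, x)) \<in> borel_measurable P"
    by (simp add: glue_start_Suc vacation_start_def visit_start_def served_eq)
  ultimately show ?case by simp
qed simp

lemma cycle_measurable' [measurable (raw)]:
  assumes f: "f \<in> measurable N P"
  shows "(\<lambda>z. entry_time (k, f z) c) \<in> borel_measurable N"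
    "(\<lambda>z. att (k, f z) c j) \<in> borel_measurable N"
    "(\<lambda>z. glue_start G n (k, f z)) \<in> borel_measurable N"
    "(\<lambda>z. visit_start G n (k, f z)) \<in> borel_measurable N"
    "Measurable.pred N (\<lambda>z. c \<in> prior G n (k, f z))"
    "(\<lambda>z. served G n (k, f z)) \<in> measurable N (count_space UNIV)"
    "(\<lambda>z. vacation_start G n (k, f z)) \<in> borel_measurable N"
    "Measurable.pred N (\<lambda>z. c \<in> customers (k, f z))"
proof -
  have [measurable]: "(\<lambda>x. glue_start G n (k, x)) \<in> borel_measurable P" "\<And>c. Measurable.pred P (\<lambda>x. c \<in> prior G n (k, x))"
    using cycle_measurable by auto
  show "(\<lambda>z. entry_time (k, f z) c) \<in> borel_measurable N"
    by (rule measurable_compose[OF f entry_time_measurable])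
  show "(\<lambda>z. att (k, f z) c j) \<in> borel_measurable N"
    by (rule measurable_compose[OF f att_measurable])
  show "(\<lambda>z. glue_start G n (k, f z)) \<in> borel_measurable N"
    by (rule measurable_compose[OF f]) measurable
  then show "(\<lambda>z. visit_start G n (k, f z)) \<in> borel_measurable N"
    by (simp add: visit_start_def)
  show "Measurable.pred N (\<lambda>z. c \<in> prior G n (k, f z))"
    by (rule measurable_compose[OF f]) measurable
  have [measurable]: "Measurable.pred P (\<lambda>x. c \<in> queue_of G (k, x) (glue_start G n (k, x)) (prior G n (k, x)))" for c
    by (rule queue_measurable) measurable
  have s [measurable]: "(\<lambda>x. served G n (k, x)) \<in> measurable P (count_space UNIV)"
    unfolding served_eq by measurable
  show "(\<lambda>z. served G n (k, f z)) \<in> measurable N (count_space UNIV)"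
    by (rule measurable_compose[OF f s])
  have v: "(\<lambda>x. vacation_start G n (k, x)) \<in> borel_measurable P"
    using random_sum_measurable[OF s] by (simp add: vacation_start_def visit_start_def)
  show "(\<lambda>z. vacation_start G n (k, f z)) \<in> borel_measurable N"
    by (rule measurable_compose[OF f v])
  show "Measurable.pred N (\<lambda>z. c \<in> customers (k, f z))" by (simp add: customers_def)
qed

lemma num_measurable [measurable (raw)]:
  assumes [measurable]: "f \<in> measurable N P" "t \<in> borel_measurable N"
  shows "Measurable.pred N (\<lambda>z. c \<in> arrived (k, f z) (t z))"
    and "Measurable.pred N (\<lambda>z. c \<in> joined G (k, f z) (t z))"
    and "(\<lambda>z. num_queue G (k, f z) (t z)) \<in> measurable N (count_space UNIV)"
    and "(\<lambda>z. num_orbit G (k, f z) (t z)) \<in> measurable N (count_space UNIV)"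
proof -
  show arr [measurable]: "Measurable.pred N (\<lambda>z. c \<in> arrived (k, f z) (t z))" for c
    by (simp add: arrived_def)
  have "(\<lambda>z. c \<in> joined G (k, f z) (t z)) = (\<lambda>z. c \<in> customers (k, f z) \<and> (\<exists>n j. glue_start G n (k, f z) \<le> att (k, f z) c j
     \<and> att (k, f z) c j \<le> visit_start G n (k, f z) \<and> att (k, f z) c j \<le> t z))" for c
    by (auto simp: joined_def attempts_eq fun_eq_iff simp del: att.simps)
  then show j [measurable]: "Measurable.pred N (\<lambda>z. c \<in> joined G (k, f z) (t z))" for c by (simp del: att.simps)
  have s: "(\<lambda>z. \<Sum>i\<le>j. f z (Service n i)) \<in> borel_measurable N" for n j
  proof -
    have "(\<lambda>z. f z a) \<in> borel_measurable N" for a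
      using measurable_compose[OF assms(1) coord_measurable] .
    then show ?thesis by measurable
  qed
  note [measurable] = s
  have [measurable]: "Measurable.pred N (\<lambda>z. (n, j) \<in> completed G (k, f z) (t z))" for n j
    by (simp add: completed_def)
  have [measurable]: "Measurable.pred N (\<lambda>z. p \<in> completed G (k, f z) (t z))" for p
    by (cases p) simp
  show "(\<lambda>z. num_queue G (k, f z) (t z)) \<in> measurable N (count_space UNIV)"
    unfolding num_queue_def by measurable
  show "(\<lambda>z. num_orbit G (k, f z) (t z)) \<in> measurable N (count_space UNIV)"
    unfolding num_orbit_def by measurable
qed

text \<open>Every attempt is an epoch of the arrival process or of the retrial process of its
  customer. The start of cycle \<open>n + 1\<close> is decided at the end of the preceding glue
  period, so \<open>AE_no_tie\<close> applies to each of these countably many processes.\<close>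

lemma AE_no_tie_cycle: "AE x in P. good_sample.no_tie G (k, x)"
proof -
  have gs: "good_sample G (k, x)" if "good_clocks x" for x
    using that G by (simp add: good_sample_def)
  have arr: "AE x in P. \<forall>j. 0 + partial Interarrival x j = glue_start G (Suc n) (k, x) \<longrightarrow>
      \<not> visit_start G n (k, x) < glue_start G (Suc n) (k, x)" for n
  proof (rule AE_no_tie[where e="\<lambda>_. 0" and S="\<lambda>x. visit_start G n (k, x)" and T="\<lambda>x. glue_start G (Suc n) (k, x)", OF arrival_clocks _ _ _ AE_good_clocks])
    fix x x' m
    assume g: "good_clocks x" "good_clocks x'" "\<forall>c. c \<notin> Interarrival ` {m..} \<longrightarrow> x c = x' c"
      and "visit_start G n (k, x) < 0 + partial Interarrival x m" "visit_start G n (k, x) < 0 + partial Interarrival x' m"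
    then have "same_history (visit_start G n (k, x)) (k, x) (k, x')"
      by (intro same_history_arrivals[OF g]) (auto simp: partial_def)
    then show "visit_start G n (k, x') = visit_start G n (k, x) \<and> glue_start G (Suc n) (k, x') = glue_start G (Suc n) (k, x)"
      using good_sample.same_history_times[OF gs[OF g(1)]] by blast
  qed auto
  have ret: "AE x in P. \<forall>j. entry_time (k, x) c + partial (Retrial c) x j = glue_start G (Suc n) (k, x) \<longrightarrow>
      \<not> visit_start G n (k, x) < glue_start G (Suc n) (k, x)" for n c
  proof (rule AE_no_tie[where e="\<lambda>x. entry_time (k, x) c" and S="\<lambda>x. visit_start G n (k, x)" and T="\<lambda>x. glue_start G (Suc n) (k, x)", OF retrial_clocks _ _ _ AE_good_clocks])
    fix x x' m
    assume g: "good_clocks x" "good_clocks x'" "\<forall>a. a \<notin> Retrial c ` {m..} \<longrightarrow> x a = x' a"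
      and "visit_start G n (k, x) < entry_time (k, x) c + partial (Retrial c) x m"
       "visit_start G n (k, x) < entry_time (k, x) c + partial (Retrial c) x' m"
    then have "same_history (visit_start G n (k, x)) (k, x) (k, x')"
      by (intro same_history_retrials[OF g]) (auto simp: partial_def)
    then show "visit_start G n (k, x') = visit_start G n (k, x) \<and> glue_start G (Suc n) (k, x') = glue_start G (Suc n) (k, x)"
      using good_sample.same_history_times[OF gs[OF g(1)]] by blast
  next
    fix x x' :: "clock \<Rightarrow> real"
    assume "\<forall>a. a \<notin> range (Retrial c) \<longrightarrow> x a = x' a"
    then show "entry_time (k, x) c = entry_time (k, x') c"
      by (cases c) (auto intro!: sum.cong)
  qed auto
  have "AE x in P. \<forall>n. \<forall>j. partial Interarrival x j = glue_start G (Suc n) (k, x) \<longrightarrow>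
      \<not> visit_start G n (k, x) < glue_start G (Suc n) (k, x)"
    using arr by (simp add: AE_all_countable)
  moreover have "AE x in P. \<forall>c n. \<forall>j. entry_time (k, x) c + partial (Retrial c) x j = glue_start G (Suc n) (k, x) \<longrightarrow>
      \<not> visit_start G n (k, x) < glue_start G (Suc n) (k, x)"
    using ret by (simp add: AE_all_countable)
  ultimately show ?thesis using AE_good_clocks
  proof eventually_elim
    fix x
    assume a: "\<forall>n. \<forall>j. partial Interarrival x j = glue_start G (Suc n) (k, x) \<longrightarrow>
      \<not> visit_start G n (k, x) < glue_start G (Suc n) (k, x)"
      and r: "\<forall>c n. \<forall>j. entry_time (k, x) c + partial (Retrial c) x j = glue_start G (Suc n) (k, x) \<longrightarrow>
      \<not> visit_start G n (k, x) < glue_start G (Suc n) (k, x)"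
      and "good_clocks x"
    then interpret good_sample G "(k, x)" using gs by blast
    show no_tie
      unfolding no_tie_def
    proof (intro allI ballI impI)
      fix n c assume "glue_start G (Suc n) (k, x) \<in> attempts (k, x) c"
      then obtain j where j: "glue_start G (Suc n) (k, x) = att (k, x) c j" by (auto simp: attempts_eq)
      \<comment> \<open>Attempt 0 of an arrival is its arrival epoch; attempt \<open>l + 1\<close>
        is the retrial epoch with index \<open>l\<close>.\<close>
      have "(\<exists>i. partial Interarrival x i = att (k, x) c j) \<or> (\<exists>i. entry_time (k, x) c + partial (Retrial c) x i = att (k, x) c j)"
      proof (cases c)
        case (Arrival i)
        then show ?thesis
        proof (cases j)
          case (Suc l)
          then have "entry_time (k, x) c + partial (Retrial c) x l = att (k, x) c j"
            using Arrival by (simp add: partial_def lessThan_Suc_atMost)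
          then show ?thesis by blast
        qed (auto simp: partial_def)
      qed (auto simp: partial_def)
      then have "\<not> visit_start G n (k, x) < glue_start G (Suc n) (k, x)"
        using a r j by metis
      then show "glue_start G (Suc n) (k, x) = visit_start G n (k, x)"
        using visit_le_later[of n "Suc n"] by simp
    qed
  qed
qed

end

end

section \<open>Glue periods\<close>

lemma attempts_meet_iff': "attempts w c \<inter> {a<..b} \<noteq> {} \<longleftrightarrow> (\<exists>j. a < att w c j \<and> att w c j \<le> b)"
proof -
  have "A \<noteq> {} \<longleftrightarrow> (\<exists>s. s \<in> A)" for A :: "real set" by auto
  then show ?thesis by (auto simp: attempts_eq)
qed

text \<open>The orbit at the start of cycle \<open>n\<close>; its size is almost surely
  \<open>X_seq\<close>.\<close>

definition alive :: "real \<Rightarrow> nat \<Rightarrow> sample \<Rightarrow> customer set" where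
  "alive G n w = arrived w (glue_start G n w) - prior G n w"

text \<open>Open on the left, like the counting window of \<open>strong_markov\<close>;
  \<open>alive_hit_closed\<close> relates it to the closed glue period.\<close>

definition hits :: "real \<Rightarrow> nat \<Rightarrow> real \<Rightarrow> sample \<Rightarrow> customer set" where
  "hits G n L w = {c. attempts w c \<inter> {glue_start G n w<..glue_start G n w + L} \<noteq> {}}"

context good_sample
begin

lemma glue_nonneg: "0 \<le> glue_start G n w"
  using glue_mono[of 0 n] by simp

lemma finite_alive: "finite (alive G n w)"
  unfolding alive_def using finite_arrived by simp

lemma arrived_diff_Arrival: "0 \<le> s \<Longrightarrow> arrived w t - arrived w s = Arrival ` {i. s < entry_time w (Arrival i) \<and> entry_time w (Arrival i) \<le> t}"
  by (auto simp: arrived_def customers_def)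

text \<open>An orbiting customer cannot attempt exactly at the start of the glue period. In cycle 0
  all attempts are positive; later, \<open>no_tie\<close> would place the attempt at the end of the
  previous glue period, where the customer would have joined.\<close>

lemma alive_hit_closed:
  assumes no_tie "c \<in> alive G n w"
  shows "attempts w c \<inter> {glue_start G n w..b} \<noteq> {} \<longleftrightarrow> attempts w c \<inter> {glue_start G n w<..b} \<noteq> {}"
proof -
  have "att w c j \<noteq> glue_start G n w" for j
  proof
    assume j: "att w c j = glue_start G n w"
    have c: "c \<in> customers w" "c \<notin> prior G n w" using assms(2) by (auto simp: alive_def arrived_def)
    show False
    proof (cases n)
      case 0
      then show False using att_pos[of c j] j by simp
    next
      case (Suc m)
      have a: "glue_start G (Suc m) w \<in> attempts w c" unfolding attempts_eq using j Suc by (metis rangeI)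
      then have v: "glue_start G (Suc m) w = visit_start G m w" using assms(1) c(1) unfolding no_tie_def by blast
      have "c \<in> prior G n w"
        unfolding prior_iff Suc using c(1) a v glue_less_visit[of m] by (intro conjI exI[of _ m] bexI[of _ "glue_start G (Suc m) w"]) auto
      then show False using c(2) by simp
    qed
  qed
  then show ?thesis unfolding attempts_meet_iff attempts_meet_iff' by (metis less_le)
qed

text \<open>A customer arriving within the window joins at once, since attempt 0 is the arrival; an
  orbiting customer joins iff it retries in the window. The queue is thus a disjoint union of part
  of the old orbit and of fresh arrivals, and the orbit keeps only customers that were there
  before.\<close>

lemma glue_split:
  fixes n :: nat
  assumes no_tie "0 \<le> L"
  defines "T \<equiv> glue_start G n w"
  defines "J \<equiv> {c \<in> customers w. attempts w c \<inter> {T..T + L} \<noteq> {}}"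
  shows "card (J - prior G n w) = card (alive G n w \<inter> hits G n L w) + card (arrived w (T + L) - arrived w T)"
    and "arrived w (T + L) - (prior G n w \<union> J) = alive G n w - hits G n L w"
proof -
  have T: "0 \<le> T" using glue_nonneg by (simp add: T_def)
  have prior_T: "prior G n w \<subseteq> arrived w T" using prior_arrived by (simp add: T_def)
  have sub: "arrived w T \<subseteq> arrived w (T + L)" using assms(2) by (intro arrived_mono) simp
  have new: "c \<in> J" if c: "c \<in> arrived w (T + L) - arrived w T" for c
  proof -
    obtain i where i: "c = Arrival i" "T < entry_time w (Arrival i)" "entry_time w (Arrival i) \<le> T + L"
      using c arrived_diff_Arrival[OF T, of "T + L"] by auto
    then have "T \<le> att w c 0 \<and> att w c 0 \<le> T + L" by simp
    then show ?thesis unfolding J_def attempts_meet_iff using c by (auto simp: arrived_def)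
  qed
  have J_arr: "J \<subseteq> arrived w (T + L)"
    using entry_le_att unfolding J_def attempts_meet_iff arrived_def by (blast intro: order.trans)
  have al: "c \<in> J \<longleftrightarrow> c \<in> hits G n L w" if "c \<in> alive G n w" for c
    using alive_hit_closed[OF assms(1) that, of "T + L"] that
    by (auto simp: J_def hits_def T_def alive_def arrived_def)
  have "J - prior G n w = (alive G n w \<inter> hits G n L w) \<union> (arrived w (T + L) - arrived w T)"
    using al new J_arr prior_T by (auto simp: alive_def T_def[symmetric])
  moreover have "(alive G n w \<inter> hits G n L w) \<inter> (arrived w (T + L) - arrived w T) = {}"
    by (auto simp: alive_def T_def)
  ultimately show "card (J - prior G n w) = card (alive G n w \<inter> hits G n L w) + card (arrived w (T + L) - arrived w T)"
    using finite_alive[of n] finite_arrived[of "T + L"] by (simp add: card_Un_disjoint)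
  show "arrived w (T + L) - (prior G n w \<union> J) = alive G n w - hits G n L w"
    using al new sub by (auto simp: alive_def T_def[symmetric])
qed

end

lemma attempts_retrial_agree:
  assumes "\<forall>a. a \<notin> Retrial c ` {m..} \<longrightarrow> x a = x' a" "d \<noteq> c"
  shows "attempts (k, x') d = attempts (k, x) d"
proof -
  have "x' (Interarrival i) = x (Interarrival i)" "x' (Retrial d i) = x (Retrial d i)" for i
    using assms(2) by (auto intro!: assms(1)[rule_format, symmetric])
  then show ?thesis by (cases d) auto
qed

text \<open>\<open>same_history\<close> fixes attempts only up to \<open>t\<close>. A customer
  present at \<open>t\<close> keeps its whole attempt sequence when later interarrival times change;
  the factor in \<open>glue_gf\<close> looks ahead at such retrials.\<close>

lemma attempts_arrival_agree:
  assumes "\<forall>a. a \<notin> Interarrival ` {m..} \<longrightarrow> x a = x' a" "good_clocks x" 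
    and t: "t < (\<Sum>i\<le>m. x (Interarrival i))" and d: "d \<in> arrived (k, x) t"
  shows "attempts (k, x') d = attempts (k, x) d"
proof -
  interpret good_sample 1 "(k, x)" using assms(2) by unfold_locales auto
  have r: "x' (Retrial d j) = x (Retrial d j)" for j by (auto intro!: assms(1)[rule_format, symmetric])
  show ?thesis
  proof (cases d)
    case (Initial i)
    then show ?thesis using r by simp
  next
    case (Arrival i)
    then have "entry_time (k, x) (Arrival i) \<le> t" using d by (simp add: arrived_def)
    then have "i < m" using t entry_Arrival_mono[of m i] by (cases "m \<le> i") auto
    then have "(\<Sum>l\<le>i. x' (Interarrival l)) = (\<Sum>l\<le>i. x (Interarrival l))"
      by (intro sum.cong) (auto intro!: assms(1)[rule_format, symmetric])
    then show ?thesis using Arrival r by simp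
  qed
qed

context glue_model
begin

lemma good_sampleI: "good_clocks x \<Longrightarrow> good_sample G (k, x)"
  using G by (simp add: good_sample_def)

lemma alive_measurable [measurable (raw)]:
  assumes [measurable]: "f \<in> measurable N P"
  shows "Measurable.pred N (\<lambda>z. c \<in> alive G n (k, f z))" "Measurable.pred N (\<lambda>z. c \<in> hits G n L (k, f z))"
  unfolding alive_def hits_def mem_Collect_eq attempts_meet_iff' by (simp_all del: att.simps)

text \<open>\<open>strong_markov\<close> for the arrival process. The factor \<open>\<Phi>\<close>
  may look beyond \<open>T\<close> at the retrials of customers already present, because redrawing
  later interarrival times leaves those untouched.\<close>

lemma arrivals_gf:
  fixes \<Phi> :: "(clock \<Rightarrow> real) \<Rightarrow> complex"
  assumes [measurable]: "T \<in> borel_measurable P" "L \<in> borel_measurable P" "\<Phi> \<in> borel_measurable P"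
    and bound: "\<And>x. norm (\<Phi> x) \<le> 1" and u: "norm u \<le> 1"
    and dom: "\<And>x. good_clocks x \<Longrightarrow> \<Phi> x \<noteq> 0 \<Longrightarrow> 0 \<le> T x \<and> 0 \<le> L x"
    and stop: "\<And>x x'. good_clocks x \<Longrightarrow> good_clocks x' \<Longrightarrow> \<Phi> x \<noteq> 0 \<Longrightarrow> same_history (T x) (k, x) (k, x') \<Longrightarrow>
       (\<And>c. c \<in> arrived (k, x) (T x) \<Longrightarrow> attempts (k, x') c = attempts (k, x) c) \<Longrightarrow>
       T x' = T x \<and> L x' = L x \<and> \<Phi> x' = \<Phi> x"
  shows "(\<integral>x. \<Phi> x * u ^ card (arrived (k, x) (T x + L x) - arrived (k, x) (T x)) \<partial>P)
       = (\<integral>x. \<Phi> x * exp (- of_real (lam * L x) * (1 - u)) \<partial>P)"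
proof -
  have "(\<integral>x. \<Phi> x * u ^ card {i. T x < 0 + partial Interarrival x i \<and> 0 + partial Interarrival x i \<le> T x + L x} \<partial>P)
       = (\<integral>x. \<Phi> x * exp (- of_real (lam * L x) * (1 - u)) \<partial>P)"
  proof (rule strong_markov[where e="\<lambda>_. 0" and T=T and L=L and \<Phi>=\<Phi> and good=good_clocks, OF arrival_clocks _ _ _ _ AE_good_clocks])
    fix x x' m
    assume g: "good_clocks x" "good_clocks x'" and a: "\<forall>c. c \<notin> Interarrival ` {m..} \<longrightarrow> x c = x' c" and z: "\<Phi> x \<noteq> 0"
      and t: "T x < 0 + partial Interarrival x m" "T x < 0 + partial Interarrival x' m"
    show "T x' = T x \<and> L x' = L x \<and> \<Phi> x' = \<Phi> x"
    proof (rule stop[OF g z])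
      show "same_history (T x) (k, x) (k, x')"
        using t by (intro same_history_arrivals[OF g a]) (auto simp: partial_def)
      show "attempts (k, x') c = attempts (k, x) c" if "c \<in> arrived (k, x) (T x)" for c
        using t that by (intro attempts_arrival_agree[OF a g(1)]) (auto simp: partial_def)
    qed
  qed (use bound u dom in auto)
  moreover have "(\<integral>x. \<Phi> x * u ^ card {i. T x < 0 + partial Interarrival x i \<and> 0 + partial Interarrival x i \<le> T x + L x} \<partial>P)
     = (\<integral>x. \<Phi> x * u ^ card (arrived (k, x) (T x + L x) - arrived (k, x) (T x)) \<partial>P)"
  proof (rule integral_cong_AE)
    show "AE x in P. \<Phi> x * u ^ card {i. T x < 0 + partial Interarrival x i \<and> 0 + partial Interarrival x i \<le> T x + L x}
       = \<Phi> x * u ^ card (arrived (k, x) (T x + L x) - arrived (k, x) (T x))"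
      using AE_good_clocks
    proof eventually_elim
      fix x assume g: "good_clocks x"
      show "\<Phi> x * u ^ card {i. T x < 0 + partial Interarrival x i \<and> 0 + partial Interarrival x i \<le> T x + L x}
       = \<Phi> x * u ^ card (arrived (k, x) (T x + L x) - arrived (k, x) (T x))"
      proof (cases "\<Phi> x = 0")
        case False
        interpret good_sample G "(k, x)" by (rule good_sampleI[OF g])
        have "0 \<le> T x" using dom[OF g False] by simp
        then have "card (arrived (k, x) (T x + L x) - arrived (k, x) (T x))
            = card (Arrival ` {i. T x < entry_time (k, x) (Arrival i) \<and> entry_time (k, x) (Arrival i) \<le> T x + L x})"
          by (simp only: arrived_diff_Arrival)
        also have "\<dots> = card {i. T x < entry_time (k, x) (Arrival i) \<and> entry_time (k, x) (Arrival i) \<le> T x + L x}"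
          by (rule card_image) (simp add: inj_on_def)
        also have "\<dots> = card {i. T x < 0 + partial Interarrival x i \<and> 0 + partial Interarrival x i \<le> T x + L x}"
          by (simp add: partial_def)
        finally show ?thesis by simp
      qed simp
    qed
  qed measurable
  ultimately show ?thesis by simp
qed

text \<open>\<open>strong_markov\<close> for the retrial process of one customer, with
  \<open>u = 0\<close>. As the customer has entered by \<open>T\<close>, its attempts after
  \<open>T\<close> are all retrials. The factor \<open>\<Phi>\<close> may depend on the whole
  attempt sequences of the other customers.\<close>

lemma retrials_miss:
  fixes \<Phi> :: "(clock \<Rightarrow> real) \<Rightarrow> complex"
  assumes [measurable]: "T \<in> borel_measurable P" "\<Phi> \<in> borel_measurable P" and L: "0 \<le> L"
    and bound: "\<And>x. norm (\<Phi> x) \<le> 1"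
    and dom: "\<And>x. good_clocks x \<Longrightarrow> \<Phi> x \<noteq> 0 \<Longrightarrow> entry_time (k, x) c \<le> T x"
    and stop: "\<And>x x'. good_clocks x \<Longrightarrow> good_clocks x' \<Longrightarrow> \<Phi> x \<noteq> 0 \<Longrightarrow> same_history (T x) (k, x) (k, x') \<Longrightarrow>
       (\<And>d. d \<noteq> c \<Longrightarrow> attempts (k, x') d = attempts (k, x) d) \<Longrightarrow> T x' = T x \<and> \<Phi> x' = \<Phi> x"
  shows "(\<integral>x. \<Phi> x * (if attempts (k, x) c \<inter> {T x<..T x + L} \<noteq> {} then 0 else 1) \<partial>P) = exp (- of_real (nu * L)) * (\<integral>x. \<Phi> x \<partial>P)"
proof -
  define N where "N = (\<lambda>x. card {i. T x < entry_time (k, x) c + partial (Retrial c) x i \<and> entry_time (k, x) c + partial (Retrial c) x i \<le> T x + L})"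
  have "(\<integral>x. \<Phi> x * 0 ^ N x \<partial>P) = (\<integral>x. \<Phi> x * exp (- of_real (nu * L) * (1 - 0)) \<partial>P)"
    unfolding N_def
  proof (rule strong_markov[where e="\<lambda>x. entry_time (k, x) c" and T=T and L="\<lambda>_. L" and \<Phi>=\<Phi> and good=good_clocks, OF retrial_clocks _ _ _ _ AE_good_clocks])
    fix x x' m
    assume g: "good_clocks x" "good_clocks x'" and a: "\<forall>a. a \<notin> Retrial c ` {m..} \<longrightarrow> x a = x' a" and z: "\<Phi> x \<noteq> 0"
      and t: "T x < entry_time (k, x) c + partial (Retrial c) x m" "T x < entry_time (k, x) c + partial (Retrial c) x' m"
    have "T x' = T x \<and> \<Phi> x' = \<Phi> x"
    proof (rule stop[OF g z])
      show "same_history (T x) (k, x) (k, x')"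
        using t by (intro same_history_retrials[OF g a]) (auto simp: partial_def)
      show "attempts (k, x') d = attempts (k, x) d" if "d \<noteq> c" for d
        by (rule attempts_retrial_agree[OF a that])
    qed
    then show "T x' = T x \<and> L = L \<and> \<Phi> x' = \<Phi> x" by simp
  next
    fix x x' :: "clock \<Rightarrow> real"
    assume "\<forall>a. a \<notin> range (Retrial c) \<longrightarrow> x a = x' a"
    then show "entry_time (k, x) c = entry_time (k, x') c"
      by (cases c) (auto intro!: sum.cong)
  qed (use bound dom L in auto)
  moreover have "(\<integral>x. \<Phi> x * 0 ^ N x \<partial>P) = (\<integral>x. \<Phi> x * (if attempts (k, x) c \<inter> {T x<..T x + L} \<noteq> {} then 0 else 1) \<partial>P)"
  proof (rule integral_cong_AE)
    show "AE x in P. \<Phi> x * 0 ^ N x = \<Phi> x * (if attempts (k, x) c \<inter> {T x<..T x + L} \<noteq> {} then 0 else 1)"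
      using AE_good_clocks AE_good_seq[OF retrial_clocks[of c]]
    proof eventually_elim
      fix x assume g: "good_clocks x" and gs: "good_seq (Retrial c) x"
      show "\<Phi> x * 0 ^ N x = \<Phi> x * (if attempts (k, x) c \<inter> {T x<..T x + L} \<noteq> {} then 0 else 1)"
      proof (cases "\<Phi> x = 0")
        case False
        define I where "I = {i. T x < entry_time (k, x) c + partial (Retrial c) x i \<and> entry_time (k, x) c + partial (Retrial c) x i \<le> T x + L}"
        obtain m where m: "\<forall>i. partial (Retrial c) x i \<le> T x + L - entry_time (k, x) c \<longleftrightarrow> i < m"
          using good_seq_threshold[OF gs] by blast
        have "I \<subseteq> {..<m}"
        proof
          fix i assume "i \<in> I"
          then have "partial (Retrial c) x i \<le> T x + L - entry_time (k, x) c" by (simp add: I_def)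
          then show "i \<in> {..<m}" using spec[OF m, of i] by simp
        qed
        then have "finite I" by (rule finite_subset) simp
        then have N0: "N x = 0 \<longleftrightarrow> I = {}" by (simp add: N_def I_def[symmetric])
        have "(\<exists>j. T x < att (k, x) c j \<and> att (k, x) c j \<le> T x + L) \<longleftrightarrow> I \<noteq> {}"
        proof (cases c)
          case (Initial i)
          then show ?thesis by (auto simp: I_def partial_def)
        next
          case (Arrival i)
          have e: "entry_time (k, x) c \<le> T x" by (rule dom[OF g False])
          have a0: "att (k, x) c 0 = entry_time (k, x) c" and aS: "att (k, x) c (Suc l) = entry_time (k, x) c + partial (Retrial c) x l" for l
            using Arrival by (simp_all add: partial_def lessThan_Suc_atMost)
          show ?thesis
          proof
            assume "\<exists>j. T x < att (k, x) c j \<and> att (k, x) c j \<le> T x + L"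
            then obtain j where j: "T x < att (k, x) c j" "att (k, x) c j \<le> T x + L" by blast
            then obtain l where "j = Suc l" using e a0 by (cases j) auto
            then have "l \<in> I" using j aS[of l] by (simp add: I_def)
            then show "I \<noteq> {}" by blast
          next
            assume "I \<noteq> {}"
            then obtain l where "l \<in> I" by blast
            then have "T x < att (k, x) c (Suc l) \<and> att (k, x) c (Suc l) \<le> T x + L" unfolding aS by (simp add: I_def)
            then show "\<exists>j. T x < att (k, x) c j \<and> att (k, x) c j \<le> T x + L" by blast
          qed
        qed
        then have "(\<exists>j. T x < att (k, x) c j \<and> att (k, x) c j \<le> T x + L) \<longleftrightarrow> N x \<noteq> 0" using N0 by (simp only:)
        then show ?thesis unfolding attempts_meet_iff' by (simp add: zero_power)
      qed simp
    qed
    show "(\<lambda>x. \<Phi> x * 0 ^ N x) \<in> borel_measurable P" unfolding N_def by measurable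
    show "(\<lambda>x. \<Phi> x * (if attempts (k, x) c \<inter> {T x<..T x + L} \<noteq> {} then 0 else 1)) \<in> borel_measurable P"
      unfolding attempts_meet_iff' by measurable
  qed
  ultimately show ?thesis by (simp add: mult.commute)
qed

text \<open>Binomial thinning. The customers are averaged one at a time in the order of their codes
  \<open>to_nat\<close>, since the strong Markov property concerns a single retrial process; the
  random finite orbit is exhausted in the limit.\<close>

lemma alive_gf:
  fixes u v :: complex
  assumes L: "0 \<le> L" and u: "norm u \<le> 1" and v: "norm v \<le> 1"
  shows "(\<integral>x. u ^ card (alive G n (k, x) \<inter> hits G n L (k, x)) * v ^ card (alive G n (k, x) - hits G n L (k, x)) \<partial>P)
    = (\<integral>x. (of_real (1 - exp (- nu * L)) * u + of_real (exp (- nu * L)) * v) ^ card (alive G n (k, x)) \<partial>P)"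
proof -
  define \<beta> where "\<beta> = of_real (1 - exp (- nu * L)) * u + of_real (exp (- nu * L)) * v"
  have ex: "exp (- complex_of_real (nu * L)) = of_real (exp (- nu * L))"
    using exp_of_real[of "- nu * L"] by simp
  have e1: "0 \<le> exp (- nu * L)" "exp (- nu * L) \<le> 1" using nu L by auto
  have "norm (complex_of_real (1 - exp (- nu * L))) = 1 - exp (- nu * L)" "norm (complex_of_real (exp (- nu * L))) = exp (- nu * L)"
    using e1 unfolding norm_of_real by linarith+
  then have "norm \<beta> \<le> (1 - exp (- nu * L)) * norm u + exp (- nu * L) * norm v"
    unfolding \<beta>_def by (intro norm_triangle_le) (simp only: norm_mult)
  also have "\<dots> \<le> (1 - exp (- nu * L)) * 1 + exp (- nu * L) * 1"
    using e1 u v by (intro add_mono mult_left_mono) auto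
  finally have \<beta>: "norm \<beta> \<le> 1" by simp
  define A H where "A = (\<lambda>x. alive G n (k, x))" and "H = (\<lambda>x. hits G n L (k, x))"
  have [measurable]: "Measurable.pred P (\<lambda>x. c \<in> A x)" "Measurable.pred P (\<lambda>x. c \<in> H x)" for c
    unfolding A_def H_def by measurable
  \<comment> \<open>Interpolation: orbiting customers with code below \<open>r\<close> carry the
    averaged factor \<open>\<beta>\<close>, the others their actual outcome. \<open>F 0\<close> is
    the left side, and the integral of \<open>F r\<close> tends to the right side.\<close>
  define F where "F = (\<lambda>r x. \<beta> ^ card {c \<in> A x. to_nat c < r} * u ^ card {c \<in> A x. r \<le> to_nat c \<and> c \<in> H x}
     * v ^ card {c \<in> A x. r \<le> to_nat c \<and> c \<notin> H x})"
  have F_le: "norm (F r x) \<le> 1" for r x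
    unfolding F_def norm_mult norm_power using \<beta> u v by (intro mult_le_one mult_nonneg_nonneg power_le_one) auto
  have F_meas [measurable]: "F r \<in> borel_measurable P" for r
    unfolding F_def by measurable
  have F_int: "integrable P (F r)" for r
    using F_meas F_le by (rule integrable_bounded_P)
  have step: "(\<integral>x. F r x \<partial>P) = (\<integral>x. F (Suc r) x \<partial>P)" for r
  proof (cases "\<exists>c::customer. to_nat c = r")
    case False
    then have "to_nat c < Suc r \<longleftrightarrow> to_nat c < r" "Suc r \<le> to_nat c \<longleftrightarrow> r \<le> to_nat c" for c :: customer
      by (metis less_Suc_eq) (metis False Suc_leI le_less Suc_leD)
    then have "F (Suc r) = F r" by (simp add: F_def)
    then show ?thesis by simp
  next
    case True
    then obtain c :: customer where c: "to_nat c = r" by blast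
    define \<Phi> where "\<Phi> = (\<lambda>x. if c \<in> A x then \<beta> ^ card {c \<in> A x. to_nat c < r} * u ^ card {c \<in> A x. Suc r \<le> to_nat c \<and> c \<in> H x}
       * v ^ card {c \<in> A x. Suc r \<le> to_nat c \<and> c \<notin> H x} else 0)"
    have \<Phi>_meas [measurable]: "\<Phi> \<in> borel_measurable P"
      unfolding \<Phi>_def by measurable
    have \<Phi>_le: "norm (\<Phi> x) \<le> 1" for x
    proof (cases "c \<in> A x")
      case True
      then show ?thesis
        unfolding \<Phi>_def if_P[OF True] norm_mult norm_power using \<beta> u v by (intro mult_le_one mult_nonneg_nonneg power_le_one) auto
    qed (simp add: \<Phi>_def)
    have \<Phi>_int: "integrable P \<Phi>" using \<Phi>_meas \<Phi>_le by (rule integrable_bounded_P)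
    have only_c: "to_nat d = r \<longleftrightarrow> d = c" for d using c by (metis to_nat_split inj_eq inj_to_nat)
    have key: "r \<le> to_nat d \<longleftrightarrow> d = c \<or> Suc r \<le> to_nat d" for d
      using only_c[of d] by (cases "to_nat d = r") (simp_all, linarith)
    \<comment> \<open>\<open>\<Phi>\<close> contains only outcomes of customers with larger codes,
      so it is unaffected by the retrials of \<open>c\<close>; its restriction to
      \<open>c \<in> A x\<close> ensures that \<open>c\<close> has entered.\<close>
    have miss: "(\<integral>x. \<Phi> x * (if c \<in> H x then 0 else 1) \<partial>P) = exp (- of_real (nu * L)) * (\<integral>x. \<Phi> x \<partial>P)"
      unfolding H_def hits_def mem_Collect_eq
    proof (rule retrials_miss[OF _ \<Phi>_meas L \<Phi>_le])
      fix x assume "\<Phi> x \<noteq> 0"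
      then have "c \<in> A x" by (simp add: \<Phi>_def split: if_splits)
      then show "entry_time (k, x) c \<le> glue_start G n (k, x)" by (simp add: A_def alive_def arrived_def)
    next
      fix x x' assume g: "good_clocks x" "good_clocks x'" and h: "same_history (glue_start G n (k, x)) (k, x) (k, x')"
        and att: "\<And>d. d \<noteq> c \<Longrightarrow> attempts (k, x') d = attempts (k, x) d"
      interpret good_sample G "(k, x)" by (rule good_sampleI[OF g(1)])
      have T: "glue_start G n (k, x') = glue_start G n (k, x)" and p: "prior G n (k, x') = prior G n (k, x)"
        using same_history_times(7,8)[OF h] by auto
      have A: "A x' = A x" using h by (simp add: A_def alive_def T p same_history_def)
      have Hd: "d \<in> H x' \<longleftrightarrow> d \<in> H x" if "d \<noteq> c" for d
        using att[OF that] by (simp add: H_def hits_def T)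
      have "{d \<in> A x. Suc r \<le> to_nat d \<and> d \<in> H x'} = {d \<in> A x. Suc r \<le> to_nat d \<and> d \<in> H x}"
        "{d \<in> A x. Suc r \<le> to_nat d \<and> d \<notin> H x'} = {d \<in> A x. Suc r \<le> to_nat d \<and> d \<notin> H x}"
        using Hd c by (metis Suc_n_not_le_n)+
      then show "glue_start G n (k, x') = glue_start G n (k, x) \<and> \<Phi> x' = \<Phi> x"
        using T by (simp add: \<Phi>_def A)
    qed measurable
    \<comment> \<open>The factor of \<open>c\<close> is \<open>u\<close> on a hit and
      \<open>v\<close> on a miss, that is \<open>u\<close> minus \<open>u - v\<close> times the
      indicator of a miss; it is compared with \<open>\<beta>\<close>.\<close>
    have decomp: "F r x - F (Suc r) x = (u - \<beta>) * \<Phi> x - (u - v) * (\<Phi> x * (if c \<in> H x then 0 else 1))"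
      if "finite (A x)" for x
    proof (cases "c \<in> A x")
      case False
      have lt: "to_nat d < Suc r \<longleftrightarrow> to_nat d < r" "Suc r \<le> to_nat d \<longleftrightarrow> r \<le> to_nat d" if "d \<in> A x" for d
      proof -
        have "to_nat d \<noteq> r" using that False only_c[of d] by auto
        then show "to_nat d < Suc r \<longleftrightarrow> to_nat d < r" "Suc r \<le> to_nat d \<longleftrightarrow> r \<le> to_nat d" by auto
      qed
      have "{d \<in> A x. to_nat d < Suc r} = {d \<in> A x. to_nat d < r}"
        "{d \<in> A x. Suc r \<le> to_nat d \<and> d \<in> H x} = {d \<in> A x. r \<le> to_nat d \<and> d \<in> H x}"
        "{d \<in> A x. Suc r \<le> to_nat d \<and> d \<notin> H x} = {d \<in> A x. r \<le> to_nat d \<and> d \<notin> H x}"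
        using lt by auto
      then show ?thesis using False by (simp add: F_def \<Phi>_def)
    next
      case True
      have 1: "{d \<in> A x. to_nat d < Suc r} = insert c {d \<in> A x. to_nat d < r}"
        using True c only_c by (auto simp: less_Suc_eq)
      have 2: "card {d \<in> A x. to_nat d < Suc r} = Suc (card {d \<in> A x. to_nat d < r})"
        unfolding 1 using that c by (subst card_insert_disjoint) auto
      have 3: "card {d \<in> A x. r \<le> to_nat d \<and> Q d} = (if Q c then Suc (card {d \<in> A x. Suc r \<le> to_nat d \<and> Q d})
          else card {d \<in> A x. Suc r \<le> to_nat d \<and> Q d})" for Q
      proof (cases "Q c")
        case Qc: True
        then have "{d \<in> A x. r \<le> to_nat d \<and> Q d} = insert c {d \<in> A x. Suc r \<le> to_nat d \<and> Q d}"
          unfolding key using True Qc by blast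
        moreover have "c \<notin> {d \<in> A x. Suc r \<le> to_nat d \<and> Q d}" using c by auto
        ultimately show ?thesis using that Qc by simp
      next
        case Qc: False
        then have "r \<le> to_nat d \<and> Q d \<longleftrightarrow> Suc r \<le> to_nat d \<and> Q d" for d
          unfolding key using Qc by blast
        then show ?thesis using Qc by simp
      qed
      define a h m where "a = card {d \<in> A x. to_nat d < r}" and "h = card {d \<in> A x. Suc r \<le> to_nat d \<and> d \<in> H x}"
        and "m = card {d \<in> A x. Suc r \<le> to_nat d \<and> d \<notin> H x}"
      have "F r x = \<beta> ^ a * u ^ (if c \<in> H x then Suc h else h) * v ^ (if c \<notin> H x then Suc m else m)"
        unfolding F_def a_def h_def m_def 3[of "\<lambda>d. d \<in> H x"] 3[of "\<lambda>d. d \<notin> H x"] ..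
      moreover have "F (Suc r) x = \<beta> ^ Suc a * u ^ h * v ^ m"
        unfolding F_def a_def h_def m_def 2 ..
      moreover have "\<Phi> x = \<beta> ^ a * u ^ h * v ^ m"
        unfolding \<Phi>_def if_P[OF True] a_def h_def m_def ..
      ultimately show ?thesis
        by (simp add: algebra_simps)
    qed
    have "(\<integral>x. F r x \<partial>P) - (\<integral>x. F (Suc r) x \<partial>P) = (\<integral>x. F r x - F (Suc r) x \<partial>P)"
      using F_int by (simp add: Bochner_Integration.integral_diff)
    also have "\<dots> = (\<integral>x. (u - \<beta>) * \<Phi> x - (u - v) * (\<Phi> x * (if c \<in> H x then 0 else 1)) \<partial>P)"
    proof (rule integral_cong_AE)
      show "AE x in P. F r x - F (Suc r) x = (u - \<beta>) * \<Phi> x - (u - v) * (\<Phi> x * (if c \<in> H x then 0 else 1))"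
        using AE_good_clocks
      proof eventually_elim
        fix x assume "good_clocks x"
        then interpret good_sample G "(k, x)" by (rule good_sampleI)
        show "F r x - F (Suc r) x = (u - \<beta>) * \<Phi> x - (u - v) * (\<Phi> x * (if c \<in> H x then 0 else 1))"
          using finite_alive[of n] by (intro decomp) (simp add: A_def)
      qed
    qed measurable
    also have "\<dots> = (u - \<beta>) * (\<integral>x. \<Phi> x \<partial>P) - (u - v) * (\<integral>x. \<Phi> x * (if c \<in> H x then 0 else 1) \<partial>P)"
    proof -
      have "integrable P (\<lambda>x. \<Phi> x * (if c \<in> H x then 0 else 1))"
      proof (rule integrable_bounded_P[where C=1])
        show "norm (\<Phi> x * (if c \<in> H x then 0 else 1)) \<le> 1" for x using \<Phi>_le[of x] by simp
      qed measurable
      then show ?thesis using \<Phi>_int by (subst Bochner_Integration.integral_diff) auto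
    qed
    \<comment> \<open>By its definition \<open>\<beta> = u - exp (- nu * L) * (u - v)\<close>, which
      is the mean of the factor of \<open>c\<close>.\<close>
    also have "\<dots> = 0"
      unfolding miss ex \<beta>_def by (simp add: algebra_simps)
    finally show ?thesis by simp
  qed
  then have F0: "(\<integral>x. F r x \<partial>P) = (\<integral>x. F 0 x \<partial>P)" for r by (induction r) auto
  have "(\<lambda>r. \<integral>x. F r x \<partial>P) \<longlonglongrightarrow> (\<integral>x. \<beta> ^ card (A x) \<partial>P)"
  proof (rule integral_dominated_convergence[where w="\<lambda>_. 1"])
    show "AE x in P. (\<lambda>r. F r x) \<longlonglongrightarrow> \<beta> ^ card (A x)"
      using AE_good_clocks
    proof eventually_elim
      fix x assume "good_clocks x"
      then interpret good_sample G "(k, x)" by (rule good_sampleI)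
      have "finite (A x)" using finite_alive[of n] by (simp add: A_def)
      then obtain R where R: "\<forall>c\<in>A x. to_nat c < R"
        using finite_nat_set_iff_bounded[of "to_nat ` A x"] by auto
      have FR: "F r x = \<beta> ^ card (A x)" if "R \<le> r" for r
      proof -
        have "\<forall>c\<in>A x. to_nat c < r" using R that by auto
        then have "{c \<in> A x. to_nat c < r} = A x" "{c \<in> A x. r \<le> to_nat c \<and> c \<in> H x} = {}"
          "{c \<in> A x. r \<le> to_nat c \<and> c \<notin> H x} = {}"
          by (auto simp: not_less[symmetric])
        then show ?thesis unfolding F_def by (simp only: card.empty power_0 mult_1_right)
      qed
      have "eventually (\<lambda>r. F r x = \<beta> ^ card (A x)) sequentially"
        by (rule eventually_mono[OF eventually_ge_at_top[of R] FR])
      then show "(\<lambda>r. F r x) \<longlonglongrightarrow> \<beta> ^ card (A x)" by (rule tendsto_eventually)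
    qed
    show "AE x in P. norm (F r x) \<le> 1" for r using F_le by simp
  qed simp_all
  moreover have "(\<lambda>r. \<integral>x. F r x \<partial>P) = (\<lambda>r. \<integral>x. F 0 x \<partial>P)"
    by (rule ext) (rule F0)
  ultimately have "(\<integral>x. F 0 x \<partial>P) = (\<integral>x. \<beta> ^ card (A x) \<partial>P)"
    by (simp only: LIMSEQ_const_iff)
  moreover have "F 0 x = u ^ card (A x \<inter> H x) * v ^ card (A x - H x)" for x
  proof -
    have "{c \<in> A x. c \<in> H x} = A x \<inter> H x" "{c \<in> A x. c \<notin> H x} = A x - H x" by auto
    then show ?thesis by (simp add: F_def)
  qed
  ultimately show ?thesis by (simp add: A_def H_def \<beta>_def)
qed

text \<open>Arrivals are averaged first, with the outcomes of the orbiting customers inside the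
  factor; what remains is \<open>alive_gf\<close>. The length \<open>L\<close> is free because the
  time integral over a glue period needs the state at each of its times, not only at its
  end.\<close>

lemma glue_gf:
  fixes u v :: complex
  assumes L: "0 \<le> L" and u: "norm u \<le> 1" and v: "norm v \<le> 1"
  shows "(\<integral>x. u ^ card ({c \<in> customers (k, x). attempts (k, x) c \<inter> {glue_start G n (k, x)..glue_start G n (k, x) + L} \<noteq> {}} - prior G n (k, x))
      * v ^ card (arrived (k, x) (glue_start G n (k, x) + L) - (prior G n (k, x) \<union>
          {c \<in> customers (k, x). attempts (k, x) c \<inter> {glue_start G n (k, x)..glue_start G n (k, x) + L} \<noteq> {}})) \<partial>P)
    = exp (- of_real (lam * L) * (1 - u)) *
      (\<integral>x. (of_real (1 - exp (- nu * L)) * u + of_real (exp (- nu * L)) * v) ^ X_seq G n (k, x) \<partial>P)" (is "(\<integral>x. ?f x \<partial>P) = _")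
proof -
  define A H where "A = (\<lambda>x. alive G n (k, x))" and "H = (\<lambda>x. hits G n L (k, x))"
  have [measurable]: "Measurable.pred P (\<lambda>x. c \<in> A x)" "Measurable.pred P (\<lambda>x. c \<in> H x)" for c
    unfolding A_def H_def by measurable
  define \<Phi> where "\<Phi> = (\<lambda>x. u ^ card (A x \<inter> H x) * v ^ card (A x - H x))"
  have [measurable]: "\<Phi> \<in> borel_measurable P" unfolding \<Phi>_def by measurable
  let ?T = "\<lambda>x. glue_start G n (k, x)"
  have "(\<integral>x. ?f x \<partial>P) = (\<integral>x. \<Phi> x * u ^ card (arrived (k, x) (?T x + L) - arrived (k, x) (?T x)) \<partial>P)"
  proof (rule integral_cong_AE)
    show "AE x in P. ?f x = \<Phi> x * u ^ card (arrived (k, x) (?T x + L) - arrived (k, x) (?T x))"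
      using AE_good_clocks AE_no_tie_cycle[of k]
    proof eventually_elim
      fix x assume g: "good_clocks x" and nt: "good_sample.no_tie G (k, x)"
      interpret good_sample G "(k, x)" by (rule good_sampleI[OF g])
      show "?f x = \<Phi> x * u ^ card (arrived (k, x) (?T x + L) - arrived (k, x) (?T x))"
        unfolding glue_split[OF nt L] by (simp add: \<Phi>_def A_def H_def power_add mult_ac)
    qed
    show "?f \<in> borel_measurable P"
      unfolding attempts_meet_iff by measurable
  qed measurable
  also have "\<dots> = (\<integral>x. \<Phi> x * exp (- of_real (lam * L) * (1 - u)) \<partial>P)"
  proof (rule arrivals_gf[where T="?T" and L="\<lambda>_. L" and \<Phi>=\<Phi>])
    show "norm (\<Phi> x) \<le> 1" for x
      unfolding \<Phi>_def norm_mult norm_power using u v by (intro mult_le_one power_le_one) auto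
    fix x assume g: "good_clocks x"
    interpret good_sample G "(k, x)" by (rule good_sampleI[OF g])
    show "0 \<le> ?T x \<and> 0 \<le> L" using glue_nonneg L by simp
    fix x' assume h: "same_history (?T x) (k, x) (k, x')"
      and att: "\<And>c. c \<in> arrived (k, x) (?T x) \<Longrightarrow> attempts (k, x') c = attempts (k, x) c"
    have T: "?T x' = ?T x" and p: "prior G n (k, x') = prior G n (k, x)"
      using same_history_times(7,8)[OF h] by auto
    have A: "A x' = A x" using h by (simp add: A_def alive_def T p same_history_def)
    have "c \<in> H x' \<longleftrightarrow> c \<in> H x" if "c \<in> A x" for c
      using att[of c] that by (simp add: H_def hits_def T A_def alive_def)
    then have "A x \<inter> H x' = A x \<inter> H x" "A x - H x' = A x - H x" by blast+
    then show "?T x' = ?T x \<and> L = L \<and> \<Phi> x' = \<Phi> x" using T by (simp add: \<Phi>_def A)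
  qed (measurable, rule u)
  also have "\<dots> = exp (- of_real (lam * L) * (1 - u)) * (\<integral>x. \<Phi> x \<partial>P)"
    by simp
  also have "(\<integral>x. \<Phi> x \<partial>P) = (\<integral>x. (of_real (1 - exp (- nu * L)) * u + of_real (exp (- nu * L)) * v) ^ card (A x) \<partial>P)"
    unfolding \<Phi>_def A_def H_def by (rule alive_gf[OF L u v])
  also have "\<dots> = (\<integral>x. (of_real (1 - exp (- nu * L)) * u + of_real (exp (- nu * L)) * v) ^ X_seq G n (k, x) \<partial>P)"
  proof (rule integral_cong_AE)
    show "AE x in P. (of_real (1 - exp (- nu * L)) * u + of_real (exp (- nu * L)) * v) ^ card (A x)
        = (of_real (1 - exp (- nu * L)) * u + of_real (exp (- nu * L)) * v) ^ X_seq G n (k, x)"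
      using AE_good_clocks AE_no_tie_cycle[of k]
    proof eventually_elim
      fix x assume g: "good_clocks x" and nt: "good_sample.no_tie G (k, x)"
      interpret good_sample G "(k, x)" by (rule good_sampleI[OF g])
      show "(of_real (1 - exp (- nu * L)) * u + of_real (exp (- nu * L)) * v) ^ card (A x)
        = (of_real (1 - exp (- nu * L)) * u + of_real (exp (- nu * L)) * v) ^ X_seq G n (k, x)"
        by (simp add: X_seq_eq[OF nt] A_def alive_def)
    qed
    show "(\<lambda>x. (of_real (1 - exp (- nu * L)) * u + of_real (exp (- nu * L)) * v) ^ X_seq G n (k, x)) \<in> borel_measurable P"
      unfolding X_seq_def num_system_def by measurable
  qed measurable
  finally show ?thesis .
qed

end

section \<open>Visit periods and vacations\<close>

lemma set_integral_shift:
  fixes f :: "real \<Rightarrow> complex"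
  shows "(LBINT t:{a..b}. f t) = (LBINT s:{0..b - a}. f (a + s))"
proof -
  have "(\<integral>t. indicator {a..b} t *\<^sub>R f t \<partial>lborel) = (\<integral>s. indicator {a..b} (a + s) *\<^sub>R f (a + s) \<partial>lborel)"
    using lborel_integral_real_affine[of 1 "\<lambda>t. indicator {a..b} t *\<^sub>R f t" a] by simp
  also have "\<dots> = (\<integral>s. indicator {0..b - a} s *\<^sub>R f (a + s) \<partial>lborel)"
    by (intro Bochner_Integration.integral_cong refl) (auto simp: indicator_def)
  finally show ?thesis by (simp add: set_lebesgue_integral_def)
qed

lemma norm_set_integral_le:
  fixes f :: "real \<Rightarrow> complex"
  assumes "f \<in> borel_measurable borel" "\<And>s. norm (f s) \<le> 1" "a \<le> b"
  shows "norm (LBINT s:{a..b}. f s) \<le> b - a"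
proof -
  have "norm (LBINT s:{a..b}. f s) \<le> (\<integral>s. norm (indicator {a..b} s *\<^sub>R f s) \<partial>lborel)"
    unfolding set_lebesgue_integral_def by (rule integral_norm_bound)
  also have "\<dots> \<le> (\<integral>s. indicator {a..b} s \<partial>lborel)"
  proof (rule integral_mono_AE)
    have i: "integrable lborel (indicator {a..b} :: real \<Rightarrow> real)"
      by (rule integrable_real_indicator) (simp_all add: emeasure_lborel_Icc_eq)
    show "integrable lborel (\<lambda>s. norm (indicator {a..b} s *\<^sub>R f s))"
      by (rule Bochner_Integration.integrable_bound[OF i]) (use assms in \<open>auto simp: indicator_def\<close>)
    show "integrable lborel (indicator {a..b} :: real \<Rightarrow> real)" by (rule i)
  qed (use assms in \<open>auto simp: indicator_def\<close>)
  also have "\<dots> = b - a" using assms(3) by simp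
  finally show ?thesis .
qed

text \<open>For \<open>a \<ge> 0\<close> this equals
  \<open>(1 - exp (- \<theta> * of_real a)) / \<theta>\<close> if \<open>\<theta>\<close> is
  nonzero, and \<open>a\<close> if \<open>\<theta> = 0\<close>. In integral form it is continuous in
  \<open>\<theta>\<close>, so \<open>zo = 1\<close> needs no separate treatment until the final
  formulas.\<close>

definition exp_integral :: "complex \<Rightarrow> real \<Rightarrow> complex" where
  "exp_integral \<theta> a = (LBINT s:{0..a}. exp (- \<theta> * of_real s))"

lemma norm_exp_le:
  assumes "0 \<le> Re \<theta>" "0 \<le> s" shows "norm (exp (- \<theta> * of_real s)) \<le> 1"
  using assms by (simp add: norm_exp_eq_Re)

lemma exp_integral_eq:
  assumes "\<theta> \<noteq> 0" "0 \<le> a"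
  shows "exp_integral \<theta> a = (1 - exp (- \<theta> * of_real a)) / \<theta>"
proof -
  have "(\<integral>x. indicator {0..a} x *\<^sub>R exp (- \<theta> * of_real x) \<partial>lborel)
      = - exp (- \<theta> * of_real a) / \<theta> - - exp (- \<theta> * of_real 0) / \<theta>"
  proof (rule integral_FTC_Icc[OF assms(2)])
    fix x :: real
    have "((\<lambda>z. - exp (- \<theta> * z) / \<theta>) has_field_derivative exp (- \<theta> * of_real x)) (at (of_real x))"
      using assms(1) by (auto intro!: derivative_eq_intros)
    then have "((\<lambda>x. - exp (- \<theta> * of_real x) / \<theta>) has_vector_derivative exp (- \<theta> * of_real x)) (at x)"
      by (rule has_vector_derivative_real_field)
    then show "((\<lambda>x. - exp (- \<theta> * of_real x) / \<theta>) has_vector_derivative exp (- \<theta> * of_real x)) (at x within {0..a})"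
      by (rule has_vector_derivative_at_within)
  qed (intro continuous_intros)
  then show ?thesis using assms(1)
    by (simp add: exp_integral_def set_lebesgue_integral_def diff_divide_distrib)
qed

lemma norm_exp_integral_le:
  assumes "0 \<le> Re \<theta>" "0 \<le> a" shows "norm (exp_integral \<theta> a) \<le> a"
proof -
  \<comment> \<open>Truncation at 0 bounds the integrand everywhere without changing it on the
    interval.\<close>
  have "exp_integral \<theta> a = (LBINT s:{0..a}. exp (- \<theta> * of_real (max 0 s)))"
    unfolding exp_integral_def by (rule set_lebesgue_integral_cong) auto
  also have "norm \<dots> \<le> a - 0"
  proof (rule norm_set_integral_le)
    show "norm (exp (- \<theta> * complex_of_real (max 0 s))) \<le> 1" for s
      by (rule norm_exp_le) (use assms in auto)
  qed (use assms in auto)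
  finally show ?thesis by simp
qed

lemma exp_integral_measurable [measurable]: "exp_integral \<theta> \<in> borel_measurable borel"
proof -
  have "(\<lambda>a. \<integral>s. indicator {0..a} s *\<^sub>R exp (- \<theta> * of_real s) \<partial>lborel) \<in> borel_measurable borel"
  proof (rule lborel.borel_measurable_lebesgue_integral)
    have "(\<lambda>z::real \<times> real. indicator {0..fst z} (snd z) *\<^sub>R exp (- \<theta> * of_real (snd z)))
      = (\<lambda>z. if 0 \<le> snd z \<and> snd z \<le> fst z then exp (- \<theta> * of_real (snd z)) else 0)"
      by (auto simp: indicator_def fun_eq_iff)
    moreover have "\<dots> \<in> borel_measurable (borel \<Otimes>\<^sub>M lborel)" by measurable
    ultimately show "(\<lambda>(a, s). indicator {0..a} s *\<^sub>R exp (- \<theta> * complex_of_real s)) \<in> borel_measurable (borel \<Otimes>\<^sub>M lborel)"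
      by (simp add: case_prod_unfold)
  qed
  then show ?thesis unfolding exp_integral_def set_lebesgue_integral_def by simp
qed

lemma gf_difference_quotient:
  fixes u :: real
  assumes "u \<noteq> 1" shows "(1 - u ^ n) / (1 - u) = (\<Sum>i<n. u ^ i)"
  using one_diff_power_eq[of u n] assms by simp

text \<open>The difference quotient of the generating function at 1 is the expectation of
  \<open>\<Sum>i<N x. u m ^ i\<close>, which is at most \<open>N x\<close> and tends to it.
  Dominated convergence gives the derivative; Fatou's lemma gives integrability when the quotients
  are bounded.\<close>

lemma gf_mean:
  fixes N :: "'a \<Rightarrow> nat"
  assumes "prob_space M" and N [measurable]: "N \<in> measurable M (count_space UNIV)"
    and u: "\<And>m. 0 \<le> u m" "\<And>m. u m < 1" "u \<longlonglongrightarrow> (1::real)"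
  shows gf_mean_tendsto: "integrable M (\<lambda>x. real (N x)) \<Longrightarrow>
      (\<lambda>m. (1 - (\<integral>x. u m ^ N x \<partial>M)) / (1 - u m)) \<longlonglongrightarrow> (\<integral>x. real (N x) \<partial>M)"
    and gf_mean_integrable: "(\<And>m. 1 - (\<integral>x. u m ^ N x \<partial>M) \<le> C * (1 - u m)) \<Longrightarrow> integrable M (\<lambda>x. real (N x))"
proof -
  interpret prob_space M by fact
  have pow: "norm (u m ^ n) \<le> 1" for m n using u(1)[of m] less_imp_le[OF u(2)[of m]] by (simp add: power_le_one)
  have [measurable]: "(\<lambda>x. f (N x)) \<in> borel_measurable M" for f :: "nat \<Rightarrow> real"
    by (rule measurable_compose[OF N]) simp
  have int: "integrable M (\<lambda>x. u m ^ N x)" for m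
    by (rule integrable_const_bound[where B=1]) (use pow in auto)
  define s where "s = (\<lambda>m x. \<Sum>i<N x. u m ^ i)"
  have s_eq: "s m x = (1 - u m ^ N x) / (1 - u m)" for m x
    unfolding s_def using u(2)[of m] by (intro gf_difference_quotient[symmetric]) simp
  have s_int: "(\<integral>x. s m x \<partial>M) = (1 - (\<integral>x. u m ^ N x \<partial>M)) / (1 - u m)" for m
    unfolding s_eq using int[of m] by (simp add: prob_space)
  have s_integrable: "integrable M (s m)" for m
    unfolding s_eq using int[of m] by simp
  have s_nonneg: "0 \<le> s m x" for m x unfolding s_def using u(1) by (intro sum_nonneg) simp
  have s_le: "s m x \<le> real (N x)" for m x
  proof -
    have "s m x \<le> (\<Sum>i<N x. 1)" unfolding s_def using pow[of m] u(1)[of m] by (intro sum_mono) simp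
    then show ?thesis by simp
  qed
  have s_lim: "(\<lambda>m. s m x) \<longlonglongrightarrow> real (N x)" for x
  proof -
    have "(\<lambda>m. \<Sum>i<N x. u m ^ i) \<longlonglongrightarrow> (\<Sum>i<N x. 1 ^ i)"
      by (intro tendsto_sum tendsto_power u(3))
    then show ?thesis by (simp add: s_def)
  qed
  show "(\<lambda>m. (1 - (\<integral>x. u m ^ N x \<partial>M)) / (1 - u m)) \<longlonglongrightarrow> (\<integral>x. real (N x) \<partial>M)"
    if i: "integrable M (\<lambda>x. real (N x))"
  proof -
    have "(\<lambda>m. \<integral>x. s m x \<partial>M) \<longlonglongrightarrow> (\<integral>x. real (N x) \<partial>M)"
      by (rule integral_dominated_convergence[where w="\<lambda>x. real (N x)"])
        (use i s_lim s_le s_nonneg s_integrable in \<open>simp_all add: borel_measurable_integrable\<close>)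
    then show ?thesis by (simp add: s_int)
  qed
  show "integrable M (\<lambda>x. real (N x))" if C: "\<And>m. 1 - (\<integral>x. u m ^ N x \<partial>M) \<le> C * (1 - u m)"
  proof (rule integrableI_nonneg)
    have "(\<integral>\<^sup>+x. ennreal (real (N x)) \<partial>M) = (\<integral>\<^sup>+x. liminf (\<lambda>m. ennreal (s m x)) \<partial>M)"
    proof (rule nn_integral_cong)
      fix x
      have "(\<lambda>m. ennreal (s m x)) \<longlonglongrightarrow> ennreal (real (N x))" by (rule tendsto_ennrealI[OF s_lim])
      then show "ennreal (real (N x)) = liminf (\<lambda>m. ennreal (s m x))"
        by (rule lim_imp_Liminf[OF sequentially_bot, symmetric])
    qed
    also have "\<dots> \<le> liminf (\<lambda>m. \<integral>\<^sup>+x. ennreal (s m x) \<partial>M)"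
      by (rule nn_integral_liminf) (use borel_measurable_integrable[OF s_integrable] in measurable)
    also have "\<dots> \<le> liminf (\<lambda>m. ennreal C)"
    proof (rule Liminf_mono, rule always_eventually, rule allI)
      fix m
      have "(\<integral>\<^sup>+x. ennreal (s m x) \<partial>M) = ennreal (\<integral>x. s m x \<partial>M)"
        by (rule nn_integral_eq_integral[OF s_integrable]) (simp add: s_nonneg)
      also have "\<dots> \<le> ennreal C"
        unfolding s_int using C[of m] u(2)[of m] by (intro ennreal_leI) (simp add: divide_le_eq)
      finally show "(\<integral>\<^sup>+x. ennreal (s m x) \<partial>M) \<le> ennreal C" .
    qed
    also have "\<dots> = ennreal C" by (simp add: Liminf_const)
    finally show "(\<integral>\<^sup>+x. ennreal (real (N x)) \<partial>M) < \<infinity>" by (simp add: le_less_trans)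
  qed simp_all
qed

text \<open>The version for nonnegative functions, for use where integrability is itself in
  question.\<close>

lemma (in real_product) nn_integral_resample:
  assumes [measurable]: "f \<in> borel_measurable P"
  shows "(\<integral>\<^sup>+x. f x \<partial>P) = (\<integral>\<^sup>+x. (\<integral>\<^sup>+y. f (override_on x y K) \<partial>P) \<partial>P)"
proof -
  have "(\<integral>\<^sup>+x. f x \<partial>P) = (\<integral>\<^sup>+x. f x \<partial>distr (P \<Otimes>\<^sub>M P) P (\<lambda>(x, y). override_on x y K))"
    by (simp add: resample)
  also have "\<dots> = (\<integral>\<^sup>+z. f (case z of (x, y) \<Rightarrow> override_on x y K) \<partial>(P \<Otimes>\<^sub>M P))"
    by (intro nn_integral_distr) auto
  also have "\<dots> = (\<integral>\<^sup>+x. (\<integral>\<^sup>+y. f (override_on x y K) \<partial>P) \<partial>P)"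
  proof -
    have "(\<lambda>z. f (case z of (x, y) \<Rightarrow> override_on x y K)) \<in> borel_measurable (P \<Otimes>\<^sub>M P)"
      by measurable
    from sigma_finite_measure.nn_integral_fst[OF prob_space_imp_sigma_finite[OF P.prob_space_axioms] this] show ?thesis by simp
  qed
  finally show ?thesis .
qed

definition later_clocks :: "nat \<Rightarrow> clock set" where
  "later_clocks n = {a. \<exists>m\<ge>n. a = Vacation m \<or> (\<exists>j. a = Service m j)}"

text \<open>The services of a visit act only after its queue has been fixed, so the start of the
  visit, its queue and the earlier customers are functions of the other clocks. The arrivals depend
  on neither services nor vacations.\<close>

lemma agree_before:
  assumes "\<And>a. a \<notin> later_clocks n \<Longrightarrow> x' a = x a"
  shows "attempts (k, x') c = attempts (k, x) c" "arrived (k, x') t = arrived (k, x) t"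
    "glue_start G n (k, x') = glue_start G n (k, x)" "prior G n (k, x') = prior G n (k, x)"
    "visit_start G n (k, x') = visit_start G n (k, x)" "prior G (Suc n) (k, x') = prior G (Suc n) (k, x)"
    "served G n (k, x') = served G n (k, x)"
proof -
  have e: "x' (Interarrival i) = x (Interarrival i)" "x' (Retrial c i) = x (Retrial c i)" for c i
    by (rule assms, simp add: later_clocks_def)+
  have f: "x' (Service m j) = x (Service m j)" "x' (Vacation m) = x (Vacation m)" if "m < n" for m j
    using that by (auto intro!: assms simp: later_clocks_def)
  have en: "entry_time (k, x') c = entry_time (k, x) c" for c using e by (cases c) auto
  have at: "attempts (k, x') c = attempts (k, x) c" for c using e en by (cases c) auto
  show "attempts (k, x') c = attempts (k, x) c" by (rule at)
  show "arrived (k, x') t = arrived (k, x) t" by (simp add: arrived_def customers_def en)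
  have q: "queue_of G (k, x') = queue_of G (k, x)"
    by (intro ext) (simp add: queue_of_def at customers_def)
  have "cycle_start G (k, x') m = cycle_start G (k, x) m" if "m \<le> n" for m
    using that
  proof (induction m)
    case (Suc m)
    then show ?case using f[of m] by (simp add: cycle_start.simps(2) q Let_def case_prod_unfold)
  qed simp
  then have c: "cycle_start G (k, x') n = cycle_start G (k, x) n" by simp
  show g: "glue_start G n (k, x') = glue_start G n (k, x)" and p: "prior G n (k, x') = prior G n (k, x)"
    using c by (simp_all add: glue_start_def prior_def)
  show "visit_start G n (k, x') = visit_start G n (k, x)" using g by (simp add: visit_start_def)
  show "prior G (Suc n) (k, x') = prior G (Suc n) (k, x)" by (simp add: prior_Suc g p q)
  show "served G n (k, x') = served G n (k, x)" by (simp add: served_eq g p q)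
qed

lemma agree_vacation:
  assumes "\<And>a. a \<noteq> Vacation n \<Longrightarrow> x' a = x a"
  shows "arrived (k, x') t = arrived (k, x) t" "vacation_start G n (k, x') = vacation_start G n (k, x)"
    "prior G (Suc n) (k, x') = prior G (Suc n) (k, x)"
proof -
  have a: "x' a = x a" if "a \<notin> later_clocks n" for a
    using that by (intro assms) (auto simp: later_clocks_def)
  show "arrived (k, x') t = arrived (k, x) t" "prior G (Suc n) (k, x') = prior G (Suc n) (k, x)"
    by (rule agree_before[OF a], assumption)+
  have v: "visit_start G n (k, x') = visit_start G n (k, x)" "served G n (k, x') = served G n (k, x)"
    by (rule agree_before[OF a], assumption)+
  show "vacation_start G n (k, x') = vacation_start G n (k, x)"
    unfolding vacation_start_def v using assms by simp
qed

text \<open>Expressed by \<open>arrived\<close> and \<open>prior\<close> instead of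
  \<open>num_orbit\<close>, so that independence of the services of cycle \<open>n\<close> holds for
  every sample and not only almost surely.\<close>

definition visit_orbit :: "real \<Rightarrow> nat \<Rightarrow> sample \<Rightarrow> nat" where
  "visit_orbit G n w = card (arrived w (visit_start G n w) - prior G (Suc n) w)"

definition vacation_orbit :: "real \<Rightarrow> nat \<Rightarrow> sample \<Rightarrow> nat" where
  "vacation_orbit G n w = card (arrived w (vacation_start G n w) - prior G (Suc n) w)"

text \<open>All of \<open>prior G (Suc n) w\<close> has arrived by the start of the visit, so
  afterwards this difference of sets grows by new arrivals only.\<close>

lemma (in good_sample) orbit_later:
  assumes "visit_start G n w \<le> s" "s \<le> t"
  shows "card (arrived w t - prior G (Suc n) w) = card (arrived w s - prior G (Suc n) w) + card (arrived w t - arrived w s)"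
proof -
  have p: "prior G (Suc n) w \<subseteq> arrived w s" using prior_Suc_arrived[of n] arrived_mono[OF assms(1)] by blast
  then have "arrived w t - prior G (Suc n) w = (arrived w s - prior G (Suc n) w) \<union> (arrived w t - arrived w s)"
    using arrived_mono[OF assms(2)] by blast
  moreover have "(arrived w s - prior G (Suc n) w) \<inter> (arrived w t - arrived w s) = {}" by blast
  ultimately show ?thesis using finite_arrived[of s] finite_arrived[of t] by (simp add: card_Un_disjoint)
qed

context glue_model
begin

lemma AE_FB: "AE x in FB. 0 \<le> x" and AE_FS: "AE x in FS. 0 \<le> x"
  and prob_FB: "prob_space FB" and prob_FS: "prob_space FS"
  and sets_FB: "sets FB = sets borel" and sets_FS: "sets FS = sets borel"
  and integrable_FB: "integrable FB (\<lambda>x. x)" and integrable_FS: "integrable FS (\<lambda>x. x)"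
  using FB FS unfolding nonneg_law_def by blast+

lemma orbit_measurable [measurable (raw)]:
  assumes [measurable]: "f \<in> measurable N P"
  shows "(\<lambda>z. visit_orbit G n (k, f z)) \<in> measurable N (count_space UNIV)"
    "(\<lambda>z. vacation_orbit G n (k, f z)) \<in> measurable N (count_space UNIV)"
  unfolding visit_orbit_def vacation_orbit_def by measurable

text \<open>The services of cycle \<open>n\<close> may be replaced by an independent copy, because
  the queue and the orbit at the start of the visit do not involve them.\<close>

lemma integral_services:
  fixes f :: "nat \<Rightarrow> nat \<Rightarrow> (nat \<Rightarrow> real) \<Rightarrow> 'b::{banach, second_countable_topology}"
  assumes "integrable P (\<lambda>x. f (served G n (k, x)) (visit_orbit G n (k, x)) (\<lambda>j. x (Service n j)))"
  shows "(\<integral>x. f (served G n (k, x)) (visit_orbit G n (k, x)) (\<lambda>j. x (Service n j)) \<partial>P)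
    = (\<integral>x. (\<integral>y. f (served G n (k, x)) (visit_orbit G n (k, x)) (\<lambda>j. y (Service n j)) \<partial>P) \<partial>P)"
proof -
  have a: "override_on x y (range (Service n)) a = x a" if "a \<notin> later_clocks n" for x y :: "clock \<Rightarrow> real" and a
    using that by (auto simp: override_on_def later_clocks_def)
  have "served G n (k, override_on x y (range (Service n))) = served G n (k, x)"
    "visit_orbit G n (k, override_on x y (range (Service n))) = visit_orbit G n (k, x)" for x y
  proof -
    have b: "arrived (k, override_on x y (range (Service n))) t = arrived (k, x) t"
      "visit_start G n (k, override_on x y (range (Service n))) = visit_start G n (k, x)"
      "prior G (Suc n) (k, override_on x y (range (Service n))) = prior G (Suc n) (k, x)" for t
      by (rule agree_before[OF a], assumption)+
    show "served G n (k, override_on x y (range (Service n))) = served G n (k, x)"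
      by (rule agree_before[OF a])
    show "visit_orbit G n (k, override_on x y (range (Service n))) = visit_orbit G n (k, x)"
      unfolding visit_orbit_def b ..
  qed
  then show ?thesis
    using integral_resample[OF assms, of "range (Service n)"] by simp
qed

lemma integral_vacation:
  fixes f :: "nat \<Rightarrow> real \<Rightarrow> 'b::{banach, second_countable_topology}"
  assumes "integrable P (\<lambda>x. f (vacation_orbit G n (k, x)) (x (Vacation n)))"
  shows "(\<integral>x. f (vacation_orbit G n (k, x)) (x (Vacation n)) \<partial>P)
    = (\<integral>x. (\<integral>y. f (vacation_orbit G n (k, x)) (y (Vacation n)) \<partial>P) \<partial>P)"
proof -
  have a: "override_on x y {Vacation n} a = x a" if "a \<noteq> Vacation n" for x y :: "clock \<Rightarrow> real" and a
    using that by (auto simp: override_on_def)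
  have "vacation_orbit G n (k, override_on x y {Vacation n}) = vacation_orbit G n (k, x)" for x y
  proof -
    have b: "arrived (k, override_on x y {Vacation n}) t = arrived (k, x) t"
      "vacation_start G n (k, override_on x y {Vacation n}) = vacation_start G n (k, x)"
      "prior G (Suc n) (k, override_on x y {Vacation n}) = prior G (Suc n) (k, x)" for t
      by (rule agree_vacation[OF a], assumption)+
    show ?thesis unfolding vacation_orbit_def b ..
  qed
  then show ?thesis
    using integral_resample[OF assms, of "{Vacation n}"] by simp
qed

lemma integrable_coordinate:
  fixes g :: "real \<Rightarrow> 'b::{banach, second_countable_topology}"
  assumes "integrable (clock_law lam nu FB FS a) g"
  shows "integrable P (\<lambda>x. g (x a))"
proof -
  have "integrable (distr P (clock_law lam nu FB FS a) (\<lambda>x. x a)) g"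
    using assms by (simp add: P.PiM_component)
  then show ?thesis
    by (subst (asm) integrable_distr_eq) (use assms in \<open>auto simp: borel_measurable_integrable\<close>)
qed

lemma integral_prod_services:
  fixes \<phi> :: "nat \<Rightarrow> real \<Rightarrow> complex"
  assumes "\<And>i. \<phi> i \<in> borel_measurable borel" and int: "\<And>i. integrable FB (\<phi> i)"
  shows "(\<integral>y. (\<Prod>i<q. \<phi> i (y (Service n i))) \<partial>P) = (\<Prod>i<q. \<integral>z. \<phi> i z \<partial>FB)"
    and "integrable P (\<lambda>y. \<Prod>i<q. \<phi> i (y (Service n i)))"
proof -
  have ii: "integrable P (\<lambda>y. \<phi> i (y (Service n i)))" for i
    by (rule integrable_coordinate) (simp add: int)
  \<comment> \<open>Independence is stated for a family indexed by clocks; \<open>idx\<close>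
    recovers the position \<open>j\<close> of a service from its clock.\<close>
  define idx where "idx = (\<lambda>a. case a of Service _ j \<Rightarrow> j | _ \<Rightarrow> 0)"
  have idx: "idx (Service n j) = j" for j by (simp add: idx_def)
  have inj: "inj_on (Service n) {..<q}" by (simp add: inj_on_def)
  have "P.P.indep_vars (\<lambda>_. borel) (\<lambda>a y. y a) (Service n ` {..<q})" by (rule indep_coordinates)
  then have "P.P.indep_vars (\<lambda>_. borel) (\<lambda>a y. \<phi> (idx a) (y a)) (Service n ` {..<q})"
    by (rule P.P.indep_vars_compose2) (use assms in simp)
  note iv = P.P.indep_vars_lebesgue_integral[OF _ this] P.P.indep_vars_integrable[OF _ this]
  have re: "(\<Prod>a\<in>Service n ` {..<q}. g a) = (\<Prod>i<q. g (Service n i))" for g :: "clock \<Rightarrow> complex"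
    by (simp add: prod.reindex[OF inj])
  have ii': "integrable P (\<lambda>y. \<phi> (idx a) (y a))" if "a \<in> Service n ` {..<q}" for a
    using that ii idx by auto
  show "(\<integral>y. (\<Prod>i<q. \<phi> i (y (Service n i))) \<partial>P) = (\<Prod>i<q. \<integral>z. \<phi> i z \<partial>FB)"
    using iv(1)[OF _ ii'] integral_coordinate[OF assms(1)] by (simp add: re idx)
  show "integrable P (\<lambda>y. \<Prod>i<q. \<phi> i (y (Service n i)))"
    using iv(2)[OF _ ii'] by (simp add: re idx)
qed

end

text \<open>During the service with index \<open>j\<close> the exponent of \<open>z\<close> is
  constantly \<open>q - j\<close>, up to one endpoint, and the exponential splits off the time at
  which this service starts. Cutting the range after \<open>m\<close> services permits induction
  while \<open>q\<close> stays fixed.\<close>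

lemma step_integral:
  fixes y :: "nat \<Rightarrow> real" and z \<theta> :: complex
  assumes y: "\<And>j. 0 \<le> y j" and \<theta>: "0 \<le> Re \<theta>" and z: "norm z \<le> 1" and m: "m \<le> q"
  shows "(LBINT s:{0..\<Sum>j<m. y j}. z ^ (q - card {j. j < q \<and> (\<Sum>i\<le>j. y i) \<le> s}) * exp (- \<theta> * of_real s))
    = (\<Sum>j<m. z ^ (q - j) * exp (- \<theta> * of_real (\<Sum>i<j. y i)) * exp_integral \<theta> (y j))"
  using m
proof (induction m)
  case 0
  have "(LBINT s:{0..0::real}. f s) = 0" for f :: "real \<Rightarrow> complex"
  proof -
    have "(\<lambda>s. indicator {0..0} s *\<^sub>R f s) = (\<lambda>s. indicator {0} s *\<^sub>R f 0)"
      by (auto simp: fun_eq_iff indicator_def)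
    then show ?thesis by (simp add: set_lebesgue_integral_def)
  qed
  then show ?case by simp
next
  case (Suc m)
  define S where "S = (\<lambda>m. \<Sum>j<m. y j)"
  define c where "c = (\<lambda>s. card {j. j < q \<and> (\<Sum>i\<le>j. y i) \<le> s})"
  define g where "g = (\<lambda>s. z ^ (q - c s) * exp (- \<theta> * of_real s))"
  have [measurable]: "c \<in> measurable borel (count_space UNIV)" unfolding c_def by measurable
  have [measurable]: "g \<in> borel_measurable borel" unfolding g_def by measurable
  have S: "S m \<le> S (Suc m)" "0 \<le> S m" using y by (auto simp: S_def intro!: sum_nonneg)
  have g_le: "norm (g s) \<le> 1" if "0 \<le> s" for s
    unfolding g_def norm_mult norm_power using norm_exp_le[OF \<theta> that] z
    by (intro mult_le_one power_le_one) auto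
  have int: "integrable lborel (\<lambda>s. indicator {a..b} s *\<^sub>R g s)" if "0 \<le> a" for a b
  proof (rule Bochner_Integration.integrable_bound)
    show "integrable lborel (indicator {a..b} :: real \<Rightarrow> real)"
      by (rule integrable_real_indicator) (simp_all add: emeasure_lborel_Icc_eq)
    show "AE s in lborel. norm (indicator {a..b} s *\<^sub>R g s) \<le> norm (indicator {a..b} s :: real)"
      using g_le that by (auto simp: indicator_def)
  qed measurable
  have "(\<integral>s. indicator {0..S (Suc m)} s *\<^sub>R g s \<partial>lborel)
      = (\<integral>s. indicator {0..S m} s *\<^sub>R g s + indicator {S m..S (Suc m)} s *\<^sub>R g s \<partial>lborel)"
  proof (rule Bochner_Integration.integral_cong_AE)
    show "AE s in lborel. indicator {0..S (Suc m)} s *\<^sub>R g s = indicator {0..S m} s *\<^sub>R g s + indicator {S m..S (Suc m)} s *\<^sub>R g s"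
      using AE_lborel_singleton[of "S m"] by eventually_elim (use S in \<open>auto simp: indicator_def\<close>)
  qed measurable
  also have "\<dots> = (\<integral>s. indicator {0..S m} s *\<^sub>R g s \<partial>lborel) + (\<integral>s. indicator {S m..S (Suc m)} s *\<^sub>R g s \<partial>lborel)"
    using S(2) by (intro Bochner_Integration.integral_add int) auto
  also have "(\<integral>s. indicator {S m..S (Suc m)} s *\<^sub>R g s \<partial>lborel)
      = (\<integral>s. indicator {S m..S (Suc m)} s *\<^sub>R (z ^ (q - m) * exp (- \<theta> * of_real s)) \<partial>lborel)"
  proof (rule Bochner_Integration.integral_cong_AE)
    show "AE s in lborel. indicator {S m..S (Suc m)} s *\<^sub>R g s = indicator {S m..S (Suc m)} s *\<^sub>R (z ^ (q - m) * exp (- \<theta> * of_real s))"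
      using AE_lborel_singleton[of "S (Suc m)"]
    proof eventually_elim
      fix s :: real assume s: "s \<noteq> S (Suc m)"
      show "indicator {S m..S (Suc m)} s *\<^sub>R g s = indicator {S m..S (Suc m)} s *\<^sub>R (z ^ (q - m) * exp (- \<theta> * of_real s))"
      proof (cases "s \<in> {S m..S (Suc m)}")
        case True
        \<comment> \<open>Exactly the first \<open>m\<close> services are over; the point
          \<open>S (Suc m)\<close>, where the next one ends, was excluded as a null set.\<close>
        have "{j. j < q \<and> (\<Sum>i\<le>j. y i) \<le> s} = {..<m}"
        proof (intro set_eqI iffI)
          fix j assume j: "j \<in> {j. j < q \<and> (\<Sum>i\<le>j. y i) \<le> s}"
          show "j \<in> {..<m}"
          proof (rule ccontr)
            assume "j \<notin> {..<m}"
            then have "S (Suc m) \<le> (\<Sum>i\<le>j. y i)" unfolding S_def using y by (intro sum_mono2) auto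
            then show False using j s True by auto
          qed
        next
          fix j assume j: "j \<in> {..<m}"
          then have "(\<Sum>i\<le>j. y i) \<le> S m" unfolding S_def using y by (intro sum_mono2) auto
          then show "j \<in> {j. j < q \<and> (\<Sum>i\<le>j. y i) \<le> s}" using j True Suc.prems by auto
        qed
        then show ?thesis by (simp add: g_def c_def)
      qed simp
    qed
  qed measurable
  also have "\<dots> = z ^ (q - m) * (LBINT s:{S m..S (Suc m)}. exp (- \<theta> * of_real s))"
    by (simp add: set_lebesgue_integral_def flip: integral_mult_right_zero mult_scaleR_right)
  also have "(LBINT s:{S m..S (Suc m)}. exp (- \<theta> * of_real s)) = (LBINT s:{0..y m}. exp (- \<theta> * of_real (S m + s)))"
    by (subst set_integral_shift) (simp add: S_def)
  also have "\<dots> = exp (- \<theta> * of_real (S m)) * exp_integral \<theta> (y m)"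
    by (simp add: exp_integral_def set_lebesgue_integral_def ring_distribs exp_diff exp_minus divide_inverse
        flip: integral_mult_right_zero mult_scaleR_right)
  finally have "(LBINT s:{0..S (Suc m)}. g s) = (LBINT s:{0..S m}. g s) + z ^ (q - m) * (exp (- \<theta> * of_real (S m)) * exp_integral \<theta> (y m))"
    by (simp add: set_lebesgue_integral_def)
  also have "(LBINT s:{0..S m}. g s) = (\<Sum>j<m. z ^ (q - j) * exp (- \<theta> * of_real (\<Sum>i<j. y i)) * exp_integral \<theta> (y j))"
    using Suc by (simp add: S_def g_def c_def)
  finally show ?case by (simp add: S_def g_def c_def)
qed

context glue_model
begin

text \<open>On the closed unit disc the argument of the transforms has nonnegative real part, so all
  exponentials over nonnegative times are bounded by 1.\<close>

lemma Re_rate: "norm v \<le> 1 \<Longrightarrow> 0 \<le> Re (of_real lam * (1 - v))"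
  using lam complex_Re_le_cmod[of v] by simp

lemma integrable_exp_clock:
  assumes "0 \<le> Re \<theta>" "prob_space F" "sets F = sets borel" "AE x in F. 0 \<le> x"
  shows "integrable F (\<lambda>x. exp (- \<theta> * of_real x))"
proof -
  interpret prob_space F by fact
  show ?thesis
  proof (rule integrable_const_bound[where B=1])
    show "AE x in F. norm (exp (- \<theta> * of_real x)) \<le> 1"
      using assms(4) by eventually_elim (rule norm_exp_le[OF assms(1)])
    have "(\<lambda>x::real. exp (- \<theta> * of_real x)) \<in> borel_measurable borel" by measurable
    then show "(\<lambda>x. exp (- \<theta> * of_real x)) \<in> borel_measurable F"
      using measurable_cong_sets[OF assms(3) refl] by blast
  qed
qed

lemma norm_lst_le:
  assumes "0 \<le> Re \<theta>" "prob_space F" "sets F = sets borel" "AE x in F. 0 \<le> x"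
  shows "norm (lst F \<theta>) \<le> 1"
proof -
  interpret prob_space F by fact
  have i: "integrable F (\<lambda>x. exp (- \<theta> * of_real x))" by (rule integrable_exp_clock[OF assms])
  have "norm (lst F \<theta>) \<le> (\<integral>x. norm (exp (- \<theta> * of_real x)) \<partial>F)"
    unfolding lst_def by (rule integral_norm_bound)
  also have "\<dots> \<le> (\<integral>x. 1 \<partial>F)"
  proof (rule integral_mono_AE)
    show "AE x in F. norm (exp (- \<theta> * of_real x)) \<le> 1"
      using assms(4) by eventually_elim (rule norm_exp_le[OF assms(1)])
  qed (rule integrable_norm[OF i], rule integrable_const)
  finally show ?thesis using prob_space by simp
qed

lemmas norm_lst_FB = norm_lst_le[OF Re_rate prob_FB sets_FB AE_FB]
  and norm_lst_FS = norm_lst_le[OF Re_rate prob_FS sets_FS AE_FS]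
  and integrable_exp_FB = integrable_exp_clock[OF Re_rate prob_FB sets_FB AE_FB]
  and integrable_exp_FS = integrable_exp_clock[OF Re_rate prob_FS sets_FS AE_FS]

lemma visit_same_history:
  assumes g: "good_clocks x" and h: "same_history (visit_start G n (k, x)) (k, x) (k, x')"
  shows "visit_start G n (k, x') = visit_start G n (k, x)" "served G n (k, x') = served G n (k, x)"
    "visit_orbit G n (k, x') = visit_orbit G n (k, x)" "vacation_start G n (k, x') = vacation_start G n (k, x)"
    "x' (Service m j) = x (Service m j)" "x' (Vacation m) = x (Vacation m)"
proof -
  interpret good_sample G "(k, x)" by (rule good_sampleI[OF g])
  note t = same_history_times[OF h, of n]
  show "visit_start G n (k, x') = visit_start G n (k, x)" "served G n (k, x') = served G n (k, x)"
    "vacation_start G n (k, x') = vacation_start G n (k, x)"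
    using t by blast+
  show "visit_orbit G n (k, x') = visit_orbit G n (k, x)"
    using t h unfolding visit_orbit_def by (simp add: same_history_def)
  show "x' (Service m j) = x (Service m j)" "x' (Vacation m) = x (Vacation m)"
    using h by (simp_all add: same_history_def)
qed

lemma vacation_same_history:
  assumes g: "good_clocks x" and h: "same_history (vacation_start G n (k, x)) (k, x) (k, x')"
  shows "vacation_start G n (k, x') = vacation_start G n (k, x)"
    "vacation_orbit G n (k, x') = vacation_orbit G n (k, x)" "x' (Vacation m) = x (Vacation m)"
proof -
  interpret good_sample G "(k, x)" by (rule good_sampleI[OF g])
  have v: "visit_start G n (k, x) \<le> vacation_start G n (k, x)" by (rule visit_le_vacation)
  note t = same_history_times(4,6)[OF h v]
  show "vacation_start G n (k, x') = vacation_start G n (k, x)" by (rule t(1))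
  show "vacation_orbit G n (k, x') = vacation_orbit G n (k, x)"
    using t h unfolding vacation_orbit_def by (simp add: same_history_def)
  show "x' (Vacation m) = x (Vacation m)" using h by (simp add: same_history_def)
qed

lemma exp_sum_services:
  fixes v :: complex and y :: "nat \<Rightarrow> real" and q :: nat
  shows
  "exp (- of_real (lam * (\<Sum>j<q. y j)) * (1 - v)) = (\<Prod>j<q. exp (- (of_real lam * (1 - v)) * of_real (y j)))"
proof -
  have "- of_real (lam * (\<Sum>j<q. y j)) * (1 - v) = (\<Sum>j<q. - (of_real lam * (1 - v)) * of_real (y j))"
    by (simp only: sum_distrib_left[symmetric] of_real_mult of_real_sum) (simp add: algebra_simps)
  then show ?thesis by (simp only:) (rule exp_sum, simp)
qed

text \<open>The length of the visit is a function of the queue and the services, both fixed at its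
  start in the sense of \<open>same_history\<close>. The arrivals during it are therefore Poisson
  given the length, and averaging over the services yields one factor \<open>lst FB\<close> per
  customer served.\<close>

lemma visit_gf:
  assumes v: "norm v \<le> 1"
  shows "(\<integral>x. v ^ Z_seq G n (k, x) \<partial>P) = (\<integral>x. lst FB (of_real lam * (1 - v)) ^ served G n (k, x) * v ^ visit_orbit G n (k, x) \<partial>P)"
    and "AE x in P. Z_seq G n (k, x) = vacation_orbit G n (k, x)"
proof -
  let ?T = "\<lambda>x. visit_start G n (k, x)" and ?L = "\<lambda>x. vacation_start G n (k, x) - visit_start G n (k, x)"
  have [measurable]: "(\<lambda>x. Z_seq G n (k, x)) \<in> measurable P (count_space UNIV)"
    unfolding Z_seq_def num_system_def by measurable
  have Z: "AE x in P. Z_seq G n (k, x) = vacation_orbit G n (k, x) \<and>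
      vacation_orbit G n (k, x) = visit_orbit G n (k, x) + card (arrived (k, x) (?T x + ?L x) - arrived (k, x) (?T x))"
    using AE_good_clocks AE_no_tie_cycle[of k]
  proof eventually_elim
    fix x assume g: "good_clocks x" and nt: "good_sample.no_tie G (k, x)"
    interpret good_sample G "(k, x)" by (rule good_sampleI[OF g])
    show "Z_seq G n (k, x) = vacation_orbit G n (k, x) \<and>
      vacation_orbit G n (k, x) = visit_orbit G n (k, x) + card (arrived (k, x) (?T x + ?L x) - arrived (k, x) (?T x))"
      using Z_seq_eq[OF nt, of n] orbit_later[OF order.refl visit_le_vacation, of n]
      by (simp add: vacation_orbit_def visit_orbit_def)
  qed
  then show "AE x in P. Z_seq G n (k, x) = vacation_orbit G n (k, x)" by eventually_elim simp
  have "(\<integral>x. v ^ Z_seq G n (k, x) \<partial>P) = (\<integral>x. v ^ visit_orbit G n (k, x) * v ^ card (arrived (k, x) (?T x + ?L x) - arrived (k, x) (?T x)) \<partial>P)"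
  proof (rule Bochner_Integration.integral_cong_AE)
    show "AE x in P. v ^ Z_seq G n (k, x) = v ^ visit_orbit G n (k, x) * v ^ card (arrived (k, x) (?T x + ?L x) - arrived (k, x) (?T x))"
      using Z by eventually_elim (simp only: power_add)
  qed measurable
  also have "\<dots> = (\<integral>x. v ^ visit_orbit G n (k, x) * exp (- of_real (lam * ?L x) * (1 - v)) \<partial>P)"
  proof (rule arrivals_gf)
    show "norm (v ^ visit_orbit G n (k, x)) \<le> 1" for x using v by (simp add: norm_power power_le_one)
    fix x assume g: "good_clocks x"
    interpret good_sample G "(k, x)" by (rule good_sampleI[OF g])
    show "0 \<le> ?T x \<and> 0 \<le> ?L x" using glue_nonneg[of n] glue_less_visit[of n] visit_le_vacation[of n] by simp
    fix x' assume h: "same_history (?T x) (k, x) (k, x')"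
    show "?T x' = ?T x \<and> ?L x' = ?L x \<and> v ^ visit_orbit G n (k, x') = v ^ visit_orbit G n (k, x)"
      using visit_same_history[OF g h] by simp
  qed (measurable, rule v)
  also have "\<dots> = (\<integral>x. (\<lambda>q m y. v ^ m * exp (- of_real (lam * (\<Sum>j<q. y j)) * (1 - v)))
     (served G n (k, x)) (visit_orbit G n (k, x)) (\<lambda>j. x (Service n j)) \<partial>P)"
    by (simp add: vacation_start_def)
  also have "\<dots> = (\<integral>x. (\<integral>y. (\<lambda>q m y. v ^ m * exp (- of_real (lam * (\<Sum>j<q. y j)) * (1 - v)))
     (served G n (k, x)) (visit_orbit G n (k, x)) (\<lambda>j. y (Service n j)) \<partial>P) \<partial>P)"
  proof (rule integral_services)
    have "integrable P (\<lambda>x. v ^ visit_orbit G n (k, x) * exp (- of_real (lam * ?L x) * (1 - v)))"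
    proof (rule P.integrable_const_bound[where B=1])
      show "AE x in P. norm (v ^ visit_orbit G n (k, x) * exp (- of_real (lam * ?L x) * (1 - v))) \<le> 1"
        using AE_good_clocks
      proof eventually_elim
        fix x assume g: "good_clocks x"
        interpret good_sample G "(k, x)" by (rule good_sampleI[OF g])
        show "norm (v ^ visit_orbit G n (k, x) * exp (- of_real (lam * ?L x) * (1 - v))) \<le> 1"
          unfolding norm_mult norm_power
          using v lam visit_le_vacation[of n] by (intro mult_le_one power_le_one norm_exp_gap_le) auto
      qed
    qed measurable
    then show "integrable P (\<lambda>x. v ^ visit_orbit G n (k, x) * exp (- of_real (lam * (\<Sum>j<served G n (k, x). x (Service n j))) * (1 - v)))"
      by (simp add: vacation_start_def)
  qed
  also have "\<dots> = (\<integral>x. lst FB (of_real lam * (1 - v)) ^ served G n (k, x) * v ^ visit_orbit G n (k, x) \<partial>P)"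
  proof (intro Bochner_Integration.integral_cong refl)
    fix x
    have "(\<integral>y. exp (- of_real (lam * (\<Sum>j<q. y (Service n j))) * (1 - v)) \<partial>P) = lst FB (of_real lam * (1 - v)) ^ q" for q
      unfolding exp_sum_services
      using integral_prod_services(1)[of "\<lambda>_ z. exp (- (of_real lam * (1 - v)) * of_real z)", where q=q and n=n] integrable_exp_FB[OF v]
      by (simp add: lst_def)
    then show "(\<integral>y. (\<lambda>q m y. v ^ m * exp (- of_real (lam * (\<Sum>j<q. y j)) * (1 - v)))
     (served G n (k, x)) (visit_orbit G n (k, x)) (\<lambda>j. y (Service n j)) \<partial>P) = lst FB (of_real lam * (1 - v)) ^ served G n (k, x) * v ^ visit_orbit G n (k, x)"
      by (simp only: integral_mult_right_zero mult.commute)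
  qed
  finally show "(\<integral>x. v ^ Z_seq G n (k, x) \<partial>P) = (\<integral>x. lst FB (of_real lam * (1 - v)) ^ served G n (k, x) * v ^ visit_orbit G n (k, x) \<partial>P)" .
qed

text \<open>The scheme of \<open>visit_gf\<close>, with a single independent clock as the
  length.\<close>

lemma vacation_gf:
  assumes v: "norm v \<le> 1"
  shows "(\<integral>x. v ^ X_seq G (Suc n) (k, x) \<partial>P) = lst FS (of_real lam * (1 - v)) * (\<integral>x. v ^ Z_seq G n (k, x) \<partial>P)"
proof -
  let ?T = "\<lambda>x. vacation_start G n (k, x)"
  have [measurable]: "(\<lambda>x. X_seq G (Suc n) (k, x)) \<in> measurable P (count_space UNIV)"
    unfolding X_seq_def num_system_def by measurable
  have [measurable]: "(\<lambda>x. Z_seq G n (k, x)) \<in> measurable P (count_space UNIV)"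
    unfolding Z_seq_def num_system_def by measurable
  have "(\<integral>x. v ^ X_seq G (Suc n) (k, x) \<partial>P) = (\<integral>x. v ^ vacation_orbit G n (k, x) * v ^ card (arrived (k, x) (?T x + x (Vacation n)) - arrived (k, x) (?T x)) \<partial>P)"
  proof (rule Bochner_Integration.integral_cong_AE)
    show "AE x in P. v ^ X_seq G (Suc n) (k, x) = v ^ vacation_orbit G n (k, x) * v ^ card (arrived (k, x) (?T x + x (Vacation n)) - arrived (k, x) (?T x))"
      using AE_good_clocks AE_no_tie_cycle[of k]
    proof eventually_elim
      fix x assume g: "good_clocks x" and nt: "good_sample.no_tie G (k, x)"
      interpret good_sample G "(k, x)" by (rule good_sampleI[OF g])
      show "v ^ X_seq G (Suc n) (k, x) = v ^ vacation_orbit G n (k, x) * v ^ card (arrived (k, x) (?T x + x (Vacation n)) - arrived (k, x) (?T x))"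
        using X_seq_eq[OF nt, of "Suc n"] orbit_later[OF visit_le_vacation vacation_le_glue, of n]
        by (simp add: vacation_orbit_def glue_start_Suc power_add)
    qed
  qed measurable
  also have "\<dots> = (\<integral>x. v ^ vacation_orbit G n (k, x) * exp (- of_real (lam * x (Vacation n)) * (1 - v)) \<partial>P)"
  proof (rule arrivals_gf)
    show "norm (v ^ vacation_orbit G n (k, x)) \<le> 1" for x using v by (simp add: norm_power power_le_one)
    fix x assume g: "good_clocks x"
    interpret good_sample G "(k, x)" by (rule good_sampleI[OF g])
    show "0 \<le> ?T x \<and> 0 \<le> x (Vacation n)"
      using glue_nonneg[of n] glue_less_visit[of n] visit_le_vacation[of n] clocks(4)[of n] by simp
    fix x' assume h: "same_history (?T x) (k, x) (k, x')"
    show "?T x' = ?T x \<and> x' (Vacation n) = x (Vacation n) \<and> v ^ vacation_orbit G n (k, x') = v ^ vacation_orbit G n (k, x)"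
      using vacation_same_history[OF g h] by simp
  qed (measurable, rule v)
  also have "\<dots> = (\<integral>x. (\<integral>y. v ^ vacation_orbit G n (k, x) * exp (- of_real (lam * y (Vacation n)) * (1 - v)) \<partial>P) \<partial>P)"
  proof (rule integral_vacation[where f="\<lambda>m a. v ^ m * exp (- of_real (lam * a) * (1 - v))"])
    show "integrable P (\<lambda>x. v ^ vacation_orbit G n (k, x) * exp (- of_real (lam * x (Vacation n)) * (1 - v)))"
    proof (rule P.integrable_const_bound[where B=1])
      show "AE x in P. norm (v ^ vacation_orbit G n (k, x) * exp (- of_real (lam * x (Vacation n)) * (1 - v))) \<le> 1"
        using AE_good_clocks
      proof eventually_elim
        fix x assume "good_clocks x"
        then have "0 \<le> lam * x (Vacation n)" using lam by (simp add: good_clocks_def)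
        then show "norm (v ^ vacation_orbit G n (k, x) * exp (- of_real (lam * x (Vacation n)) * (1 - v))) \<le> 1"
          unfolding norm_mult norm_power using v by (intro mult_le_one power_le_one norm_exp_gap_le) auto
      qed
    qed measurable
  qed
  also have "\<dots> = (\<integral>x. lst FS (of_real lam * (1 - v)) * v ^ vacation_orbit G n (k, x) \<partial>P)"
  proof (intro Bochner_Integration.integral_cong refl)
    fix x
    have "(\<integral>y. exp (- of_real (lam * y (Vacation n)) * (1 - v)) \<partial>P) = lst FS (of_real lam * (1 - v))"
      using integral_coordinate[of "\<lambda>a. exp (- of_real (lam * a) * (1 - v))" "Vacation n"]
      by (simp add: lst_def mult_ac)
    then show "(\<integral>y. v ^ vacation_orbit G n (k, x) * exp (- of_real (lam * y (Vacation n)) * (1 - v)) \<partial>P) = lst FS (of_real lam * (1 - v)) * v ^ vacation_orbit G n (k, x)"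
      by (simp only: integral_mult_right_zero mult.commute)
  qed
  also have "\<dots> = lst FS (of_real lam * (1 - v)) * (\<integral>x. v ^ Z_seq G n (k, x) \<partial>P)"
  proof -
    have "(\<integral>x. v ^ vacation_orbit G n (k, x) \<partial>P) = (\<integral>x. v ^ Z_seq G n (k, x) \<partial>P)"
    proof (rule Bochner_Integration.integral_cong_AE)
      show "AE x in P. v ^ vacation_orbit G n (k, x) = v ^ Z_seq G n (k, x)"
        using visit_gf(2)[OF v, where k=k and n=n] by eventually_elim simp
    qed measurable
    then show ?thesis by (simp only: integral_mult_right_zero)
  qed
  finally show ?thesis .
qed

sublocale PL: pair_sigma_finite P lborel ..

text \<open>The time integral of \<open>arrivals_gf\<close>. Fubini brings the time outside; for
  each fixed \<open>s\<close> the window has constant length, and the restriction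
  \<open>s \<le> D x\<close> is absorbed into the factor.\<close>

lemma period_arrivals:
  fixes f :: "(clock \<Rightarrow> real) \<Rightarrow> real \<Rightarrow> complex"
  assumes [measurable]: "T \<in> borel_measurable P" "D \<in> borel_measurable P"
    and f [measurable]: "(\<lambda>(x, s). f x s) \<in> borel_measurable (P \<Otimes>\<^sub>M borel)"
    and D: "integrable P D" and f_le: "\<And>x s. norm (f x s) \<le> 1" and v: "norm v \<le> 1"
    and dom: "\<And>x. good_clocks x \<Longrightarrow> 0 \<le> T x \<and> 0 \<le> D x"
    and stop: "\<And>x x'. good_clocks x \<Longrightarrow> good_clocks x' \<Longrightarrow> same_history (T x) (k, x) (k, x') \<Longrightarrow>
       T x' = T x \<and> D x' = D x \<and> f x' = f x"
  shows "(\<integral>x. (LBINT s:{0..D x}. f x s * v ^ card (arrived (k, x) (T x + s) - arrived (k, x) (T x))) \<partial>P)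
    = (\<integral>x. (LBINT s:{0..D x}. f x s * exp (- of_real (lam * s) * (1 - v))) \<partial>P)"
proof -
  \<comment> \<open>The indicator of the region under \<open>D\<close> dominates the integrand, and
    its integral is the mean of the positive part of \<open>D\<close>.\<close>
  have dom_int: "integrable (P \<Otimes>\<^sub>M lborel) (\<lambda>z. (if 0 \<le> snd z \<and> snd z \<le> D (fst z) then 1 else 0 :: real))"
  proof (rule PL.Fubini_integrable)
    show "(\<lambda>z. (if 0 \<le> snd z \<and> snd z \<le> D (fst z) then 1 else 0 :: real)) \<in> borel_measurable (P \<Otimes>\<^sub>M lborel)" by measurable
    have ind: "(\<lambda>s. (if 0 \<le> s \<and> s \<le> D x then 1 else 0 :: real)) = indicator {0..D x}" for x
      by (auto simp: indicator_def fun_eq_iff)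
    have "(\<integral>s. (if 0 \<le> s \<and> s \<le> D x then 1 else 0 :: real) \<partial>lborel) = max 0 (D x)" for x
      unfolding ind by (cases "0 \<le> D x") auto
    then show "integrable P (\<lambda>x. \<integral>s. norm (if 0 \<le> snd (x, s) \<and> snd (x, s) \<le> D (fst (x, s)) then 1 else 0 :: real) \<partial>lborel)"
      using D by simp
    show "AE x in P. integrable lborel (\<lambda>s. if 0 \<le> snd (x, s) \<and> snd (x, s) \<le> D (fst (x, s)) then 1 else 0 :: real)"
      by (simp add: ind emeasure_lborel_Icc_eq)
  qed
  \<comment> \<open>The cut-off belongs to the factor \<open>\<Phi>\<close> of
    \<open>arrivals_gf\<close>, so \<open>D\<close> has to be known at time \<open>T\<close>; this
    is part of \<open>stop\<close>.\<close>
  define I where "I = (\<lambda>x s. if 0 \<le> s \<and> s \<le> D x then f x s else 0)"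
  have f' [measurable]: "(\<lambda>z. f (fst z) (snd z)) \<in> borel_measurable (P \<Otimes>\<^sub>M borel)" using f by (simp add: case_prod_unfold)
  have I_meas [measurable]: "(\<lambda>z. I (fst z) (snd z)) \<in> borel_measurable (P \<Otimes>\<^sub>M lborel)"
  proof -
    have "(\<lambda>z. f (fst z) (snd z)) \<in> borel_measurable (P \<Otimes>\<^sub>M lborel)"
      using f' measurable_cong_sets[OF sets_pair_measure_cong[OF refl sets_lborel] refl] by blast
    then show ?thesis unfolding I_def by measurable
  qed
  have I_sec: "(\<lambda>x. I x s) \<in> borel_measurable P" for s
    using measurable_compose[OF measurable_Pair2'[of s lborel P] I_meas] by simp
  have swap: "(\<integral>x. (LBINT s:{0..D x}. f x s * g x s) \<partial>P) = (\<integral>s. (\<integral>x. I x s * g x s \<partial>P) \<partial>lborel)"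
    if [measurable]: "(\<lambda>z. g (fst z) (snd z)) \<in> borel_measurable (P \<Otimes>\<^sub>M lborel)"
      and g: "AE x in P. \<forall>s. 0 \<le> s \<longrightarrow> s \<le> D x \<longrightarrow> norm (g x s) \<le> 1" for g
  proof -
    have gI: "AE z in P \<Otimes>\<^sub>M lborel. norm (I (fst z) (snd z) * g (fst z) (snd z)) \<le> norm (if 0 \<le> snd z \<and> snd z \<le> D (fst z) then 1 else 0 :: real)"
    proof (rule PL.AE_pair_measure)
      have "{z \<in> space (P \<Otimes>\<^sub>M lborel). norm (I (fst z) (snd z) * g (fst z) (snd z)) \<le> norm (if 0 \<le> snd z \<and> snd z \<le> D (fst z) then 1 else 0 :: real)} \<in> sets (P \<Otimes>\<^sub>M lborel)"
        by measurable
      then show "{z \<in> space (P \<Otimes>\<^sub>M lborel). norm (I (fst z) (snd z) * g (fst z) (snd z)) \<le> norm (if 0 \<le> snd z \<and> snd z \<le> D (fst z) then 1 else 0 :: real)} \<in> sets (P \<Otimes>\<^sub>M lborel)" .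
      show "AE x in P. AE s in lborel. norm (I (fst (x, s)) (snd (x, s)) * g (fst (x, s)) (snd (x, s)))
         \<le> norm (if 0 \<le> snd (x, s) \<and> snd (x, s) \<le> D (fst (x, s)) then 1 else 0 :: real)"
        using g
      proof eventually_elim
        fix x assume "\<forall>s. 0 \<le> s \<longrightarrow> s \<le> D x \<longrightarrow> norm (g x s) \<le> 1"
        then show "AE s in lborel. norm (I (fst (x, s)) (snd (x, s)) * g (fst (x, s)) (snd (x, s)))
         \<le> norm (if 0 \<le> snd (x, s) \<and> snd (x, s) \<le> D (fst (x, s)) then 1 else 0 :: real)"
          using f_le by (intro AE_I2) (auto simp: I_def norm_mult intro!: mult_le_one)
      qed
    qed
    have "integrable (P \<Otimes>\<^sub>M lborel) (\<lambda>z. I (fst z) (snd z) * g (fst z) (snd z))"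
      by (rule Bochner_Integration.integrable_bound[OF dom_int _ gI]) measurable
    then have "integrable (P \<Otimes>\<^sub>M lborel) (case_prod (\<lambda>x s. I x s * g x s))"
      by (simp add: case_prod_unfold)
    from PL.Fubini_integral[OF this]
    have "(\<integral>s. (\<integral>x. I x s * g x s \<partial>P) \<partial>lborel) = (\<integral>x. (\<integral>s. I x s * g x s \<partial>lborel) \<partial>P)" .
    moreover have "(\<integral>s. I x s * g x s \<partial>lborel) = (LBINT s:{0..D x}. f x s * g x s)" for x
      unfolding set_lebesgue_integral_def by (intro Bochner_Integration.integral_cong refl) (auto simp: I_def indicator_def)
    ultimately show ?thesis by simp
  qed
  have "(\<integral>x. (LBINT s:{0..D x}. f x s * v ^ card (arrived (k, x) (T x + s) - arrived (k, x) (T x))) \<partial>P)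
     = (\<integral>s. (\<integral>x. I x s * v ^ card (arrived (k, x) (T x + s) - arrived (k, x) (T x)) \<partial>P) \<partial>lborel)"
  proof (rule swap)
    show "AE x in P. \<forall>s. 0 \<le> s \<longrightarrow> s \<le> D x \<longrightarrow> norm (v ^ card (arrived (k, x) (T x + s) - arrived (k, x) (T x))) \<le> 1"
      using v by (intro AE_I2) (simp add: norm_power power_le_one)
  qed measurable
  also have "\<dots> = (\<integral>s. (\<integral>x. I x s * exp (- of_real (lam * s) * (1 - v)) \<partial>P) \<partial>lborel)"
  proof (rule Bochner_Integration.integral_cong[OF refl])
    fix s :: real
    show "(\<integral>x. I x s * v ^ card (arrived (k, x) (T x + s) - arrived (k, x) (T x)) \<partial>P) = (\<integral>x. I x s * exp (- of_real (lam * s) * (1 - v)) \<partial>P)"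
    proof (rule arrivals_gf[where T=T and L="\<lambda>_. s" and \<Phi>="\<lambda>x. I x s"])
      show "norm (I x s) \<le> 1" for x using f_le by (simp add: I_def)
      show "0 \<le> T x \<and> 0 \<le> s" if "good_clocks x" "I x s \<noteq> 0" for x
        using that dom[of x] by (auto simp: I_def split: if_splits)
      show "T x' = T x \<and> s = s \<and> I x' s = I x s"
        if "good_clocks x" "good_clocks x'" "same_history (T x) (k, x) (k, x')" for x x'
        using stop[OF that] by (simp add: I_def)
      show "(\<lambda>x. I x s) \<in> borel_measurable P" by (rule I_sec)
    qed (use v in simp_all)
  qed
  also have "\<dots> = (\<integral>x. (LBINT s:{0..D x}. f x s * exp (- of_real (lam * s) * (1 - v))) \<partial>P)"
  proof (rule swap[symmetric])
    show "AE x in P. \<forall>s. 0 \<le> s \<longrightarrow> s \<le> D x \<longrightarrow> norm (exp (- of_real (lam * s) * (1 - v))) \<le> 1"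
      using norm_exp_gap_le[OF _ v] lam by (intro AE_I2 allI impI) simp
  qed measurable
  finally show ?thesis .
qed

end

section \<open>The first cycle from a fixed initial number\<close>

text \<open>A fixed sequence in [0, 1) tending to 1, along which derivatives at 1 are taken.\<close>

definition to_one :: "nat \<Rightarrow> real" where "to_one m = 1 - 1 / real (Suc m)"

lemma to_one: "0 \<le> to_one m" "to_one m < 1" "to_one \<longlonglongrightarrow> 1"
proof -
  show "0 \<le> to_one m" "to_one m < 1" by (simp_all add: to_one_def divide_le_eq)
  have "(\<lambda>m. 1 - 1 / real (Suc m)) \<longlonglongrightarrow> 1 - 0"
    by (intro tendsto_diff tendsto_const LIMSEQ_Suc[OF lim_1_over_n])
  then show "to_one \<longlonglongrightarrow> 1" by (simp add: to_one_def[abs_def])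
qed

lemma one_minus_mult_le:
  fixes a b :: real
  assumes "0 \<le> a" "a \<le> 1" "0 \<le> b" "b \<le> 1" shows "1 - a * b \<le> (1 - a) + (1 - b)"
proof -
  have "0 \<le> (1 - a) * (1 - b)" using assms by simp
  then show ?thesis by (simp add: algebra_simps)
qed

lemma lbint_mult_right:
  fixes c :: complex
  shows "(LBINT t:A. c * f t) = c * (LBINT t:A. f t)"
  by (simp add: set_lebesgue_integral_def flip: integral_mult_right_zero mult_scaleR_right)

text \<open>During the (j+1)-st of \<open>q\<close> services the queue has \<open>q - j\<close> customers, and \<open>j\<close> completed services have fed the orbit.\<close>

definition run_length_gf :: "complex \<Rightarrow> complex \<Rightarrow> nat \<Rightarrow> complex" where
  "run_length_gf z b q = (\<Sum>j<q. z ^ (q - j) * b ^ j)"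

context glue_model
begin

text \<open>Generating function for the place of one orbiting customer after time \<open>t\<close>
  of a glue period: in the queue, marked \<open>u\<close>, or still in orbit, marked
  \<open>v\<close>.\<close>

definition stick :: "real \<Rightarrow> complex \<Rightarrow> complex \<Rightarrow> complex" where
  "stick t u v = of_real (1 - exp (- nu * t)) * u + of_real (exp (- nu * t)) * v"

lemma visit_start_gf:
  fixes u v :: complex
  assumes u: "norm u \<le> 1" and v: "norm v \<le> 1"
  shows "(\<integral>x. u ^ served G n (k, x) * v ^ visit_orbit G n (k, x) \<partial>P)
    = exp (- of_real (lam * G) * (1 - u)) * (\<integral>x. stick G u v ^ X_seq G n (k, x) \<partial>P)"
proof -
  define J where "J = (\<lambda>x. {c \<in> customers (k, x). attempts (k, x) c \<inter> {glue_start G n (k, x)..glue_start G n (k, x) + G} \<noteq> {}})"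
  have "queue_of G (k, x) (glue_start G n (k, x)) (prior G n (k, x)) = J x - prior G n (k, x)" for x
    by (auto simp: queue_of_def J_def)
  then have "served G n (k, x) = card (J x - prior G n (k, x))" "prior G (Suc n) (k, x) = prior G n (k, x) \<union> J x" for x
    unfolding served_eq prior_Suc by simp_all
  then have "(\<integral>x. u ^ served G n (k, x) * v ^ visit_orbit G n (k, x) \<partial>P)
     = (\<integral>x. u ^ card (J x - prior G n (k, x)) * v ^ card (arrived (k, x) (glue_start G n (k, x) + G) - (prior G n (k, x) \<union> J x)) \<partial>P)"
    by (simp add: visit_orbit_def visit_start_def)
  then show ?thesis using glue_gf[OF less_imp_le[OF G] u v, of k n] by (simp add: J_def stick_def)
qed

lemma AE_X_seq_0: "AE x in P. X_seq G 0 (k, x) = k"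
  using AE_good_clocks AE_no_tie_cycle[of k]
proof eventually_elim
  fix x assume g: "good_clocks x" and nt: "good_sample.no_tie G (k, x)"
  interpret good_sample G "(k, x)" by (rule good_sampleI[OF g])
  have pos: "\<not> entry_time (k, x) (Arrival i) \<le> 0" for i
    using att_pos[of "Arrival i" 0] by simp
  have "arrived (k, x) 0 = Initial ` {..<k}"
  proof (rule set_eqI)
    fix c show "c \<in> arrived (k, x) 0 \<longleftrightarrow> c \<in> Initial ` {..<k}"
      by (cases c) (auto simp: arrived_def customers_def pos simp del: entry_time.simps(2))
  qed
  then show "X_seq G 0 (k, x) = k"
    using X_seq_eq[OF nt, of 0] by (simp add: card_image inj_on_def)
qed

lemma X_seq_0_integral: "(\<integral>x. z ^ X_seq G 0 (k, x) \<partial>P) = (z :: complex) ^ k"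
proof -
  have [measurable]: "(\<lambda>x. X_seq G 0 (k, x)) \<in> measurable P (count_space UNIV)"
    unfolding X_seq_def num_system_def by measurable
  have "(\<integral>x. z ^ X_seq G 0 (k, x) \<partial>P) = (\<integral>x. z ^ k \<partial>P)"
  proof (rule Bochner_Integration.integral_cong_AE)
    show "AE x in P. z ^ X_seq G 0 (k, x) = z ^ k"
      using AE_X_seq_0[of k] by eventually_elim simp
  qed measurable
  then show ?thesis using P.P.prob_space by simp
qed

text \<open>Obtained from the explicit generating function for \<open>k\<close> initial customers.
  The bound counts all of them as served; being linear in \<open>k\<close>, it can later be
  integrated against \<open>X\<close>.\<close>

lemma served_mean:
  shows served_integrable: "integrable P (\<lambda>x. real (served G 0 (k, x)))"
    and served_mean_le: "(\<integral>x. real (served G 0 (k, x)) \<partial>P) \<le> lam * G + real k"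
proof -
  let ?e = "exp (- nu * G)"
  have e: "0 \<le> ?e" "?e \<le> 1" using nu G by auto
  have gf: "(\<integral>x. u ^ served G 0 (k, x) \<partial>P) = exp (- (lam * G) * (1 - u)) * (1 - (1 - ?e) * (1 - u)) ^ k"
    if u: "0 \<le> u" "u < 1" for u :: real
  proof -
    have "complex_of_real (\<integral>x. u ^ served G 0 (k, x) \<partial>P) = (\<integral>x. of_real u ^ served G 0 (k, x) * 1 ^ visit_orbit G 0 (k, x) \<partial>P)"
      by (simp flip: integral_complex_of_real)
    also have "\<dots> = exp (- of_real (lam * G) * (1 - of_real u)) * stick G (of_real u) 1 ^ k"
      using u by (subst visit_start_gf) (auto simp: X_seq_0_integral)
    also have "stick G (of_real u) 1 = of_real (1 - (1 - ?e) * (1 - u))"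
      by (simp add: stick_def algebra_simps)
    also have "exp (- of_real (lam * G) * (1 - of_real u)) = complex_of_real (exp (- (lam * G) * (1 - u)))"
      using exp_of_real[of "- (lam * G) * (1 - u)", where 'a=complex] by simp
    also have "complex_of_real (exp (- (lam * G) * (1 - u))) * of_real (1 - (1 - ?e) * (1 - u)) ^ k
        = of_real (exp (- (lam * G) * (1 - u)) * (1 - (1 - ?e) * (1 - u)) ^ k)" by simp
    finally show ?thesis by (simp only: of_real_eq_iff)
  qed
  have le: "1 - (\<integral>x. u ^ served G 0 (k, x) \<partial>P) \<le> (lam * G + real k) * (1 - u)" if u: "0 \<le> u" "u < 1" for u :: real
  proof -
    define d where "d = (1 - ?e) * (1 - u)"
    have d: "0 \<le> d" "d \<le> 1" "d \<le> 1 - u" unfolding d_def using e u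
      by (auto intro: mult_le_one mult_left_le_one_le)
    have a: "0 \<le> lam * G * (1 - u)" using lam G u by simp
    \<comment> \<open>Bernoulli's inequality linearises the power,
      \<open>1 - exp (- a) \<le> a\<close> the exponential, and \<open>one_minus_mult_le\<close>
      their product.\<close>
    have "1 + real k * (- d) \<le> (1 + - d) ^ k" using d by (intro Bernoulli_inequality) simp
    then have 1: "1 - (1 - d) ^ k \<le> real k * d" by simp
    have "real k * d \<le> real k * (1 - u)" using d by (intro mult_left_mono) auto
    moreover have "1 - exp (- (lam * G * (1 - u))) \<le> lam * G * (1 - u)"
      using exp_ge_add_one_self[of "- (lam * G * (1 - u))"] by simp
    moreover have "1 - exp (- (lam * G * (1 - u))) * (1 - d) ^ k \<le> (1 - exp (- (lam * G * (1 - u)))) + (1 - (1 - d) ^ k)"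
      using a d by (intro one_minus_mult_le power_le_one) auto
    ultimately show ?thesis using 1 unfolding gf[OF u] d_def[symmetric] by (simp add: algebra_simps)
  qed
  have m: "(\<lambda>x. served G 0 (k, x)) \<in> measurable P (count_space UNIV)" by measurable
  show i: "integrable P (\<lambda>x. real (served G 0 (k, x)))"
    by (rule gf_mean_integrable[where u=to_one, OF P.prob_space_axioms m to_one]) (rule le[OF to_one(1,2)])
  have "(\<lambda>j. (1 - (\<integral>x. to_one j ^ served G 0 (k, x) \<partial>P)) / (1 - to_one j)) \<longlonglongrightarrow> (\<integral>x. real (served G 0 (k, x)) \<partial>P)"
    by (rule gf_mean_tendsto[OF P.prob_space_axioms m to_one i])
  then show "(\<integral>x. real (served G 0 (k, x)) \<partial>P) \<le> lam * G + real k"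
  proof (rule LIMSEQ_le_const2)
    have "(1 - (\<integral>x. to_one j ^ served G 0 (k, x) \<partial>P)) / (1 - to_one j) \<le> lam * G + real k" for j
      using le[OF to_one(1,2)[of j]] to_one(2)[of j] by (simp add: divide_le_eq)
    then show "\<exists>N. \<forall>j\<ge>N. (1 - (\<integral>x. to_one j ^ served G 0 (k, x) \<partial>P)) / (1 - to_one j) \<le> lam * G + real k"
      by blast
  qed
qed

definition visit_length :: "nat \<Rightarrow> (clock \<Rightarrow> real) \<Rightarrow> real" where
  "visit_length k x = vacation_start G 0 (k, x) - visit_start G 0 (k, x)"

lemma visit_length_eq: "visit_length k x = (\<Sum>j<served G 0 (k, x). x (Service 0 j))"
  by (simp add: visit_length_def vacation_start_def)

lemma visit_length_measurable [measurable]: "visit_length k \<in> borel_measurable P"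
  unfolding visit_length_def[abs_def] by measurable

lemma AE_visit_length: "AE x in P. 0 \<le> visit_length k x"
  using AE_good_clocks
proof eventually_elim
  fix x assume g: "good_clocks x"
  interpret good_sample G "(k, x)" by (rule good_sampleI[OF g])
  show "0 \<le> visit_length k x" using visit_le_vacation[of 0] by (simp add: visit_length_def)
qed

lemma services_mean:
  shows "integrable P (\<lambda>y. \<Sum>j<q. y (Service 0 j))"
    and "(\<integral>y. (\<Sum>j<q. y (Service 0 j)) \<partial>P) = real q * (\<integral>z. z \<partial>FB)"
proof -
  have i: "integrable P (\<lambda>y. y (Service 0 j))" for j
    by (rule integrable_coordinate[where g="\<lambda>z. z"]) (simp add: integrable_FB)
  then show "integrable P (\<lambda>y. \<Sum>j<q. y (Service 0 j))" by simp
  have "(\<integral>y. (\<Sum>j<q. y (Service 0 j)) \<partial>P) = (\<Sum>j<q. \<integral>y. y (Service 0 j) \<partial>P)"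
    using i by (rule Bochner_Integration.integral_sum)
  also have "\<dots> = (\<Sum>j<q. \<integral>z. z \<partial>FB)"
    using integral_coordinate[of "\<lambda>z. z"] by simp
  finally show "(\<integral>y. (\<Sum>j<q. y (Service 0 j)) \<partial>P) = real q * (\<integral>z. z \<partial>FB)" by simp
qed

text \<open>Wald's identity, by conditioning on the number served. The computation is done with
  nonnegative integrals, since integrability is part of the claim.\<close>

lemma visit_length_mean:
  shows visit_length_integrable: "integrable P (visit_length k)"
    and visit_length_integral: "(\<integral>x. visit_length k x \<partial>P) = (\<integral>x. real (served G 0 (k, x)) \<partial>P) * (\<integral>z. z \<partial>FB)"
proof -
  have EB: "0 \<le> (\<integral>z. z \<partial>FB)" using FB by (simp add: nonneg_law_def)
  have a: "override_on x y (range (Service 0)) a = x a" if "a \<notin> later_clocks 0" for x y :: "clock \<Rightarrow> real" and a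
    using that by (auto simp: override_on_def later_clocks_def)
  have s: "served G 0 (k, override_on x y (range (Service 0))) = served G 0 (k, x)" for x y
    by (rule agree_before[OF a])
  have "(\<integral>\<^sup>+x. ennreal (visit_length k x) \<partial>P) = (\<integral>\<^sup>+x. (\<integral>\<^sup>+y. ennreal (visit_length k (override_on x y (range (Service 0)))) \<partial>P) \<partial>P)"
    by (rule nn_integral_resample) measurable
  also have "\<dots> = (\<integral>\<^sup>+x. ennreal (real (served G 0 (k, x)) * (\<integral>z. z \<partial>FB)) \<partial>P)"
  proof (rule nn_integral_cong)
    fix x
    have "(\<integral>\<^sup>+y. ennreal (visit_length k (override_on x y (range (Service 0)))) \<partial>P) = (\<integral>\<^sup>+y. ennreal (\<Sum>j<served G 0 (k, x). y (Service 0 j)) \<partial>P)"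
      unfolding visit_length_eq s by simp
    also have "\<dots> = ennreal (\<integral>y. (\<Sum>j<served G 0 (k, x). y (Service 0 j)) \<partial>P)"
    proof (rule nn_integral_eq_integral[OF services_mean(1)])
      show "AE y in P. 0 \<le> (\<Sum>j<served G 0 (k, x). y (Service 0 j))"
        using AE_good_clocks by eventually_elim (auto simp: good_clocks_def intro!: sum_nonneg)
    qed
    finally show "(\<integral>\<^sup>+y. ennreal (visit_length k (override_on x y (range (Service 0)))) \<partial>P) = ennreal (real (served G 0 (k, x)) * (\<integral>z. z \<partial>FB))"
      by (simp only: services_mean(2))
  qed
  also have "\<dots> = ennreal (\<integral>x. real (served G 0 (k, x)) * (\<integral>z. z \<partial>FB) \<partial>P)"
    using EB by (intro nn_integral_eq_integral) (auto intro: integrable_mult_left served_integrable)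
  finally have nn: "(\<integral>\<^sup>+x. ennreal (visit_length k x) \<partial>P) = ennreal (\<integral>x. real (served G 0 (k, x)) * (\<integral>z. z \<partial>FB) \<partial>P)" .
  show "integrable P (visit_length k)"
    by (rule integrableI_nonneg) (use nn AE_visit_length in auto)
  have "(\<integral>x. visit_length k x \<partial>P) = enn2real (\<integral>\<^sup>+x. ennreal (visit_length k x) \<partial>P)"
    by (rule integral_eq_nn_integral) (use AE_visit_length in auto)
  also have "\<dots> = (\<integral>x. real (served G 0 (k, x)) * (\<integral>z. z \<partial>FB) \<partial>P)"
    unfolding nn using EB by (intro enn2real_ennreal integral_nonneg_AE) auto
  finally show "(\<integral>x. visit_length k x \<partial>P) = (\<integral>x. real (served G 0 (k, x)) \<partial>P) * (\<integral>z. z \<partial>FB)"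
    by simp
qed

lemma period_integral_measurable:
  fixes f :: "(clock \<Rightarrow> real) \<Rightarrow> real \<Rightarrow> complex"
  assumes [measurable]: "a \<in> borel_measurable P" "b \<in> borel_measurable P"
    and f: "(\<lambda>z. f (fst z) (snd z)) \<in> borel_measurable (P \<Otimes>\<^sub>M lborel)"
  shows "(\<lambda>x. LBINT t:{a x..b x}. f x t) \<in> borel_measurable P"
  unfolding set_lebesgue_integral_def
proof (rule lborel.borel_measurable_lebesgue_integral)
  have "(\<lambda>z. indicator {a (fst z)..b (fst z)} (snd z) *\<^sub>R f (fst z) (snd z))
    = (\<lambda>z. if a (fst z) \<le> snd z \<and> snd z \<le> b (fst z) then f (fst z) (snd z) else 0)"
    by (auto simp: indicator_def fun_eq_iff)
  moreover have "\<dots> \<in> borel_measurable (P \<Otimes>\<^sub>M lborel)"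
    using f by measurable
  ultimately show "(\<lambda>(x, t). indicator {a x..b x} t *\<^sub>R f x t) \<in> borel_measurable (P \<Otimes>\<^sub>M lborel)"
    by (simp add: case_prod_unfold)
qed

text \<open>The queue is empty, so \<open>zq\<close> drops out; the orbit is its value at the start
  of the vacation plus the arrivals since then. Averaging over the independent length leaves the
  mean of \<open>exp_integral\<close>.\<close>

lemma vacation_period:
  assumes zq: "norm zq \<le> 1" and zo: "norm zo \<le> 1"
  shows "(\<integral>x. (LBINT t:{vacation_start G 0 (k, x)..glue_start G 1 (k, x)}. zq ^ num_queue G (k, x) t * zo ^ num_orbit G (k, x) t) \<partial>P)
    = (\<integral>x. zo ^ Z_seq G 0 (k, x) \<partial>P) * (\<integral>a. exp_integral (of_real lam * (1 - zo)) a \<partial>FS)"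
proof -
  let ?T = "\<lambda>x. vacation_start G 0 (k, x)" and ?\<theta> = "of_real lam * (1 - zo)"
  have [measurable]: "(\<lambda>x. Z_seq G 0 (k, x)) \<in> measurable P (count_space UNIV)"
    unfolding Z_seq_def num_system_def by measurable
  have exp_eq: "exp (- of_real (lam * s) * (1 - zo)) = exp (- ?\<theta> * of_real s)" for s by (simp add: mult_ac)
  have Vint: "integrable P (\<lambda>x. x (Vacation 0))"
    by (rule integrable_coordinate[where g="\<lambda>z. z"]) (simp add: integrable_FS)
  have "(\<integral>x. (LBINT t:{?T x..glue_start G 1 (k, x)}. zq ^ num_queue G (k, x) t * zo ^ num_orbit G (k, x) t) \<partial>P)
    = (\<integral>x. (LBINT s:{0..x (Vacation 0)}. zo ^ vacation_orbit G 0 (k, x) * zo ^ card (arrived (k, x) (?T x + s) - arrived (k, x) (?T x))) \<partial>P)"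
  proof (rule Bochner_Integration.integral_cong_AE)
    show "AE x in P. (LBINT t:{?T x..glue_start G 1 (k, x)}. zq ^ num_queue G (k, x) t * zo ^ num_orbit G (k, x) t)
      = (LBINT s:{0..x (Vacation 0)}. zo ^ vacation_orbit G 0 (k, x) * zo ^ card (arrived (k, x) (?T x + s) - arrived (k, x) (?T x)))"
      using AE_good_clocks AE_no_tie_cycle[of k]
    proof eventually_elim
      fix x assume g: "good_clocks x" and nt: "good_sample.no_tie G (k, x)"
      interpret good_sample G "(k, x)" by (rule good_sampleI[OF g])
      have len: "glue_start G 1 (k, x) - ?T x = x (Vacation 0)" by (simp add: glue_start_Suc)
      show "(LBINT t:{?T x..glue_start G 1 (k, x)}. zq ^ num_queue G (k, x) t * zo ^ num_orbit G (k, x) t)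
      = (LBINT s:{0..x (Vacation 0)}. zo ^ vacation_orbit G 0 (k, x) * zo ^ card (arrived (k, x) (?T x + s) - arrived (k, x) (?T x)))"
        unfolding set_integral_shift[of "?T x"] len
      proof (rule set_lebesgue_integral_cong)
        show "\<forall>s. s \<in> {0..x (Vacation 0)} \<longrightarrow> zq ^ num_queue G (k, x) (?T x + s) * zo ^ num_orbit G (k, x) (?T x + s)
          = zo ^ vacation_orbit G 0 (k, x) * zo ^ card (arrived (k, x) (?T x + s) - arrived (k, x) (?T x))"
        proof (intro allI impI)
          fix s assume s: "s \<in> {0..x (Vacation 0)}"
          have t: "?T x \<le> ?T x + s" "?T x + s \<le> glue_start G (Suc 0) (k, x)" using s len by auto
          show "zq ^ num_queue G (k, x) (?T x + s) * zo ^ num_orbit G (k, x) (?T x + s)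
          = zo ^ vacation_orbit G 0 (k, x) * zo ^ card (arrived (k, x) (?T x + s) - arrived (k, x) (?T x))"
            using num_vacation[OF t nt] orbit_later[OF visit_le_vacation t(1)]
            by (simp add: vacation_orbit_def power_add)
        qed
      qed simp
    qed
    show "(\<lambda>x. LBINT t:{?T x..glue_start G 1 (k, x)}. zq ^ num_queue G (k, x) t * zo ^ num_orbit G (k, x) t) \<in> borel_measurable P"
      "(\<lambda>x. LBINT s:{0..x (Vacation 0)}. zo ^ vacation_orbit G 0 (k, x) * zo ^ card (arrived (k, x) (?T x + s) - arrived (k, x) (?T x))) \<in> borel_measurable P"
      by (rule period_integral_measurable; measurable)+
  qed
  also have "\<dots> = (\<integral>x. (LBINT s:{0..x (Vacation 0)}. zo ^ vacation_orbit G 0 (k, x) * exp (- of_real (lam * s) * (1 - zo))) \<partial>P)"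
  proof (rule period_arrivals[where T="?T" and D="\<lambda>x. x (Vacation 0)" and f="\<lambda>x s. zo ^ vacation_orbit G 0 (k, x)"])
    show "norm (zo ^ vacation_orbit G 0 (k, x)) \<le> 1" for x using zo by (simp add: norm_power power_le_one)
    fix x assume g: "good_clocks x"
    interpret good_sample G "(k, x)" by (rule good_sampleI[OF g])
    show "0 \<le> ?T x \<and> 0 \<le> x (Vacation 0)"
      using visit_le_vacation[of 0] clocks(4)[of 0] G by simp
    fix x' assume h: "same_history (?T x) (k, x) (k, x')"
    show "?T x' = ?T x \<and> x' (Vacation 0) = x (Vacation 0) \<and> (\<lambda>s::real. zo ^ vacation_orbit G 0 (k, x')) = (\<lambda>s. zo ^ vacation_orbit G 0 (k, x))"
      using vacation_same_history[OF g h] by simp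
  next
    show "integrable P (\<lambda>x. x (Vacation 0))" by (rule Vint)
    show "norm zo \<le> 1" by (rule zo)
  qed measurable
  also have "\<dots> = (\<integral>x. zo ^ vacation_orbit G 0 (k, x) * exp_integral ?\<theta> (x (Vacation 0)) \<partial>P)"
    unfolding exp_integral_def exp_eq by (simp only: lbint_mult_right)
  also have "\<dots> = (\<integral>x. (\<integral>y. zo ^ vacation_orbit G 0 (k, x) * exp_integral ?\<theta> (y (Vacation 0)) \<partial>P) \<partial>P)"
  proof (rule integral_vacation[where f="\<lambda>m a. zo ^ m * exp_integral ?\<theta> a"])
    show "integrable P (\<lambda>x. zo ^ vacation_orbit G 0 (k, x) * exp_integral ?\<theta> (x (Vacation 0)))"
    proof (rule Bochner_Integration.integrable_bound[OF Vint])
      show "AE x in P. norm (zo ^ vacation_orbit G 0 (k, x) * exp_integral ?\<theta> (x (Vacation 0))) \<le> norm (x (Vacation 0))"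
        using AE_good_clocks
      proof eventually_elim
        fix x assume "good_clocks x"
        then have v: "0 \<le> x (Vacation 0)" by (simp add: good_clocks_def)
        have "norm (zo ^ vacation_orbit G 0 (k, x)) * norm (exp_integral ?\<theta> (x (Vacation 0))) \<le> 1 * x (Vacation 0)"
          using norm_exp_integral_le[OF Re_rate[OF zo] v] zo v by (intro mult_mono) (auto simp: norm_power power_le_one)
        then show "norm (zo ^ vacation_orbit G 0 (k, x) * exp_integral ?\<theta> (x (Vacation 0))) \<le> norm (x (Vacation 0))"
          using v by (simp add: norm_mult)
      qed
    qed measurable
  qed
  also have "\<dots> = (\<integral>x. zo ^ vacation_orbit G 0 (k, x) * (\<integral>a. exp_integral ?\<theta> a \<partial>FS) \<partial>P)"
  proof (rule Bochner_Integration.integral_cong[OF refl])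
    fix x
    have "(\<integral>y. exp_integral ?\<theta> (y (Vacation 0)) \<partial>P) = (\<integral>a. exp_integral ?\<theta> a \<partial>FS)"
      using integral_coordinate[of "exp_integral ?\<theta>" "Vacation 0"] by simp
    then show "(\<integral>y. zo ^ vacation_orbit G 0 (k, x) * exp_integral ?\<theta> (y (Vacation 0)) \<partial>P) = zo ^ vacation_orbit G 0 (k, x) * (\<integral>a. exp_integral ?\<theta> a \<partial>FS)"
      by (simp only: integral_mult_right_zero)
  qed
  also have "\<dots> = (\<integral>x. zo ^ vacation_orbit G 0 (k, x) \<partial>P) * (\<integral>a. exp_integral ?\<theta> a \<partial>FS)"
    by (rule integral_mult_left_zero)
  also have "(\<integral>x. zo ^ vacation_orbit G 0 (k, x) \<partial>P) = (\<integral>x. zo ^ Z_seq G 0 (k, x) \<partial>P)"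
  proof (rule Bochner_Integration.integral_cong_AE)
    show "AE x in P. zo ^ vacation_orbit G 0 (k, x) = zo ^ Z_seq G 0 (k, x)"
      using visit_gf(2)[OF zo, where k=k and n=0] by eventually_elim simp
  qed measurable
  finally show ?thesis .
qed

text \<open>The term with index \<open>j\<close> is a product over independent services: one
  exponential for each of the \<open>j\<close> completed ones, and \<open>exp_integral\<close> for
  the one in progress.\<close>

lemma services_run_integral:
  assumes zo: "norm zo \<le> 1"
  defines "\<theta> \<equiv> of_real lam * (1 - zo)"
  shows "(\<integral>y. (\<Sum>j<q. z ^ (q - j) * exp (- \<theta> * of_real (\<Sum>i<j. y (Service 0 i))) * exp_integral \<theta> (y (Service 0 j))) \<partial>P)
    = run_length_gf z (lst FB \<theta>) q * (\<integral>a. exp_integral \<theta> a \<partial>FB)"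
proof -
  \<comment> \<open>For fixed \<open>j\<close>, the factor contributed by service \<open>i\<close>:
    completed if \<open>i < j\<close>, in progress if \<open>i = j\<close>.\<close>
  define \<phi> where "\<phi> = (\<lambda>(j::nat) i a. if i < j then exp (- \<theta> * of_real a) else exp_integral \<theta> a)"
  have \<phi>_meas: "\<phi> j i \<in> borel_measurable borel" for j i :: nat unfolding \<phi>_def by measurable
  have \<phi>_int: "integrable FB (\<phi> j i)" for j i :: nat
  proof (cases "i < j")
    case True
    then show ?thesis using integrable_exp_FB[OF zo] by (simp add: \<phi>_def \<theta>_def)
  next
    case False
    have "integrable FB (exp_integral \<theta>)"
    proof (rule Bochner_Integration.integrable_bound[OF integrable_FB])
      show "exp_integral \<theta> \<in> borel_measurable FB"
        using exp_integral_measurable[of \<theta>] measurable_cong_sets[OF sets_FB refl] by blast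
      show "AE a in FB. norm (exp_integral \<theta> a) \<le> norm a"
        using AE_FB by eventually_elim (use norm_exp_integral_le[OF Re_rate[OF zo]] in \<open>simp add: \<theta>_def\<close>)
    qed
    then show ?thesis using False by (simp add: \<phi>_def)
  qed
  have term_eq: "(\<Prod>i<Suc j. \<phi> j i (y (Service 0 i))) = exp (- \<theta> * of_real (\<Sum>i<j. y (Service 0 i))) * exp_integral \<theta> (y (Service 0 j))"
    for j and y :: "clock \<Rightarrow> real"
  proof -
    have "- \<theta> * of_real (\<Sum>i<j. y (Service 0 i)) = (\<Sum>i<j. - \<theta> * of_real (y (Service 0 i)))"
      by (simp only: sum_distrib_left of_real_sum)
    then have "exp (- \<theta> * of_real (\<Sum>i<j. y (Service 0 i))) = (\<Prod>i<j. exp (- \<theta> * of_real (y (Service 0 i))))"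
      by (simp only:) (rule exp_sum, simp)
    then show ?thesis by (simp add: \<phi>_def)
  qed
  have prod_eq: "(\<Prod>i<Suc j. \<integral>a. \<phi> j i a \<partial>FB) = lst FB \<theta> ^ j * (\<integral>a. exp_integral \<theta> a \<partial>FB)" for j
    by (simp add: \<phi>_def lst_def)
  have each: "(\<integral>y. exp (- \<theta> * of_real (\<Sum>i<j. y (Service 0 i))) * exp_integral \<theta> (y (Service 0 j)) \<partial>P) = lst FB \<theta> ^ j * (\<integral>a. exp_integral \<theta> a \<partial>FB)"
    "integrable P (\<lambda>y. exp (- \<theta> * of_real (\<Sum>i<j. y (Service 0 i))) * exp_integral \<theta> (y (Service 0 j)))" for j
    using integral_prod_services[of "\<phi> j", where q="Suc j" and n=0, OF \<phi>_meas \<phi>_int]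
    unfolding term_eq prod_eq by auto
  have "(\<integral>y. (\<Sum>j<q. z ^ (q - j) * (exp (- \<theta> * of_real (\<Sum>i<j. y (Service 0 i))) * exp_integral \<theta> (y (Service 0 j)))) \<partial>P)
    = (\<Sum>j<q. \<integral>y. z ^ (q - j) * (exp (- \<theta> * of_real (\<Sum>i<j. y (Service 0 i))) * exp_integral \<theta> (y (Service 0 j))) \<partial>P)"
    using each(2) by (intro Bochner_Integration.integral_sum integrable_mult_right)
  also have "\<dots> = (\<Sum>j<q. z ^ (q - j) * (lst FB \<theta> ^ j * (\<integral>a. exp_integral \<theta> a \<partial>FB)))"
    by (simp only: integral_mult_right_zero each(1))
  also have "\<dots> = run_length_gf z (lst FB \<theta>) q * (\<integral>a. exp_integral \<theta> a \<partial>FB)"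
    by (simp add: run_length_gf_def sum_distrib_right mult.assoc)
  finally show ?thesis by (simp add: mult.assoc)
qed

text \<open>The queue is determined by its initial size and the services, so the arrivals to the
  orbit can be averaged first; \<open>step_integral\<close> then cuts the visit into services, and
  these are averaged last.\<close>

lemma visit_period:
  assumes zq: "norm zq \<le> 1" and zo: "norm zo \<le> 1"
  defines "\<theta> \<equiv> of_real lam * (1 - zo)"
  shows "(\<integral>x. (LBINT t:{visit_start G 0 (k, x)..vacation_start G 0 (k, x)}. zq ^ num_queue G (k, x) t * zo ^ num_orbit G (k, x) t) \<partial>P)
    = (\<integral>x. zo ^ visit_orbit G 0 (k, x) * run_length_gf zq (lst FB \<theta>) (served G 0 (k, x)) \<partial>P) * (\<integral>a. exp_integral \<theta> a \<partial>FB)"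
proof -
  let ?T = "\<lambda>x. visit_start G 0 (k, x)"
  define c where "c = (\<lambda>x s. card {j. j < served G 0 (k, x) \<and> (\<Sum>i\<le>j. x (Service 0 i)) \<le> s})"
  define f where "f = (\<lambda>x s. zo ^ visit_orbit G 0 (k, x) * zq ^ (served G 0 (k, x) - c x s))"
  define h where "h = (\<lambda>q m y. zo ^ m * (\<Sum>j<q. zq ^ (q - j) * exp (- \<theta> * of_real (\<Sum>i<j. y i)) * exp_integral \<theta> (y j)))"
  have \<theta>: "0 \<le> Re \<theta>" unfolding \<theta>_def by (rule Re_rate[OF zo])
  have exp_eq: "exp (- of_real (lam * s) * (1 - zo)) = exp (- \<theta> * of_real s)" for s by (simp add: \<theta>_def mult_ac)
  have c_meas [measurable]: "(\<lambda>z. c (g z) (s z)) \<in> measurable N (count_space UNIV)"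
    if [measurable]: "g \<in> measurable N P" "s \<in> borel_measurable N" for g s N
  proof -
    have "(\<lambda>z. g z a) \<in> borel_measurable N" for a using measurable_compose[OF that(1) coord_measurable] .
    then have [measurable]: "(\<lambda>z. \<Sum>i\<le>j. g z (Service 0 i)) \<in> borel_measurable N" for j by measurable
    show ?thesis unfolding c_def by measurable
  qed
  have f_meas [measurable]: "(\<lambda>z. f (g z) (s z)) \<in> borel_measurable N"
    if [measurable]: "g \<in> measurable N P" "s \<in> borel_measurable N" for g s N
    unfolding f_def by measurable
  have h_meas: "(\<lambda>x. h (served G 0 (k, x)) (visit_orbit G 0 (k, x)) (\<lambda>j. x (Service 0 j))) \<in> borel_measurable P"
  proof -
    have "(\<lambda>x. h q (visit_orbit G 0 (k, x)) (\<lambda>j. x (Service 0 j))) \<in> borel_measurable P" for q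
      unfolding h_def by measurable
    then show ?thesis
      by (rule measurable_compose_countable[where g="\<lambda>x. served G 0 (k, x)"
          and f="\<lambda>q x. h q (visit_orbit G 0 (k, x)) (\<lambda>j. x (Service 0 j))"]) measurable
  qed
  have f_le: "norm (f x s) \<le> 1" for x s
    unfolding f_def norm_mult norm_power using zq zo by (intro mult_le_one power_le_one) auto
  have "(\<integral>x. (LBINT t:{?T x..vacation_start G 0 (k, x)}. zq ^ num_queue G (k, x) t * zo ^ num_orbit G (k, x) t) \<partial>P)
    = (\<integral>x. (LBINT s:{0..visit_length k x}. f x s * zo ^ card (arrived (k, x) (?T x + s) - arrived (k, x) (?T x))) \<partial>P)"
  proof (rule Bochner_Integration.integral_cong_AE)
    show "AE x in P. (LBINT t:{?T x..vacation_start G 0 (k, x)}. zq ^ num_queue G (k, x) t * zo ^ num_orbit G (k, x) t)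
      = (LBINT s:{0..visit_length k x}. f x s * zo ^ card (arrived (k, x) (?T x + s) - arrived (k, x) (?T x)))"
      using AE_good_clocks AE_no_tie_cycle[of k]
    proof eventually_elim
      fix x assume g: "good_clocks x" and nt: "good_sample.no_tie G (k, x)"
      interpret good_sample G "(k, x)" by (rule good_sampleI[OF g])
      have x_meas [measurable]: "(\<lambda>s::real. x) \<in> measurable borel P" by simp
      have [measurable]: "(\<lambda>s. num_queue G (k, x) (?T x + s)) \<in> measurable borel (count_space UNIV)"
        "(\<lambda>s. num_orbit G (k, x) (?T x + s)) \<in> measurable borel (count_space UNIV)"
        "(\<lambda>s. card (arrived (k, x) (?T x + s) - arrived (k, x) (?T x))) \<in> measurable borel (count_space UNIV)"
        "(\<lambda>s. f x s) \<in> borel_measurable borel"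
        using num_measurable(3,4)[where k=k and t="\<lambda>s. ?T x + s", OF x_meas] f_meas[OF x_meas, of "\<lambda>s. s"] by measurable
      show "(LBINT t:{?T x..vacation_start G 0 (k, x)}. zq ^ num_queue G (k, x) t * zo ^ num_orbit G (k, x) t)
      = (LBINT s:{0..visit_length k x}. f x s * zo ^ card (arrived (k, x) (?T x + s) - arrived (k, x) (?T x)))"
        unfolding set_integral_shift[of "?T x"] visit_length_def[symmetric] unfolding set_lebesgue_integral_def
      proof (rule Bochner_Integration.integral_cong_AE)
        \<comment> \<open>\<open>completed_first_visit\<close> is stated for times before the end of
          the visit; the last instant is a null set.\<close>
        show "AE s in lborel. indicator {0..visit_length k x} s *\<^sub>R (zq ^ num_queue G (k, x) (?T x + s) * zo ^ num_orbit G (k, x) (?T x + s))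
          = indicator {0..visit_length k x} s *\<^sub>R (f x s * zo ^ card (arrived (k, x) (?T x + s) - arrived (k, x) (?T x)))"
          using AE_lborel_singleton[of "visit_length k x"]
        proof eventually_elim
          fix s :: real assume s: "s \<noteq> visit_length k x"
          show "indicator {0..visit_length k x} s *\<^sub>R (zq ^ num_queue G (k, x) (?T x + s) * zo ^ num_orbit G (k, x) (?T x + s))
          = indicator {0..visit_length k x} s *\<^sub>R (f x s * zo ^ card (arrived (k, x) (?T x + s) - arrived (k, x) (?T x)))"
          proof (cases "s \<in> {0..visit_length k x}")
            case True
            then have t: "?T x \<le> ?T x + s" "?T x + s \<le> vacation_start G 0 (k, x)" and lt: "?T x + s < vacation_start G 0 (k, x)"
              using s by (auto simp: visit_length_def)
            have q: "card (prior G (Suc 0) (k, x)) = served G 0 (k, x)" using card_prior[of "Suc 0"] by simp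
            have c: "card (completed G (k, x) (?T x + s)) = c x s"
              using completed_first_visit[OF lt] by (simp add: c_def)
            show ?thesis
              unfolding num_visit[OF t nt] q c orbit_later[OF order.refl t(1)]
              by (simp add: f_def visit_orbit_def power_add mult_ac)
          qed simp
        qed
      qed measurable
    qed
    show "(\<lambda>x. LBINT t:{?T x..vacation_start G 0 (k, x)}. zq ^ num_queue G (k, x) t * zo ^ num_orbit G (k, x) t) \<in> borel_measurable P"
      "(\<lambda>x. LBINT s:{0..visit_length k x}. f x s * zo ^ card (arrived (k, x) (?T x + s) - arrived (k, x) (?T x))) \<in> borel_measurable P"
      by (rule period_integral_measurable; measurable)+
  qed
  also have "\<dots> = (\<integral>x. (LBINT s:{0..visit_length k x}. f x s * exp (- of_real (lam * s) * (1 - zo))) \<partial>P)"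
  proof (rule period_arrivals[where T="?T" and D="visit_length k" and f=f])
    fix x assume g: "good_clocks x"
    interpret good_sample G "(k, x)" by (rule good_sampleI[OF g])
    show "0 \<le> ?T x \<and> 0 \<le> visit_length k x"
      using visit_le_vacation[of 0] G by (simp add: visit_length_def)
    fix x' assume h: "same_history (?T x) (k, x) (k, x')"
    note s = visit_same_history[OF g h]
    have "f x' = f x" unfolding f_def c_def s(2) s(3) s(5) ..
    then show "?T x' = ?T x \<and> visit_length k x' = visit_length k x \<and> f x' = f x"
      using s by (simp add: visit_length_def)
  next
    show "(\<lambda>(x, s). f x s) \<in> borel_measurable (P \<Otimes>\<^sub>M borel)" unfolding case_prod_unfold by measurable
    show "integrable P (visit_length k)" by (rule visit_length_integrable)
    show "norm (f x s) \<le> 1" for x s by (rule f_le)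
    show "norm zo \<le> 1" by (rule zo)
  qed measurable
  also have "\<dots> = (\<integral>x. h (served G 0 (k, x)) (visit_orbit G 0 (k, x)) (\<lambda>j. x (Service 0 j)) \<partial>P)"
  proof (rule Bochner_Integration.integral_cong_AE)
    show "AE x in P. (LBINT s:{0..visit_length k x}. f x s * exp (- of_real (lam * s) * (1 - zo)))
      = h (served G 0 (k, x)) (visit_orbit G 0 (k, x)) (\<lambda>j. x (Service 0 j))"
      using AE_good_clocks
    proof eventually_elim
      fix x assume g: "good_clocks x"
      have "(LBINT s:{0..visit_length k x}. f x s * exp (- of_real (lam * s) * (1 - zo)))
         = (LBINT s:{0..visit_length k x}. zo ^ visit_orbit G 0 (k, x) * (zq ^ (served G 0 (k, x) - c x s) * exp (- \<theta> * of_real s)))"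
        unfolding f_def exp_eq by (simp only: mult.assoc)
      also have "\<dots> = zo ^ visit_orbit G 0 (k, x) * (LBINT s:{0..visit_length k x}. zq ^ (served G 0 (k, x) - c x s) * exp (- \<theta> * of_real s))"
        by (rule lbint_mult_right)
      also have "(LBINT s:{0..visit_length k x}. zq ^ (served G 0 (k, x) - c x s) * exp (- \<theta> * of_real s))
         = (\<Sum>j<served G 0 (k, x). zq ^ (served G 0 (k, x) - j) * exp (- \<theta> * of_real (\<Sum>i<j. x (Service 0 i))) * exp_integral \<theta> (x (Service 0 j)))"
        unfolding visit_length_eq c_def
        by (rule step_integral) (use g \<theta> zq in \<open>auto simp: good_clocks_def\<close>)
      finally show "(LBINT s:{0..visit_length k x}. f x s * exp (- of_real (lam * s) * (1 - zo)))
      = h (served G 0 (k, x)) (visit_orbit G 0 (k, x)) (\<lambda>j. x (Service 0 j))" by (simp add: h_def)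
    qed
    show "(\<lambda>x. h (served G 0 (k, x)) (visit_orbit G 0 (k, x)) (\<lambda>j. x (Service 0 j))) \<in> borel_measurable P"
      by (rule h_meas)
    show "(\<lambda>x. LBINT s:{0..visit_length k x}. f x s * exp (- of_real (lam * s) * (1 - zo))) \<in> borel_measurable P"
      by (rule period_integral_measurable; measurable)
  qed
  also have "\<dots> = (\<integral>x. (\<integral>y. h (served G 0 (k, x)) (visit_orbit G 0 (k, x)) (\<lambda>j. y (Service 0 j)) \<partial>P) \<partial>P)"
  proof (rule integral_services[where f=h and n=0 and k=k])
    show "integrable P (\<lambda>x. h (served G 0 (k, x)) (visit_orbit G 0 (k, x)) (\<lambda>j. x (Service 0 j)))"
    proof (rule Bochner_Integration.integrable_bound[OF visit_length_integrable])
      show "(\<lambda>x. h (served G 0 (k, x)) (visit_orbit G 0 (k, x)) (\<lambda>j. x (Service 0 j))) \<in> borel_measurable P"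
        by (rule h_meas)
      \<comment> \<open>Each term is bounded by the length of its service, so the sum is bounded by
        the length of the visit.\<close>
      show "AE x in P. norm (h (served G 0 (k, x)) (visit_orbit G 0 (k, x)) (\<lambda>j. x (Service 0 j))) \<le> norm (visit_length k x)"
        using AE_good_clocks AE_visit_length[of k]
      proof eventually_elim
        fix x assume g: "good_clocks x" and l: "0 \<le> visit_length k x"
        let ?q = "served G 0 (k, x)"
        have s: "0 \<le> x (Service 0 j)" for j using g by (simp add: good_clocks_def)
        have "norm (\<Sum>j<?q. zq ^ (?q - j) * exp (- \<theta> * of_real (\<Sum>i<j. x (Service 0 i))) * exp_integral \<theta> (x (Service 0 j)))
           \<le> (\<Sum>j<?q. x (Service 0 j))"
        proof (rule sum_norm_le)
          fix j
          have "norm (zq ^ (?q - j) * exp (- \<theta> * of_real (\<Sum>i<j. x (Service 0 i)))) \<le> 1"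
            unfolding norm_mult norm_power using zq norm_exp_le[OF \<theta> sum_nonneg[of "{..<j}" "\<lambda>i. x (Service 0 i)"]] s
            by (intro mult_le_one power_le_one) auto
          then have "norm (zq ^ (?q - j) * exp (- \<theta> * of_real (\<Sum>i<j. x (Service 0 i)))) * norm (exp_integral \<theta> (x (Service 0 j))) \<le> 1 * x (Service 0 j)"
            using norm_exp_integral_le[OF \<theta> s] by (intro mult_mono) auto
          then show "norm (zq ^ (?q - j) * exp (- \<theta> * of_real (\<Sum>i<j. x (Service 0 i))) * exp_integral \<theta> (x (Service 0 j))) \<le> x (Service 0 j)"
            by (simp only: norm_mult mult_1_left)
        qed
        then have "norm (zo ^ visit_orbit G 0 (k, x)) * norm (\<Sum>j<?q. zq ^ (?q - j) * exp (- \<theta> * of_real (\<Sum>i<j. x (Service 0 i))) * exp_integral \<theta> (x (Service 0 j)))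
           \<le> 1 * visit_length k x"
          unfolding visit_length_eq using zo s by (intro mult_mono) (auto simp: norm_power power_le_one)
        then show "norm (h (served G 0 (k, x)) (visit_orbit G 0 (k, x)) (\<lambda>j. x (Service 0 j))) \<le> norm (visit_length k x)"
          using l by (simp only: h_def norm_mult mult_1_left real_norm_def abs_of_nonneg)
      qed
    qed
  qed
  also have "\<dots> = (\<integral>x. zo ^ visit_orbit G 0 (k, x) * run_length_gf zq (lst FB \<theta>) (served G 0 (k, x)) * (\<integral>a. exp_integral \<theta> a \<partial>FB) \<partial>P)"
  proof (rule Bochner_Integration.integral_cong[OF refl])
    fix x
    show "(\<integral>y. h (served G 0 (k, x)) (visit_orbit G 0 (k, x)) (\<lambda>j. y (Service 0 j)) \<partial>P)
      = zo ^ visit_orbit G 0 (k, x) * run_length_gf zq (lst FB \<theta>) (served G 0 (k, x)) * (\<integral>a. exp_integral \<theta> a \<partial>FB)"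
      unfolding h_def integral_mult_right_zero mult.assoc[of "zo ^ _"]
      using services_run_integral[OF zo, of zq "served G 0 (k, x)"] unfolding \<theta>_def[symmetric] by (simp only: mult.assoc)
  qed
  finally show ?thesis by (simp only: integral_mult_left_zero)
qed

text \<open>Fubini reduces the claim to a fixed time \<open>t\<close>, where \<open>glue_gf\<close>
  applies with \<open>L = t\<close>. The integrand is bounded and the glue period has deterministic
  length, so integrability is immediate.\<close>

lemma glue_period:
  assumes zq: "norm zq \<le> 1" and zo: "norm zo \<le> 1"
  shows "(\<integral>x. (LBINT t:{glue_start G 0 (k, x)..visit_start G 0 (k, x)}. zq ^ num_queue G (k, x) t * zo ^ num_orbit G (k, x) t) \<partial>P)
    = (LBINT t:{0..G}. exp (- of_real lam * (1 - zq) * of_real t) * stick t zq zo ^ k)"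
proof -
  let ?f = "\<lambda>x t. zq ^ num_queue G (k, x) t * zo ^ num_orbit G (k, x) t"
  have f_le: "norm (?f x t) \<le> 1" for x t
    unfolding norm_mult norm_power using zq zo by (intro mult_le_one power_le_one) auto
  have "integrable (P \<Otimes>\<^sub>M lborel) (\<lambda>z. if 0 \<le> snd z \<and> snd z \<le> G then ?f (fst z) (snd z) else 0)"
  proof (rule PL.Fubini_integrable)
    show "(\<lambda>z. if 0 \<le> snd z \<and> snd z \<le> G then ?f (fst z) (snd z) else 0) \<in> borel_measurable (P \<Otimes>\<^sub>M lborel)" by measurable
    have ii: "integrable lborel (\<lambda>t. if 0 \<le> t \<and> t \<le> G then ?f x t else 0)" for x
    proof (rule Bochner_Integration.integrable_bound)
      show "integrable lborel (indicator {0..G} :: real \<Rightarrow> real)"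
        by (rule integrable_real_indicator) (simp_all add: emeasure_lborel_Icc_eq)
      have x_meas [measurable]: "(\<lambda>s::real. x) \<in> measurable borel P" by simp
      have [measurable]: "(\<lambda>s. num_queue G (k, x) s) \<in> measurable borel (count_space UNIV)"
        "(\<lambda>s. num_orbit G (k, x) s) \<in> measurable borel (count_space UNIV)"
        using num_measurable(3,4)[where k=k and t="\<lambda>s. s", OF x_meas] by measurable
      show "(\<lambda>t. if 0 \<le> t \<and> t \<le> G then ?f x t else 0) \<in> borel_measurable lborel" by measurable
      show "AE t in lborel. norm (if 0 \<le> t \<and> t \<le> G then ?f x t else 0) \<le> norm (indicator {0..G} t :: real)"
        using f_le[of x] by (auto simp: indicator_def)
    qed
    then show "AE x in P. integrable lborel (\<lambda>t. if 0 \<le> snd (x, t) \<and> snd (x, t) \<le> G then ?f (fst (x, t)) (snd (x, t)) else 0)"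
      unfolding fst_conv snd_conv by (intro AE_I2 ii)
    have bd: "norm (\<integral>t. norm (if 0 \<le> t \<and> t \<le> G then ?f x t else 0) \<partial>lborel) \<le> G" for x
    proof -
      have "(\<integral>t. norm (if 0 \<le> t \<and> t \<le> G then ?f x t else 0) \<partial>lborel) \<le> (\<integral>t. indicator {0..G} t \<partial>lborel)"
      proof (rule integral_mono)
        show "integrable lborel (indicator {0..G} :: real \<Rightarrow> real)"
          by (rule integrable_real_indicator) (simp_all add: emeasure_lborel_Icc_eq)
        show "norm (if 0 \<le> t \<and> t \<le> G then ?f x t else 0) \<le> indicator {0..G} t" for t
          using f_le[of x t] by (auto simp: indicator_def)
      qed (rule integrable_norm[OF ii])
      then show ?thesis using G by (simp add: Bochner_Integration.integral_nonneg)
    qed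
    show "integrable P (\<lambda>x. \<integral>t. norm (if 0 \<le> snd (x, t) \<and> snd (x, t) \<le> G then ?f (fst (x, t)) (snd (x, t)) else 0) \<partial>lborel)"
      unfolding fst_conv snd_conv by (rule integrable_bounded_P[OF _ bd]) measurable
  qed
  then have "integrable (P \<Otimes>\<^sub>M lborel) (case_prod (\<lambda>x t. if 0 \<le> t \<and> t \<le> G then ?f x t else 0))"
    by (simp add: case_prod_unfold)
  from PL.Fubini_integral[OF this]
  have "(\<integral>x. (\<integral>t. (if 0 \<le> t \<and> t \<le> G then ?f x t else 0) \<partial>lborel) \<partial>P) = (\<integral>t. (\<integral>x. (if 0 \<le> t \<and> t \<le> G then ?f x t else 0) \<partial>P) \<partial>lborel)"
    by (rule sym)
  also have "\<dots> = (\<integral>t. indicator {0..G} t *\<^sub>R (exp (- of_real lam * (1 - zq) * of_real t) * stick t zq zo ^ k) \<partial>lborel)"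
  proof (rule Bochner_Integration.integral_cong_AE)
    \<comment> \<open>At \<open>t = G\<close> services of length 0 may already be completed, so
      \<open>num_queue_glue\<close> stops short of this point; it is a null set.\<close>
    show "AE t in lborel. (\<integral>x. (if 0 \<le> t \<and> t \<le> G then ?f x t else 0) \<partial>P)
       = indicator {0..G} t *\<^sub>R (exp (- of_real lam * (1 - zq) * of_real t) * stick t zq zo ^ k)"
      using AE_lborel_singleton[of G]
    proof eventually_elim
      fix t :: real assume tG: "t \<noteq> G"
      show "(\<integral>x. (if 0 \<le> t \<and> t \<le> G then ?f x t else 0) \<partial>P)
       = indicator {0..G} t *\<^sub>R (exp (- of_real lam * (1 - zq) * of_real t) * stick t zq zo ^ k)"
      proof (cases "0 \<le> t \<and> t \<le> G")
        case True
        then have t: "0 \<le> t" "t < G" using tG by auto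
        let ?J = "\<lambda>x. {c \<in> customers (k, x). attempts (k, x) c \<inter> {glue_start G 0 (k, x)..glue_start G 0 (k, x) + t} \<noteq> {}}"
        have "(\<integral>x. ?f x t \<partial>P) = (\<integral>x. zq ^ card (?J x - prior G 0 (k, x)) *
            zo ^ card (arrived (k, x) (glue_start G 0 (k, x) + t) - (prior G 0 (k, x) \<union> ?J x)) \<partial>P)"
        proof (rule Bochner_Integration.integral_cong_AE)
          show "AE x in P. ?f x t = zq ^ card (?J x - prior G 0 (k, x)) *
            zo ^ card (arrived (k, x) (glue_start G 0 (k, x) + t) - (prior G 0 (k, x) \<union> ?J x))"
            using AE_good_clocks
          proof eventually_elim
            fix x assume g: "good_clocks x"
            interpret good_sample G "(k, x)" by (rule good_sampleI[OF g])
            have "num_queue G (k, x) t = card (?J x)"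
              using num_queue_glue[of 0 t] t by simp
            moreover have "joined G (k, x) t = ?J x"
              using joined_eq[of 0 t] t by simp
            ultimately show "?f x t = zq ^ card (?J x - prior G 0 (k, x)) *
            zo ^ card (arrived (k, x) (glue_start G 0 (k, x) + t) - (prior G 0 (k, x) \<union> ?J x))"
              by (simp add: num_orbit_def)
          qed
          show "(\<lambda>x. zq ^ card (?J x - prior G 0 (k, x)) *
            zo ^ card (arrived (k, x) (glue_start G 0 (k, x) + t) - (prior G 0 (k, x) \<union> ?J x))) \<in> borel_measurable P"
            unfolding attempts_meet_iff by measurable
        qed measurable
        also have "\<dots> = exp (- of_real (lam * t) * (1 - zq)) * stick t zq zo ^ k"
          using glue_gf[OF t(1) zq zo, of k 0] by (simp only: stick_def[symmetric] X_seq_0_integral)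
        finally show ?thesis using True by (simp add: mult_ac)
      qed auto
    qed
    show "(\<lambda>t. indicator {0..G} t *\<^sub>R (exp (- of_real lam * (1 - zq) * of_real t) * stick t zq zo ^ k)) \<in> borel_measurable lborel"
      unfolding stick_def by measurable
    show "(\<lambda>t. \<integral>x. (if 0 \<le> t \<and> t \<le> G then ?f x t else 0) \<partial>P) \<in> borel_measurable lborel"
      by measurable
  qed
  finally have "(\<integral>x. (\<integral>t. (if 0 \<le> t \<and> t \<le> G then ?f x t else 0) \<partial>lborel) \<partial>P)
      = (LBINT t:{0..G}. exp (- of_real lam * (1 - zq) * of_real t) * stick t zq zo ^ k)"
    by (simp add: set_lebesgue_integral_def)
  moreover have "(\<integral>t. (if 0 \<le> t \<and> t \<le> G then ?f x t else 0) \<partial>lborel) = (LBINT t:{0..G}. ?f x t)" for x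
    unfolding set_lebesgue_integral_def by (intro Bochner_Integration.integral_cong refl) (auto simp: indicator_def)
  ultimately show ?thesis by simp
qed

end

section \<open>Limit laws\<close>

lemma expectation_finite_values:
  fixes g :: "'a::countable \<Rightarrow> complex" and U :: "'w \<Rightarrow> 'a"
  assumes "prob_space M" and U [measurable]: "U \<in> measurable M (count_space UNIV)" and "finite A"
  shows "(\<integral>w. (if U w \<in> A then g (U w) else 0) \<partial>M) = (\<Sum>a\<in>A. of_real (measure M {w\<in>space M. U w = a}) * g a)"
proof -
  interpret prob_space M by fact
  have ind: "(if U w \<in> A then g (U w) else 0) = (\<Sum>a\<in>A. indicator {w\<in>space M. U w = a} w *\<^sub>R g a)" if "w \<in> space M" for w
  proof -
    have "(\<Sum>a\<in>A. indicator {w\<in>space M. U w = a} w *\<^sub>R g a) = (\<Sum>a\<in>A. if a = U w then g a else 0)"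
      using that by (intro sum.cong) (auto simp: indicator_def)
    then show ?thesis using \<open>finite A\<close> by simp
  qed
  have "(\<integral>w. (if U w \<in> A then g (U w) else 0) \<partial>M) = (\<integral>w. (\<Sum>a\<in>A. indicator {w\<in>space M. U w = a} w *\<^sub>R g a) \<partial>M)"
    by (rule Bochner_Integration.integral_cong[OF refl ind])
  also have "\<dots> = (\<Sum>a\<in>A. \<integral>w. indicator {w\<in>space M. U w = a} w *\<^sub>R g a \<partial>M)"
    by (intro Bochner_Integration.integral_sum integrable_scaleR_left integrable_real_indicator)
       (auto simp: emeasure_eq_measure)
  also have "\<dots> = (\<Sum>a\<in>A. of_real (measure M {w\<in>space M. U w = a}) * g a)"
    by (intro sum.cong refl) (simp add: scaleR_conv_of_real)
  finally show ?thesis .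
qed

text \<open>Outside \<open>A\<close> the integrand is at most \<open>C\<close> in norm, and the mass
  there is 1 minus the mass of \<open>A\<close>.\<close>

lemma expectation_truncation:
  fixes g :: "'a::countable \<Rightarrow> complex" and U :: "'w \<Rightarrow> 'a"
  assumes "prob_space M" and U [measurable]: "U \<in> measurable M (count_space UNIV)" and A: "finite A"
    and g: "\<And>a. norm (g a) \<le> C"
  shows "norm ((\<integral>w. g (U w) \<partial>M) - (\<Sum>a\<in>A. of_real (measure M {w\<in>space M. U w = a}) * g a))
    \<le> C * (1 - (\<Sum>a\<in>A. measure M {w\<in>space M. U w = a}))"
proof -
  interpret prob_space M by fact
  have C: "0 \<le> C" using g[of undefined] norm_ge_zero order.trans by blast
  have [measurable]: "(\<lambda>w. f (U w)) \<in> borel_measurable M" for f :: "'a \<Rightarrow> 'c::topological_space"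
    by (rule measurable_compose[OF U]) simp
  have i1: "integrable M (\<lambda>w. g (U w))" 
    by (rule integrable_const_bound[where B=C]) (auto intro: g)
  have i2: "integrable M (\<lambda>w. if U w \<in> A then g (U w) else 0)"
    by (rule integrable_const_bound[where B=C]) (auto intro: g C)
  have i3: "integrable M (\<lambda>w. if U w \<in> A then 0 else (1::real))"
    by (rule integrable_const_bound[where B=1]) auto
  have "(\<integral>w. g (U w) \<partial>M) - (\<Sum>a\<in>A. of_real (measure M {w\<in>space M. U w = a}) * g a)
     = (\<integral>w. g (U w) - (if U w \<in> A then g (U w) else 0) \<partial>M)"
    using i1 i2 by (simp add: expectation_finite_values[OF assms(1,2,3)])
  also have "norm \<dots> \<le> (\<integral>w. norm (g (U w) - (if U w \<in> A then g (U w) else 0)) \<partial>M)"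
    by (rule integral_norm_bound)
  also have "\<dots> \<le> (\<integral>w. C * (if U w \<in> A then 0 else 1) \<partial>M)"
    by (rule integral_mono) (use i1 i2 i3 g in auto)
  also have "\<dots> = C * (\<integral>w. (if U w \<in> A then 0 else 1) \<partial>M)" by simp
  also have "(\<integral>w. (if U w \<in> A then 0 else 1) \<partial>M) = 1 - (\<Sum>a\<in>A. measure M {w\<in>space M. U w = a})"
  proof -
    have "complex_of_real (\<integral>w. (if U w \<in> A then 0 else 1) \<partial>M) = (\<integral>w. 1 - (if U w \<in> A then 1 else 0) \<partial>M)"
      unfolding integral_complex_of_real[symmetric] by (intro Bochner_Integration.integral_cong) auto
    also have "\<dots> = 1 - (\<integral>w. (if U w \<in> A then 1 else 0) \<partial>M)"
    proof -
      have "integrable M (\<lambda>w. if U w \<in> A then 1 else 0 :: complex)"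
        by (rule integrable_const_bound[where B=1]) auto
      then show ?thesis by (simp add: prob_space)
    qed
    also have "(\<integral>w. (if U w \<in> A then 1 else 0 :: complex) \<partial>M) = of_real (\<Sum>a\<in>A. measure M {w\<in>space M. U w = a})"
      using expectation_finite_values[OF assms(1,2,3), of "\<lambda>_. 1"] by simp
    finally have "complex_of_real (\<integral>w. (if U w \<in> A then 0 else 1) \<partial>M) = of_real (1 - (\<Sum>a\<in>A. measure M {w\<in>space M. U w = a}))"
      by simp
    then show ?thesis by (simp only: of_real_eq_iff)
  qed
  finally show ?thesis .
qed

text \<open>Since the limit is a probability law, no mass escapes, and pointwise convergence suffices.\<close>

lemma has_limit_law_expectation:
  fixes g :: "'a::countable \<Rightarrow> complex"
  assumes M: "prob_space M" and lim: "has_limit_law M U q" and U: "\<And>n. U n \<in> measurable M (count_space UNIV)"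
    and g: "\<And>a. norm (g a) \<le> C"
  shows "(\<lambda>n. \<integral>w. g (U n w) \<partial>M) \<longlonglongrightarrow> measure_pmf.expectation q g"
proof (rule LIMSEQ_I)
  fix r :: real assume r: "0 < r"
  have C: "0 \<le> C" using g[of undefined] norm_ge_zero order.trans by blast
  \<comment> \<open>Each of three errors is to be at most \<open>r / 4\<close>; the added 1 covers
    \<open>C = 0\<close>.\<close>
  define \<epsilon> where "\<epsilon> = r / (4 * (C + 1))"
  have \<epsilon>: "0 < \<epsilon>" using r C by (simp add: \<epsilon>_def)
  have C\<epsilon>: "C * \<epsilon> \<le> r / 4" using r C by (simp add: \<epsilon>_def field_simps)
  have "(\<lambda>m. measure q {a. to_nat a < m}) \<longlonglongrightarrow> measure q (\<Union>m. {a. to_nat a < m})"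
    by (rule measure_pmf.finite_Lim_measure_incseq) (auto simp: incseq_def)
  moreover have "(\<Union>m. {a::'a. to_nat a < m}) = UNIV" by auto
  ultimately have "(\<lambda>m. measure q {a. to_nat a < m}) \<longlonglongrightarrow> 1" by simp
  then have "eventually (\<lambda>m. 1 - \<epsilon> < measure q {a. to_nat a < m}) sequentially"
    using \<epsilon> by (intro order_tendstoD(1)) auto
  then obtain m where m: "1 - \<epsilon> < measure q {a. to_nat a < m}"
    by (auto simp: eventually_sequentially)
  \<comment> \<open>A finite set carrying almost all mass of the limit; by pointwise convergence it
    eventually carries almost all mass of \<open>U n\<close> as well.\<close>
  define A where "A = {a::'a. to_nat a < m}"
  have A: "finite A"
    using finite_vimageI[OF finite_lessThan[of m] inj_to_nat] by (simp add: A_def vimage_def)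
  have qA: "1 - \<epsilon> < (\<Sum>a\<in>A. pmf q a)" using m A by (simp add: A_def[symmetric] measure_measure_pmf_finite)
  define p where "p = (\<lambda>n a. measure M {w \<in> space M. U n w = a})"
  have p: "(\<lambda>n. p n a) \<longlonglongrightarrow> pmf q a" for a using lim by (simp add: has_limit_law_def p_def)
  have "(\<lambda>n. \<Sum>a\<in>A. p n a) \<longlonglongrightarrow> (\<Sum>a\<in>A. pmf q a)" by (intro tendsto_sum p)
  then have e1: "eventually (\<lambda>n. 1 - \<epsilon> < (\<Sum>a\<in>A. p n a)) sequentially"
    using qA by (rule order_tendstoD(1))
  have "(\<lambda>n. \<Sum>a\<in>A. of_real (p n a) * g a) \<longlonglongrightarrow> (\<Sum>a\<in>A. of_real (pmf q a) * g a)"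
    by (intro tendsto_sum tendsto_mult tendsto_of_real p tendsto_const)
  then have e2: "eventually (\<lambda>n. dist (\<Sum>a\<in>A. of_real (p n a) * g a) (\<Sum>a\<in>A. of_real (pmf q a) * g a) < r / 4) sequentially"
    using r by (intro tendstoD) auto
  have q: "norm (measure_pmf.expectation q g - (\<Sum>a\<in>A. of_real (pmf q a) * g a)) \<le> C * (1 - (\<Sum>a\<in>A. pmf q a))"
    using expectation_truncation[OF prob_space_measure_pmf[of q], where U="\<lambda>a. a" and A=A and g=g and C=C] A g
    by (simp add: pmf.rep_eq)
  have "C * (1 - (\<Sum>a\<in>A. pmf q a)) \<le> C * \<epsilon>" using qA C by (intro mult_left_mono) auto
  then have q': "norm (measure_pmf.expectation q g - (\<Sum>a\<in>A. of_real (pmf q a) * g a)) \<le> r / 4"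
    using q C\<epsilon> by linarith
  have "eventually (\<lambda>n. norm ((\<integral>w. g (U n w) \<partial>M) - measure_pmf.expectation q g) < r) sequentially"
    using e1 e2
  proof eventually_elim
    fix n assume a: "1 - \<epsilon> < (\<Sum>a\<in>A. p n a)"
      and b: "dist (\<Sum>a\<in>A. of_real (p n a) * g a) (\<Sum>a\<in>A. of_real (pmf q a) * g a) < r / 4"
    have c: "norm ((\<integral>w. g (U n w) \<partial>M) - (\<Sum>a\<in>A. of_real (p n a) * g a)) \<le> C * (1 - (\<Sum>a\<in>A. p n a))"
      unfolding p_def by (rule expectation_truncation[OF M U A g])
    have "C * (1 - (\<Sum>a\<in>A. p n a)) \<le> C * \<epsilon>" using a C by (intro mult_left_mono) auto
    then have c': "norm ((\<integral>w. g (U n w) \<partial>M) - (\<Sum>a\<in>A. of_real (p n a) * g a)) \<le> r / 4"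
      using c C\<epsilon> by linarith
    have "norm ((\<integral>w. g (U n w) \<partial>M) - measure_pmf.expectation q g)
       = norm (((\<integral>w. g (U n w) \<partial>M) - (\<Sum>a\<in>A. of_real (p n a) * g a))
         + ((\<Sum>a\<in>A. of_real (p n a) * g a) - (\<Sum>a\<in>A. of_real (pmf q a) * g a))
         - (measure_pmf.expectation q g - (\<Sum>a\<in>A. of_real (pmf q a) * g a)))" by simp
    also have "\<dots> \<le> norm ((\<integral>w. g (U n w) \<partial>M) - (\<Sum>a\<in>A. of_real (p n a) * g a))
         + norm ((\<Sum>a\<in>A. of_real (p n a) * g a) - (\<Sum>a\<in>A. of_real (pmf q a) * g a))
         + norm (measure_pmf.expectation q g - (\<Sum>a\<in>A. of_real (pmf q a) * g a))"
      by (intro order.trans[OF norm_triangle_ineq4] add_right_mono norm_triangle_ineq)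
    also have "\<dots> \<le> r / 4 + r / 4 + r / 4"
      using c' b q' unfolding dist_norm by (intro add_mono) auto
    finally show "norm ((\<integral>w. g (U n w) \<partial>M) - measure_pmf.expectation q g) < r" using r by simp
  qed
  then show "\<exists>no. \<forall>n\<ge>no. norm ((\<integral>w. g (U n w) \<partial>M) - measure_pmf.expectation q g) < r"
    by (simp add: eventually_sequentially)
qed

section \<open>Transform equations of successive cycles\<close>

context glue_model
begin

abbreviation S :: "nat pmf \<Rightarrow> sample measure" where "S p \<equiv> system lam nu FB FS p"

lemma pair_S: "pair_prob_space (measure_pmf p) P"
  by (intro pair_prob_space.intro pair_sigma_finite.intro prob_space_imp_sigma_finite prob_space_measure_pmf P.prob_space_axioms)

lemma prob_S: "prob_space (S p)"
proof -
  interpret pair_prob_space "measure_pmf p" P by (rule pair_S)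
  show ?thesis unfolding system_def by (rule prob_space_axioms)
qed

lemma space_S [simp]: "space (S p) = UNIV"
  by (simp add: system_def space_pair_measure)

text \<open>The initial number is discrete, so measurability in the clocks for each fixed initial
  number is enough.\<close>

lemma measurable_S:
  assumes "\<And>k. (\<lambda>x. f (k, x)) \<in> measurable P N"
  shows "f \<in> measurable (S p) N"
proof -
  have "f \<in> measurable (count_space UNIV \<Otimes>\<^sub>M P) N"
    by (rule measurable_pair_measure_countable1) (use assms in auto)
  moreover have "sets (S p) = sets (count_space UNIV \<Otimes>\<^sub>M P)"
    unfolding system_def by (intro sets_pair_measure_cong) simp_all
  ultimately show ?thesis using measurable_cong_sets by blast
qed

lemma integral_S:
  fixes f :: "sample \<Rightarrow> 'b::{banach, second_countable_topology}"
  assumes "integrable (S p) f"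
  shows "(\<integral>w. f w \<partial>S p) = measure_pmf.expectation p (\<lambda>k. \<integral>x. f (k, x) \<partial>P)"
proof -
  interpret pair_prob_space "measure_pmf p" P by (rule pair_S)
  show ?thesis using integral_fst'[of f] assms unfolding system_def by simp
qed

lemma integrable_S_bounded:
  fixes f :: "sample \<Rightarrow> 'b::{banach, second_countable_topology}"
  assumes "\<And>k. (\<lambda>x. f (k, x)) \<in> borel_measurable P" "\<And>w. norm (f w) \<le> C"
  shows "integrable (S p) f"
proof -
  interpret prob_space "S p" by (rule prob_S)
  show ?thesis
  proof (rule integrable_const_bound[where B=C])
    show "f \<in> borel_measurable (S p)" by (rule measurable_S[OF assms(1)])
  qed (use assms(2) in simp)
qed

lemma integrable_S:
  fixes f :: "sample \<Rightarrow> 'b::{banach, second_countable_topology}"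
  assumes m: "\<And>k. (\<lambda>x. f (k, x)) \<in> borel_measurable P"
    and i: "\<And>k. integrable P (\<lambda>x. f (k, x))" and "integrable (measure_pmf p) (\<lambda>k. \<integral>x. norm (f (k, x)) \<partial>P)"
  shows "integrable (S p) f"
proof -
  interpret pair_prob_space "measure_pmf p" P by (rule pair_S)
  have "f \<in> borel_measurable (S p)" by (rule measurable_S[OF m])
  then show ?thesis unfolding system_def
    by (intro Fubini_integrable) (use assms in auto)
qed

lemma AE_S:
  assumes "\<And>k. AE x in P. Q (k, x)" "\<And>k. Measurable.pred P (\<lambda>x. Q (k, x))"
  shows "AE w in S p. Q w"
proof -
  interpret pair_prob_space "measure_pmf p" P by (rule pair_S)
  have "Q \<in> measurable (S p) (count_space UNIV)" by (rule measurable_S) (use assms in auto)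
  then have "Measurable.pred (measure_pmf p \<Otimes>\<^sub>M P) Q" unfolding system_def .
  then have "{w \<in> space (measure_pmf p \<Otimes>\<^sub>M P). Q w} \<in> sets (measure_pmf p \<Otimes>\<^sub>M P)" by measurable
  then show ?thesis unfolding system_def
    by (intro AE_pair_measure) (use assms in auto)
qed

lemma seq_measurable:
  "(\<lambda>x. X_seq G n (k, x)) \<in> measurable P (count_space UNIV)"
  "(\<lambda>x. Y_seq G n (k, x)) \<in> measurable P (count_space UNIV)"
  "(\<lambda>x. Z_seq G n (k, x)) \<in> measurable P (count_space UNIV)"
proof -
  show "(\<lambda>x. X_seq G n (k, x)) \<in> measurable P (count_space UNIV)" "(\<lambda>x. Z_seq G n (k, x)) \<in> measurable P (count_space UNIV)"
    unfolding X_seq_def Z_seq_def num_system_def by measurable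
  have "(\<lambda>x. (served G n (k, x), num_orbit G (k, x) (visit_start G n (k, x)))) \<in> measurable P (count_space UNIV \<Otimes>\<^sub>M count_space UNIV)"
    by measurable
  moreover have "count_space (UNIV :: nat set) \<Otimes>\<^sub>M count_space (UNIV :: nat set) = count_space UNIV"
    by (subst pair_measure_countable) auto
  ultimately show "(\<lambda>x. Y_seq G n (k, x)) \<in> measurable P (count_space UNIV)"
    unfolding Y_seq_def by (simp only:)
qed

lemma Y_seq_integral:
  fixes g :: "nat \<Rightarrow> nat \<Rightarrow> complex"
  shows "(\<integral>x. (case Y_seq G n (k, x) of (q, m) \<Rightarrow> g q m) \<partial>P) = (\<integral>x. g (served G n (k, x)) (visit_orbit G n (k, x)) \<partial>P)"
proof (rule Bochner_Integration.integral_cong_AE)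
  show "AE x in P. (case Y_seq G n (k, x) of (q, m) \<Rightarrow> g q m) = g (served G n (k, x)) (visit_orbit G n (k, x))"
    using AE_good_clocks
  proof eventually_elim
    fix x assume g: "good_clocks x"
    interpret good_sample G "(k, x)" by (rule good_sampleI[OF g])
    show "(case Y_seq G n (k, x) of (q, m) \<Rightarrow> g q m) = g (served G n (k, x)) (visit_orbit G n (k, x))"
      by (simp add: Y_seq_eq visit_orbit_def)
  qed
  show "(\<lambda>x. case Y_seq G n (k, x) of (q, m) \<Rightarrow> g q m) \<in> borel_measurable P"
    by (rule measurable_compose[OF seq_measurable(2)]) simp
  show "(\<lambda>x. g (served G n (k, x)) (visit_orbit G n (k, x))) \<in> borel_measurable P"
    by measurable
qed

text \<open>The three periods of a cycle in transform form, obtained from the versions with fixed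
  initial number by integrating over \<open>p\<close>. Both \<open>p\<close> and \<open>n\<close>
  are free: the limit needs \<open>init\<close> with large \<open>n\<close>, the stationary cycle
  needs \<open>X\<close> with \<open>n = 0\<close>.\<close>

lemma S_gf_equations:
  fixes u v :: complex
  assumes u: "norm u \<le> 1" and v: "norm v \<le> 1"
  defines "b \<equiv> lst FB (of_real lam * (1 - v))" and "s \<equiv> lst FS (of_real lam * (1 - v))"
  shows "(\<integral>w. (case Y_seq G n w of (q, m) \<Rightarrow> u ^ q * v ^ m) \<partial>S p) = exp (- of_real (lam * G) * (1 - u)) * (\<integral>w. stick G u v ^ X_seq G n w \<partial>S p)"
    "(\<integral>w. v ^ Z_seq G n w \<partial>S p) = (\<integral>w. (case Y_seq G n w of (q, m) \<Rightarrow> b ^ q * v ^ m) \<partial>S p)"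
    "(\<integral>w. v ^ X_seq G (Suc n) w \<partial>S p) = s * (\<integral>w. v ^ Z_seq G n w \<partial>S p)"
    "norm (stick G u v) \<le> 1"
proof -
  have b: "norm b \<le> 1" unfolding b_def by (rule norm_lst_FB[OF v])
  have e: "0 \<le> exp (- nu * G)" "exp (- nu * G) \<le> 1" using nu G by auto
  have "norm (complex_of_real (1 - exp (- nu * G))) = 1 - exp (- nu * G)" "norm (complex_of_real (exp (- nu * G))) = exp (- nu * G)"
    using e unfolding norm_of_real by linarith+
  then have "norm (stick G u v) \<le> (1 - exp (- nu * G)) * norm u + exp (- nu * G) * norm v"
    unfolding stick_def by (intro norm_triangle_le) (simp only: norm_mult)
  also have "\<dots> \<le> (1 - exp (- nu * G)) * 1 + exp (- nu * G) * 1"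
    using e u v by (intro add_mono mult_left_mono) auto
  finally show st: "norm (stick G u v) \<le> 1" by simp
  have iX: "integrable (S p) (\<lambda>w. z ^ X_seq G n w)" if "norm z \<le> 1" for z :: complex and n
  proof (rule integrable_S_bounded[where C=1])
    show "(\<lambda>x. z ^ X_seq G n (k, x)) \<in> borel_measurable P" for k
      by (rule measurable_compose[OF seq_measurable(1)]) simp
  qed (use that in \<open>simp add: norm_power power_le_one\<close>)
  have iZ: "integrable (S p) (\<lambda>w. z ^ Z_seq G n w)" if "norm z \<le> 1" for z :: complex
  proof (rule integrable_S_bounded[where C=1])
    show "(\<lambda>x. z ^ Z_seq G n (k, x)) \<in> borel_measurable P" for k
      by (rule measurable_compose[OF seq_measurable(3)]) simp
  qed (use that in \<open>simp add: norm_power power_le_one\<close>)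
  have iY: "integrable (S p) (\<lambda>w. case Y_seq G n w of (q, m) \<Rightarrow> y ^ q * v ^ m)" if "norm y \<le> 1" for y :: complex
  proof (rule integrable_S_bounded[where C=1])
    show "(\<lambda>x. case Y_seq G n (k, x) of (q, m) \<Rightarrow> y ^ q * v ^ m) \<in> borel_measurable P" for k
      by (rule measurable_compose[OF seq_measurable(2)]) simp
    show "norm (case Y_seq G n w of (q, m) \<Rightarrow> y ^ q * v ^ m) \<le> 1" for w
      using that v by (auto simp: norm_mult norm_power split: prod.split intro!: mult_le_one power_le_one)
  qed
  show "(\<integral>w. (case Y_seq G n w of (q, m) \<Rightarrow> u ^ q * v ^ m) \<partial>S p) = exp (- of_real (lam * G) * (1 - u)) * (\<integral>w. stick G u v ^ X_seq G n w \<partial>S p)"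
    unfolding integral_S[OF iY[OF u]] integral_S[OF iX[OF st]] Y_seq_integral visit_start_gf[OF u v] by (rule integral_mult_right_zero)
  show "(\<integral>w. v ^ Z_seq G n w \<partial>S p) = (\<integral>w. (case Y_seq G n w of (q, m) \<Rightarrow> b ^ q * v ^ m) \<partial>S p)"
    unfolding integral_S[OF iY[OF b]] integral_S[OF iZ[OF v]] Y_seq_integral visit_gf(1)[OF v] unfolding b_def ..
  show "(\<integral>w. v ^ X_seq G (Suc n) w \<partial>S p) = s * (\<integral>w. v ^ Z_seq G n w \<partial>S p)"
    unfolding integral_S[OF iX[OF v]] integral_S[OF iZ[OF v]] vacation_gf[OF v] s_def by simp
qed

end

locale steady_state = glue_model +
  fixes init X Z :: "nat pmf" and Y :: "(nat \<times> nat) pmf"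
  assumes X: "has_limit_law (S init) (X_seq G) X"
    and Y: "has_limit_law (S init) (Y_seq G) Y"
    and Z: "has_limit_law (S init) (Z_seq G) Z"
    and rho: "lam * (\<integral>x. x \<partial>FB) < 1"
begin

text \<open>On the closed disc the transforms are expectations of bounded functions, so they
  converge under \<open>has_limit_law\<close>, and uniqueness of limits transfers each equation. The
  last one uses the shifted sequence for \<open>X\<close>.\<close>

lemma limit_gf_equations:
  fixes u v :: complex
  assumes u: "norm u \<le> 1" and v: "norm v \<le> 1"
  defines "b \<equiv> lst FB (of_real lam * (1 - v))" and "s \<equiv> lst FS (of_real lam * (1 - v))"
  shows "measure_pmf.expectation Y (\<lambda>(q, m). u ^ q * v ^ m) = exp (- of_real (lam * G) * (1 - u)) * measure_pmf.expectation X (\<lambda>k. stick G u v ^ k)"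
    "measure_pmf.expectation Z (\<lambda>k. v ^ k) = measure_pmf.expectation Y (\<lambda>(q, m). b ^ q * v ^ m)"
    "measure_pmf.expectation X (\<lambda>k. v ^ k) = s * measure_pmf.expectation Z (\<lambda>k. v ^ k)"
proof -
  have b: "norm b \<le> 1" unfolding b_def by (rule norm_lst_FB[OF v])
  note eqs = S_gf_equations(1-3)[OF u v, folded b_def s_def, where p=init] S_gf_equations(4)[OF u v]
  have m: "X_seq G n \<in> measurable (S init) (count_space UNIV)" "Y_seq G n \<in> measurable (S init) (count_space UNIV)"
    "Z_seq G n \<in> measurable (S init) (count_space UNIV)" for n
    by (rule measurable_S, rule seq_measurable)+
  have LX: "(\<lambda>n. \<integral>w. z ^ X_seq G n w \<partial>S init) \<longlonglongrightarrow> measure_pmf.expectation X (\<lambda>k. z ^ k)" if "norm z \<le> 1" for z :: complex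
    by (rule has_limit_law_expectation[OF prob_S X m(1), where C=1]) (use that in \<open>simp add: norm_power power_le_one\<close>)
  have LZ: "(\<lambda>n. \<integral>w. v ^ Z_seq G n w \<partial>S init) \<longlonglongrightarrow> measure_pmf.expectation Z (\<lambda>k. v ^ k)"
    by (rule has_limit_law_expectation[OF prob_S Z m(3), where C=1]) (use v in \<open>simp add: norm_power power_le_one\<close>)
  have LY: "(\<lambda>n. \<integral>w. (case Y_seq G n w of (q, m) \<Rightarrow> z ^ q * v ^ m) \<partial>S init) \<longlonglongrightarrow> measure_pmf.expectation Y (\<lambda>(q, m). z ^ q * v ^ m)"
    if "norm z \<le> 1" for z :: complex
    by (rule has_limit_law_expectation[OF prob_S Y m(2), where C=1])
      (use that v in \<open>auto simp: norm_mult norm_power split: prod.split intro!: mult_le_one power_le_one\<close>)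
  show "measure_pmf.expectation Y (\<lambda>(q, m). u ^ q * v ^ m) = exp (- of_real (lam * G) * (1 - u)) * measure_pmf.expectation X (\<lambda>k. stick G u v ^ k)"
    by (rule LIMSEQ_unique[OF LY[OF u]]) (unfold eqs(1), intro tendsto_mult tendsto_const LX eqs(4))
  show "measure_pmf.expectation Z (\<lambda>k. v ^ k) = measure_pmf.expectation Y (\<lambda>(q, m). b ^ q * v ^ m)"
    by (rule LIMSEQ_unique[OF LZ]) (unfold eqs(2), rule LY[OF b])
  show "measure_pmf.expectation X (\<lambda>k. v ^ k) = s * measure_pmf.expectation Z (\<lambda>k. v ^ k)"
    by (rule LIMSEQ_unique[OF LIMSEQ_Suc[OF LX[OF v]]]) (unfold eqs(3), intro tendsto_mult tendsto_const LZ)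
qed

end

section \<open>The mean number of customers served\<close>

context glue_model
begin

text \<open>On [0, 1] the transforms are real, so means can be found from real difference quotients.
  The linear bound comes from \<open>1 - exp (- y) \<le> y\<close>.\<close>

lemma real_lst:
  assumes F: "prob_space F" "sets F = sets borel" "AE x in F. 0 \<le> x" "integrable F (\<lambda>x. x)" and v: "0 \<le> v" "v \<le> 1"
  defines "r \<equiv> \<integral>x. exp (- (lam * (1 - v)) * x) \<partial>F"
  shows "lst F (of_real lam * (1 - of_real v)) = of_real r"
    "0 \<le> r" "r \<le> 1" "1 - r \<le> lam * (\<integral>x. x \<partial>F) * (1 - v)" "integrable F (\<lambda>x. exp (- (lam * (1 - v)) * x))"
proof -
  interpret prob_space F by (rule F(1))
  have d: "0 \<le> lam * (1 - v)" using lam v by simp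
  have e: "exp (- (of_real lam * (1 - of_real v)) * complex_of_real x) = of_real (exp (- (lam * (1 - v)) * x))" for x
    using exp_of_real[of "- (lam * (1 - v)) * x", where 'a=complex] by simp
  show "lst F (of_real lam * (1 - of_real v)) = of_real r"
    unfolding lst_def e r_def by (rule integral_complex_of_real)
  have le: "AE x in F. exp (- (lam * (1 - v)) * x) \<le> 1"
    using F(3) by eventually_elim (use d in simp)
  show i: "integrable F (\<lambda>x. exp (- (lam * (1 - v)) * x))"
  proof (rule integrable_const_bound[where B=1])
    show "AE x in F. norm (exp (- (lam * (1 - v)) * x)) \<le> 1" using le by simp
    have "(\<lambda>x::real. exp (- (lam * (1 - v)) * x)) \<in> borel_measurable borel" by measurable
    then show "(\<lambda>x. exp (- (lam * (1 - v)) * x)) \<in> borel_measurable F"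
      using measurable_cong_sets[OF F(2) refl] by blast
  qed
  show "0 \<le> r" unfolding r_def by (rule Bochner_Integration.integral_nonneg) simp
  have "r \<le> (\<integral>x. 1 \<partial>F)" unfolding r_def by (rule integral_mono_AE[OF i _ le]) simp
  then show "r \<le> 1" by (simp add: prob_space)
  have "(\<integral>x. 1 - exp (- (lam * (1 - v)) * x) \<partial>F) \<le> (\<integral>x. lam * (1 - v) * x \<partial>F)"
  proof (rule integral_mono)
    show "1 - exp (- (lam * (1 - v)) * x) \<le> lam * (1 - v) * x" for x
      using exp_ge_add_one_self[of "- (lam * (1 - v)) * x"] by simp
    show "integrable F (\<lambda>x. 1 - exp (- (lam * (1 - v)) * x))"
      by (rule Bochner_Integration.integrable_diff[OF integrable_const i])
    show "integrable F (\<lambda>x. lam * (1 - v) * x)" by (rule integrable_mult_right[OF F(4)])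
  qed
  then show "1 - r \<le> lam * (\<integral>x. x \<partial>F) * (1 - v)"
    using i by (simp add: r_def prob_space mult_ac)
qed

text \<open>The difference quotients of the exponential are dominated by \<open>lam * x\<close>,
  which is integrable because the law has finite mean.\<close>

lemma real_lst_derivative:
  assumes F: "prob_space F" "sets F = sets borel" "AE x in F. 0 \<le> x" "integrable F (\<lambda>x. x)"
  shows "(\<lambda>m. (1 - (\<integral>x. exp (- (lam * (1 - to_one m)) * x) \<partial>F)) / (1 - to_one m)) \<longlonglongrightarrow> lam * (\<integral>x. x \<partial>F)"
proof -
  interpret prob_space F by (rule F(1))
  define d where "d = (\<lambda>m. 1 - to_one m)"
  have d: "0 < d m" for m using to_one(2)[of m] by (simp add: d_def)
  have "d \<longlonglongrightarrow> 1 - 1" unfolding d_def by (intro tendsto_intros to_one(3))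
  then have d0: "filterlim d (at 0) sequentially"
  proof (intro filterlim_atI)
    show "eventually (\<lambda>m. d m \<noteq> 0) sequentially"
    proof (rule always_eventually, rule allI)
      fix m show "d m \<noteq> 0" using d[of m] by simp
    qed
  qed simp
  have i: "integrable F (\<lambda>x. exp (- (lam * d m) * x))" for m
    using real_lst(5)[OF F to_one(1) less_imp_le[OF to_one(2)], of m] by (simp add: d_def)
  have "(\<lambda>m. \<integral>x. (1 - exp (- (lam * d m) * x)) / d m \<partial>F) \<longlonglongrightarrow> (\<integral>x. lam * x \<partial>F)"
  proof (rule integral_dominated_convergence[where w="\<lambda>x. lam * x"])
    show "(\<lambda>x. (1 - exp (- (lam * d m) * x)) / d m) \<in> borel_measurable F" for m
      using borel_measurable_integrable[OF i[of m]] by simp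
    show "AE x in F. (\<lambda>m. (1 - exp (- (lam * d m) * x)) / d m) \<longlonglongrightarrow> lam * x"
    proof (rule AE_I2)
      fix x
      have "((\<lambda>h. 1 - exp (- (lam * h) * x)) has_field_derivative lam * x) (at 0)"
        by (auto intro!: derivative_eq_intros)
      then have "((\<lambda>h. (1 - exp (- (lam * h) * x)) / h) \<longlongrightarrow> lam * x) (at 0)"
        by (simp add: has_field_derivative_iff)
      then show "(\<lambda>m. (1 - exp (- (lam * d m) * x)) / d m) \<longlonglongrightarrow> lam * x"
        by (rule filterlim_compose[OF _ d0])
    qed
    show "AE x in F. norm ((1 - exp (- (lam * d m) * x)) / d m) \<le> lam * x" for m
      using F(3)
    proof eventually_elim
      fix x :: real assume x: "0 \<le> x"
      have "0 \<le> lam * d m * x" using lam d[of m] x by simp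
      then have "0 \<le> 1 - exp (- (lam * d m) * x)" by simp
      moreover have "1 - exp (- (lam * d m) * x) \<le> lam * d m * x"
        using exp_ge_add_one_self[of "- (lam * d m) * x"] by simp
      ultimately show "norm ((1 - exp (- (lam * d m) * x)) / d m) \<le> lam * x"
        using d[of m] by (simp add: divide_le_eq mult_ac)
    qed
    show "integrable F (\<lambda>x. lam * x)" by (rule integrable_mult_right[OF F(4)])
    then show "(\<lambda>x. lam * x) \<in> borel_measurable F" by (rule borel_measurable_integrable)
  qed
  moreover have "(\<integral>x. (1 - exp (- (lam * d m) * x)) / d m \<partial>F) = (1 - (\<integral>x. exp (- (lam * d m) * x) \<partial>F)) / d m" for m
    using i[of m] by (simp add: prob_space)
  ultimately have "(\<lambda>m. (1 - (\<integral>x. exp (- (lam * d m) * x) \<partial>F)) / d m) \<longlonglongrightarrow> (\<integral>x. lam * x \<partial>F)" by (simp only:)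
  then show ?thesis unfolding d_def by simp
qed

end

section \<open>A branching process with immigration\<close>

context steady_state
begin

definition EB :: real where "EB = (\<integral>x. x \<partial>FB)"
definition ES :: real where "ES = (\<integral>x. x \<partial>FS)"
definition p_stick :: real where "p_stick = 1 - exp (- nu * G)"
definition gfX :: "real \<Rightarrow> real" where "gfX v = measure_pmf.expectation X (\<lambda>k. v ^ k)"
definition lstB :: "real \<Rightarrow> real" where "lstB v = (\<integral>x. exp (- (lam * (1 - v)) * x) \<partial>FB)"
definition lstS :: "real \<Rightarrow> real" where "lstS v = (\<integral>x. exp (- (lam * (1 - v)) * x) \<partial>FS)"

lemma EB_pos: "0 < EB" and ES_pos: "0 < ES"
  using FB FS unfolding EB_def ES_def nonneg_law_def by blast+

lemma p_stick: "0 < p_stick" "p_stick < 1"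
  using nu G by (auto simp: p_stick_def)

lemma rho_less: "lam * EB < 1" using rho by (simp add: EB_def)

lemmas real_lstB = real_lst[OF prob_FB sets_FB AE_FB integrable_FB, folded EB_def lstB_def]
  and real_lstS = real_lst[OF prob_FS sets_FS AE_FS integrable_FS, folded ES_def lstS_def]

lemma gfX_bounds:
  assumes "0 \<le> v" "v \<le> 1" shows "0 \<le> gfX v" "gfX v \<le> 1"
proof -
  show "0 \<le> gfX v" unfolding gfX_def using assms by (intro Bochner_Integration.integral_nonneg) simp
  have "gfX v \<le> measure_pmf.expectation X (\<lambda>k. 1)"
    unfolding gfX_def using assms
    by (intro integral_mono measure_pmf.integrable_const_bound[where B=1]) (auto simp: power_le_one)
  then show "gfX v \<le> 1" by simp
qed

text \<open>Offspring generating function of one orbiting customer: with probability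
  \<open>p_stick\<close> it is served and leaves behind the arrivals during its service, otherwise
  it stays in orbit. It is \<open>stick G\<close> at \<open>lstB v\<close> and
  \<open>v\<close>.\<close>

definition next_point :: "real \<Rightarrow> real" where "next_point v = p_stick * lstB v + (1 - p_stick) * v"

lemma next_point:
  assumes "0 \<le> v" "v \<le> 1"
  shows "0 \<le> next_point v" "next_point v \<le> 1" "1 - next_point v \<le> (p_stick * (lam * EB) + (1 - p_stick)) * (1 - v)"
proof -
  note b = real_lstB(2-4)[OF assms]
  show "0 \<le> next_point v" using assms p_stick b by (simp add: next_point_def)
  have "next_point v \<le> p_stick * 1 + (1 - p_stick) * 1"
    unfolding next_point_def using assms p_stick b by (intro add_mono mult_left_mono) auto
  then show "next_point v \<le> 1" by simp
  have "p_stick * (1 - lstB v) \<le> p_stick * (lam * EB * (1 - v))"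
    using p_stick b by (intro mult_left_mono) auto
  then show "1 - next_point v \<le> (p_stick * (lam * EB) + (1 - p_stick)) * (1 - v)"
    unfolding next_point_def by (simp add: algebra_simps)
qed

text \<open>The three equations chained around a cycle. The first two factors are the immigration:
  the arrivals during the vacation, and the arrivals during the services of customers who came in
  the glue period.\<close>

lemma gfX_equation:
  assumes v: "0 \<le> v" "v \<le> 1"
  shows "gfX v = lstS v * exp (- (lam * G) * (1 - lstB v)) * gfX (next_point v)"
proof -
  note b = real_lstB(1-3)[OF v] and s = real_lstS(1)[OF v]
  have nv: "norm (complex_of_real v) \<le> 1" and nb: "norm (complex_of_real (lstB v)) \<le> 1" using v b by auto
  have gf: "measure_pmf.expectation X (\<lambda>k. complex_of_real w ^ k) = of_real (gfX w)" for w
    unfolding gfX_def by (simp flip: integral_complex_of_real)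
  have st: "stick G (of_real (lstB v)) (of_real v) = of_real (next_point v)"
    by (simp add: stick_def next_point_def p_stick_def)
  have ex: "exp (- of_real (lam * G) * (1 - complex_of_real (lstB v))) = of_real (exp (- (lam * G) * (1 - lstB v)))"
    using exp_of_real[of "- (lam * G) * (1 - lstB v)", where 'a=complex] by simp
  have "complex_of_real (gfX v) = of_real (lstS v) * measure_pmf.expectation Z (\<lambda>k. of_real v ^ k)"
    unfolding gf[symmetric] limit_gf_equations(3)[OF nv nv] s ..
  also have "measure_pmf.expectation Z (\<lambda>k. complex_of_real v ^ k) = measure_pmf.expectation Y (\<lambda>(q, m). of_real (lstB v) ^ q * of_real v ^ m)"
    unfolding limit_gf_equations(2)[OF nv nv] b ..
  also have "\<dots> = of_real (exp (- (lam * G) * (1 - lstB v))) * of_real (gfX (next_point v))"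
    unfolding limit_gf_equations(1)[OF nb nv] st gf ex ..
  finally have "complex_of_real (gfX v) = of_real (lstS v * exp (- (lam * G) * (1 - lstB v)) * gfX (next_point v))" by simp
  then show ?thesis by (simp only: of_real_eq_iff)
qed

text \<open>The constant is the mean immigration per cycle: \<open>lam * ES\<close> from the
  vacation, and on average \<open>lam * G\<close> arrivals in the glue period whose services bring
  \<open>lam * EB\<close> customers each.\<close>

lemma gfX_step:
  assumes v: "0 \<le> v" "v \<le> 1"
  shows "1 - gfX v \<le> (lam * ES + lam * G * (lam * EB)) * (1 - v) + (1 - gfX (next_point v))"
proof -
  note b = real_lstB(2-4)[OF v] and s = real_lstS(2-4)[OF v] and n = next_point[OF v]
  let ?a = "lam * G * (1 - lstB v)"
  have a: "0 \<le> ?a" using lam G b by simp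
  have ea: "1 - exp (- ?a) \<le> ?a" using exp_ge_add_one_self[of "- ?a"] by simp
  have a_le: "?a \<le> lam * G * (lam * EB * (1 - v))" using lam G b by (intro mult_left_mono) auto
  have "1 - gfX v = 1 - lstS v * (exp (- ?a) * gfX (next_point v))"
    using gfX_equation[OF v] by (simp add: mult_ac)
  also have "\<dots> \<le> (1 - lstS v) + (1 - exp (- ?a) * gfX (next_point v))"
    using s a gfX_bounds[OF n(1,2)] by (intro one_minus_mult_le mult_nonneg_nonneg mult_le_one) auto
  also have "1 - exp (- ?a) * gfX (next_point v) \<le> (1 - exp (- ?a)) + (1 - gfX (next_point v))"
    using a gfX_bounds[OF n(1,2)] by (intro one_minus_mult_le) auto
  finally have "1 - gfX v \<le> (1 - lstS v) + ((1 - exp (- ?a)) + (1 - gfX (next_point v)))" by simp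
  also have "\<dots> \<le> lam * ES * (1 - v) + (lam * G * (lam * EB * (1 - v)) + (1 - gfX (next_point v)))"
    using s(3) ea a_le by linarith
  finally show ?thesis by (simp add: algebra_simps)
qed

text \<open>The mean number of offspring of one orbiting customer.\<close>

definition contraction :: real where "contraction = p_stick * (lam * EB) + (1 - p_stick)"

lemma contraction: "0 \<le> contraction" "contraction < 1"
proof -
  show "0 \<le> contraction" using p_stick lam EB_pos by (simp add: contraction_def)
  have "p_stick * (lam * EB) < p_stick * 1" using p_stick rho_less by (intro mult_strict_left_mono) auto
  then show "contraction < 1" by (simp add: contraction_def)
qed

text \<open>No moment enters: the value at 1 is attained because \<open>X\<close> is a probability
  law, and powers on [0, 1] are dominated by 1.\<close>

lemma gfX_continuous_at_1:
  assumes "\<And>m. 0 \<le> u m" "\<And>m. u m \<le> 1" "u \<longlonglongrightarrow> (1::real)"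
  shows "(\<lambda>m. gfX (u m)) \<longlonglongrightarrow> 1"
proof -
  have "(\<lambda>m. measure_pmf.expectation X (\<lambda>k. u m ^ k)) \<longlonglongrightarrow> measure_pmf.expectation X (\<lambda>k. 1)"
  proof (rule integral_dominated_convergence[where w="\<lambda>_. 1"])
    show "AE k in X. (\<lambda>m. u m ^ k) \<longlonglongrightarrow> 1"
      using tendsto_power[OF assms(3)] by simp
  qed (use assms in \<open>auto simp: power_le_one\<close>)
  then show ?thesis by (simp add: gfX_def)
qed

text \<open>Iterating the functional equation drives the argument to 1 geometrically fast, because the load is below 1.\<close>

lemma gfX_linear_bound:
  assumes v: "0 \<le> v" "v \<le> 1"
  shows "1 - gfX v \<le> (lam * ES + lam * G * (lam * EB)) / (1 - contraction) * (1 - v)"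
proof -
  define C where "C = lam * ES + lam * G * (lam * EB)"
  have C: "0 \<le> C" using lam G ES_pos EB_pos by (simp add: C_def)
  define u where "u = (\<lambda>m. (next_point ^^ m) v)"
  have u: "0 \<le> u m \<and> u m \<le> 1 \<and> 1 - u m \<le> contraction ^ m * (1 - v)" for m
  proof (induction m)
    case (Suc m)
    then have m: "0 \<le> u m" "u m \<le> 1" by auto
    have "1 - u (Suc m) \<le> contraction * (1 - u m)"
      using next_point(3)[OF m] by (simp add: u_def contraction_def)
    also have "\<dots> \<le> contraction * (contraction ^ m * (1 - v))"
      using Suc contraction by (intro mult_left_mono) auto
    finally show ?case using next_point(1,2)[OF m] by (simp add: u_def mult_ac)
  qed (use v in \<open>simp add: u_def\<close>)
  \<comment> \<open>The increments add up to a geometric series; the remainder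
    \<open>1 - gfX (u m)\<close> vanishes because the iterates tend to 1.\<close>
  have bound: "1 - gfX v \<le> C * (1 - v) * (\<Sum>i<m. contraction ^ i) + (1 - gfX (u m))" for m
  proof (induction m)
    case (Suc m)
    have "1 - gfX (u m) \<le> C * (1 - u m) + (1 - gfX (u (Suc m)))"
      using gfX_step[of "u m"] u[of m] by (simp add: C_def u_def)
    also have "C * (1 - u m) \<le> C * (contraction ^ m * (1 - v))"
      using C u[of m] by (intro mult_left_mono) auto
    finally show ?case using Suc by (simp add: algebra_simps)
  qed (simp add: u_def)
  have cm: "(\<lambda>m. contraction ^ m) \<longlonglongrightarrow> 0"
    using contraction by (intro LIMSEQ_realpow_zero) auto
  have "(\<lambda>m. 1 - contraction ^ m * (1 - v)) \<longlonglongrightarrow> 1 - 0 * (1 - v)"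
    by (intro tendsto_intros cm)
  then have low: "(\<lambda>m. 1 - contraction ^ m * (1 - v)) \<longlonglongrightarrow> 1" by simp
  have "u \<longlonglongrightarrow> 1"
  proof (rule tendsto_sandwich[OF _ _ low tendsto_const])
    show "\<forall>\<^sub>F m in sequentially. 1 - contraction ^ m * (1 - v) \<le> u m"
      using u by (intro always_eventually allI) (simp add: algebra_simps)
    show "\<forall>\<^sub>F m in sequentially. u m \<le> 1" using u by simp
  qed
  then have "(\<lambda>m. gfX (u m)) \<longlonglongrightarrow> 1" using u by (intro gfX_continuous_at_1) auto
  moreover have "(\<lambda>m. \<Sum>i<m. contraction ^ i) \<longlonglongrightarrow> 1 / (1 - contraction)"
    using geometric_sums[of contraction] contraction by (simp add: sums_def)
  ultimately have "(\<lambda>m. C * (1 - v) * (\<Sum>i<m. contraction ^ i) + (1 - gfX (u m))) \<longlonglongrightarrow> C * (1 - v) * (1 / (1 - contraction)) + (1 - 1)"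
    by (intro tendsto_intros)
  then have "1 - gfX v \<le> C * (1 - v) * (1 / (1 - contraction)) + (1 - 1)"
    using bound by (intro LIMSEQ_le_const) auto
  then show ?thesis by (simp add: C_def)
qed

definition mean_X :: real where "mean_X = measure_pmf.expectation X real"

text \<open>The linear bound on \<open>1 - gfX\<close> bounds the difference quotients at 1, and
  hence the mean.\<close>

lemma X_integrable: "integrable (measure_pmf X) real"
proof (rule gf_mean_integrable[where u=to_one and N="\<lambda>k. k", OF prob_space_measure_pmf _ to_one])
  show "1 - measure_pmf.expectation X (\<lambda>k. to_one m ^ k) \<le> (lam * ES + lam * G * (lam * EB)) / (1 - contraction) * (1 - to_one m)" for m
    using gfX_linear_bound[OF to_one(1) less_imp_le[OF to_one(2)], of m] by (simp only: gfX_def)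
qed simp

lemma gfX_derivative:
  assumes "\<And>m. 0 \<le> u m" "\<And>m. u m < 1" "u \<longlonglongrightarrow> (1::real)"
  shows "(\<lambda>m. (1 - gfX (u m)) / (1 - u m)) \<longlonglongrightarrow> mean_X"
  unfolding gfX_def mean_X_def
  by (rule gf_mean_tendsto[where N="\<lambda>k. k", OF prob_space_measure_pmf _ assms X_integrable]) simp

lemma exp_derivative:
  assumes "\<And>m. 0 < h m" "h \<longlonglongrightarrow> (0::real)"
  shows "(\<lambda>m. (1 - exp (- c * h m)) / h m) \<longlonglongrightarrow> c"
proof -
  have h0: "filterlim h (at 0) sequentially"
  proof (intro filterlim_atI)
    show "eventually (\<lambda>m. h m \<noteq> 0) sequentially"
    proof (rule always_eventually, rule allI)
      fix m show "h m \<noteq> 0" using assms(1)[of m] by simp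
    qed
  qed (rule assms(2))
  have "((\<lambda>h. 1 - exp (- c * h)) has_field_derivative c) (at 0)"
    by (auto intro!: derivative_eq_intros)
  then have "((\<lambda>h. (1 - exp (- c * h)) / h) \<longlongrightarrow> c) (at 0)"
    by (simp add: has_field_derivative_iff)
  then show ?thesis by (rule filterlim_compose[OF _ h0])
qed

text \<open>Equality would force the exponential to be 1 almost surely, hence service time 0,
  against a positive mean. Strictness permits division by \<open>1 - lstB v\<close> in the chain
  rule.\<close>

lemma lstB_less_1:
  assumes "0 \<le> v" "v < 1" shows "lstB v < 1"
proof (rule ccontr)
  assume "\<not> lstB v < 1"
  then have one: "lstB v = 1" using real_lstB(3)[of v] assms by simp
  interpret FB: prob_space FB by (rule prob_FB)
  have i: "integrable FB (\<lambda>x. exp (- (lam * (1 - v)) * x))" using real_lstB(5)[of v] assms by simp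
  have d: "0 < lam * (1 - v)" using lam assms by simp
  have "(\<integral>x. 1 - exp (- (lam * (1 - v)) * x) \<partial>FB) = 0"
    using one i by (simp add: lstB_def FB.prob_space)
  moreover have "AE x in FB. 0 \<le> 1 - exp (- (lam * (1 - v)) * x)"
    using AE_FB by eventually_elim (use d in simp)
  ultimately have "AE x in FB. 1 - exp (- (lam * (1 - v)) * x) = 0"
    using i by (subst (asm) integral_nonneg_eq_0_iff_AE) auto
  then have "AE x in FB. x = 0" by eventually_elim (use lam assms in auto)
  then have "EB = (\<integral>x. 0 \<partial>FB)"
    unfolding EB_def using borel_measurable_integrable[OF integrable_FB]
    by (intro Bochner_Integration.integral_cong_AE) auto
  then show False using EB_pos by simp
qed

text \<open>Differentiation of \<open>gfX_equation\<close> at 1: the mean equals the mean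
  immigration plus \<open>contraction\<close> times itself, and
  \<open>1 - contraction = p_stick * (1 - lam * EB)\<close>.\<close>

lemma mean_balance: "p_stick * mean_X * (1 - lam * EB) = lam * ES + lam * G * (lam * EB)"
proof -
  define d where "d = (\<lambda>m. 1 - to_one m)"
  define b where "b = (\<lambda>m. lstB (to_one m))"
  define w where "w = (\<lambda>m. next_point (to_one m))"
  have v: "0 \<le> to_one m" "to_one m \<le> 1" for m using to_one(1,2)[of m] by auto
  have d: "0 < d m" for m using to_one(2)[of m] by (simp add: d_def)
  have "d \<longlonglongrightarrow> 1 - 1" unfolding d_def by (intro tendsto_intros to_one(3))
  then have d0: "d \<longlonglongrightarrow> 0" by simp
  have B: "(\<lambda>m. (1 - b m) / d m) \<longlonglongrightarrow> lam * EB"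
    using real_lst_derivative[OF prob_FB sets_FB AE_FB integrable_FB] by (simp add: b_def d_def lstB_def EB_def)
  have Sd: "(\<lambda>m. (1 - lstS (to_one m)) / d m) \<longlonglongrightarrow> lam * ES"
    using real_lst_derivative[OF prob_FS sets_FS AE_FS integrable_FS] by (simp add: d_def lstS_def ES_def)
  have lim1: "x \<longlonglongrightarrow> 1" if "(\<lambda>m. (1 - x m) / d m) \<longlonglongrightarrow> c" for x c
  proof -
    have "(\<lambda>m. 1 - (1 - x m) / d m * d m) \<longlonglongrightarrow> 1 - c * 0" by (intro tendsto_intros that d0)
    moreover have "1 - (1 - x m) / d m * d m = x m" for m using d[of m] by simp
    ultimately show ?thesis by simp
  qed
  have b1: "b \<longlonglongrightarrow> 1" by (rule lim1[OF B])
  have S1: "(\<lambda>m. lstS (to_one m)) \<longlonglongrightarrow> 1" by (rule lim1[OF Sd])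
  have b_less: "0 < 1 - b m" for m using lstB_less_1[OF to_one(1,2)] by (simp add: b_def)
  \<comment> \<open>The chain rule in sequential form: the quotient by \<open>d m\<close> is
    expanded by \<open>1 - b m\<close>, which is nonzero and tends to 0. The same is done below with
    \<open>1 - w m\<close>.\<close>
  have "(\<lambda>m. (1 - exp (- (lam * G) * (1 - b m))) / (1 - b m)) \<longlonglongrightarrow> lam * G"
  proof (rule exp_derivative[OF b_less])
    have "(\<lambda>m. 1 - b m) \<longlonglongrightarrow> 1 - 1" by (intro tendsto_intros b1)
    then show "(\<lambda>m. 1 - b m) \<longlonglongrightarrow> 0" by simp
  qed
  then have "(\<lambda>m. (1 - exp (- (lam * G) * (1 - b m))) / (1 - b m) * ((1 - b m) / d m)) \<longlonglongrightarrow> lam * G * (lam * EB)"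
    using B by (rule tendsto_mult)
  moreover have "(1 - exp (- (lam * G) * (1 - b m))) / (1 - b m) * ((1 - b m) / d m) = (1 - exp (- (lam * G) * (1 - b m))) / d m" for m
    using less_imp_neq[OF b_less[of m]] by simp
  ultimately have E: "(\<lambda>m. (1 - exp (- (lam * G) * (1 - b m))) / d m) \<longlonglongrightarrow> lam * G * (lam * EB)"
    by (simp only:)
  have E1: "(\<lambda>m. exp (- (lam * G) * (1 - b m))) \<longlonglongrightarrow> 1" by (rule lim1[OF E])
  have w_eq: "(1 - w m) / d m = p_stick * ((1 - b m) / d m) + (1 - p_stick)" for m
    using d[of m] by (simp add: w_def next_point_def b_def d_def field_simps)
  have W: "(\<lambda>m. (1 - w m) / d m) \<longlonglongrightarrow> contraction"
    unfolding w_eq contraction_def by (intro tendsto_intros B)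
  have w1: "w \<longlonglongrightarrow> 1" by (rule lim1[OF W])
  have w0: "0 \<le> w m" for m unfolding w_def by (rule next_point(1)[OF v])
  have w_less: "w m < 1" for m
  proof -
    have "w m < p_stick * 1 + (1 - p_stick) * 1"
      unfolding w_def next_point_def b_def[symmetric] using p_stick b_less[of m] to_one(2)[of m]
      by (intro add_strict_mono mult_strict_left_mono) (auto simp: b_def)
    then show ?thesis by simp
  qed
  have "(\<lambda>m. (1 - gfX (w m)) / (1 - w m) * ((1 - w m) / d m)) \<longlonglongrightarrow> mean_X * contraction"
    by (intro tendsto_mult gfX_derivative w0 w_less w1 W)
  moreover have "(1 - gfX (w m)) / (1 - w m) * ((1 - w m) / d m) = (1 - gfX (w m)) / d m" for m
    using less_imp_neq[OF w_less[of m]] by simp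
  ultimately have Gw: "(\<lambda>m. (1 - gfX (w m)) / d m) \<longlonglongrightarrow> mean_X * contraction"
    by (simp only:)
  \<comment> \<open>The product rule for three factors, as an exact identity before the
    limit.\<close>
  have split: "(1 - gfX (to_one m)) / d m = (1 - lstS (to_one m)) / d m
     + lstS (to_one m) * ((1 - exp (- (lam * G) * (1 - b m))) / d m)
     + lstS (to_one m) * exp (- (lam * G) * (1 - b m)) * ((1 - gfX (w m)) / d m)" for m
  proof -
    have eq: "gfX (to_one m) = lstS (to_one m) * exp (- (lam * G) * (1 - b m)) * gfX (w m)"
      unfolding b_def w_def by (rule gfX_equation[OF v])
    have "1 - s * e * g = (1 - s) + s * (1 - e) + s * e * (1 - g)" for s e g :: real
      by (simp add: algebra_simps)
    from this[of "lstS (to_one m)" "exp (- (lam * G) * (1 - b m))" "gfX (w m)"]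
    show ?thesis unfolding eq by (simp only: add_divide_distrib times_divide_eq_right)
  qed
  have "(\<lambda>m. (1 - gfX (to_one m)) / d m) \<longlonglongrightarrow> lam * ES + 1 * (lam * G * (lam * EB)) + 1 * 1 * (mean_X * contraction)"
    unfolding split by (intro tendsto_intros Sd S1 E E1 Gw)
  from LIMSEQ_unique[OF gfX_derivative[OF to_one] this[unfolded d_def]]
  have "mean_X = lam * ES + lam * G * (lam * EB) + mean_X * contraction" by (simp add: d_def)
  then show ?thesis by (simp add: contraction_def algebra_simps)
qed

text \<open>Arrivals during the glue period plus the sticking share of the orbit;
  \<open>mean_Y\<close> identifies it as the mean queue at the start of a visit.\<close>

definition mean_Q :: real where "mean_Q = lam * G + p_stick * mean_X"

text \<open>Equivalent to \<open>mean_Q = lam * (G + mean_Q * EB + ES)\<close>: the customers served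
  per cycle balance the arrivals per cycle.\<close>

lemma mean_Q_eq: "mean_Q * (1 - lam * EB) = lam * (G + ES)" and mean_Q_pos: "0 < mean_Q"
proof -
  show *: "mean_Q * (1 - lam * EB) = lam * (G + ES)"
    using mean_balance by (simp add: mean_Q_def algebra_simps)
  have "0 < lam * (G + ES)" using lam G ES_pos by simp
  then show "0 < mean_Q" using zero_less_mult_pos2[of mean_Q "1 - lam * EB"] * rho_less by simp
qed

text \<open>Stated for any variable with this generating function, since it serves both the limit
  law \<open>Y\<close> and the first cycle started from \<open>X\<close>.\<close>

lemma mean_of_served_gf:
  fixes N :: "'a \<Rightarrow> nat"
  assumes M: "prob_space M" and N: "N \<in> measurable M (count_space UNIV)"
    and gf: "\<And>u::real. 0 \<le> u \<Longrightarrow> u \<le> 1 \<Longrightarrow> (\<integral>x. u ^ N x \<partial>M) = exp (- (lam * G) * (1 - u)) * gfX (1 - p_stick * (1 - u))"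
  shows "integrable M (\<lambda>x. real (N x))" "(\<integral>x. real (N x) \<partial>M) = mean_Q"
proof -
  define d where "d = (\<lambda>m. 1 - to_one m)"
  define w where "w = (\<lambda>m. 1 - p_stick * d m)"
  have d: "0 < d m" "d m \<le> 1" for m using to_one(1,2)[of m] by (auto simp: d_def)
  have "d \<longlonglongrightarrow> 1 - 1" unfolding d_def by (intro tendsto_intros to_one(3))
  then have d0: "d \<longlonglongrightarrow> 0" by simp
  have w: "0 \<le> w m" "w m < 1" for m
  proof -
    have "p_stick * d m \<le> p_stick * 1" using d[of m] p_stick by (intro mult_left_mono) auto
    moreover have "0 < p_stick * d m" using d[of m] p_stick by simp
    ultimately show "0 \<le> w m" "w m < 1" unfolding w_def using p_stick by linarith+
  qed
  have "w \<longlonglongrightarrow> 1 - p_stick * 0" unfolding w_def by (intro tendsto_intros d0)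
  then have w1: "w \<longlonglongrightarrow> 1" by simp
  have gfm: "(\<integral>x. to_one m ^ N x \<partial>M) = exp (- (lam * G) * d m) * gfX (w m)" for m
    using gf[of "to_one m"] to_one(1,2)[of m] by (simp add: d_def w_def)
  have E: "(\<lambda>m. (1 - exp (- (lam * G) * d m)) / d m) \<longlonglongrightarrow> lam * G"
    by (rule exp_derivative[OF d(1) d0])
  have E1: "(\<lambda>m. exp (- (lam * G) * d m)) \<longlonglongrightarrow> exp (- (lam * G) * 0)" by (intro tendsto_intros d0)
  have "(\<lambda>m. (1 - gfX (w m)) / (1 - w m) * p_stick) \<longlonglongrightarrow> mean_X * p_stick"
    by (intro tendsto_mult gfX_derivative w w1 tendsto_const)
  moreover have "(1 - gfX (w m)) / (1 - w m) * p_stick = (1 - gfX (w m)) / d m" for m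
    using p_stick d[of m] by (simp add: w_def)
  ultimately have Gw: "(\<lambda>m. (1 - gfX (w m)) / d m) \<longlonglongrightarrow> mean_X * p_stick" by simp
  have split: "(1 - (\<integral>x. to_one m ^ N x \<partial>M)) / (1 - to_one m) = (1 - exp (- (lam * G) * d m)) / d m
      + exp (- (lam * G) * d m) * ((1 - gfX (w m)) / d m)" for m
  proof -
    have "1 - e * g = (1 - e) + e * (1 - g)" for e g :: real by (simp add: algebra_simps)
    from this[of "exp (- (lam * G) * d m)" "gfX (w m)"]
    have "1 - exp (- (lam * G) * d m) * gfX (w m) = 1 - exp (- (lam * G) * d m) + exp (- (lam * G) * d m) * (1 - gfX (w m))" .
    moreover have "1 - to_one m = d m" by (simp add: d_def)
    ultimately show ?thesis unfolding gfm by (simp only: add_divide_distrib times_divide_eq_right)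
  qed
  have lim: "(\<lambda>m. (1 - (\<integral>x. to_one m ^ N x \<partial>M)) / (1 - to_one m)) \<longlonglongrightarrow> lam * G + exp (- (lam * G) * 0) * (mean_X * p_stick)"
    unfolding split by (intro tendsto_intros E E1 Gw)
  \<comment> \<open>Convergent difference quotients are bounded, which gives integrability; after
    that their limit is known to be the mean.\<close>
  then have "Bseq (\<lambda>m. (1 - (\<integral>x. to_one m ^ N x \<partial>M)) / (1 - to_one m))"
    by (intro convergent_imp_Bseq convergentI)
  then obtain K where K: "\<And>m. norm ((1 - (\<integral>x. to_one m ^ N x \<partial>M)) / (1 - to_one m)) \<le> K"
    by (auto simp: Bseq_def)
  show i: "integrable M (\<lambda>x. real (N x))"
  proof (rule gf_mean_integrable[where u=to_one and C=K, OF M N to_one])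
    fix m
    have "(1 - (\<integral>x. to_one m ^ N x \<partial>M)) / (1 - to_one m) \<le> K" using K[of m] unfolding real_norm_def by linarith
    then show "1 - (\<integral>x. to_one m ^ N x \<partial>M) \<le> K * (1 - to_one m)"
      using to_one(2)[of m] by (simp add: divide_le_eq)
  qed
  have "(\<integral>x. real (N x) \<partial>M) = lam * G + exp (- (lam * G) * 0) * (mean_X * p_stick)"
    by (rule LIMSEQ_unique[OF gf_mean_tendsto[OF M N to_one i] lim])
  then show "(\<integral>x. real (N x) \<partial>M) = mean_Q" by (simp add: mean_Q_def mult_ac)
qed

end

section \<open>The first cycle in steady state\<close>

lemma continuous_on_integral_dominated:
  fixes f :: "'a::metric_space \<Rightarrow> 'w \<Rightarrow> complex"
  assumes m: "\<And>z. z \<in> A \<Longrightarrow> f z \<in> borel_measurable M"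
    and c: "AE w in M. continuous_on A (\<lambda>z. f z w)"
    and b: "\<And>z. z \<in> A \<Longrightarrow> AE w in M. norm (f z w) \<le> h w" and h: "integrable M h"
  shows "continuous_on A (\<lambda>z. \<integral>w. f z w \<partial>M)"
  unfolding continuous_on_sequentially comp_def
proof (intro allI ballI impI, elim conjE)
  fix x :: "nat \<Rightarrow> 'a" and a
  assume a: "a \<in> A" and x: "\<forall>n. x n \<in> A" "x \<longlonglongrightarrow> a"
  show "(\<lambda>n. \<integral>w. f (x n) w \<partial>M) \<longlonglongrightarrow> (\<integral>w. f a w \<partial>M)"
  proof (rule integral_dominated_convergence[where w=h])
    show "AE w in M. (\<lambda>n. f (x n) w) \<longlonglongrightarrow> f a w"
      using c
    proof eventually_elim
      fix w assume "continuous_on A (\<lambda>z. f z w)"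
      then show "(\<lambda>n. f (x n) w) \<longlonglongrightarrow> f a w"
        using a x unfolding continuous_on_sequentially comp_def by blast
    qed
    show "f a \<in> borel_measurable M" by (rule m[OF a])
    show "f (x n) \<in> borel_measurable M" for n using x(1) by (intro m) blast
    show "AE w in M. norm (f (x n) w) \<le> h w" for n using x(1) by (intro b) blast
  qed (rule h)
qed

text \<open>A quotient with removable singularities is treated by exhibiting a function
  \<open>H\<close>, continuous on all of \<open>D\<close>, that agrees with it on \<open>N\<close>;
  the limit along \<open>N\<close> is then the value of \<open>H\<close>.\<close>

lemma value_by_continuityI:
  assumes "N \<subseteq> D" "z \<in> D" and lim: "z \<notin> N \<Longrightarrow> z islimpt N" and H: "continuous_on D H"
    and eq: "\<And>y. y \<in> N \<Longrightarrow> F y = H y" and v: "v = H z"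
  shows "value_by_continuity N F z v"
proof (cases "z \<in> N")
  case False
  have "(H \<longlongrightarrow> H z) (at z within D)" using H assms(2) unfolding continuous_on_def by blast
  then have "(H \<longlongrightarrow> H z) (at z within N)" using assms(1) by (rule tendsto_within_subset)
  moreover have "eventually (\<lambda>y. H y = F y) (at z within N)"
    unfolding eventually_at_filter by (rule always_eventually) (simp add: eq)
  ultimately have "(F \<longlongrightarrow> H z) (at z within N)" by (rule Lim_transform_eventually)
  then show ?thesis using False lim v by (simp add: value_by_continuity_def)
qed (simp add: value_by_continuity_def eq v)

lemma set_integral_split:
  fixes f :: "real \<Rightarrow> complex"
  assumes f: "f \<in> borel_measurable borel" "\<And>t. norm (f t) \<le> 1" and ab: "a \<le> b" "b \<le> c"
  shows "(LBINT t:{a..c}. f t) = (LBINT t:{a..b}. f t) + (LBINT t:{b..c}. f t)"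
proof -
  have i: "set_integrable lborel {l..u} f" for l u
    unfolding set_integrable_def
  proof (rule Bochner_Integration.integrable_bound)
    show "integrable lborel (indicator {l..u} :: real \<Rightarrow> real)"
      by (rule integrable_real_indicator) (auto simp: emeasure_lborel_Icc_eq)
    show "(\<lambda>x. indicator {l..u} x *\<^sub>R f x) \<in> borel_measurable lborel" using f(1) by measurable
    show "AE x in lborel. norm (indicator {l..u} x *\<^sub>R f x) \<le> norm (indicator {l..u} x :: real)"
      using f(2) by (intro AE_I2) (auto simp: indicator_def)
  qed
  have "{a..c} = {a..b} \<union> {b..c}" using ab by auto
  moreover have "(LBINT t:{a..b} \<union> {b..c}. f t) = (LBINT t:{a..b}. f t) + (LBINT t:{b..c}. f t)"
  proof (rule set_integral_Un_AE[OF _ _ _ i i])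
    show "AE x in lborel. \<not> (x \<in> {a..b} \<and> x \<in> {b..c})"
      using AE_lborel_singleton[of b] by eventually_elim auto
  qed auto
  ultimately show ?thesis by simp
qed

lemma continuous_on_exp_integral:
  assumes "0 \<le> a" shows "continuous_on {\<theta>. 0 \<le> Re \<theta>} (\<lambda>\<theta>. exp_integral \<theta> a)"
  unfolding exp_integral_def set_lebesgue_integral_def
proof (rule continuous_on_integral_dominated)
  show "AE s in lborel. continuous_on {\<theta>. 0 \<le> Re \<theta>} (\<lambda>\<theta>. indicator {0..a} s *\<^sub>R exp (- \<theta> * of_real s))"
    by (intro AE_I2 continuous_intros)
  show "AE s in lborel. norm (indicator {0..a} s *\<^sub>R exp (- \<theta> * complex_of_real s)) \<le> indicator {0..a} s" if "\<theta> \<in> {\<theta>. 0 \<le> Re \<theta>}" for \<theta>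
    using that norm_exp_le[of \<theta>] by (intro AE_I2) (auto simp: indicator_def)
  show "integrable lborel (indicator {0..a} :: real \<Rightarrow> real)"
    by (rule integrable_real_indicator) (auto simp: emeasure_lborel_Icc_eq)
qed measurable

lemma norm_run_length_gf:
  assumes "norm z \<le> 1" "norm b \<le> 1" shows "norm (run_length_gf z b q) \<le> real q"
proof -
  have "norm (run_length_gf z b q) \<le> (\<Sum>j<q. norm (z ^ (q - j) * b ^ j))"
    unfolding run_length_gf_def by (rule norm_sum)
  also have "\<dots> \<le> (\<Sum>j<q. 1)"
    using assms by (intro sum_mono) (auto simp: norm_mult norm_power intro!: mult_le_one power_le_one)
  finally show ?thesis by simp
qed

text \<open>The factorisation of \<open>z ^ q - b ^ q\<close>. The sum remains meaningful at
  \<open>z = b\<close>, where the quotient becomes 0/0.\<close>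

lemma run_length_gf_eq:
  assumes "z \<noteq> b" shows "run_length_gf z b q = z / (z - b) * (z ^ q - b ^ q)"
proof -
  have "run_length_gf z b q = z * (\<Sum>j<q. z ^ (q - Suc j) * b ^ j)"
    unfolding run_length_gf_def sum_distrib_left
    by (intro sum.cong refl) (simp add: Suc_diff_Suc mult.assoc[symmetric] flip: power_Suc)
  moreover have "b ^ q - z ^ q = (b - z) * (\<Sum>j<q. z ^ (q - Suc j) * b ^ j)"
    by (rule power_diff_sumr2)
  then have "(\<Sum>j<q. z ^ (q - Suc j) * b ^ j) = (z ^ q - b ^ q) / (z - b)"
    using assms by (simp add: field_simps)
  ultimately show ?thesis by simp
qed

context glue_model
begin

lemma queue_orbit_measurable:
  "(\<lambda>z. zq ^ num_queue G (k, fst z) (snd z) * zo ^ num_orbit G (k, fst z) (snd z) :: complex) \<in> borel_measurable (P \<Otimes>\<^sub>M lborel)"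
  by measurable

lemma queue_orbit_path_measurable:
  "(\<lambda>t. zq ^ num_queue G w t * zo ^ num_orbit G w t :: complex) \<in> borel_measurable borel"
proof -
  obtain k x where w: "w = (k, x)" by (cases w)
  have x_meas: "(\<lambda>s::real. x) \<in> measurable borel P" by simp
  have [measurable]: "(\<lambda>s. num_queue G (k, x) s) \<in> measurable borel (count_space UNIV)"
    "(\<lambda>s. num_orbit G (k, x) s) \<in> measurable borel (count_space UNIV)"
    using num_measurable(3,4)[where k=k and t="\<lambda>s. s", OF x_meas] by measurable
  show ?thesis unfolding w by measurable
qed

lemma norm_queue_orbit_le:
  assumes "norm zq \<le> 1" "norm zo \<le> 1" shows "norm (zq ^ i * zo ^ j :: complex) \<le> 1"
  using assms by (auto simp: norm_mult norm_power intro!: mult_le_one power_le_one)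

text \<open>The integrand has modulus at most 1, so the length of the period dominates its time
  integral.\<close>

lemma period_integrable:
  fixes zq zo :: complex
  assumes zq: "norm zq \<le> 1" and zo: "norm zo \<le> 1"
    and m: "\<And>k. (\<lambda>x. a (k, x)) \<in> borel_measurable P" "\<And>k. (\<lambda>x. b (k, x)) \<in> borel_measurable P"
    and le: "AE w in S p. a w \<le> b w" and i: "integrable (S p) (\<lambda>w. b w - a w)"
  shows "integrable (S p) (\<lambda>w. LBINT t:{a w..b w}. zq ^ num_queue G w t * zo ^ num_orbit G w t)"
proof (rule Bochner_Integration.integrable_bound[OF i])
  show "(\<lambda>w. LBINT t:{a w..b w}. zq ^ num_queue G w t * zo ^ num_orbit G w t) \<in> borel_measurable (S p)"
    by (rule measurable_S, rule period_integral_measurable[OF m queue_orbit_measurable])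
  show "AE w in S p. norm (LBINT t:{a w..b w}. zq ^ num_queue G w t * zo ^ num_orbit G w t) \<le> norm (b w - a w)"
    using le
  proof eventually_elim
    fix w assume "a w \<le> b w"
    then show "norm (LBINT t:{a w..b w}. zq ^ num_queue G w t * zo ^ num_orbit G w t) \<le> norm (b w - a w)"
      using norm_set_integral_le[OF queue_orbit_path_measurable norm_queue_orbit_le[OF zq zo], of "a w" "b w"] by simp
  qed
qed

lemma AE_S_order:
  "AE w in S p. glue_start G 0 w \<le> visit_start G 0 w" "AE w in S p. visit_start G 0 w \<le> vacation_start G 0 w"
  "AE w in S p. vacation_start G 0 w \<le> glue_start G 1 w"
proof -
  show "AE w in S p. glue_start G 0 w \<le> visit_start G 0 w" using G by (simp add: visit_start_def)
  show "AE w in S p. visit_start G 0 w \<le> vacation_start G 0 w"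
  proof (rule AE_S)
    show "AE x in P. visit_start G 0 (k, x) \<le> vacation_start G 0 (k, x)" for k
      using AE_good_clocks
    proof eventually_elim
      fix x assume g: "good_clocks x"
      interpret good_sample G "(k, x)" by (rule good_sampleI[OF g])
      show "visit_start G 0 (k, x) \<le> vacation_start G 0 (k, x)" by (rule visit_le_vacation)
    qed
  qed measurable
  show "AE w in S p. vacation_start G 0 w \<le> glue_start G 1 w"
  proof (rule AE_S)
    show "AE x in P. vacation_start G 0 (k, x) \<le> glue_start G 1 (k, x)" for k
      using AE_good_clocks
    proof eventually_elim
      fix x assume g: "good_clocks x"
      interpret good_sample G "(k, x)" by (rule good_sampleI[OF g])
      show "vacation_start G 0 (k, x) \<le> glue_start G 1 (k, x)" using vacation_le_glue[of 0] by simp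
    qed
  qed measurable
qed

lemma vacation_length: "glue_start G 1 w - vacation_start G 0 w = snd w (Vacation 0)"
  by (simp add: glue_start_Suc)

lemma vacation_clock:
  shows "integrable (S p) (\<lambda>w. snd w (Vacation 0))" and "(\<integral>w. snd w (Vacation 0) \<partial>S p) = (\<integral>z. z \<partial>FS)"
proof -
  have i: "integrable P (\<lambda>x. x (Vacation 0))"
    by (rule integrable_coordinate[where g="\<lambda>z. z"]) (simp add: integrable_FS)
  show *: "integrable (S p) (\<lambda>w. snd w (Vacation 0))"
    by (rule integrable_S) (use i borel_measurable_integrable[OF i] in \<open>simp_all\<close>)
  show "(\<integral>w. snd w (Vacation 0) \<partial>S p) = (\<integral>z. z \<partial>FS)"
    unfolding integral_S[OF *] using integral_coordinate[of "\<lambda>z. z" "Vacation 0"] by simp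
qed

lemma X_seq_0_S:
  assumes "norm z \<le> 1"
  shows "(\<integral>w. (z::complex) ^ X_seq G 0 w \<partial>S p) = measure_pmf.expectation p (\<lambda>k. z ^ k)"
proof -
  have "integrable (S p) (\<lambda>w. z ^ X_seq G 0 w)"
  proof (rule integrable_S_bounded[where C=1])
    show "(\<lambda>x. z ^ X_seq G 0 (k, x)) \<in> borel_measurable P" for k
      by (rule measurable_compose[OF seq_measurable(1)]) simp
  qed (use assms in \<open>simp add: norm_power power_le_one\<close>)
  then show ?thesis by (simp only: integral_S X_seq_0_integral)
qed

end

context steady_state
begin

lemma real_stick: "stick G (of_real u) 1 = of_real (1 - p_stick * (1 - u))"
  by (simp add: stick_def p_stick_def algebra_simps)

lemma real_exp: "exp (- complex_of_real (lam * G) * (1 - of_real u)) = of_real (exp (- (lam * G) * (1 - u)))"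
  using exp_of_real[of "- (lam * G) * (1 - u)", where 'a=complex] by simp

lemma real_gfX: "measure_pmf.expectation X (\<lambda>k. complex_of_real w ^ k) = of_real (gfX w)"
  unfolding gfX_def by (simp flip: integral_complex_of_real)

text \<open>The transforms of the first cycle are expressed by that of the initial law in the same
  way as those of \<open>Y\<close> and \<open>Z\<close> by that of \<open>X\<close>; with initial
  law \<open>X\<close> they coincide.\<close>

lemma first_cycle_gf:
  fixes u v :: complex
  assumes u: "norm u \<le> 1" and v: "norm v \<le> 1"
  shows "(\<integral>w. (case Y_seq G 0 w of (q, m) \<Rightarrow> u ^ q * v ^ m) \<partial>S X) = measure_pmf.expectation Y (\<lambda>(q, m). u ^ q * v ^ m)"
    "(\<integral>w. v ^ Z_seq G 0 w \<partial>S X) = measure_pmf.expectation Z (\<lambda>k. v ^ k)"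
proof -
  have Y: "(\<integral>w. (case Y_seq G 0 w of (q, m) \<Rightarrow> y ^ q * v ^ m) \<partial>S X) = measure_pmf.expectation Y (\<lambda>(q, m). y ^ q * v ^ m)"
    if y: "norm y \<le> 1" for y :: complex
    unfolding S_gf_equations(1)[OF y v] limit_gf_equations(1)[OF y v] X_seq_0_S[OF S_gf_equations(4)[OF y v]] ..
  show "(\<integral>w. (case Y_seq G 0 w of (q, m) \<Rightarrow> u ^ q * v ^ m) \<partial>S X) = measure_pmf.expectation Y (\<lambda>(q, m). u ^ q * v ^ m)"
    by (rule Y[OF u])
  show "(\<integral>w. v ^ Z_seq G 0 w \<partial>S X) = measure_pmf.expectation Z (\<lambda>k. v ^ k)"
    unfolding S_gf_equations(2)[OF u v] limit_gf_equations(2)[OF u v] by (rule Y[OF norm_lst_FB[OF v]])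
qed

lemma served_gf:
  assumes u: "0 \<le> u" "u \<le> (1::real)"
  shows "measure_pmf.expectation Y (\<lambda>y. u ^ fst y) = exp (- (lam * G) * (1 - u)) * gfX (1 - p_stick * (1 - u))"
    "(\<integral>w. u ^ served G 0 w \<partial>S X) = exp (- (lam * G) * (1 - u)) * gfX (1 - p_stick * (1 - u))"
proof -
  have nu: "norm (complex_of_real u) \<le> 1" and n1: "norm (1::complex) \<le> 1" using u by simp_all
  have "measure_pmf.expectation Y (\<lambda>(q, m). of_real u ^ q * 1 ^ m) = complex_of_real (exp (- (lam * G) * (1 - u)) * gfX (1 - p_stick * (1 - u)))"
    unfolding limit_gf_equations(1)[OF nu n1] real_stick real_exp real_gfX by simp
  moreover have "measure_pmf.expectation Y (\<lambda>(q, m). of_real u ^ q * 1 ^ m) = complex_of_real (measure_pmf.expectation Y (\<lambda>y. u ^ fst y))"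
    by (simp add: case_prod_unfold flip: integral_complex_of_real)
  moreover have "(\<integral>w. (case Y_seq G 0 w of (q, m) \<Rightarrow> of_real u ^ q * 1 ^ m) \<partial>S X) = complex_of_real (\<integral>w. u ^ served G 0 w \<partial>S X)"
    by (simp add: Y_seq_def flip: integral_complex_of_real)
  moreover have "(\<integral>w. (case Y_seq G 0 w of (q, m) \<Rightarrow> of_real u ^ q * 1 ^ m) \<partial>S X)
     = measure_pmf.expectation Y (\<lambda>(q, m). complex_of_real u ^ q * 1 ^ m)"
    by (rule first_cycle_gf(1)[OF nu]) simp
  ultimately have "complex_of_real (measure_pmf.expectation Y (\<lambda>y. u ^ fst y)) = complex_of_real (exp (- (lam * G) * (1 - u)) * gfX (1 - p_stick * (1 - u)))"
    "complex_of_real (\<integral>w. u ^ served G 0 w \<partial>S X) = complex_of_real (exp (- (lam * G) * (1 - u)) * gfX (1 - p_stick * (1 - u)))"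
    by (simp_all only:)
  then show "measure_pmf.expectation Y (\<lambda>y. u ^ fst y) = exp (- (lam * G) * (1 - u)) * gfX (1 - p_stick * (1 - u))"
    "(\<integral>w. u ^ served G 0 w \<partial>S X) = exp (- (lam * G) * (1 - u)) * gfX (1 - p_stick * (1 - u))"
    by (simp_all only: of_real_eq_iff)
qed

lemma served_S:
  shows served_S_integrable: "integrable (S X) (\<lambda>w. real (served G 0 w))"
    and served_S_mean: "(\<integral>w. real (served G 0 w) \<partial>S X) = mean_Q"
proof -
  have m: "served G 0 \<in> measurable (S X) (count_space UNIV)" by (rule measurable_S) measurable
  show "integrable (S X) (\<lambda>w. real (served G 0 w))" "(\<integral>w. real (served G 0 w) \<partial>S X) = mean_Q"
    by (rule mean_of_served_gf[OF prob_S m served_gf(2)]; assumption)+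
qed

lemma mean_Y: "measure_pmf.expectation Y (\<lambda>(q, k). real q) = mean_Q"
proof -
  have "measure_pmf.expectation Y (\<lambda>y. real (fst y)) = mean_Q"
    by (rule mean_of_served_gf(2)[OF prob_space_measure_pmf _ served_gf(1)]) auto
  then show ?thesis by (simp add: case_prod_unfold)
qed

lemma visit_length_S:
  shows visit_length_S_integrable: "integrable (S X) (\<lambda>w. vacation_start G 0 w - visit_start G 0 w)"
    and visit_length_S_mean: "(\<integral>w. vacation_start G 0 w - visit_start G 0 w \<partial>S X) = mean_Q * EB"
proof -
  note i = visit_length_integrable[unfolded visit_length_def[abs_def]]
  show *: "integrable (S X) (\<lambda>w. vacation_start G 0 w - visit_start G 0 w)"
  proof (rule integrable_S)
    show "(\<lambda>x. vacation_start G 0 (k, x) - visit_start G 0 (k, x)) \<in> borel_measurable P" for k by measurable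
    show "integrable P (\<lambda>x. vacation_start G 0 (k, x) - visit_start G 0 (k, x))" for k by (rule i)
    show "integrable (measure_pmf X) (\<lambda>k. \<integral>x. norm (vacation_start G 0 (k, x) - visit_start G 0 (k, x)) \<partial>P)"
    proof (rule Bochner_Integration.integrable_bound)
      \<comment> \<open>The bound of \<open>served_mean_le\<close> is linear in the initial number,
        which has finite mean under \<open>X\<close>.\<close>
      show "integrable (measure_pmf X) (\<lambda>k. (lam * G + real k) * EB)"
        using X_integrable by (intro integrable_mult_left Bochner_Integration.integrable_add) auto
      have "norm (\<integral>x. norm (vacation_start G 0 (k, x) - visit_start G 0 (k, x)) \<partial>P) \<le> norm ((lam * G + real k) * EB)" for k
      proof -
        have "(\<integral>x. norm (vacation_start G 0 (k, x) - visit_start G 0 (k, x)) \<partial>P) = (\<integral>x. visit_length k x \<partial>P)"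
        proof (rule Bochner_Integration.integral_cong_AE)
          show "AE x in P. norm (vacation_start G 0 (k, x) - visit_start G 0 (k, x)) = visit_length k x"
            using AE_visit_length[of k] by eventually_elim (simp add: visit_length_def)
        qed measurable
        also have "\<dots> \<le> (lam * G + real k) * EB"
          unfolding visit_length_integral EB_def[symmetric]
          using served_mean_le[of k] EB_pos by (intro mult_right_mono) auto
        finally show ?thesis by (simp add: Bochner_Integration.integral_nonneg)
      qed
      then show "AE k in X. norm (\<integral>x. norm (vacation_start G 0 (k, x) - visit_start G 0 (k, x)) \<partial>P) \<le> norm ((lam * G + real k) * EB)"
        by (rule AE_I2)
    qed simp
  qed
  have "(\<integral>w. vacation_start G 0 w - visit_start G 0 w \<partial>S X) = measure_pmf.expectation X (\<lambda>k. (\<integral>x. real (served G 0 (k, x)) \<partial>P) * EB)"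
    unfolding integral_S[OF *] visit_length_def[symmetric] visit_length_integral EB_def ..
  also have "\<dots> = mean_Q * EB"
    unfolding integral_mult_left_zero served_S_mean[symmetric] integral_S[OF served_S_integrable] ..
  finally show "(\<integral>w. vacation_start G 0 w - visit_start G 0 w \<partial>S X) = mean_Q * EB" .
qed

lemma glue_length_S:
  "integrable (S X) (\<lambda>w. visit_start G 0 w - glue_start G 0 w)" "(\<integral>w. visit_start G 0 w - glue_start G 0 w \<partial>S X) = G"
proof -
  interpret SX: prob_space "S X" by (rule prob_S)
  show "integrable (S X) (\<lambda>w. visit_start G 0 w - glue_start G 0 w)" by (simp add: visit_start_def)
  show "(\<integral>w. visit_start G 0 w - glue_start G 0 w \<partial>S X) = G"
    using SX.prob_space by (simp add: visit_start_def)
qed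

lemma vacation_length_S:
  "integrable (S X) (\<lambda>w. glue_start G 1 w - vacation_start G 0 w)" "(\<integral>w. glue_start G 1 w - vacation_start G 0 w \<partial>S X) = ES"
  unfolding vacation_length ES_def by (rule vacation_clock)+

lemma cycle_length_S: "(\<integral>w. glue_start G 1 w - glue_start G 0 w \<partial>S X) = G + mean_Q * EB + ES"
proof -
  have "(\<integral>w. glue_start G 1 w - glue_start G 0 w \<partial>S X) = (\<integral>w. (visit_start G 0 w - glue_start G 0 w)
     + (vacation_start G 0 w - visit_start G 0 w) + (glue_start G 1 w - vacation_start G 0 w) \<partial>S X)"
    by (intro Bochner_Integration.integral_cong[OF refl]) simp
  then show ?thesis
    by (simp only: Bochner_Integration.integral_add Bochner_Integration.integrable_add glue_length_S visit_length_S vacation_length_S)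
qed

end

section \<open>Time integrals over the periods of a stationary cycle\<close>

context steady_state
begin

text \<open>\<open>glue_period\<close> gives the time integral for each initial number; the average
  over \<open>X\<close> is moved inside by Fubini, the integrand being bounded by the indicator of
  \<open>{0..G}\<close>.\<close>

lemma glue_numerator:
  fixes zq zo :: complex
  assumes zq: "norm zq \<le> 1" and zo: "norm zo \<le> 1"
  shows "(\<integral>w. (LBINT t:{glue_start G 0 w..visit_start G 0 w}. zq ^ num_queue G w t * zo ^ num_orbit G w t) \<partial>S X)
    = (LBINT t:{0..G}. exp (- of_real lam * (1 - zq) * of_real t) * measure_pmf.expectation X (\<lambda>k. stick t zq zo ^ k))"
proof -
  interpret PX: pair_sigma_finite "measure_pmf X" lborel
    by (intro pair_sigma_finite.intro measure_pmf.sigma_finite_measure_axioms lborel.sigma_finite_measure_axioms)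
  define e where "e = (\<lambda>t. exp (- of_real lam * (1 - zq) * complex_of_real t))"
  define f where "f = (\<lambda>(k, t). indicator {0..G} t *\<^sub>R (e t * stick t zq zo ^ k))"
  have e: "norm (e t) \<le> 1" if "0 \<le> t" for t
    unfolding e_def using norm_exp_le[OF Re_rate[OF zq] that] by simp
  have st: "norm (stick t zq zo) \<le> 1" if "0 \<le> t" for t
  proof -
    have p: "0 \<le> exp (- nu * t)" "exp (- nu * t) \<le> 1" using nu that by auto
    have "norm (complex_of_real (1 - exp (- nu * t))) = 1 - exp (- nu * t)" "norm (complex_of_real (exp (- nu * t))) = exp (- nu * t)"
      using p unfolding norm_of_real by linarith+
    then have "norm (stick t zq zo) \<le> (1 - exp (- nu * t)) * norm zq + exp (- nu * t) * norm zo"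
      unfolding stick_def by (intro norm_triangle_le) (simp only: norm_mult)
    also have "\<dots> \<le> (1 - exp (- nu * t)) * 1 + exp (- nu * t) * 1"
      using p zq zo by (intro add_mono mult_left_mono) auto
    finally show ?thesis by simp
  qed
  have fm: "(\<lambda>t. f (k, t)) \<in> borel_measurable lborel" for k
    unfolding f_def e_def stick_def by simp
  have fn: "norm (f (k, t)) \<le> indicator {0..G} t" for k t
  proof (cases "t \<in> {0..G}")
    case True
    then have "norm (e t * stick t zq zo ^ k) \<le> 1"
      using e[of t] st[of t] by (auto simp: norm_mult norm_power intro!: mult_le_one power_le_one)
    then show ?thesis using True by (simp add: f_def)
  qed (simp add: f_def)
  have ind: "integrable lborel (indicator {0..G} :: real \<Rightarrow> real)"
    by (rule integrable_real_indicator) (auto simp: emeasure_lborel_Icc_eq)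
  have fi: "integrable lborel (\<lambda>t. f (k, t))" for k
    by (rule Bochner_Integration.integrable_bound[OF ind fm]) (use fn[of k] in auto)
  have "integrable (measure_pmf X \<Otimes>\<^sub>M lborel) f"
  proof (rule PX.Fubini_integrable)
    have "f \<in> borel_measurable (count_space UNIV \<Otimes>\<^sub>M lborel)"
      by (rule measurable_pair_measure_countable1) (use fm in auto)
    moreover have "sets (measure_pmf X \<Otimes>\<^sub>M lborel) = sets (count_space UNIV \<Otimes>\<^sub>M (lborel :: real measure))"
      by (intro sets_pair_measure_cong) simp_all
    ultimately show "f \<in> borel_measurable (measure_pmf X \<Otimes>\<^sub>M lborel)" using measurable_cong_sets by blast
    show "integrable (measure_pmf X) (\<lambda>k. \<integral>t. norm (f (k, t)) \<partial>lborel)"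
    proof (rule measure_pmf.integrable_const_bound[where B="\<integral>t. indicator {0..G} t \<partial>lborel"])
      have "norm (\<integral>t. norm (f (k, t)) \<partial>lborel) \<le> (\<integral>t. indicator {0..G} t \<partial>lborel)" for k
      proof -
        have "(\<integral>t. norm (f (k, t)) \<partial>lborel) \<le> (\<integral>t. indicator {0..G} t \<partial>lborel)"
          by (rule integral_mono[OF integrable_norm[OF fi] ind fn])
        then show ?thesis by (simp only: real_norm_def abs_of_nonneg[OF Bochner_Integration.integral_nonneg[OF norm_ge_zero]])
      qed
      then show "AE k in X. norm (\<integral>t. norm (f (k, t)) \<partial>lborel) \<le> (\<integral>t. indicator {0..G} t \<partial>lborel)"
        by (rule AE_I2)
    qed simp
    show "AE k in X. integrable lborel (\<lambda>t. f (k, t))" by (rule AE_I2) (rule fi)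
  qed
  then have fub: "(\<integral>t. (\<integral>k. f (k, t) \<partial>X) \<partial>lborel) = (\<integral>k. (\<integral>t. f (k, t) \<partial>lborel) \<partial>X)"
    using PX.Fubini_integral[of "\<lambda>k t. f (k, t)"] by simp
  have "(\<integral>w. (LBINT t:{glue_start G 0 w..visit_start G 0 w}. zq ^ num_queue G w t * zo ^ num_orbit G w t) \<partial>S X)
    = (\<integral>k. (\<integral>t. f (k, t) \<partial>lborel) \<partial>X)"
    by (subst integral_S[OF period_integrable[OF zq zo _ _ AE_S_order(1) glue_length_S(1)]])
      (measurable, simp only: glue_period[OF zq zo], simp only: f_def e_def set_lebesgue_integral_def prod.case)
  also have "\<dots> = (\<integral>t. (\<integral>k. f (k, t) \<partial>X) \<partial>lborel)" by (rule fub[symmetric])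
  also have "\<dots> = (LBINT t:{0..G}. e t * measure_pmf.expectation X (\<lambda>k. stick t zq zo ^ k))"
    by (simp add: f_def set_lebesgue_integral_def)
  finally show ?thesis by (simp only: e_def)
qed

text \<open>The mean vacation times the transform of the elapsed time in a vacation at an arbitrary
  instant of it; \<open>residual_eq\<close> gives the closed form away from
  \<open>zo = 1\<close>.\<close>

definition vacation_residual :: "complex \<Rightarrow> complex" where
  "vacation_residual zo = (\<integral>a. exp_integral (of_real lam * (1 - zo)) a \<partial>FS)"

definition service_residual :: "complex \<Rightarrow> complex" where
  "service_residual zo = (\<integral>a. exp_integral (of_real lam * (1 - zo)) a \<partial>FB)"

text \<open>The sum, over the services of a visit, of the joint transform of queue and orbit at the
  start of the service: each of the \<open>j\<close> services completed before contributes a factor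
  \<open>lst FB\<close> for the arrivals it brought to the orbit.\<close>

definition service_starts_gf :: "complex \<Rightarrow> complex \<Rightarrow> complex" where
  "service_starts_gf zq zo =
     (\<integral>w. (case Y_seq G 0 w of (q, m) \<Rightarrow> zo ^ m * run_length_gf zq (lst FB (of_real lam * (1 - zo))) q) \<partial>S X)"

lemma vacation_numerator:
  fixes zq zo :: complex
  assumes zq: "norm zq \<le> 1" and zo: "norm zo \<le> 1"
  shows "(\<integral>w. (LBINT t:{vacation_start G 0 w..glue_start G 1 w}. zq ^ num_queue G w t * zo ^ num_orbit G w t) \<partial>S X)
    = measure_pmf.expectation Z (\<lambda>k. zo ^ k) * vacation_residual zo"
proof -
  have i: "integrable (S X) (\<lambda>w. zo ^ Z_seq G 0 w)"
  proof (rule integrable_S_bounded[where C=1])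
    show "(\<lambda>x. zo ^ Z_seq G 0 (k, x)) \<in> borel_measurable P" for k
      by (rule measurable_compose[OF seq_measurable(3)]) simp
  qed (use zo in \<open>simp add: norm_power power_le_one\<close>)
  have "(\<integral>w. (LBINT t:{vacation_start G 0 w..glue_start G 1 w}. zq ^ num_queue G w t * zo ^ num_orbit G w t) \<partial>S X)
    = measure_pmf.expectation X (\<lambda>k. (\<integral>x. zo ^ Z_seq G 0 (k, x) \<partial>P) * vacation_residual zo)"
    by (subst integral_S[OF period_integrable[OF zq zo _ _ AE_S_order(3) vacation_length_S(1)]])
      (measurable, simp only: vacation_period[OF zq zo] vacation_residual_def)
  also have "\<dots> = (\<integral>w. zo ^ Z_seq G 0 w \<partial>S X) * vacation_residual zo"
    unfolding integral_mult_left_zero integral_S[OF i] ..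
  finally show ?thesis by (simp only: first_cycle_gf(2)[OF zo zo])
qed

lemma service_starts_measurable:
  "(\<lambda>w. case Y_seq G 0 w of (q, m) \<Rightarrow> zo ^ m * run_length_gf zq b q) \<in> borel_measurable (S X)"
  by (rule measurable_S, rule measurable_compose[OF seq_measurable(2)]) simp

lemma norm_service_starts_le:
  assumes "norm zq \<le> 1" "norm zo \<le> 1" "norm b \<le> 1"
  shows "norm (case Y_seq G 0 w of (q, m) \<Rightarrow> zo ^ m * run_length_gf zq b q) \<le> real (served G 0 w)"
proof -
  have "norm (zo ^ m) * norm (run_length_gf zq b q) \<le> 1 * real q" for m q
    using assms by (intro mult_mono norm_run_length_gf) (auto simp: norm_power power_le_one)
  then show ?thesis by (simp add: Y_seq_def norm_mult)
qed

lemma visit_numerator: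
  fixes zq zo :: complex
  assumes zq: "norm zq \<le> 1" and zo: "norm zo \<le> 1"
  shows "(\<integral>w. (LBINT t:{visit_start G 0 w..vacation_start G 0 w}. zq ^ num_queue G w t * zo ^ num_orbit G w t) \<partial>S X)
    = service_starts_gf zq zo * service_residual zo"
proof -
  let ?b = "lst FB (of_real lam * (1 - zo))"
  have i: "integrable (S X) (\<lambda>w. case Y_seq G 0 w of (q, m) \<Rightarrow> zo ^ m * run_length_gf zq ?b q)"
    by (rule Bochner_Integration.integrable_bound[OF served_S_integrable service_starts_measurable])
      (use norm_service_starts_le[OF zq zo norm_lst_FB[OF zo]] in simp)
  have "(\<integral>w. (LBINT t:{visit_start G 0 w..vacation_start G 0 w}. zq ^ num_queue G w t * zo ^ num_orbit G w t) \<partial>S X)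
    = measure_pmf.expectation X (\<lambda>k. (\<integral>x. (case Y_seq G 0 (k, x) of (q, m) \<Rightarrow> zo ^ m * run_length_gf zq ?b q) \<partial>P) * service_residual zo)"
    unfolding Y_seq_integral
    by (subst integral_S[OF period_integrable[OF zq zo _ _ AE_S_order(2) visit_length_S_integrable]])
      (measurable, simp only: visit_period[OF zq zo] service_residual_def)
  then show ?thesis
    unfolding integral_mult_left_zero service_starts_gf_def integral_S[OF i] .
qed

text \<open>Geometric summation under the expectation leaves a difference of two transforms of the
  first cycle, which are those of \<open>Y\<close> by \<open>first_cycle_gf\<close>.\<close>

lemma service_starts_gf_eq:
  assumes zq: "norm zq \<le> 1" and zo: "norm zo \<le> 1"
  defines "b \<equiv> lst FB (of_real lam * (1 - zo))"
  assumes ne: "zq \<noteq> b"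
  shows "service_starts_gf zq zo = zq / (zq - b) *
    (measure_pmf.expectation Y (\<lambda>(q, m). zq ^ q * zo ^ m) - measure_pmf.expectation Y (\<lambda>(q, m). b ^ q * zo ^ m))"
proof -
  have nb: "norm b \<le> 1" unfolding b_def by (rule norm_lst_FB[OF zo])
  have i: "integrable (S X) (\<lambda>w. case Y_seq G 0 w of (q, m) \<Rightarrow> y ^ q * zo ^ m)" if "norm y \<le> 1" for y :: complex
  proof (rule integrable_S_bounded[where C=1])
    show "(\<lambda>x. case Y_seq G 0 (k, x) of (q, m) \<Rightarrow> y ^ q * zo ^ m) \<in> borel_measurable P" for k
      by (rule measurable_compose[OF seq_measurable(2)]) simp
    show "norm (case Y_seq G 0 w of (q, m) \<Rightarrow> y ^ q * zo ^ m) \<le> 1" for w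
      using that zo by (auto simp: norm_mult norm_power split: prod.split intro!: mult_le_one power_le_one)
  qed
  have "service_starts_gf zq zo = (\<integral>w. zq / (zq - b) * ((case Y_seq G 0 w of (q, m) \<Rightarrow> zq ^ q * zo ^ m) - (case Y_seq G 0 w of (q, m) \<Rightarrow> b ^ q * zo ^ m)) \<partial>S X)"
    unfolding service_starts_gf_def b_def[symmetric] run_length_gf_eq[OF ne]
    by (intro Bochner_Integration.integral_cong[OF refl]) (simp add: Y_seq_def algebra_simps)
  also have "\<dots> = zq / (zq - b) * ((\<integral>w. (case Y_seq G 0 w of (q, m) \<Rightarrow> zq ^ q * zo ^ m) \<partial>S X) - (\<integral>w. (case Y_seq G 0 w of (q, m) \<Rightarrow> b ^ q * zo ^ m) \<partial>S X))"
    unfolding integral_mult_right_zero Bochner_Integration.integral_diff[OF i[OF zq] i[OF nb]] ..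
  finally show ?thesis unfolding first_cycle_gf(1)[OF zq zo] first_cycle_gf(1)[OF nb zo] .
qed

text \<open>For \<open>zo \<noteq> 1\<close> the rate is nonzero, so the exponential integral has
  its closed form for almost every length.\<close>

lemma residual_eq:
  assumes zo: "norm zo \<le> 1" "zo \<noteq> 1" and F: "prob_space F" "sets F = sets borel" "AE x in F. 0 \<le> x"
  shows "(\<integral>a. exp_integral (of_real lam * (1 - zo)) a \<partial>F) = (1 - lst F (of_real lam * (1 - zo))) / (of_real lam * (1 - zo))"
proof -
  interpret prob_space F by (rule F(1))
  let ?\<theta> = "of_real lam * (1 - zo)"
  have t: "?\<theta> \<noteq> 0" using zo lam by simp
  have i: "integrable F (\<lambda>x. exp (- ?\<theta> * of_real x))"
    by (rule integrable_exp_clock[OF Re_rate[OF zo(1)] F])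
  have "(\<integral>a. exp_integral ?\<theta> a \<partial>F) = (\<integral>a. (1 - exp (- ?\<theta> * of_real a)) / ?\<theta> \<partial>F)"
  proof (rule Bochner_Integration.integral_cong_AE)
    show "AE a in F. exp_integral ?\<theta> a = (1 - exp (- ?\<theta> * of_real a)) / ?\<theta>"
      using F(3) by eventually_elim (rule exp_integral_eq[OF t])
    show "exp_integral ?\<theta> \<in> borel_measurable F"
      using exp_integral_measurable measurable_cong_sets[OF F(2) refl] by blast
    show "(\<lambda>a. (1 - exp (- ?\<theta> * of_real a)) / ?\<theta>) \<in> borel_measurable F"
      by (intro borel_measurable_divide borel_measurable_diff borel_measurable_const borel_measurable_integrable[OF i])
  qed
  then show ?thesis using i by (simp add: lst_def prob_space)
qed

text \<open>Dominated by the length itself, whose mean is finite; this gives continuity up to and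
  including \<open>zo = 1\<close>.\<close>

lemma continuous_on_residual:
  assumes F: "sets F = sets borel" "AE x in F. 0 \<le> x" "integrable F (\<lambda>x. x)"
  shows "continuous_on (cball 0 1) (\<lambda>zo. \<integral>a. exp_integral (of_real lam * (1 - zo)) a \<partial>F)"
proof (rule continuous_on_integral_dominated[OF _ _ _ F(3)])
  show "exp_integral (of_real lam * (1 - zo)) \<in> borel_measurable F" for zo
    using exp_integral_measurable measurable_cong_sets[OF F(1) refl] by blast
  show "AE a in F. continuous_on (cball 0 1) (\<lambda>zo. exp_integral (of_real lam * (1 - zo)) a)"
    using F(2)
  proof eventually_elim
    fix a :: real assume "0 \<le> a"
    show "continuous_on (cball 0 1) (\<lambda>zo. exp_integral (of_real lam * (1 - zo)) a)"
      by (rule continuous_on_compose2[OF continuous_on_exp_integral[OF \<open>0 \<le> a\<close>]])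
        (auto intro!: continuous_intros Re_rate[simplified])
  qed
  show "AE a in F. norm (exp_integral (of_real lam * (1 - zo)) a) \<le> a" if "zo \<in> cball 0 1" for zo
    using F(2) by eventually_elim (rule norm_exp_integral_le[OF Re_rate], use that in simp)
qed

lemma continuous_on_lst_FB: "continuous_on (cball 0 1) (\<lambda>zo. lst FB (of_real lam * (1 - zo)))"
  unfolding lst_def
proof (rule continuous_on_integral_dominated[where h="\<lambda>_. 1"])
  interpret prob_space FB by (rule prob_FB)
  show "integrable FB (\<lambda>_. 1::real)" by simp
  show "(\<lambda>x. exp (- (of_real lam * (1 - zo)) * complex_of_real x)) \<in> borel_measurable FB" if "zo \<in> cball 0 1" for zo
    using that by (intro borel_measurable_integrable integrable_exp_FB) simp
  show "AE x in FB. continuous_on (cball 0 1) (\<lambda>zo. exp (- (of_real lam * (1 - zo)) * complex_of_real x))"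
    by (intro AE_I2 continuous_intros)
  show "AE x in FB. norm (exp (- (of_real lam * (1 - zo)) * complex_of_real x)) \<le> 1" if "zo \<in> cball 0 1" for zo
    using AE_FB by eventually_elim (rule norm_exp_le[OF Re_rate], use that in simp)
qed

lemma continuous_on_gf_Z: "continuous_on (cball 0 1) (\<lambda>zo::complex. measure_pmf.expectation Z (\<lambda>k. zo ^ k))"
proof (rule continuous_on_integral_dominated[where h="\<lambda>_. 1"])
  show "AE k in Z. continuous_on (cball 0 1) (\<lambda>zo::complex. zo ^ k)"
    by (intro AE_I2 continuous_intros)
  show "AE k in Z. norm (zo ^ k) \<le> 1" if "zo \<in> cball 0 1" for zo :: complex
    using that by (intro AE_I2) (simp add: norm_power power_le_one)
qed simp_all

text \<open>For each sample the integrand is a polynomial in \<open>zq\<close>, \<open>zo\<close>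
  and the continuous \<open>lst FB\<close>; the number served, which has finite mean, dominates it
  on the whole closed bidisc.\<close>

lemma continuous_on_service_starts_gf:
  "continuous_on (cball 0 1 \<times> cball 0 1) (\<lambda>z. service_starts_gf (fst z) (snd z))"
  unfolding service_starts_gf_def
proof (rule continuous_on_integral_dominated[OF service_starts_measurable _ _ served_S_integrable])
  have b: "continuous_on (cball 0 1 \<times> cball 0 1) (\<lambda>z::complex \<times> complex. lst FB (of_real lam * (1 - snd z)))"
    by (rule continuous_on_compose2[OF continuous_on_lst_FB]) (auto intro!: continuous_intros)
  show "AE w in S X. continuous_on (cball 0 1 \<times> cball 0 1) (\<lambda>z. case Y_seq G 0 w of (q, m) \<Rightarrow>
      snd z ^ m * run_length_gf (fst z) (lst FB (of_real lam * (1 - snd z))) q)"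
    unfolding run_length_gf_def Y_seq_def prod.case by (intro AE_I2 continuous_intros b)
  show "AE w in S X. norm (case Y_seq G 0 w of (q, m) \<Rightarrow>
      snd z ^ m * run_length_gf (fst z) (lst FB (of_real lam * (1 - snd z))) q) \<le> real (served G 0 w)"
    if "z \<in> cball 0 1 \<times> cball 0 1" for z
    using that by (intro AE_I2 norm_service_starts_le norm_lst_FB) auto
qed

end

section \<open>Formulas for the generating functions\<close>

context steady_state
begin

lemma gf_glue_eq:
  assumes zq: "norm zq \<le> 1" and zo: "norm zo \<le> 1"
  shows "gf_glue (S X) G zq zo = (LBINT t:{0..G}. exp (- of_real lam * (1 - zq) * of_real t)
     * measure_pmf.expectation X (\<lambda>k. (of_real (1 - exp (- nu * t)) * zq + of_real (exp (- nu * t)) * zo) ^ k) / of_real G)"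
  unfolding gf_glue_def period_gf_def glue_numerator[OF zq zo] glue_length_S(2) stick_def
  by (rule set_integral_divide_zero[symmetric])

lemma gf_vacation_eq:
  assumes zq: "norm zq \<le> 1" and zo: "norm zo \<le> 1"
  shows "gf_vacation (S X) G zq zo = measure_pmf.expectation Z (\<lambda>k. zo ^ k) * vacation_residual zo / of_real ES"
  unfolding gf_vacation_def period_gf_def vacation_numerator[OF zq zo] vacation_length_S(2) ..

text \<open>The value does not depend on \<open>zq\<close>, and \<open>zq = 1\<close> leaves the
  orbit alone.\<close>

lemma gf_vacation_orbit_eq:
  assumes zq: "norm zq \<le> 1" and zo: "norm zo \<le> 1"
  shows "gf_vacation (S X) G zq zo = gf_vacation_orbit (S X) G zo"
proof -
  have "gf_vacation_orbit (S X) G zo = gf_vacation (S X) G 1 zo"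
    by (simp add: gf_vacation_orbit_def gf_vacation_def period_gf_def period_gf_orbit_def)
  then show ?thesis by (simp only: gf_vacation_eq[OF zq zo] gf_vacation_eq[OF _ zo] norm_one order.refl)
qed

lemma gf_visit_eq:
  assumes zq: "norm zq \<le> 1" and zo: "norm zo \<le> 1"
  shows "gf_visit (S X) G zq zo = service_starts_gf zq zo * service_residual zo / of_real (mean_Q * EB)"
  unfolding gf_visit_def period_gf_def visit_numerator[OF zq zo] visit_length_S_mean ..

text \<open>The cycle integral splits into the three periods. The weights are mean period lengths
  divided by the mean cycle length, brought into the stated form by
  \<open>mean_Q_eq\<close>.\<close>

lemma gf_cycle_eq:
  assumes zq: "norm zq \<le> 1" and zo: "norm zo \<le> 1"
  shows "gf_cycle (S X) G zq zo = of_real (lam * EB) * gf_visit (S X) G zq zo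
        + of_real ((1 - lam * EB) * (G / (G + ES))) * gf_glue (S X) G zq zo
        + of_real ((1 - lam * EB) * (ES / (G + ES))) * gf_vacation (S X) G zq zo"
proof -
  let ?f = "\<lambda>w t. zq ^ num_queue G w t * zo ^ num_orbit G w t"
  let ?I = "\<lambda>a b. \<integral>w. (LBINT t:{a w..b w}. ?f w t) \<partial>S X"
  define gl vi va where "gl = ?I (glue_start G 0) (visit_start G 0)" and "vi = ?I (visit_start G 0) (vacation_start G 0)"
    and "va = ?I (vacation_start G 0) (glue_start G 1)"
  note i = period_integrable[OF zq zo _ _ AE_S_order(1) glue_length_S(1)]
    period_integrable[OF zq zo _ _ AE_S_order(2) visit_length_S_integrable]
    period_integrable[OF zq zo _ _ AE_S_order(3) vacation_length_S(1)]
  have i1: "integrable (S X) (\<lambda>w. LBINT t:{glue_start G 0 w..visit_start G 0 w}. ?f w t)" by (rule i(1)) measurable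
  have i2: "integrable (S X) (\<lambda>w. LBINT t:{visit_start G 0 w..vacation_start G 0 w}. ?f w t)" by (rule i(2)) measurable
  have i3: "integrable (S X) (\<lambda>w. LBINT t:{vacation_start G 0 w..glue_start G 1 w}. ?f w t)" by (rule i(3)) measurable
  have "?I (glue_start G 0) (glue_start G 1) = (\<integral>w. (LBINT t:{glue_start G 0 w..visit_start G 0 w}. ?f w t)
     + (LBINT t:{visit_start G 0 w..vacation_start G 0 w}. ?f w t) + (LBINT t:{vacation_start G 0 w..glue_start G 1 w}. ?f w t) \<partial>S X)"
  proof (rule Bochner_Integration.integral_cong_AE)
    show "AE w in S X. (LBINT t:{glue_start G 0 w..glue_start G 1 w}. ?f w t) = (LBINT t:{glue_start G 0 w..visit_start G 0 w}. ?f w t)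
     + (LBINT t:{visit_start G 0 w..vacation_start G 0 w}. ?f w t) + (LBINT t:{vacation_start G 0 w..glue_start G 1 w}. ?f w t)"
      using AE_S_order(1) AE_S_order(2) AE_S_order(3)
    proof eventually_elim
      fix w assume o: "glue_start G 0 w \<le> visit_start G 0 w" "visit_start G 0 w \<le> vacation_start G 0 w" "vacation_start G 0 w \<le> glue_start G 1 w"
      note split = set_integral_split[OF queue_orbit_path_measurable norm_queue_orbit_le[OF zq zo]]
      show "(LBINT t:{glue_start G 0 w..glue_start G 1 w}. ?f w t) = (LBINT t:{glue_start G 0 w..visit_start G 0 w}. ?f w t)
     + (LBINT t:{visit_start G 0 w..vacation_start G 0 w}. ?f w t) + (LBINT t:{vacation_start G 0 w..glue_start G 1 w}. ?f w t)"
        unfolding split[OF order.trans[OF o(1,2)] o(3)] split[OF o(1,2)] ..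
    qed
    show "(\<lambda>w. LBINT t:{glue_start G 0 w..glue_start G 1 w}. ?f w t) \<in> borel_measurable (S X)"
      by (rule measurable_S, rule period_integral_measurable[OF _ _ queue_orbit_measurable]) measurable
    show "(\<lambda>w. (LBINT t:{glue_start G 0 w..visit_start G 0 w}. ?f w t)
     + (LBINT t:{visit_start G 0 w..vacation_start G 0 w}. ?f w t) + (LBINT t:{vacation_start G 0 w..glue_start G 1 w}. ?f w t)) \<in> borel_measurable (S X)"
      using i1 i2 i3 by (intro borel_measurable_add borel_measurable_integrable)
  qed
  also have "\<dots> = gl + vi + va"
    unfolding gl_def vi_def va_def
    by (simp only: Bochner_Integration.integral_add Bochner_Integration.integrable_add i1 i2 i3)
  finally have num: "?I (glue_start G 0) (glue_start G 1) = gl + vi + va" .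
  \<comment> \<open>The mean number served is \<open>lam\<close> times the mean cycle
    length.\<close>
  have len: "G + mean_Q * EB + ES = mean_Q / lam"
    using mean_Q_eq lam by (simp add: field_simps)
  have cycle: "gf_cycle (S X) G zq zo = (gl + vi + va) * of_real (lam / mean_Q)"
    unfolding gf_cycle_def period_gf_def num cycle_length_S len by simp
  have GE: "0 < G + ES" using G ES_pos by simp
  have r: "(1 - lam * EB) / (G + ES) = lam / mean_Q"
    using mean_Q_eq mean_Q_pos GE by (simp add: field_simps)
  \<comment> \<open>All three weights become \<open>lam / mean_Q\<close> times the mean length of
    the period, which cancels the denominator of the corresponding ratio.\<close>
  have c1: "(1 - lam * EB) * (G / (G + ES)) = lam / mean_Q * G"
    and c2: "(1 - lam * EB) * (ES / (G + ES)) = lam / mean_Q * ES" by (simp_all flip: r)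
  have c3: "lam * EB = lam / mean_Q * (mean_Q * EB)" using mean_Q_pos by simp
  have scale: "complex_of_real (c * d) * (N / of_real d) = N * of_real c" if "d \<noteq> 0" for c d :: real and N
    using that by simp
  have "of_real ((1 - lam * EB) * (G / (G + ES))) * gf_glue (S X) G zq zo = gl * of_real (lam / mean_Q)"
    unfolding c1 gf_glue_def period_gf_def glue_length_S(2) gl_def using G by (intro scale) simp
  moreover have "of_real ((1 - lam * EB) * (ES / (G + ES))) * gf_vacation (S X) G zq zo = va * of_real (lam / mean_Q)"
    unfolding c2 gf_vacation_def period_gf_def vacation_length_S(2) va_def using ES_pos by (intro scale) simp
  moreover have "of_real (lam / mean_Q * (mean_Q * EB)) * gf_visit (S X) G zq zo = vi * of_real (lam / mean_Q)"
    unfolding gf_visit_def period_gf_def visit_length_S_mean vi_def using mean_Q_pos EB_pos by (intro scale) simp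
  ultimately show ?thesis unfolding cycle unfolding c3[symmetric] by (simp only: distrib_right add_ac)
qed

lemma to_one_islimpt: "(1::complex) islimpt {zo. norm zo \<le> 1 \<and> zo \<noteq> 1}"
  unfolding islimpt_sequential
proof (intro exI conjI allI)
  show "complex_of_real (to_one n) \<in> {zo. norm zo \<le> 1 \<and> zo \<noteq> 1} - {1}" for n
    using to_one(1,2)[of n] by simp
  show "(\<lambda>n. complex_of_real (to_one n)) \<longlonglongrightarrow> 1"
    using tendsto_of_real[OF to_one(3), where 'a=complex] by simp
qed

text \<open>The set where the formula is literal is dense, for an arbitrary function
  \<open>b\<close>: the second coordinate is moved off 1 first, then the first coordinate off the
  value of \<open>b\<close> there, so no continuity of \<open>b\<close> enters.\<close>

lemma pair_islimpt:
  fixes b :: "complex \<Rightarrow> complex"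
  defines "N \<equiv> {(zq, zo). norm zq \<le> 1 \<and> norm zo \<le> 1 \<and> zo \<noteq> 1 \<and> zq \<noteq> b zo}"
  assumes zq: "norm zq \<le> 1" and zo: "norm zo \<le> 1" and z: "(zq, zo) \<notin> N"
  shows "(zq, zo) islimpt N"
proof -
  \<comment> \<open>Points of the closed disc different from \<open>zq\<close> and tending to it:
    shrinking towards 0 works unless \<open>zq = 0\<close>.\<close>
  define p where "p = (\<lambda>n. if zq = 0 then complex_of_real (1 / real (Suc n)) else of_real (to_one n) * zq)"
  define o' where "o' = (\<lambda>n. if zo = 1 then complex_of_real (to_one n) else zo)"
  define q' where "q' = (\<lambda>n. if zq = b (o' n) then p n else zq)"
  have p: "p n \<noteq> zq" "norm (p n) \<le> 1" "norm (p n - zq) \<le> 1 / real (Suc n)" for n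
  proof -
    have t: "0 \<le> to_one n" "to_one n < 1" by (rule to_one)+
    show "p n \<noteq> zq" using t by (auto simp: p_def simp del: of_nat_Suc)
    have "norm (complex_of_real (1 / real (Suc n))) \<le> 1" unfolding norm_of_real by simp
    then show "norm (p n) \<le> 1" using t zq by (auto simp: p_def norm_mult simp del: of_nat_Suc of_real_divide intro!: mult_le_one)
    show "norm (p n - zq) \<le> 1 / real (Suc n)"
    proof (cases "zq = 0")
      case True
      then show ?thesis unfolding p_def by (simp add: norm_divide del: of_nat_Suc)
    next
      case False
      then have "p n - zq = of_real (- (1 / real (Suc n))) * zq"
        by (simp add: p_def to_one_def algebra_simps del: of_nat_Suc)
      then have "norm (p n - zq) = 1 / real (Suc n) * norm zq"
        by (simp only: norm_mult norm_of_real) (simp del: of_nat_Suc)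
      then show ?thesis using zq by (simp add: divide_right_mono del: of_nat_Suc)
    qed
  qed
  have mem: "(q' n, o' n) \<in> N" for n
    using p[of n] to_one(1,2)[of n] zq zo by (auto simp: N_def q'_def o'_def)
  have "(\<lambda>n. complex_of_real (to_one n)) \<longlonglongrightarrow> 1"
    using tendsto_of_real[OF to_one(3), where 'a=complex] by simp
  then have o_lim: "o' \<longlonglongrightarrow> zo" by (cases "zo = 1") (simp_all add: o'_def)
  have "(\<lambda>n. q' n - zq) \<longlonglongrightarrow> 0"
  proof (rule tendsto_norm_zero_cancel, rule tendsto_sandwich[OF _ _ tendsto_const])
    show "eventually (\<lambda>n. 0 \<le> norm (q' n - zq)) sequentially" by simp
    show "eventually (\<lambda>n. norm (q' n - zq) \<le> 1 / real (Suc n)) sequentially"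
    proof (rule always_eventually, rule allI)
      show "norm (q' n - zq) \<le> 1 / real (Suc n)" for n
        using p(3)[of n] by (cases "zq = b (o' n)") (simp_all add: q'_def del: of_nat_Suc)
    qed
    show "(\<lambda>n. 1 / real (Suc n)) \<longlonglongrightarrow> 0" by (rule LIMSEQ_Suc[OF lim_1_over_n])
  qed
  then have "q' \<longlonglongrightarrow> zq" by (rule LIM_zero_cancel)
  then have "(\<lambda>n. (q' n, o' n)) \<longlonglongrightarrow> (zq, zo)" using o_lim by (rule tendsto_Pair)
  moreover have "(q' n, o' n) \<in> N - {(zq, zo)}" for n using mem[of n] z by auto
  ultimately show ?thesis
    unfolding islimpt_sequential by (intro exI[of _ "\<lambda>n. (q' n, o' n)"] conjI allI)
qed

lemma gf_vacation_value:
  assumes zq: "norm zq \<le> 1" and zo: "norm zo \<le> 1"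
  shows "value_by_continuity {zo. norm zo \<le> 1 \<and> zo \<noteq> 1}
        (\<lambda>zo. measure_pmf.expectation Z (\<lambda>k. zo ^ k)
              * ((1 - lst FS (of_real lam * (1 - zo))) / (of_real lam * (1 - zo) * of_real ES)))
        zo (gf_vacation (S X) G zq zo)"
proof (rule value_by_continuityI[where D="cball 0 1"
      and H="\<lambda>zo. measure_pmf.expectation Z (\<lambda>k. zo ^ k) * vacation_residual zo / of_real ES"])
  show "zo islimpt {zo. norm zo \<le> 1 \<and> zo \<noteq> 1}" if "zo \<notin> {zo. norm zo \<le> 1 \<and> zo \<noteq> 1}"
    using that zo to_one_islimpt by auto
  show "continuous_on (cball 0 1) (\<lambda>zo. measure_pmf.expectation Z (\<lambda>k. zo ^ k) * vacation_residual zo / of_real ES)"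
    unfolding vacation_residual_def
    by (intro continuous_on_divide continuous_on_mult continuous_on_const continuous_on_gf_Z continuous_on_residual sets_FS AE_FS integrable_FS)
      (use ES_pos in simp)
  show "measure_pmf.expectation Z (\<lambda>k. y ^ k) * ((1 - lst FS (of_real lam * (1 - y))) / (of_real lam * (1 - y) * of_real ES))
      = measure_pmf.expectation Z (\<lambda>k. y ^ k) * vacation_residual y / of_real ES" if "y \<in> {zo. norm zo \<le> 1 \<and> zo \<noteq> 1}" for y
    using that residual_eq[OF _ _ prob_FS sets_FS AE_FS, of y] by (simp add: vacation_residual_def)
  show "gf_vacation (S X) G zq zo = measure_pmf.expectation Z (\<lambda>k. zo ^ k) * vacation_residual zo / of_real ES"
    by (rule gf_vacation_eq[OF zq zo])
qed (use zo in auto)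

text \<open>\<open>H\<close> is built from the sum over services and from
  \<open>service_residual\<close>, hence continuous on the whole closed bidisc; on \<open>?N\<close>
  geometric summation and the closed form of the residual turn it into the quotients.\<close>

lemma gf_visit_value:
  assumes zq: "norm zq \<le> 1" and zo: "norm zo \<le> 1"
  shows "value_by_continuity
        {(zq, zo). norm zq \<le> 1 \<and> norm zo \<le> 1 \<and> zo \<noteq> 1 \<and> zq \<noteq> lst FB (of_real lam * (1 - zo))}
        (\<lambda>(zq, zo).
           zq * (measure_pmf.expectation Y (\<lambda>(q, k). zq ^ q * zo ^ k)
                 - measure_pmf.expectation Y (\<lambda>(q, k). lst FB (of_real lam * (1 - zo)) ^ q * zo ^ k))
           / (of_real (measure_pmf.expectation Y (\<lambda>(q, k). real q)) * (zq - lst FB (of_real lam * (1 - zo))))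
           * ((1 - lst FB (of_real lam * (1 - zo))) / (of_real lam * (1 - zo) * of_real EB)))
        (zq, zo) (gf_visit (S X) G zq zo)" (is "value_by_continuity ?N ?F _ _")
proof (rule value_by_continuityI[where D="cball 0 1 \<times> cball 0 1"
      and H="\<lambda>z. service_starts_gf (fst z) (snd z) * service_residual (snd z) / of_real (mean_Q * EB)"])
  show "(zq, zo) islimpt ?N" if "(zq, zo) \<notin> ?N" using that by (rule pair_islimpt[OF zq zo])
  have r: "continuous_on (cball 0 1) service_residual"
    using continuous_on_residual[OF sets_FB AE_FB integrable_FB] by (simp add: service_residual_def[abs_def])
  have "continuous_on (cball 0 1 \<times> cball 0 1) (\<lambda>z::complex \<times> complex. service_residual (snd z))"
    by (rule continuous_on_compose2[OF r]) (auto intro!: continuous_intros)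
  then show "continuous_on (cball 0 1 \<times> cball 0 1) (\<lambda>z. service_starts_gf (fst z) (snd z) * service_residual (snd z) / of_real (mean_Q * EB))"
    by (intro continuous_on_divide continuous_on_mult continuous_on_const continuous_on_service_starts_gf)
      (use mean_Q_pos EB_pos in simp_all)
  show "?F y = service_starts_gf (fst y) (snd y) * service_residual (snd y) / of_real (mean_Q * EB)" if y: "y \<in> ?N" for y
  proof -
    obtain q v where qv: "y = (q, v)" by (cases y)
    have n: "norm q \<le> 1" "norm v \<le> 1" "v \<noteq> 1" "q \<noteq> lst FB (of_real lam * (1 - v))" using y qv by auto
    show ?thesis
      unfolding qv prod.case fst_conv snd_conv service_starts_gf_eq[OF n(1,2,4)] mean_Y service_residual_def
        residual_eq[OF n(2,3) prob_FB sets_FB AE_FB]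
      by simp
  qed
  show "gf_visit (S X) G zq zo = service_starts_gf (fst (zq, zo)) (snd (zq, zo)) * service_residual (snd (zq, zo)) / of_real (mean_Q * EB)"
    using gf_visit_eq[OF zq zo] by simp
qed (use zq zo in auto)

end

theorem theorem2:
  fixes lam nu G EB ES rho :: real
    and FB FS :: "real measure"
    and init X Z :: "nat pmf"
    and Y :: "(nat \<times> nat) pmf"
    and R_va R_gl R_vi R :: "complex \<Rightarrow> complex \<Rightarrow> complex"
    and R_va_orbit :: "complex \<Rightarrow> complex"
  defines "EB \<equiv> \<integral>x. x \<partial>FB"
    and "ES \<equiv> \<integral>x. x \<partial>FS"
    and "rho \<equiv> lam * EB"
    and "R_va \<equiv> gf_vacation (system lam nu FB FS X) G"
    and "R_va_orbit \<equiv> gf_vacation_orbit (system lam nu FB FS X) G"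
    and "R_gl \<equiv> gf_glue (system lam nu FB FS X) G"
    and "R_vi \<equiv> gf_visit (system lam nu FB FS X) G"
    and "R \<equiv> gf_cycle (system lam nu FB FS X) G"
  assumes "lam > 0" and "nu > 0" and "G > 0"
    and "nonneg_law FB" and "nonneg_law FS"
    and "has_limit_law (system lam nu FB FS init) (X_seq G) X"
    and "has_limit_law (system lam nu FB FS init) (Y_seq G) Y"
    and "has_limit_law (system lam nu FB FS init) (Z_seq G) Z"
    and "rho < 1"
  shows "\<forall>zq zo :: complex. norm zq \<le> 1 \<longrightarrow> norm zo \<le> 1 \<longrightarrow>
      R_va zq zo = R_va_orbit zo
    \<and> value_by_continuity {zo. norm zo \<le> 1 \<and> zo \<noteq> 1}
        (\<lambda>zo. measure_pmf.expectation Z (\<lambda>k. zo ^ k)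
              * ((1 - lst FS (of_real lam * (1 - zo))) / (of_real lam * (1 - zo) * of_real ES)))
        zo (R_va zq zo)
    \<and> R_gl zq zo =
        (LBINT t:{0..G}. exp (- of_real lam * (1 - zq) * of_real t)
           * measure_pmf.expectation X
               (\<lambda>k. (of_real (1 - exp (- nu * t)) * zq + of_real (exp (- nu * t)) * zo) ^ k) / of_real G)
    \<and> value_by_continuity
        {(zq, zo). norm zq \<le> 1 \<and> norm zo \<le> 1 \<and> zo \<noteq> 1 \<and> zq \<noteq> lst FB (of_real lam * (1 - zo))}
        (\<lambda>(zq, zo).
           zq * (measure_pmf.expectation Y (\<lambda>(q, k). zq ^ q * zo ^ k)
                 - measure_pmf.expectation Y (\<lambda>(q, k). lst FB (of_real lam * (1 - zo)) ^ q * zo ^ k))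
           / (of_real (measure_pmf.expectation Y (\<lambda>(q, k). real q)) * (zq - lst FB (of_real lam * (1 - zo))))
           * ((1 - lst FB (of_real lam * (1 - zo))) / (of_real lam * (1 - zo) * of_real EB)))
        (zq, zo) (R_vi zq zo)
    \<and> R zq zo = of_real rho * R_vi zq zo
        + of_real ((1 - rho) * (G / (G + ES))) * R_gl zq zo
        + of_real ((1 - rho) * (ES / (G + ES))) * R_va zq zo"
proof -
  interpret M: steady_state lam nu G FB FS init X Z Y
    by unfold_locales (use assms in \<open>simp_all add: EB_def rho_def\<close>)
  show ?thesis
    unfolding EB_def ES_def rho_def R_va_def R_va_orbit_def R_gl_def R_vi_def R_def
    unfolding M.EB_def[symmetric] M.ES_def[symmetric]
    by (intro allI impI conjI M.gf_vacation_orbit_eq M.gf_vacation_value M.gf_glue_eq M.gf_visit_value M.gf_cycle_eq)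
qed

end
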